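(* Let $N\ge2$, let $b^-<b^+$ be real constants, let $\Omega=\{x\in\mathbb{R}^N : b^-<x_N<b^+\}$, and let $1<p<\infty$. Then there exists a constant $c=c(N,p)>0$ such that for every $u\in\dot{W}^{2,p}(\Omega)$ and for every $i=1,\dots,N$, $$\int_{\mathbb{R}^{N-1}}|\operatorname{Tr}(\partial_iu)(x',b^+)-\operatorname{Tr}(\partial_iu)(x',b^-)|^p\,dx'\le(b^+-b^-)^{p-1}\int_\Omega|\partial^2_{i,N}u(x)|^p\,dx,$$ $$\int_{\mathbb{R}^{N-1}}\left|\operatorname{Tr}(u)(x',b^+)-\operatorname{Tr}(u)(x',b^-)-\big(\operatorname{Tr}(\partial_Nu)(x',b^+)+\operatorname{Tr}(\partial_Nu)(x',b^-)\big)\frac{b^+-b^-}{2}\right|^p dx'\le(b^+-b^-)^{2p-1}\int_\Omega|\partial_N^2u(x)|^p\,dx,$$ and $$|\operatorname{Tr}(\partial_iu)(\cdot,b^\pm)|^p_{\tilde{W}^{1-1/p,p}_{(b^+-b^-)}(\mathbb{R}^{N-1})}\le c\int_\Omega|\nabla^2u(x)|^p\,dx.$$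
   Context: Points are written $x=(x',x_N)\in\mathbb{R}^{N-1}\times\mathbb{R}$. $\dot{W}^{m,p}(\Omega)$ is the space of real-valued $u\in L^1_{\mathrm{loc}}(\Omega)$ all of whose weak derivatives of order $m$ belong to $L^p(\Omega)$; $\nabla^2u$ is the vector of all second-order partial derivatives. $\operatorname{Tr}$ denotes the usual Sobolev boundary trace with values in $L^p_{\mathrm{loc}}(\partial\Omega)$: if $u\in\dot W^{2,p}(\Omega)$ then $u$ and each $\partial_iu$ belong to $W^{1,p}$ of bounded Lipschitz subdomains of $\Omega$, so their traces are defined, and they agree with restriction to $\partial\Omega$ for functions continuous on $\overline\Omega$. For a constant $a>0$ and $f\in L^1_{\mathrm{loc}}(\mathbb{R}^{N-1})$, with $B'(0,a)$ the open ball in $\mathbb{R}^{N-1}$, $$|f|_{\tilde{W}^{1-1/p,p}_{(a)}(\mathbb{R}^{N-1})}:=\left(\int_{\mathbb{R}^{N-1}}\int_{B'(0,a)}\frac{|f(x'+h')-f(x')|^p}{|h'|^{p+N-2}}\,dh'\,dx'\right)^{1/p}.$$ *)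

theory Defs
  imports "HOL-Analysis.Analysis"
begin

definition partial_deriv :: "'a::euclidean_space \<Rightarrow> ('a \<Rightarrow> real) \<Rightarrow> 'a \<Rightarrow> real" where
  "partial_deriv e f = (\<lambda>x. frechet_derivative f (at x) e)"

primrec partial_derivs :: "'a::euclidean_space list \<Rightarrow> ('a \<Rightarrow> real) \<Rightarrow> 'a \<Rightarrow> real" where
  "partial_derivs [] f = f"
| "partial_derivs (e # es) f = partial_deriv e (partial_derivs es f)"

primrec class_C :: "nat \<Rightarrow> ('a::euclidean_space \<Rightarrow> real) \<Rightarrow> bool" where
  "class_C 0 f \<longleftrightarrow> continuous_on UNIV f"
| "class_C (Suc k) f \<longleftrightarrow>
     (\<forall>x. f differentiable (at x)) \<and> (\<forall>e\<in>Basis. class_C k (partial_deriv e f))"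

definition smooth :: "('a::euclidean_space \<Rightarrow> real) \<Rightarrow> bool" where
  "smooth f \<longleftrightarrow> (\<forall>k. class_C k f)"

definition test_functions :: "'a::euclidean_space set \<Rightarrow> ('a \<Rightarrow> real) set" where
  "test_functions \<Omega> =
     {\<phi>. smooth \<phi> \<and> compact (closure {x. \<phi> x \<noteq> 0}) \<and> closure {x. \<phi> x \<noteq> 0} \<subseteq> \<Omega>}"

definition L1_loc :: "'a::euclidean_space set \<Rightarrow> ('a \<Rightarrow> real) set" where
  "L1_loc \<Omega> = {u. \<forall>K. compact K \<and> K \<subseteq> \<Omega> \<longrightarrow> u absolutely_integrable_on K}"

definition Lp :: "real \<Rightarrow> 'a::euclidean_space set \<Rightarrow> ('a \<Rightarrow> real) set" where
  "Lp p S = {f. f \<in> borel_measurable (lebesgue_on S) \<and>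
                integrable (lebesgue_on S) (\<lambda>x. \<bar>f x\<bar> powr p)}"

text \<open>A multi-index is given by the list \<open>es\<close> of the basis vectors along which one
  differentiates, so its order is the length of the list.\<close>

definition has_weak_deriv ::
  "'a::euclidean_space set \<Rightarrow> 'a list \<Rightarrow> ('a \<Rightarrow> real) \<Rightarrow> ('a \<Rightarrow> real) \<Rightarrow> bool" where
  "has_weak_deriv \<Omega> es u v \<longleftrightarrow> v \<in> L1_loc \<Omega> \<and>
     (\<forall>\<phi>\<in>test_functions \<Omega>.
        (LINT x:\<Omega>|lebesgue. u x * partial_derivs es \<phi> x) =
        (- 1) ^ length es * (LINT x:\<Omega>|lebesgue. v x * \<phi> x))"

text \<open>Weak derivatives are unique up to a null subset of \<open>\<Omega>\<close>; the choice below picks one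
  representative, whose values outside \<open>\<Omega>\<close> are irrelevant.\<close>

definition weak_deriv ::
  "'a::euclidean_space set \<Rightarrow> 'a list \<Rightarrow> ('a \<Rightarrow> real) \<Rightarrow> 'a \<Rightarrow> real" where
  "weak_deriv \<Omega> es u = (SOME v. has_weak_deriv \<Omega> es u v)"

text \<open>Only the weak derivatives of order exactly \<open>m\<close> are required to exist and to lie in
  \<open>L\<^sup>p\<close>; nothing is assumed about lower orders.\<close>

definition hom_sobolev :: "nat \<Rightarrow> real \<Rightarrow> 'a::euclidean_space set \<Rightarrow> ('a \<Rightarrow> real) set" where
  "hom_sobolev m p \<Omega> = {u \<in> L1_loc \<Omega>.
     \<forall>es. length es = m \<and> set es \<subseteq> Basis \<longrightarrow> (\<exists>v\<in>Lp p \<Omega>. has_weak_deriv \<Omega> es u v)}"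

definition hessian_norm :: "'a::euclidean_space set \<Rightarrow> ('a \<Rightarrow> real) \<Rightarrow> 'a \<Rightarrow> real" where
  "hessian_norm \<Omega> u x = sqrt (\<Sum>i\<in>Basis. \<Sum>j\<in>Basis. (weak_deriv \<Omega> [i, j] u x)\<^sup>2)"

text \<open>Points of \<open>\<real>\<^sup>N\<close> are pairs \<open>(x', x\<^sub>N)\<close>, where \<open>x'\<close> ranges over the
  Euclidean space \<open>'a\<close> of dimension \<open>N - 1\<close>.\<close>

definition strip :: "real \<Rightarrow> real \<Rightarrow> ('a::euclidean_space \<times> real) set" where
  "strip a b = {x. a < snd x \<and> snd x < b}"

text \<open>The \<open>p\<close>-th power of the \<open>W\<^sup>1\<^sup>,\<^sup>p(S)\<close>-distance between a smooth \<open>\<phi>\<close> and \<open>v\<close>, where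
  \<open>S \<subseteq> \<Omega>\<close> and the weak derivatives of \<open>v\<close> are taken in \<open>\<Omega>\<close>.\<close>

definition sobolev_dist_pow ::
  "real \<Rightarrow> 'a::euclidean_space set \<Rightarrow> 'a set \<Rightarrow> ('a \<Rightarrow> real) \<Rightarrow> ('a \<Rightarrow> real) \<Rightarrow> ennreal" where
  "sobolev_dist_pow p \<Omega> S \<phi> v =
     (\<integral>\<^sup>+x\<in>S. ennreal (\<bar>\<phi> x - v x\<bar> powr p) \<partial>lebesgue) +
     (\<Sum>e\<in>Basis. \<integral>\<^sup>+x\<in>S. ennreal (\<bar>partial_deriv e \<phi> x - weak_deriv \<Omega> [e] v x\<bar> powr p) \<partial>lebesgue)"

text \<open>The trace operator is the continuous extension, from \<open>W\<^sup>1\<^sup>,\<^sup>p\<close> of the bounded pieces of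
  the strip to \<open>L\<^sup>p\<^sub>l\<^sub>o\<^sub>c\<close> of its boundary, of the restriction of functions smooth up to the
  boundary. A trace is a function \<open>g\<close> of boundary points, of which only the values
  \<open>g (x', a)\<close> and \<open>g (x', b)\<close> matter.\<close>

definition has_trace ::
  "real \<Rightarrow> real \<Rightarrow> real \<Rightarrow> ('a::euclidean_space \<times> real \<Rightarrow> real) \<Rightarrow> ('a \<times> real \<Rightarrow> real) \<Rightarrow> bool" where
  "has_trace p a b v g \<longleftrightarrow>
     (\<forall>R>0. \<forall>t\<in>{a, b}. (\<lambda>x'. g (x', t)) \<in> Lp p (ball 0 R)) \<and>
     (\<exists>\<phi> :: nat \<Rightarrow> 'a \<times> real \<Rightarrow> real.
        (\<forall>k. smooth (\<phi> k)) \<and>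
        (\<forall>R>0.
           (\<lambda>k. sobolev_dist_pow p (strip a b) (strip a b \<inter> ball 0 R) (\<phi> k) v) \<longlonglongrightarrow> 0 \<and>
           (\<forall>t\<in>{a, b}.
              (\<lambda>k. \<integral>\<^sup>+x'\<in>ball 0 R. ennreal (\<bar>\<phi> k (x', t) - g (x', t)\<bar> powr p) \<partial>lebesgue)
                \<longlonglongrightarrow> 0)))"

definition Tr ::
  "real \<Rightarrow> real \<Rightarrow> real \<Rightarrow> ('a::euclidean_space \<times> real \<Rightarrow> real) \<Rightarrow> 'a \<times> real \<Rightarrow> real" where
  "Tr p a b v = (SOME g. has_trace p a b v g)"

text \<open>Real powers of extended nonnegative reals, meant for exponents \<open>r > 0\<close>.\<close>

definition ennreal_powr :: "ennreal \<Rightarrow> real \<Rightarrow> ennreal" where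
  "ennreal_powr x r = (if x = \<infinity> then \<infinity> else ennreal (enn2real x powr r))"

text \<open>The exponent of \<open>|h'|\<close> is \<open>p + N - 2\<close> with \<open>N - 1 = DIM('a)\<close>.\<close>

definition trunc_seminorm :: "real \<Rightarrow> real \<Rightarrow> ('a::euclidean_space \<Rightarrow> real) \<Rightarrow> ennreal" where
  "trunc_seminorm p a f =
     ennreal_powr
       (\<integral>\<^sup>+x'. (\<integral>\<^sup>+h'\<in>ball 0 a.
          ennreal (\<bar>f (x' + h') - f x'\<bar> powr p / norm h' powr (p + real DIM('a) - 1))
        \<partial>lebesgue) \<partial>lebesgue)
       (1 / p)"

end

theory Submission
  imports Defs
begin

text \<open>
  Let \<open>\<Omega>\<close> be open and convex and \<open>\<eta>\<close> a mollifier supported in \<open>\<Omega>\<close>. The averages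
  \<open>\<integral> \<eta>(y) f((1 - \<kappa>) x + \<kappa> y) dy\<close> contract \<open>\<Omega>\<close> into itself, so they are smooth up to the
  boundary, commute with weak derivatives up to factors \<open>1 - \<kappa>\<close>, and converge to \<open>f\<close> in
  \<open>L\<^sup>p\<close> as \<open>\<kappa> \<rightarrow> 0\<close>. Applied to \<open>u\<close> this gives smooth functions whose second derivatives converge in
  \<open>L\<^sup>p(\<Omega> \<inter> ball 0 R)\<close>. A smooth function differs from its \<open>\<eta>\<close>-average by an integral operator
  in its gradient which is bounded on \<open>L\<^sup>p\<close> of bounded convex sets (Poincare). Two
  applications show that the gradients and the functions converge as well; hence \<open>u\<close> has first
  weak derivatives and both \<open>u\<close> and \<open>\<partial>\<^sub>i u\<close> are \<open>W\<^sup>1\<^sup>,\<^sup>p\<close> limits, up to the boundary, of smooth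
  functions. The traces exist because a boundary value is an integral of the function and its normal
  derivative over the vertical segment.

  The first two estimates are Jensen's inequality on vertical segments. For the seminorm,
  \<open>(x', t)\<close> and \<open>(x' + h, t)\<close> are joined by two segments meeting at distance \<open>|h| / 2\<close> inside the
  strip, and the powers of \<open>|h|\<close> are integrated as in Hardy's inequality. All three pass from the
  approximants to the limit.
\<close>

section \<open>Powers and Jensen's inequality\<close>

text \<open>Membership in \<open>hom_sobolev 2 p\<close> gives local integrability of u and second
  derivatives in L^p, nothing in between. Averaging towards a fixed support, unlike ordinary
  mollification, never evaluates u outside \<Omega>, and a weak derivative of order 2 passes to the
  average in one step, before first derivatives are known to exist.

  \<open>weak_deriv\<close> and \<open>Tr\<close> are choices. Weak derivatives are pinned down
  almost everywhere by the fundamental lemma; for a trace, each estimate is proved along the smooth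
  sequence that belongs to the chosen trace.

  The first two estimates have exact constants, which a triangle inequality with factor
  \<open>2 powr p\<close> would spoil in the limit; a weighted one with leading coefficient tending
  to 1 is used.

  In the seminorm, plain Jensen on a segment leaves |h|^(-d), d = N - 1, whose integral over \<tau>
  < |h| < b - a grows like log((b - a) / \<tau>) near the face. The density \<tau>^(-1/2) changes
  the exponent to -(d + \<beta>) with \<beta> = (p - 1) / 2; the integral is then of order
  \<tau>^(-\<beta>) and cancels a gained \<tau>^\<beta>. Here p > 1 is essential.\<close>

lemma powr_abs_add_le:
  fixes a b p :: real
  assumes "0 \<le> p"
  shows "\<bar>a + b\<bar> powr p \<le> 2 powr p * (\<bar>a\<bar> powr p + \<bar>b\<bar> powr p)"
proof -
  have "\<bar>a + b\<bar> powr p \<le> (2 * max \<bar>a\<bar> \<bar>b\<bar>) powr p"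
    by (rule powr_mono2) (use assms in auto)
  also have "\<dots> = 2 powr p * max \<bar>a\<bar> \<bar>b\<bar> powr p"
    by (rule powr_mult)
  also have "\<dots> \<le> 2 powr p * (\<bar>a\<bar> powr p + \<bar>b\<bar> powr p)"
    by (intro mult_left_mono) (auto simp: max_def)
  finally show ?thesis .
qed

lemma powr_sum_abs_le:
  fixes f :: "'i \<Rightarrow> real"
  assumes "finite I" "0 < p"
  shows "(\<Sum>i\<in>I. \<bar>f i\<bar>) powr p \<le> real (card I) powr p * (\<Sum>i\<in>I. \<bar>f i\<bar> powr p)"
proof (cases "I = {}")
  case False
  define m where "m = Max ((\<lambda>i. \<bar>f i\<bar>) ` I)"
  have m: "\<bar>f i\<bar> \<le> m" if "i \<in> I" for i
    unfolding m_def using that assms by auto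
  have "m \<in> (\<lambda>i. \<bar>f i\<bar>) ` I"
    unfolding m_def using False assms by (intro Max_in) auto
  then obtain j where j: "j \<in> I" "m = \<bar>f j\<bar>" by auto
  have "(\<Sum>i\<in>I. \<bar>f i\<bar>) powr p \<le> (real (card I) * m) powr p"
    using assms m by (intro powr_mono2 sum_nonneg sum_bounded_above) auto
  also have "\<dots> = real (card I) powr p * m powr p"
    using j by (intro powr_mult)
  also have "\<dots> \<le> real (card I) powr p * (\<Sum>i\<in>I. \<bar>f i\<bar> powr p)"
    using assms j by (intro mult_left_mono) (auto intro: member_le_sum)
  finally show ?thesis .
qed (use assms in auto)

text \<open>Convexity of \<open>t powr p\<close> at a + b = (1 - \<theta>) (a / (1 - \<theta>)) +
  \<theta> (b / \<theta>). As \<theta> tends to 0 the coefficient of the first term tends to 1, so a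
  main term can pass to a limit without losing a factor.\<close>

lemma powr_abs_add_le_weighted:
  fixes a b p \<theta> :: real
  assumes p: "1 \<le> p" and \<theta>: "0 < \<theta>" "\<theta> < 1"
  shows "\<bar>a + b\<bar> powr p \<le> (1 - \<theta>) powr (1 - p) * \<bar>a\<bar> powr p + \<theta> powr (1 - p) * \<bar>b\<bar> powr p"
proof -
  \<comment> \<open>Both coefficients are at least 1. This covers a = 0 or b = 0, since the
    convexity argument below is carried out for positive arguments.\<close>
  have le: "t powr p \<le> s powr (1 - p) * t powr p" if "0 < s" "s < 1" for s t :: real
    using that p powr_mono2'[of "1 - p" s 1] mult_right_mono[of 1 "s powr (1 - p)" "t powr p"] by simp
  have *: "(x + y) powr p \<le> (1 - \<theta>) powr (1 - p) * x powr p + \<theta> powr (1 - p) * y powr p"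
    if "0 < x" "0 < y" for x y
  proof -
    have "((1 - \<theta>) *\<^sub>R (x / (1 - \<theta>)) + \<theta> *\<^sub>R (y / \<theta>)) powr p
        \<le> (1 - \<theta>) * (x / (1 - \<theta>)) powr p + \<theta> * (y / \<theta>) powr p"
      using that \<theta> by (intro convex_onD[OF powr_convex[OF p]]) auto
    also have "(1 - \<theta>) *\<^sub>R (x / (1 - \<theta>)) + \<theta> *\<^sub>R (y / \<theta>) = x + y"
      using \<theta> by simp
    also have "(1 - \<theta>) * (x / (1 - \<theta>)) powr p = (1 - \<theta>) powr (1 - p) * x powr p"
      using \<theta> that by (simp add: powr_divide powr_diff)
    also have "\<theta> * (y / \<theta>) powr p = \<theta> powr (1 - p) * y powr p"
      using \<theta> that by (simp add: powr_divide powr_diff)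
    finally show ?thesis .
  qed
  have "\<bar>a + b\<bar> powr p \<le> (\<bar>a\<bar> + \<bar>b\<bar>) powr p"
    using p by (intro powr_mono2) auto
  also have "\<dots> \<le> (1 - \<theta>) powr (1 - p) * \<bar>a\<bar> powr p + \<theta> powr (1 - p) * \<bar>b\<bar> powr p"
    using *[of "\<bar>a\<bar>" "\<bar>b\<bar>"] le[of \<theta> "\<bar>b\<bar>"] le[of "1 - \<theta>" "\<bar>a\<bar>"] \<theta> p
    by (cases "a = 0"; cases "b = 0") auto
  finally show ?thesis .
qed

text \<open>The tangent of \<open>x powr p\<close> at t lies below the graph; here it comes out of
  Young's inequality with exponents p and p / (p - 1).\<close>

lemma powr_tangent_le:
  fixes x t p :: real
  assumes "1 \<le> p" "0 \<le> x" "0 < t"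
  shows "p * t powr (p - 1) * x \<le> x powr p + (p - 1) * t powr p"
proof (cases "x = 0")
  case False
  then have x: "x > 0" using assms by simp
  have "(x powr p) powr (1 / p) * (t powr p) powr (1 - 1 / p)
      \<le> 1 / p * x powr p + (1 - 1 / p) * t powr p"
    using assms x by (intro Youngs_inequality_0) auto
  also have "(x powr p) powr (1 / p) * (t powr p) powr (1 - 1 / p) = x * t powr (p - 1)"
    using assms x by (simp add: powr_powr right_diff_distrib)
  finally have "x * t powr (p - 1) * p \<le> (1 / p * x powr p + (1 - 1 / p) * t powr p) * p"
    using assms by (intro mult_right_mono) auto
  also have "\<dots> = x powr p + (p - 1) * t powr p"
    using assms by (simp add: field_simps)
  finally show ?thesis by (simp add: mult_ac)
qed (use assms in auto)

lemma abs_le_one_plus_powr: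
  fixes x p :: real
  assumes "1 \<le> p"
  shows "\<bar>x\<bar> \<le> 1 + \<bar>x\<bar> powr p"
proof (cases "\<bar>x\<bar> \<le> 1")
  case False
  then have "\<bar>x\<bar> powr 1 \<le> \<bar>x\<bar> powr p" using assms by (intro powr_mono) auto
  then show ?thesis using False by simp
qed (auto intro: order_trans[of _ 1])

lemma (in finite_measure) integrable_of_powr_finite:
  fixes f :: "'a \<Rightarrow> real"
  assumes p: "1 \<le> p" and f[measurable]: "f \<in> borel_measurable M"
    and fin: "(\<integral>\<^sup>+x. ennreal (\<bar>f x\<bar> powr p) \<partial>M) < \<infinity>"
  shows "integrable M f"
proof (rule integrableI_bounded[OF f])
  have "(\<integral>\<^sup>+x. ennreal (norm (f x)) \<partial>M) \<le> (\<integral>\<^sup>+x. 1 + ennreal (\<bar>f x\<bar> powr p) \<partial>M)"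
    using abs_le_one_plus_powr[OF p]
    by (intro nn_integral_mono) (auto simp flip: ennreal_1 ennreal_plus intro!: ennreal_leI)
  also have "\<dots> = emeasure M (space M) + (\<integral>\<^sup>+x. ennreal (\<bar>f x\<bar> powr p) \<partial>M)"
    by (subst nn_integral_add) auto
  also have "\<dots> < \<infinity>" using fin emeasure_finite by (simp add: less_top[symmetric])
  finally show "(\<integral>\<^sup>+x. ennreal (norm (f x)) \<partial>M) < \<infinity>" .
qed

text \<open>Jensen's inequality for total mass W: integrate the tangent inequality at t = I / W, the
  mean of |f|. The remaining cases rest on default values: a function that is not integrable has
  Bochner integral 0, and if only its p-th power is not integrable the right-hand side is
  infinite.\<close>

lemma (in finite_measure) powr_integral_le:
  fixes f :: "'a \<Rightarrow> real"
  assumes p: "1 \<le> p" and f[measurable]: "f \<in> borel_measurable M"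
  shows "ennreal (\<bar>\<integral>x. f x \<partial>M\<bar> powr p)
    \<le> ennreal (measure M (space M) powr (p - 1)) * (\<integral>\<^sup>+x. ennreal (\<bar>f x\<bar> powr p) \<partial>M)"
proof (cases "(\<integral>x. \<bar>f x\<bar> \<partial>M) = 0 \<or> \<not> integrable M (\<lambda>x. \<bar>f x\<bar> powr p) \<or> \<not> integrable M f")
  case False
  define W where "W = measure M (space M)"
  define I where "I = (\<integral>x. \<bar>f x\<bar> \<partial>M)"
  have int: "integrable M f" "integrable M (\<lambda>x. \<bar>f x\<bar> powr p)" and I: "I > 0"
    using False Bochner_Integration.integral_nonneg[where M=M and f="\<lambda>x. \<bar>f x\<bar>"] by (auto simp: I_def less_le)
  have "W \<noteq> 0"
  proof
    assume "W = 0"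
    then have "emeasure M (space M) = 0" by (simp add: W_def emeasure_eq_measure)
    then have "AE x in M. f x = 0" by (intro AE_I'[of "space M"]) (auto simp: null_sets_def)
    then have "I = 0" unfolding I_def by (intro Bochner_Integration.integral_eq_zero_AE) auto
    then show False using I by simp
  qed
  then have W: "W > 0" by (simp add: W_def less_le)
  define t where "t = I / W"
  have t: "t > 0" using I W by (simp add: t_def)
  have "(\<integral>x. p * t powr (p - 1) * \<bar>f x\<bar> \<partial>M) \<le> (\<integral>x. \<bar>f x\<bar> powr p + (p - 1) * t powr p \<partial>M)"
    using int powr_tangent_le[OF p _ t] by (intro integral_mono) auto
  then have "p * t powr (p - 1) * I \<le> (\<integral>x. \<bar>f x\<bar> powr p \<partial>M) + (p - 1) * t powr p * W"
    using int by (simp add: I_def W_def mult_ac)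
  moreover have "(p - 1) * t powr p * W = (p - 1) * (t powr (p - 1) * I)"
  proof -
    have "t powr p = t powr (p - 1) * t" using t powr_mult_base[of t "p - 1"] by (simp add: mult.commute)
    moreover have "t * W = I" using W by (simp add: t_def)
    ultimately show ?thesis by (simp only: mult.assoc)
  qed
  ultimately have "t powr (p - 1) * I \<le> (\<integral>x. \<bar>f x\<bar> powr p \<partial>M)"
    by (simp add: algebra_simps)
  then have "W powr (p - 1) * (t powr (p - 1) * I) \<le> W powr (p - 1) * (\<integral>x. \<bar>f x\<bar> powr p \<partial>M)"
    by (intro mult_left_mono) auto
  moreover have "W powr (p - 1) * (t powr (p - 1) * I) = I powr p"
    using W I by (simp add: t_def powr_divide powr_diff)
  ultimately have *: "I powr p \<le> W powr (p - 1) * (\<integral>x. \<bar>f x\<bar> powr p \<partial>M)" by simp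
  have "\<bar>\<integral>x. f x \<partial>M\<bar> powr p \<le> I powr p"
    unfolding I_def using p by (intro powr_mono2 Bochner_Integration.integral_abs_bound) auto
  with * have "ennreal (\<bar>\<integral>x. f x \<partial>M\<bar> powr p) \<le> ennreal (W powr (p - 1) * (\<integral>x. \<bar>f x\<bar> powr p \<partial>M))"
    by (intro ennreal_leI) auto
  also have "\<dots> = ennreal (W powr (p - 1)) * (\<integral>\<^sup>+x. ennreal (\<bar>f x\<bar> powr p) \<partial>M)"
    using int by (subst nn_integral_eq_integral) (auto simp: ennreal_mult')
  finally show ?thesis by (simp add: W_def)
next
  case True
  then consider "(\<integral>x. \<bar>f x\<bar> \<partial>M) = 0" | "\<not> integrable M (\<lambda>x. \<bar>f x\<bar> powr p)" "integrable M f" | "\<not> integrable M f"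
    by blast
  then show ?thesis
  proof cases
    case 1
    then have "(\<integral>x. f x \<partial>M) = 0" using Bochner_Integration.integral_abs_bound[of M f] by simp
    then show ?thesis by simp
  next
    case 2
    have top: "(\<integral>\<^sup>+x. ennreal (\<bar>f x\<bar> powr p) \<partial>M) = \<infinity>"
    proof (rule ccontr)
      assume "(\<integral>\<^sup>+x. ennreal (\<bar>f x\<bar> powr p) \<partial>M) \<noteq> \<infinity>"
      then have "integrable M (\<lambda>x. \<bar>f x\<bar> powr p)"
        by (intro integrableI_bounded) (auto simp: less_top[symmetric])
      then show False using 2 by simp
    qed
    \<comment> \<open>Mass 0 is separate: there \<open>0 powr (p - 1) = 0\<close> and
      \<open>0 * top = 0\<close>, so the infinite factor gives nothing, but f vanishes almost
      everywhere.\<close>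
    show ?thesis
    proof (cases "measure M (space M) = 0")
      case True
      then have "emeasure M (space M) = 0" by (simp add: emeasure_eq_measure)
      then have "AE x in M. f x = 0" by (intro AE_I'[of "space M"]) (auto simp: null_sets_def)
      then have "(\<integral>x. f x \<partial>M) = 0" by (rule Bochner_Integration.integral_eq_zero_AE)
      then show ?thesis by simp
    qed (use top in \<open>simp add: ennreal_mult_top\<close>)
  next
    case 3
    then have "(\<integral>x. f x \<partial>M) = 0" by (rule not_integrable_integral_eq)
    then show ?thesis by simp
  qed
qed

text \<open>If \<open>g\<close> is not integrable, the right-hand side is infinite.\<close>

lemma (in finite_measure) powr_integral_diff_le:
  fixes f g :: "'a \<Rightarrow> real"
  assumes p: "1 \<le> p" and f: "integrable M f" and g[measurable]: "g \<in> borel_measurable M"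
    and W: "W = measure M (space M)" "0 < W"
  shows "ennreal (\<bar>(\<integral>x. f x \<partial>M) - (\<integral>x. g x \<partial>M)\<bar> powr p)
    \<le> ennreal (W powr (p - 1)) * (\<integral>\<^sup>+x. ennreal (\<bar>f x - g x\<bar> powr p) \<partial>M)"
proof -
  note [measurable] = borel_measurable_integrable[OF f]
  show ?thesis
  proof (cases "(\<integral>\<^sup>+x. ennreal (\<bar>f x - g x\<bar> powr p) \<partial>M) < \<infinity>")
    case True
    then have "integrable M (\<lambda>x. f x - g x)"
      by (intro integrable_of_powr_finite[OF p]) auto
    from Bochner_Integration.integrable_diff[OF f this]
    have "integrable M (\<lambda>x. f x - (f x - g x))" .
    moreover have "(\<lambda>x. f x - (f x - g x)) = g" by auto
    ultimately have "integrable M g" by metis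
    then have "(\<integral>x. f x \<partial>M) - (\<integral>x. g x \<partial>M) = (\<integral>x. f x - g x \<partial>M)"
      using f by simp
    then show ?thesis using powr_integral_le[OF p, of "\<lambda>x. f x - g x"] W by simp
  next
    case False
    then have "(\<integral>\<^sup>+x. ennreal (\<bar>f x - g x\<bar> powr p) \<partial>M) = \<infinity>" by (simp add: less_top[symmetric])
    then show ?thesis using W by (simp add: ennreal_mult_top)
  qed
qed

section \<open>Calculus of smooth functions\<close>

lemma partial_deriv_eq:
  assumes "(f has_derivative f') (at x)"
  shows "partial_deriv e f x = f' e"
  unfolding partial_deriv_def using frechet_derivative_at[OF assms] by simp

lemma has_derivative_partial_deriv:
  fixes f :: "'a::euclidean_space \<Rightarrow> real"
  assumes "f differentiable (at x)"
  shows "(f has_derivative (\<lambda>h. \<Sum>e\<in>Basis. (h \<bullet> e) * partial_deriv e f x)) (at x)"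
proof -
  obtain f' where f': "(f has_derivative f') (at x)"
    using assms by (auto simp: differentiable_def)
  then interpret f': bounded_linear f' by (rule has_derivative_bounded_linear)
  have "f' h = (\<Sum>e\<in>Basis. (h \<bullet> e) * partial_deriv e f x)" for h
  proof -
    have "f' h = f' (\<Sum>e\<in>Basis. (h \<bullet> e) *\<^sub>R e)" by (simp add: euclidean_representation)
    also have "\<dots> = (\<Sum>e\<in>Basis. (h \<bullet> e) * partial_deriv e f x)"
      by (simp add: f'.sum f'.scaleR partial_deriv_eq[OF f'])
    finally show ?thesis .
  qed
  then have "f' = (\<lambda>h. \<Sum>e\<in>Basis. (h \<bullet> e) * partial_deriv e f x)" by (rule ext)
  then show ?thesis using f' by simp
qed

lemma class_C_SucD: "class_C (Suc k) f \<Longrightarrow> class_C k f"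
proof (induction k arbitrary: f)
  case 0
  then show ?case
    by (auto intro!: continuous_at_imp_continuous_on differentiable_imp_continuous_within)
next
  case (Suc k)
  then show ?case by (metis class_C.simps(2))
qed

lemma class_C_const: "class_C k (\<lambda>x::'a::euclidean_space. c)"
proof (induction k arbitrary: c)
  case (Suc k)
  have "partial_deriv e (\<lambda>x::'a. c) = (\<lambda>x. 0)" for e
    by (rule ext, subst partial_deriv_eq[OF has_derivative_const]) simp
  then show ?case using Suc by simp
qed simp

lemma class_C_inner: "class_C k (\<lambda>x::'a::euclidean_space. x \<bullet> b)"
proof (cases k)
  case (Suc j)
  have d: "((\<lambda>x::'a. x \<bullet> b) has_derivative (\<lambda>h. h \<bullet> b)) (at x)" for x
    by (auto intro!: derivative_eq_intros)
  have "partial_deriv e (\<lambda>x::'a. x \<bullet> b) = (\<lambda>x. e \<bullet> b)" for e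
    by (rule ext, subst partial_deriv_eq[OF d]) simp
  then show ?thesis using Suc class_C_const differentiableI[OF d] by auto
qed (auto intro!: continuous_intros)

lemma class_C_add:
  assumes "class_C k f" "class_C k g"
  shows "class_C k (\<lambda>x. f x + g x)"
  using assms
proof (induction k arbitrary: f g)
  case (Suc k)
  then have d: "((\<lambda>x. f x + g x) has_derivative
      (\<lambda>h. frechet_derivative f (at x) h + frechet_derivative g (at x) h)) (at x)" for x
    by (intro has_derivative_add) (auto simp: frechet_derivative_works)
  have "partial_deriv e (\<lambda>x. f x + g x) = (\<lambda>x. partial_deriv e f x + partial_deriv e g x)" for e
    by (rule ext, subst partial_deriv_eq[OF d]) (simp add: partial_deriv_def)
  then show ?case using Suc differentiableI[OF d] by auto
qed (auto intro!: continuous_intros)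

lemma class_C_mult:
  assumes "class_C k f" "class_C k g"
  shows "class_C k (\<lambda>x. f x * g x)"
  using assms
proof (induction k arbitrary: f g)
  case (Suc k)
  then have d: "((\<lambda>x. f x * g x) has_derivative
      (\<lambda>h. f x * frechet_derivative g (at x) h + frechet_derivative f (at x) h * g x)) (at x)" for x
    by (intro has_derivative_mult) (auto simp: frechet_derivative_works)
  have "partial_deriv e (\<lambda>x. f x * g x) = (\<lambda>x. f x * partial_deriv e g x + partial_deriv e f x * g x)" for e
    by (rule ext, subst partial_deriv_eq[OF d]) (simp add: partial_deriv_def)
  moreover have "class_C k f" "class_C k g" using Suc.prems class_C_SucD by auto
  ultimately show ?case using Suc differentiableI[OF d] by (auto intro!: class_C_add)
qed (auto intro!: continuous_intros)

lemma smooth_mult: "smooth f \<Longrightarrow> smooth g \<Longrightarrow> smooth (\<lambda>x. f x * g x)"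
  unfolding smooth_def using class_C_mult by blast

lemma smooth_const: "smooth (\<lambda>x. c)"
  unfolding smooth_def using class_C_const by blast

lemma smooth_differentiable: "smooth f \<Longrightarrow> f differentiable (at x)"
  unfolding smooth_def by (metis class_C.simps(2))

lemma smooth_continuous: "smooth f \<Longrightarrow> continuous_on S f"
  unfolding smooth_def by (metis class_C.simps(1) continuous_on_subset top_greatest)

lemma smooth_borel_measurable[measurable_dest]: "smooth f \<Longrightarrow> f \<in> borel_measurable borel"
  using smooth_continuous[of f UNIV] by (rule borel_measurable_continuous_onI)

lemma smooth_partial_deriv: "smooth f \<Longrightarrow> e \<in> Basis \<Longrightarrow> smooth (partial_deriv e f)"
  unfolding smooth_def by (metis class_C.simps(2))

lemma smooth_partial_derivs: "smooth f \<Longrightarrow> set es \<subseteq> Basis \<Longrightarrow> smooth (partial_derivs es f)"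
  by (induction es) (auto intro: smooth_partial_deriv)

lemma smooth_has_derivative:
  "smooth f \<Longrightarrow> (f has_derivative (\<lambda>h. \<Sum>e\<in>Basis. (h \<bullet> e) * partial_deriv e f x)) (at x)"
  by (intro has_derivative_partial_deriv smooth_differentiable)

lemma partial_deriv_mult:
  assumes "smooth f" "smooth g"
  shows "partial_deriv e (\<lambda>x. f x * g x) = (\<lambda>x. f x * partial_deriv e g x + partial_deriv e f x * g x)"
proof
  fix x
  have "((\<lambda>x. f x * g x) has_derivative
      (\<lambda>h. f x * frechet_derivative g (at x) h + frechet_derivative f (at x) h * g x)) (at x)"
    using assms by (intro has_derivative_mult) (auto dest!: smooth_differentiable[of _ x] simp: frechet_derivative_works)
  from partial_deriv_eq[OF this, of e]
  show "partial_deriv e (\<lambda>x. f x * g x) x = f x * partial_deriv e g x + partial_deriv e f x * g x"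
    by (simp add: partial_deriv_def)
qed

lemma affine_composition_derivative:
  fixes f :: "'a::euclidean_space \<Rightarrow> real"
  assumes "\<And>x. f differentiable (at x)"
  shows "((\<lambda>x. f (a *\<^sub>R x + c)) has_derivative (\<lambda>h. frechet_derivative f (at (a *\<^sub>R x + c)) (a *\<^sub>R h))) (at x)"
    and "partial_deriv e (\<lambda>x. f (a *\<^sub>R x + c)) = (\<lambda>x. a * partial_deriv e f (a *\<^sub>R x + c))"
proof -
  have F: "(f has_derivative frechet_derivative f (at y)) (at y)" for y
    using assms by (simp add: frechet_derivative_works)
  show d: "((\<lambda>x. f (a *\<^sub>R x + c)) has_derivative (\<lambda>h. frechet_derivative f (at (a *\<^sub>R x + c)) (a *\<^sub>R h))) (at x)" for x
    by (rule has_derivative_compose[OF _ F]) (auto intro!: derivative_eq_intros)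
  show "partial_deriv e (\<lambda>x. f (a *\<^sub>R x + c)) = (\<lambda>x. a * partial_deriv e f (a *\<^sub>R x + c))"
  proof
    fix x
    interpret L: bounded_linear "frechet_derivative f (at (a *\<^sub>R x + c))"
      by (rule has_derivative_bounded_linear[OF F])
    show "partial_deriv e (\<lambda>x. f (a *\<^sub>R x + c)) x = a * partial_deriv e f (a *\<^sub>R x + c)"
      by (subst partial_deriv_eq[OF d]) (simp add: partial_deriv_def L.scaleR)
  qed
qed

lemma class_C_affine:
  fixes f :: "'a::euclidean_space \<Rightarrow> real"
  assumes "class_C k f"
  shows "class_C k (\<lambda>x. f (a *\<^sub>R x + c))"
  using assms
proof (induction k arbitrary: f)
  case 0
  then show ?case by (auto intro!: continuous_on_compose2[of UNIV f] continuous_intros)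
next
  case (Suc k)
  then have d: "\<And>x. f differentiable (at x)" by simp
  then show ?case
    using Suc affine_composition_derivative(2)[OF d] differentiableI[OF affine_composition_derivative(1)[OF d]]
    by (auto intro!: class_C_mult class_C_const)
qed

lemma smooth_affine: "smooth f \<Longrightarrow> smooth (\<lambda>x. f (a *\<^sub>R x + c))"
  unfolding smooth_def using class_C_affine by blast

text \<open>Each derivative contributes one factor a. The prefactor b is carried along because
  rescaled mollifiers have one; the explicit \<open>1 *\<close> and \<open>+ 0\<close> in later
  formulas bring them into exactly this shape.\<close>

lemma partial_derivs_affine:
  assumes "smooth f" "set es \<subseteq> Basis"
  shows "partial_derivs es (\<lambda>x. b * f (a *\<^sub>R x + c)) =
    (\<lambda>x. b * a ^ length es * partial_derivs es f (a *\<^sub>R x + c))"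
  using assms(2)
proof (induction es)
  case (Cons e es)
  have sm: "smooth (partial_derivs es f)" using assms Cons by (auto intro: smooth_partial_derivs)
  have c: "partial_deriv e (\<lambda>x. b * a ^ length es) = (\<lambda>x. 0)"
    by (rule ext, subst partial_deriv_eq[OF has_derivative_const]) simp
  have "partial_derivs (e # es) (\<lambda>x. b * f (a *\<^sub>R x + c)) =
      partial_deriv e (\<lambda>x. (b * a ^ length es) * partial_derivs es f (a *\<^sub>R x + c))"
    using Cons by simp
  also have "\<dots> = (\<lambda>x. (b * a ^ length es) * (a * partial_deriv e (partial_derivs es f) (a *\<^sub>R x + c)))"
    by (subst partial_deriv_mult[OF smooth_const smooth_affine[OF sm]])
      (simp add: c affine_composition_derivative(2)[OF smooth_differentiable[OF sm]])
  finally show ?case by (simp add: mult_ac)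
qed simp

section \<open>A smooth bump function\<close>

text \<open>The classical exp(-1/t), divided by powers of t. Up to linear combinations the family is
  closed under differentiation, which makes smoothness a single induction for all n at once.\<close>

definition flat_exp :: "nat \<Rightarrow> real \<Rightarrow> real" where
  "flat_exp n t = (if 0 < t then exp (- (1 / t)) / t ^ n else 0)"

lemma flat_exp_tendsto_0: "(flat_exp n \<longlongrightarrow> 0) (at 0)"
proof (rule filterlim_split_at)
  show "(flat_exp n \<longlongrightarrow> 0) (at_left 0)"
    by (rule tendsto_eventually) (auto simp: eventually_at_filter flat_exp_def)
  have "((\<lambda>t. inverse t ^ n / exp (inverse t)) \<longlongrightarrow> (0::real)) (at_right 0)"
    by (rule filterlim_compose[OF tendsto_power_div_exp_0 filterlim_inverse_at_top_right])
  moreover have "eventually (\<lambda>t. inverse t ^ n / exp (inverse t) = flat_exp n t) (at_right 0)"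
    by (auto simp: eventually_at_filter flat_exp_def exp_minus field_simps)
  ultimately show "(flat_exp n \<longlongrightarrow> 0) (at_right 0)"
    using Lim_transform_eventually by blast
qed

lemma flat_exp_has_derivative:
  "(flat_exp n has_real_derivative flat_exp (n + 2) t - real n * flat_exp (n + 1) t) (at t)"
proof -
  consider "t > 0" | "t < 0" | "t = 0" by linarith
  then show ?thesis
  proof cases
    case 1
    have "((\<lambda>t. exp (- (1 / t)) / t ^ n) has_real_derivative
        (exp (- (1 / t)) * (1 / (t * t)) * t ^ n - exp (- (1 / t)) * (real n * t ^ (n - Suc 0))) / (t ^ n * t ^ n)) (at t)"
      using 1 by (auto intro!: derivative_eq_intros)
    also have "(exp (- (1 / t)) * (1 / (t * t)) * t ^ n - exp (- (1 / t)) * (real n * t ^ (n - Suc 0))) / (t ^ n * t ^ n)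
        = flat_exp (n + 2) t - real n * flat_exp (n + 1) t"
      using 1 by (cases n) (simp_all add: flat_exp_def field_simps)
    finally have "((\<lambda>t. exp (- (1 / t)) / t ^ n) has_real_derivative
        flat_exp (n + 2) t - real n * flat_exp (n + 1) t) (at t)" .
    then show ?thesis
      by (rule has_field_derivative_transform_within_open[of _ _ _ "{0<..}"])
         (use 1 in \<open>auto simp: flat_exp_def\<close>)
  next
    case 2
    have "((\<lambda>t. 0) has_real_derivative flat_exp (n + 2) t - real n * flat_exp (n + 1) t) (at t)"
      using 2 by (auto simp: flat_exp_def)
    then show ?thesis
      by (rule has_field_derivative_transform_within_open[of _ _ _ "{..<0}"])
         (use 2 in \<open>auto simp: flat_exp_def\<close>)
  next
    \<comment> \<open>At 0 the difference quotient of \<open>flat_exp n\<close> is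
      \<open>flat_exp (Suc n)\<close>, which tends to 0.\<close>
    case 3
    have "((\<lambda>h. (flat_exp n (0 + h) - flat_exp n 0) / h) \<longlongrightarrow> 0) (at 0)"
      by (rule Lim_transform_eventually[OF flat_exp_tendsto_0[of "Suc n"]])
         (auto simp: flat_exp_def eventually_at_filter)
    then show ?thesis using 3 by (simp add: DERIV_def flat_exp_def)
  qed
qed

text \<open>The partial derivatives are combinations of the same functions for n + 1 and n + 2 with
  affine coefficients, so the induction on the order of differentiability has to run with n
  arbitrary.\<close>

lemma smooth_flat_exp_ball: "smooth (\<lambda>x::'a::euclidean_space. flat_exp n (r\<^sup>2 - (x - c) \<bullet> (x - c)))"
proof -
  have "class_C k (\<lambda>x::'a. flat_exp n (r\<^sup>2 - (x - c) \<bullet> (x - c)))" for k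
  proof (induction k arbitrary: n)
    case 0
    have "continuous_on UNIV (flat_exp n)"
      using DERIV_isCont[OF flat_exp_has_derivative] by (intro continuous_at_imp_continuous_on) blast
    then show ?case
      by (auto intro!: continuous_on_compose2[of UNIV "flat_exp n"] continuous_intros)
  next
    case (Suc k)
    define q where "q x = r\<^sup>2 - (x - c) \<bullet> (x - c)" for x :: 'a
    have d: "((\<lambda>x. flat_exp n (q x)) has_derivative
       (\<lambda>h. (flat_exp (n + 2) (q x) - real n * flat_exp (n + 1) (q x)) * (- (2 * (h \<bullet> (x - c)))))) (at x)" for x
    proof -
      have 1: "(flat_exp n has_derivative (*) (flat_exp (n + 2) (q x) - real n * flat_exp (n + 1) (q x))) (at (q x))"
        using flat_exp_has_derivative by (simp add: has_field_derivative_def)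
      have 2: "(q has_derivative (\<lambda>h. - (2 * (h \<bullet> (x - c))))) (at x)"
        unfolding q_def by (auto intro!: derivative_eq_intros simp: inner_commute)
      show ?thesis using has_derivative_compose[OF 2 1] by simp
    qed
    have "partial_deriv e (\<lambda>x. flat_exp n (q x)) =
        (\<lambda>x. (flat_exp (n + 2) (q x) + (- real n) * flat_exp (n + 1) (q x)) * ((-2) * (x \<bullet> e + - (c \<bullet> e))))" for e
      by (rule ext, subst partial_deriv_eq[OF d]) (simp add: inner_commute[of e] inner_diff_left algebra_simps)
    moreover have "class_C k (\<lambda>x. (flat_exp (n + 2) (q x) + (- real n) * flat_exp (n + 1) (q x)) * ((-2) * (x \<bullet> e + - (c \<bullet> e))))" for e
      using Suc unfolding q_def
      by (intro class_C_mult class_C_add class_C_const class_C_inner) auto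
    ultimately have "class_C (Suc k) (\<lambda>x. flat_exp n (q x))"
      using differentiableI[OF d] by simp
    then show ?case by (simp add: q_def)
  qed
  then show ?thesis by (simp add: smooth_def)
qed

lemma integrable_compact_support:
  fixes f :: "'a::euclidean_space \<Rightarrow> real"
  assumes "continuous_on UNIV f" "compact K" "\<And>x. x \<notin> K \<Longrightarrow> f x = 0"
  shows "integrable lborel f"
proof -
  have "integrable lborel (\<lambda>x. indicator K x *\<^sub>R f x)"
    using assms by (intro borel_integrable_compact) (auto intro: continuous_on_subset)
  moreover have "(\<lambda>x. indicator K x *\<^sub>R f x) = f"
  proof
    show "indicator K x *\<^sub>R f x = f x" for x
      using assms(3)[of x] by (cases "x \<in> K") auto
  qed
  ultimately show ?thesis by simp
qed

lemma test_functionsD: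
  assumes "\<phi> \<in> test_functions \<Omega>"
  obtains K where "compact K" "K \<subseteq> \<Omega>" "\<And>x. x \<notin> K \<Longrightarrow> \<phi> x = 0" "smooth \<phi>" "K = closure {x. \<phi> x \<noteq> 0}"
  using assms closure_subset[of "{x. \<phi> x \<noteq> 0}"] unfolding test_functions_def by blast

lemma test_functionsI:
  assumes "smooth \<phi>" "compact K" "K \<subseteq> \<Omega>" "\<And>x. x \<notin> K \<Longrightarrow> \<phi> x = 0"
  shows "\<phi> \<in> test_functions \<Omega>"
proof -
  have "closure {x. \<phi> x \<noteq> 0} \<subseteq> K"
    using assms by (intro closure_minimal compact_imp_closed) auto
  then show ?thesis
    using assms compact_Int_closed[OF assms(2), of "closure {x. \<phi> x \<noteq> 0}"]
    unfolding test_functions_def by (auto simp: Int_absorb1)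
qed

lemma ex_mollifier:
  fixes \<Omega> :: "'a::euclidean_space set"
  assumes "open \<Omega>" "\<Omega> \<noteq> {}"
  obtains \<eta> where "\<eta> \<in> test_functions \<Omega>" "\<And>x. 0 \<le> \<eta> x" "(\<integral>x. \<eta> x \<partial>lborel) = 1"
proof -
  obtain c r where r: "r > 0" "cball c r \<subseteq> \<Omega>"
    using assms open_contains_cball by (metis ex_in_conv)
  define f where "f x = flat_exp 0 (r\<^sup>2 - (x - c) \<bullet> (x - c))" for x
  have pos_iff: "f x \<noteq> 0 \<longleftrightarrow> x \<in> ball c r" for x
  proof -
    have "(x - c) \<bullet> (x - c) = (dist c x)\<^sup>2"
      by (simp add: dist_norm norm_minus_commute[of c] flip: power2_norm_eq_inner)
    then show ?thesis using r abs_le_square_iff[of r "dist c x"] power2_less_imp_less[of "dist c x" r] by (auto simp: f_def flat_exp_def not_less)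
  qed
  have nn: "0 \<le> f x" for x by (simp add: f_def flat_exp_def)
  have sm: "smooth f" unfolding f_def by (rule smooth_flat_exp_ball)
  have int: "integrable lborel f"
    by (rule integrable_compact_support[OF smooth_continuous[OF sm], of "cball c r"])
       (metis compact_cball pos_iff mem_ball_imp_mem_cball)+
  have "(\<integral>x. f x \<partial>lborel) \<noteq> 0"
  proof
    assume "(\<integral>x. f x \<partial>lborel) = 0"
    then have "AE x in lborel. f x = 0" using integral_nonneg_eq_0_iff_AE[OF int] nn by simp
    then have "AE x in lborel. x \<notin> ball c r" by eventually_elim (use pos_iff in blast)
    then have "emeasure lborel (ball c r) = 0"
      by (subst (asm) AE_iff_measurable[OF _ refl]) (auto simp: ball_def)
    then have "measure lborel (ball c r) = 0" by (simp add: measure_def)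
    then show False using content_ball_pos[OF r(1), of c] by simp
  qed
  then have I: "(\<integral>x. f x \<partial>lborel) > 0" using Bochner_Integration.integral_nonneg[where M=lborel and f=f] nn by (simp add: less_le)
  show ?thesis
  proof (rule that[of "\<lambda>x. inverse (\<integral>x. f x \<partial>lborel) * f x"])
    show "(\<lambda>x. inverse (\<integral>x. f x \<partial>lborel) * f x) \<in> test_functions \<Omega>"
    proof (rule test_functionsI[of _ "cball c r"])
      show "smooth (\<lambda>x. inverse (\<integral>x. f x \<partial>lborel) * f x)" by (intro smooth_mult smooth_const sm)
      fix x assume "x \<notin> cball c r"
      then have "f x = 0" using pos_iff[of x] by auto
      then show "inverse (\<integral>x. f x \<partial>lborel) * f x = 0" by simp
    qed (use r in auto)
  qed (use I nn in auto)
qed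

section \<open>Convolution with a smooth kernel\<close>

lemma nn_integral_lborel_affine:
  fixes f :: "'a::euclidean_space \<Rightarrow> ennreal"
  assumes [measurable]: "f \<in> borel_measurable borel" and c: "c \<noteq> 0"
  shows "(\<integral>\<^sup>+x. f (t + c *\<^sub>R x) \<partial>lborel) = ennreal (1 / \<bar>c\<bar> ^ DIM('a)) * (\<integral>\<^sup>+x. f x \<partial>lborel)"
proof -
  have "(\<integral>\<^sup>+x. f x \<partial>lborel) = ennreal (\<bar>c\<bar> ^ DIM('a)) * (\<integral>\<^sup>+x. f (t + c *\<^sub>R x) \<partial>lborel)"
    by (subst lborel_affine[OF c, of t])
       (simp add: nn_integral_density nn_integral_distr nn_integral_cmult)
  moreover have "ennreal (1 / \<bar>c\<bar> ^ DIM('a)) * ennreal (\<bar>c\<bar> ^ DIM('a)) = 1"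
    using c by (simp flip: ennreal_mult')
  ultimately show ?thesis by (simp add: mult.assoc[symmetric])
qed

text \<open>Holds for every f: the affine map is a homeomorphism, so f and the composition are
  measurable together, and if they are not, both Bochner integrals are 0.\<close>

lemma integral_lborel_affine:
  fixes f :: "'a::euclidean_space \<Rightarrow> real"
  assumes c: "c \<noteq> 0"
  shows "(\<integral>x. f (t + c *\<^sub>R x) \<partial>lborel) = (1 / \<bar>c\<bar> ^ DIM('a)) * (\<integral>x. f x \<partial>lborel)"
proof (cases "f \<in> borel_measurable borel")
  case True
  note [measurable] = True
  have "(\<integral>x. f x \<partial>lborel) = \<bar>c\<bar> ^ DIM('a) * (\<integral>x. f (t + c *\<^sub>R x) \<partial>lborel)"
    by (subst lborel_affine[OF c, of t])
       (simp add: integral_density integral_distr)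
  then show ?thesis using c by simp
next
  case False
  have "(\<lambda>x. f (t + c *\<^sub>R x)) \<notin> borel_measurable borel"
  proof
    assume [measurable]: "(\<lambda>x. f (t + c *\<^sub>R x)) \<in> borel_measurable borel"
    have "(\<lambda>y. (\<lambda>x. f (t + c *\<^sub>R x)) ((1 / c) *\<^sub>R (y - t))) \<in> borel_measurable borel"
      by measurable
    then show False using False c by simp
  qed
  then have "\<not> integrable lborel (\<lambda>x. f (t + c *\<^sub>R x))" "\<not> integrable lborel f"
    using False by (auto dest: borel_measurable_integrable)
  then show ?thesis by (simp add: not_integrable_integral_eq)
qed

lemma compact_support_bounded:
  fixes f :: "'a::euclidean_space \<Rightarrow> real"
  assumes "continuous_on UNIV f" "compact K" "\<And>x. x \<notin> K \<Longrightarrow> f x = 0"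
  obtains B where "0 < B" "\<And>x. \<bar>f x\<bar> \<le> B"
proof -
  have "bounded (f ` K)"
    using assms by (intro compact_imp_bounded compact_continuous_image) (auto intro: continuous_on_subset)
  then obtain B where B: "0 < B" "\<And>x. x \<in> K \<Longrightarrow> \<bar>f x\<bar> \<le> B"
    by (auto simp: bounded_pos)
  have "\<bar>f x\<bar> \<le> B" for x using B assms(3)[of x] by (cases "x \<in> K") auto
  then show ?thesis using B that by blast
qed

lemma partial_deriv_support:
  assumes "closed K" "\<And>x. x \<notin> K \<Longrightarrow> f x = 0" "x \<notin> K"
  shows "partial_deriv e f x = 0"
proof -
  have "(f has_derivative (\<lambda>h. 0)) (at x)"
    by (rule has_derivative_transform_within_open[OF has_derivative_const, of "- K"])
       (use assms in auto)
  then show ?thesis by (rule partial_deriv_eq)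
qed

lemma partial_derivs_support:
  assumes "closed K" "\<And>x. x \<notin> K \<Longrightarrow> f x = 0" "x \<notin> K"
  shows "partial_derivs es f x = 0"
  using assms(3)
proof (induction es arbitrary: x)
  case (Cons e es)
  then show ?case using partial_deriv_support[OF assms(1), of "partial_derivs es f"] by simp
qed (use assms in auto)

lemma test_functions_partial_derivs:
  assumes "\<phi> \<in> test_functions \<Omega>" "set es \<subseteq> Basis"
  shows "partial_derivs es \<phi> \<in> test_functions \<Omega>"
proof -
  obtain K where K: "compact K" "K \<subseteq> \<Omega>" "\<And>x. x \<notin> K \<Longrightarrow> \<phi> x = 0" "smooth \<phi>"
    using test_functionsD[OF assms(1)] by metis
  then show ?thesis
    using assms(2) partial_derivs_support[OF compact_imp_closed[OF K(1)] K(3)]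
    by (intro test_functionsI[of _ K]) (auto intro: smooth_partial_derivs)
qed

lemma test_functions_partial_deriv:
  "\<phi> \<in> test_functions \<Omega> \<Longrightarrow> e \<in> Basis \<Longrightarrow> partial_deriv e \<phi> \<in> test_functions \<Omega>"
  using test_functions_partial_derivs[of \<phi> \<Omega> "[e]"] by simp

lemma smooth_line_derivative:
  assumes "smooth f"
  shows "((\<lambda>t. f (x + t *\<^sub>R h)) has_real_derivative (\<Sum>e\<in>Basis. (h \<bullet> e) * partial_deriv e f (x + t *\<^sub>R h))) (at t)"
proof -
  have 1: "((\<lambda>t. x + t *\<^sub>R h) has_derivative (\<lambda>s. s *\<^sub>R h)) (at t)"
    by (auto intro!: derivative_eq_intros)
  have "((\<lambda>t. f (x + t *\<^sub>R h)) has_derivative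
      (\<lambda>s. \<Sum>e\<in>Basis. ((s *\<^sub>R h) \<bullet> e) * partial_deriv e f (x + t *\<^sub>R h))) (at t)"
    by (rule has_derivative_compose[OF 1 smooth_has_derivative[OF assms]])
  moreover have "(\<lambda>s. \<Sum>e\<in>Basis. ((s *\<^sub>R h) \<bullet> e) * partial_deriv e f (x + t *\<^sub>R h)) =
      (*) (\<Sum>e\<in>Basis. (h \<bullet> e) * partial_deriv e f (x + t *\<^sub>R h))"
    by (rule ext) (simp add: sum_distrib_left sum_distrib_right mult_ac)
  ultimately show ?thesis by (simp add: has_field_derivative_def)
qed

text \<open>The first-order error is small uniformly in x, as needed to pull it through the integral
  defining a convolution. It comes from the mean value theorem and the uniform continuity of the
  partial derivatives near the support.\<close>

lemma smooth_uniformly_differentiable: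
  fixes f :: "'a::euclidean_space \<Rightarrow> real"
  assumes f: "smooth f" and K: "compact K" "\<And>x. x \<notin> K \<Longrightarrow> f x = 0" and \<epsilon>: "0 < \<epsilon>"
  obtains d where "0 < d"
    "\<And>x h. norm h < d \<Longrightarrow> \<bar>f (x + h) - f x - (\<Sum>e\<in>Basis. (h \<bullet> e) * partial_deriv e f x)\<bar> \<le> \<epsilon> * norm h"
proof -
  obtain R where R: "0 < R" "K \<subseteq> cball 0 R"
    using compact_imp_bounded[OF K(1)] by (auto simp: bounded_pos subset_eq)
  define \<epsilon>' where "\<epsilon>' = \<epsilon> / DIM('a)"
  have \<epsilon>': "0 < \<epsilon>'" using \<epsilon> by (simp add: \<epsilon>'_def)
  \<comment> \<open>Since d is at most 1, the segment from x to x + h stays in the ball of radius R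
    + 2 when |x| is at most R + 1; for larger |x| both end points miss K and everything
    vanishes.\<close>
  have "\<forall>e\<in>Basis. \<exists>d>0. \<forall>x\<in>cball 0 (R+2). \<forall>y\<in>cball 0 (R+2). dist y x < d \<longrightarrow>
      dist (partial_deriv e f y) (partial_deriv e f x) < \<epsilon>'"
  proof
    fix e :: 'a assume "e \<in> Basis"
    then have "uniformly_continuous_on (cball 0 (R+2)) (partial_deriv e f)"
      using f by (intro compact_uniformly_continuous smooth_continuous smooth_partial_deriv) auto
    then show "\<exists>d>0. \<forall>x\<in>cball 0 (R+2). \<forall>y\<in>cball 0 (R+2). dist y x < d \<longrightarrow>
      dist (partial_deriv e f y) (partial_deriv e f x) < \<epsilon>'"
      unfolding uniformly_continuous_on_def using \<epsilon>' by blast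
  qed
  then obtain D where D: "\<And>e. e \<in> Basis \<Longrightarrow> D e > (0::real)"
    "\<And>e x y. e \<in> Basis \<Longrightarrow> x \<in> cball 0 (R+2) \<Longrightarrow> y \<in> cball 0 (R+2) \<Longrightarrow> dist y x < D e \<Longrightarrow>
      dist (partial_deriv e f y) (partial_deriv e f x) < \<epsilon>'" by metis
  define d where "d = min 1 (Min (D ` Basis))"
  have d: "0 < d" "d \<le> 1" "\<And>e. e \<in> Basis \<Longrightarrow> d \<le> D e"
    using D(1) by (auto simp: d_def min_le_iff_disj)
  show ?thesis
  proof (rule that[OF d(1)])
    fix x h :: 'a assume h: "norm h < d"
    show "\<bar>f (x + h) - f x - (\<Sum>e\<in>Basis. (h \<bullet> e) * partial_deriv e f x)\<bar> \<le> \<epsilon> * norm h"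
    proof (cases "norm x \<le> R + 1")
      case False
      then have n: "norm x > R" "norm (x + h) > R"
        using h d(2) norm_triangle_ineq4[of "x + h" h] by auto
      then have "x \<notin> K" "x + h \<notin> K" using R(2) by auto
      then have "f x = 0" "f (x + h) = 0" "\<And>e. partial_deriv e f x = 0"
        using K partial_deriv_support[OF compact_imp_closed[OF K(1)] K(2)] by auto
      then show ?thesis using \<epsilon> by simp
    next
      case True
      obtain z where z: "0 < z" "z < 1"
        "f (x + 1 *\<^sub>R h) - f (x + 0 *\<^sub>R h) = (1 - 0) * (\<Sum>e\<in>Basis. (h \<bullet> e) * partial_deriv e f (x + z *\<^sub>R h))"
        using MVT2[of 0 1 "\<lambda>t. f (x + t *\<^sub>R h)", OF _ smooth_line_derivative[OF f]] by auto
      have zh: "norm (z *\<^sub>R h) \<le> norm h" using z by (simp add: mult_left_le_one_le)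
      have x: "x \<in> cball 0 (R+2)" "x + z *\<^sub>R h \<in> cball 0 (R+2)"
        using True h d(2) zh norm_triangle_ineq[of x "z *\<^sub>R h"] by auto
      have "f (x + h) - f x - (\<Sum>e\<in>Basis. (h \<bullet> e) * partial_deriv e f x) =
          (\<Sum>e\<in>Basis. (h \<bullet> e) * (partial_deriv e f (x + z *\<^sub>R h) - partial_deriv e f x))"
        using z(3) by (simp add: right_diff_distrib sum_subtractf)
      also have "\<bar>\<dots>\<bar> \<le> (\<Sum>e\<in>(Basis::'a set). norm h * \<epsilon>')"
      proof (rule order_trans[OF sum_abs], rule sum_mono)
        fix e :: 'a assume e: "e \<in> Basis"
        have "dist (x + z *\<^sub>R h) x < D e" using h zh d(3)[OF e] by (simp add: dist_norm)
        then have "\<bar>partial_deriv e f (x + z *\<^sub>R h) - partial_deriv e f x\<bar> \<le> \<epsilon>'"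
          using D(2)[OF e x] by (simp add: dist_real_def)
        then show "\<bar>h \<bullet> e * (partial_deriv e f (x + z *\<^sub>R h) - partial_deriv e f x)\<bar> \<le> norm h * \<epsilon>'"
          using Basis_le_norm[OF e, of h] \<epsilon>' by (simp add: abs_mult mult_mono)
      qed
      also have "\<dots> = \<epsilon> * norm h" by (simp add: \<epsilon>'_def)
      finally show ?thesis .
    qed
  qed
qed

section \<open>Differentiation of convolutions\<close>

definition conv :: "('a::euclidean_space \<Rightarrow> real) \<Rightarrow> ('a \<Rightarrow> real) \<Rightarrow> 'a \<Rightarrow> real" where
  "conv f \<theta> x = (\<integral>z. f z * \<theta> (x - z) \<partial>lborel)"

lemma integrable_mult_bounded:
  fixes f g :: "'a::euclidean_space \<Rightarrow> real"
  assumes "integrable lborel f" "g \<in> borel_measurable borel" "\<And>x. \<bar>g x\<bar> \<le> B"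
  shows "integrable lborel (\<lambda>x. f x * g x)"
proof (rule Bochner_Integration.integrable_bound)
  show "integrable lborel (\<lambda>x. B * f x)" using assms by simp
  show "AE x in lborel. norm (f x * g x) \<le> norm (B * f x)"
  proof (rule AE_I2)
    fix x
    have "\<bar>f x\<bar> * \<bar>g x\<bar> \<le> \<bar>f x\<bar> * \<bar>B\<bar>" using assms(3)[of x] by (intro mult_left_mono) auto
    then show "norm (f x * g x) \<le> norm (B * f x)" by (simp add: abs_mult mult_ac)
  qed
qed (use assms in auto)

context
  fixes K :: "'a::euclidean_space set" and f :: "'a \<Rightarrow> real"
  assumes K: "compact K" and f: "integrable lborel f"
begin

lemma conv_integrable:
  assumes \<theta>: "smooth \<theta>" "\<And>x. x \<notin> K \<Longrightarrow> \<theta> x = 0"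
  shows "integrable lborel (\<lambda>z. f z * \<theta> (x - z))"
proof -
  obtain B where B: "0 < B" "\<And>x. \<bar>\<theta> x\<bar> \<le> B"
    using compact_support_bounded[OF smooth_continuous[OF \<theta>(1)] K \<theta>(2)] by metis
  note [measurable] = smooth_borel_measurable[OF \<theta>(1)]
  show ?thesis by (rule integrable_mult_bounded[OF f _ B(2)]) measurable
qed

text \<open>All derivatives fall on \<theta>, so f only has to be integrable: at each z the
  first-order error is at most |f z| times a uniform multiple of |y - x|.\<close>

lemma conv_has_derivative:
  assumes \<theta>: "smooth \<theta>" "\<And>x. x \<notin> K \<Longrightarrow> \<theta> x = 0"
  shows "(conv f \<theta> has_derivative (\<lambda>h. \<Sum>e\<in>Basis. (h \<bullet> e) * conv f (partial_deriv e \<theta>) x)) (at x)"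
  unfolding has_derivative_at_alt
proof (intro conjI allI impI)
  show "bounded_linear (\<lambda>h. \<Sum>e\<in>Basis. (h \<bullet> e) * conv f (partial_deriv e \<theta>) x)"
    by (intro bounded_linear_sum bounded_linear_mult_const bounded_linear_inner_left)
  fix \<epsilon> :: real assume \<epsilon>: "0 < \<epsilon>"
  define I where "I = (\<integral>z. \<bar>f z\<bar> \<partial>lborel)"
  have I: "0 \<le> I" by (simp add: I_def)
  \<comment> \<open>I + 1 instead of I, because f may vanish almost everywhere.\<close>
  have "0 < \<epsilon> / (I + 1)" using \<epsilon> I by simp
  then obtain d where d: "0 < d"
    "\<And>x h. norm h < d \<Longrightarrow> \<bar>\<theta> (x + h) - \<theta> x - (\<Sum>e\<in>Basis. (h \<bullet> e) * partial_deriv e \<theta> x)\<bar> \<le> \<epsilon> / (I + 1) * norm h"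
    using smooth_uniformly_differentiable[OF \<theta>(1) K \<theta>(2)] by metis
  have D: "integrable lborel (\<lambda>z. f z * partial_deriv e \<theta> (x - z))" if "e \<in> Basis" for e
    using that partial_deriv_support[OF compact_imp_closed[OF K] \<theta>(2)]
    by (intro conv_integrable smooth_partial_deriv \<theta>) auto
  show "\<exists>d>0. \<forall>y. norm (y - x) < d \<longrightarrow> norm (conv f \<theta> y - conv f \<theta> x -
      (\<Sum>e\<in>Basis. (y - x) \<bullet> e * conv f (partial_deriv e \<theta>) x)) \<le> \<epsilon> * norm (y - x)"
  proof (intro exI conjI allI impI)
    fix y assume y: "norm (y - x) < d"
    have "conv f \<theta> y - conv f \<theta> x - (\<Sum>e\<in>Basis. (y - x) \<bullet> e * conv f (partial_deriv e \<theta>) x) =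
      (\<integral>z. f z * \<theta> (y - z) - f z * \<theta> (x - z) - (\<Sum>e\<in>Basis. (y - x) \<bullet> e * (f z * partial_deriv e \<theta> (x - z))) \<partial>lborel)"
      unfolding conv_def using conv_integrable[OF \<theta>] D by (simp add: Bochner_Integration.integral_sum)
    also have "norm \<dots> \<le> (\<integral>z. \<epsilon> / (I + 1) * norm (y - x) * \<bar>f z\<bar> \<partial>lborel)"
    proof (rule Bochner_Integration.integral_norm_bound_integral)
      show "integrable lborel (\<lambda>z. f z * \<theta> (y - z) - f z * \<theta> (x - z) - (\<Sum>e\<in>Basis. (y - x) \<bullet> e * (f z * partial_deriv e \<theta> (x - z))))"
        using conv_integrable[OF \<theta>] D by (intro Bochner_Integration.integrable_diff Bochner_Integration.integrable_sum integrable_mult_right) auto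
      show "integrable lborel (\<lambda>z. \<epsilon> / (I + 1) * norm (y - x) * \<bar>f z\<bar>)" using f by simp
      fix z
      have "f z * \<theta> (y - z) - f z * \<theta> (x - z) - (\<Sum>e\<in>Basis. (y - x) \<bullet> e * (f z * partial_deriv e \<theta> (x - z))) =
        f z * (\<theta> ((x - z) + (y - x)) - \<theta> (x - z) - (\<Sum>e\<in>Basis. (y - x) \<bullet> e * partial_deriv e \<theta> (x - z)))"
        by (simp add: algebra_simps sum_distrib_left)
      also have "norm \<dots> \<le> \<bar>f z\<bar> * (\<epsilon> / (I + 1) * norm (y - x))"
        unfolding real_norm_def abs_mult by (intro mult_left_mono d(2) y) auto
      finally show "norm (f z * \<theta> (y - z) - f z * \<theta> (x - z) - (\<Sum>e\<in>Basis. (y - x) \<bullet> e * (f z * partial_deriv e \<theta> (x - z))))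
        \<le> \<epsilon> / (I + 1) * norm (y - x) * \<bar>f z\<bar>" by (simp add: mult_ac)
    qed
    also have "\<dots> = \<epsilon> * norm (y - x) * (I / (I + 1))" by (simp add: I_def)
    also have "\<dots> \<le> \<epsilon> * norm (y - x)" using \<epsilon> I by (intro mult_right_le_one_le) auto
    finally show "norm (conv f \<theta> y - conv f \<theta> x - (\<Sum>e\<in>Basis. (y - x) \<bullet> e * conv f (partial_deriv e \<theta>) x)) \<le> \<epsilon> * norm (y - x)" .
  qed (rule d)
qed

lemma partial_deriv_conv:
  assumes \<theta>: "smooth \<theta>" "\<And>x. x \<notin> K \<Longrightarrow> \<theta> x = 0" and e: "e \<in> Basis"
  shows "partial_deriv e (conv f \<theta>) = conv f (partial_deriv e \<theta>)"
proof
  fix x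
  have "partial_deriv e (conv f \<theta>) x = (\<Sum>b\<in>Basis. (e \<bullet> b) * conv f (partial_deriv b \<theta>) x)"
    by (rule partial_deriv_eq[OF conv_has_derivative[OF \<theta>]])
  also have "\<dots> = (\<Sum>b\<in>Basis. if b = e then conv f (partial_deriv b \<theta>) x else 0)"
    using e by (intro sum.cong) (auto simp: inner_Basis)
  finally show "partial_deriv e (conv f \<theta>) x = conv f (partial_deriv e \<theta>) x" using e by simp
qed

lemma smooth_conv:
  assumes \<theta>: "smooth \<theta>" "\<And>x. x \<notin> K \<Longrightarrow> \<theta> x = 0"
  shows "smooth (conv f \<theta>)"
proof -
  have "class_C k (conv f \<theta>)" for k
    using \<theta>
  proof (induction k arbitrary: \<theta>)
    case 0
    then show ?case using conv_has_derivative[OF 0]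
      by (auto intro!: continuous_at_imp_continuous_on has_derivative_continuous)
  next
    case (Suc k)
    have "class_C k (conv f (partial_deriv e \<theta>))" if "e \<in> Basis" for e
      using that Suc.prems partial_deriv_support[OF compact_imp_closed[OF K] Suc.prems(2)]
      by (intro Suc.IH smooth_partial_deriv) auto
    then show ?case
      using differentiableI[OF conv_has_derivative[OF Suc.prems]] partial_deriv_conv[OF Suc.prems] by simp
  qed
  then show ?thesis by (simp add: smooth_def)
qed

lemma partial_derivs_conv:
  assumes \<theta>: "smooth \<theta>" "\<And>x. x \<notin> K \<Longrightarrow> \<theta> x = 0" and es: "set es \<subseteq> Basis"
  shows "partial_derivs es (conv f \<theta>) = conv f (partial_derivs es \<theta>)"
  using es
proof (induction es)
  case (Cons e es)
  then show ?case
    using partial_deriv_conv[OF smooth_partial_derivs[OF \<theta>(1)], of es e]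
      partial_derivs_support[OF compact_imp_closed[OF K] \<theta>(2)] by simp
qed simp

end

text \<open>The convolution of \<open>f\<close> with the indicator of a large ball is constant near the origin.\<close>

lemma integral_partial_deriv_eq_0:
  fixes f :: "'a::euclidean_space \<Rightarrow> real"
  assumes f: "smooth f" and K: "compact K" "\<And>x. x \<notin> K \<Longrightarrow> f x = 0" and e: "e \<in> Basis"
  shows "(\<integral>x. partial_deriv e f x \<partial>lborel) = 0"
proof -
  obtain R where R: "0 < R" "K \<subseteq> cball 0 R"
    using compact_imp_bounded[OF K(1)] by (auto simp: bounded_pos subset_eq)
  define cut :: "'a \<Rightarrow> real" where "cut = indicator (cball 0 (R + 1))"
  have cut: "integrable lborel cut" unfolding cut_def
    using emeasure_lborel_cball_finite[of 0 "R+1"] by (intro integrable_real_indicator) auto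
  have *: "conv cut g x = (\<integral>z. g z \<partial>lborel)" if g: "\<And>x. x \<notin> K \<Longrightarrow> g x = 0" and x: "norm x < 1" for g x
  proof -
    have "conv cut g x = (\<integral>z. g (x + (-1) *\<^sub>R z) \<partial>lborel)"
      unfolding conv_def
    proof (rule Bochner_Integration.integral_cong[OF refl])
      fix z
      show "cut z * g (x - z) = g (x + (-1) *\<^sub>R z)"
      proof (cases "x - z \<in> K")
        case True
        then have "norm z \<le> R + 1" using R(2) x norm_triangle_ineq4[of x "x - z"] by auto
        then show ?thesis by (simp add: cut_def)
      qed (use g in simp)
    qed
    also have "\<dots> = (\<integral>z. g z \<partial>lborel)" by (subst integral_lborel_affine) auto
    finally show ?thesis .
  qed
  have "(conv cut f has_derivative (\<lambda>h. 0)) (at 0)"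
    by (rule has_derivative_transform_within_open[OF has_derivative_const, of "ball 0 1"])
       (use *[OF K(2)] in auto)
  then have "partial_deriv e (conv cut f) 0 = 0" by (rule partial_deriv_eq)
  then show ?thesis
    using partial_deriv_conv[OF K(1) cut f K(2) e] *[of "partial_deriv e f" 0]
      partial_deriv_support[OF compact_imp_closed[OF K(1)] K(2)] by simp
qed

lemma integral_by_parts_test:
  fixes f \<phi> :: "'a::euclidean_space \<Rightarrow> real"
  assumes f: "smooth f" and \<phi>: "\<phi> \<in> test_functions \<Omega>" and e: "e \<in> Basis"
  shows "(\<integral>x. f x * partial_deriv e \<phi> x \<partial>lborel) = - (\<integral>x. partial_deriv e f x * \<phi> x \<partial>lborel)"
proof -
  obtain K where K: "compact K" "\<And>x. x \<notin> K \<Longrightarrow> \<phi> x = 0" "smooth \<phi>"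
    using test_functionsD[OF \<phi>] by metis
  have 1: "integrable lborel (\<lambda>x. f x * partial_deriv e \<phi> x)"
    using partial_deriv_support[OF compact_imp_closed[OF K(1)] K(2)]
    by (intro integrable_compact_support[OF smooth_continuous K(1)] smooth_mult f smooth_partial_deriv K e) auto
  have 2: "integrable lborel (\<lambda>x. partial_deriv e f x * \<phi> x)"
    using K(2)
    by (intro integrable_compact_support[OF smooth_continuous K(1)] smooth_mult f smooth_partial_deriv K e) auto
  have "(\<integral>x. partial_deriv e (\<lambda>x. f x * \<phi> x) x \<partial>lborel) = 0"
    using K by (intro integral_partial_deriv_eq_0[OF _ K(1) _ e] smooth_mult f) auto
  then show ?thesis
    using 1 2 by (simp add: partial_deriv_mult[OF f K(3)])
qed

section \<open>Integrals of powers\<close>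

text \<open>The p-th power of an L^p norm, with value infinity allowed so that no integrability
  conditions appear. It uses \<open>lborel\<close>, where Fubini and affine substitutions apply; by
  \<open>nn_integral_completion\<close> the value is that of the \<open>lebesgue\<close> integrals
  in the theorem.\<close>

definition pow_int :: "real \<Rightarrow> 'a::euclidean_space set \<Rightarrow> ('a \<Rightarrow> real) \<Rightarrow> ennreal" where
  "pow_int p S f = (\<integral>\<^sup>+x\<in>S. ennreal (\<bar>f x\<bar> powr p) \<partial>lborel)"

lemma pow_int_mono_set: "S \<subseteq> T \<Longrightarrow> pow_int p S f \<le> pow_int p T f"
  unfolding pow_int_def by (intro nn_integral_mono mult_left_mono) (auto simp: indicator_def)

lemma pow_int_cong: "(\<And>x. x \<in> S \<Longrightarrow> f x = g x) \<Longrightarrow> pow_int p S f = pow_int p S g"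
  unfolding pow_int_def by (intro nn_integral_cong) (auto simp: indicator_def)

lemma pow_int_cong_AE:
  assumes "AE x in lborel. x \<in> S \<longrightarrow> f x = g x"
  shows "pow_int p S f = pow_int p S g"
  unfolding pow_int_def by (rule nn_integral_cong_AE, use assms in eventually_elim) (auto simp: indicator_def)

lemma pow_int_mono:
  assumes "0 \<le> p" "\<And>x. x \<in> S \<Longrightarrow> \<bar>f x\<bar> \<le> \<bar>g x\<bar>"
  shows "pow_int p S f \<le> pow_int p S g"
  unfolding pow_int_def using assms
  by (intro nn_integral_mono) (auto simp: indicator_def intro!: ennreal_leI powr_mono2)

lemma pow_int_minus_commute: "pow_int p S (\<lambda>x. f x - g x) = pow_int p S (\<lambda>x. g x - f x)"
  by (simp add: pow_int_def abs_minus_commute)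

lemma pow_int_cmult:
  assumes [measurable]: "f \<in> borel_measurable borel" "S \<in> sets borel"
  shows "pow_int p S (\<lambda>x. c * f x) = ennreal (\<bar>c\<bar> powr p) * pow_int p S f"
  unfolding pow_int_def
  by (simp add: abs_mult powr_mult ennreal_mult' nn_integral_cmult[symmetric] mult.assoc)

lemma pow_int_add_le:
  assumes [measurable]: "f \<in> borel_measurable borel" "g \<in> borel_measurable borel" "S \<in> sets borel"
    and p: "0 \<le> p"
  shows "pow_int p S (\<lambda>x. f x + g x) \<le> ennreal (2 powr p) * (pow_int p S f + pow_int p S g)"
proof -
  have "pow_int p S (\<lambda>x. f x + g x) \<le>
      (\<integral>\<^sup>+x. ennreal (2 powr p) * (ennreal (\<bar>f x\<bar> powr p) * indicator S x + ennreal (\<bar>g x\<bar> powr p) * indicator S x) \<partial>lborel)"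
    unfolding pow_int_def using powr_abs_add_le[OF p]
    by (intro nn_integral_mono) (auto simp: indicator_def simp flip: ennreal_mult' ennreal_plus intro!: ennreal_leI)
  also have "\<dots> = ennreal (2 powr p) * (pow_int p S f + pow_int p S g)"
    unfolding pow_int_def by (subst nn_integral_cmult; simp add: nn_integral_add)
  finally show ?thesis .
qed

lemma pow_int_diff_le:
  assumes [measurable]: "f \<in> borel_measurable borel" "g \<in> borel_measurable borel" "h \<in> borel_measurable borel" "S \<in> sets borel"
    and p: "0 \<le> p"
  shows "pow_int p S (\<lambda>x. f x - h x) \<le> ennreal (2 powr p) * (pow_int p S (\<lambda>x. f x - g x) + pow_int p S (\<lambda>x. g x - h x))"
  using pow_int_add_le[of "\<lambda>x. f x - g x" "\<lambda>x. g x - h x" S p] p by simp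

lemma pow_int_const: "pow_int p S (\<lambda>x. c) = ennreal (\<bar>c\<bar> powr p) * (\<integral>\<^sup>+x\<in>S. 1 \<partial>lborel)"
  if "S \<in> sets borel"
  unfolding pow_int_def using that by (simp add: nn_integral_cmult_indicator)

section \<open>Limits equal to 0 in the extended nonnegative reals\<close>

lemma ennreal_tendsto_0_add:
  fixes f g :: "'b \<Rightarrow> ennreal"
  assumes "(f \<longlongrightarrow> 0) F" "(g \<longlongrightarrow> 0) F"
  shows "((\<lambda>k. f k + g k) \<longlongrightarrow> 0) F"
  using tendsto_add[OF assms] by simp

lemma ennreal_tendsto_0_cmult:
  fixes f :: "'b \<Rightarrow> ennreal"
  assumes "(f \<longlongrightarrow> 0) F" "c < top"
  shows "((\<lambda>k. c * f k) \<longlongrightarrow> 0) F"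
  using ennreal_tendsto_cmult[OF assms(2,1)] by simp

lemma ennreal_tendsto_0_le:
  fixes f g :: "'b \<Rightarrow> ennreal"
  assumes "(g \<longlongrightarrow> 0) F" "\<And>k. f k \<le> g k"
  shows "(f \<longlongrightarrow> 0) F"
  by (rule tendsto_sandwich[OF _ _ tendsto_const assms(1)]) (use assms(2) in auto)

lemma pow_int_tendsto_0_trans:
  assumes [measurable]: "\<And>k. f k \<in> borel_measurable borel" "\<And>k. g k \<in> borel_measurable borel"
      "h \<in> borel_measurable borel" "S \<in> sets borel"
    and p: "0 \<le> p"
    and "((\<lambda>k. pow_int p S (\<lambda>x. f k x - g k x)) \<longlongrightarrow> 0) F"
    and "((\<lambda>k. pow_int p S (\<lambda>x. g k x - h x)) \<longlongrightarrow> 0) F"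
  shows "((\<lambda>k. pow_int p S (\<lambda>x. f k x - h x)) \<longlongrightarrow> 0) F"
  by (rule ennreal_tendsto_0_le[OF ennreal_tendsto_0_cmult[OF ennreal_tendsto_0_add[OF assms(6,7)],
        of "ennreal (2 powr p)"] pow_int_diff_le]) (use p in auto)

text \<open>Density of continuous functions in L^p of a ball. Truncating f at height n costs little
  by dominated convergence; the truncated function is then an almost everywhere limit of continuous
  functions.\<close>

lemma pow_int_approx_continuous:
  fixes f :: "'a::euclidean_space \<Rightarrow> real"
  assumes [measurable]: "f \<in> borel_measurable borel" and p: "1 \<le> p"
    and fin: "pow_int p (cball 0 R) f < \<infinity>" and \<epsilon>: "0 < \<epsilon>"
  obtains g where "continuous_on UNIV g" "pow_int p (cball 0 R) (\<lambda>x. f x - g x) < ennreal \<epsilon>"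
proof -
  have [measurable]: "cball (0::'a) R \<in> sets borel" by (rule borel_closed) simp
  define clip where "clip (n::nat) t = max (- real n) (min (real n) t)" for n and t :: real
  have clip_cont: "continuous_on UNIV (clip n)" for n
    unfolding clip_def by (intro continuous_intros)
  then have [measurable]: "clip n \<in> borel_measurable borel" for n
    by (rule borel_measurable_continuous_onI)
  have clip_le: "\<bar>clip n t\<bar> \<le> real n" for n t unfolding clip_def by auto
  have *: "(\<lambda>n. pow_int p (cball 0 R) (\<lambda>x. f x - clip n (f x))) \<longlonglongrightarrow> (\<integral>\<^sup>+x. 0 \<partial>(lborel :: 'a measure))"
    unfolding pow_int_def
  proof (rule nn_integral_dominated_convergence[where w="\<lambda>x. ennreal (\<bar>f x\<bar> powr p) * indicator (cball 0 R) x"])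
    show "AE x in lborel. ennreal (\<bar>f x - clip n (f x)\<bar> powr p) * indicator (cball 0 R) x
        \<le> ennreal (\<bar>f x\<bar> powr p) * indicator (cball 0 R) x" for n
      using p by (intro AE_I2 mult_right_mono ennreal_leI powr_mono2) (auto simp: clip_def)
    show "AE x in lborel. (\<lambda>n. ennreal (\<bar>f x - clip n (f x)\<bar> powr p) * indicator (cball 0 R) x) \<longlonglongrightarrow> 0"
    proof (rule AE_I2)
      fix x
      obtain N :: nat where N: "\<bar>f x\<bar> \<le> real N" using real_arch_simple by blast
      have "\<forall>\<^sub>F n in sequentially. ennreal (\<bar>f x - clip n (f x)\<bar> powr p) * indicator (cball 0 R) x = 0"
        using eventually_ge_at_top[of N]
      proof eventually_elim
        case (elim n)
        then have "\<bar>f x\<bar> \<le> real n" using N by linarith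
        then have "clip n (f x) = f x" unfolding clip_def by auto
        then show ?case by simp
      qed
      then show "(\<lambda>n. ennreal (\<bar>f x - clip n (f x)\<bar> powr p) * indicator (cball 0 R) x) \<longlonglongrightarrow> 0"
        by (rule tendsto_eventually)
    qed
    show "(\<integral>\<^sup>+ x\<in>cball 0 R. ennreal (\<bar>f x\<bar> powr p) \<partial>lborel) < \<infinity>"
      using fin by (simp add: pow_int_def)
  qed auto
  define \<epsilon>' where "\<epsilon>' = \<epsilon> / (2 * 2 powr p)"
  have \<epsilon>': "0 < \<epsilon>'" using \<epsilon> by (simp add: \<epsilon>'_def)
  from * have "\<forall>\<^sub>F n in sequentially. pow_int p (cball 0 R) (\<lambda>x. f x - clip n (f x)) < ennreal \<epsilon>'"
    using \<epsilon>' by (intro order_tendstoD(2)[of _ "\<integral>\<^sup>+x. 0 \<partial>(lborel :: 'a measure)"]) auto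
  then obtain n where n: "pow_int p (cball 0 R) (\<lambda>x. f x - clip n (f x)) < ennreal \<epsilon>'"
    using eventually_happens'[OF sequentially_bot] by blast
  \<comment> \<open>\<open>measurable_on\<close> supplies continuous functions converging off a
    negligible set. They may be unbounded, so they are clipped as well; this provides the dominating
    constant \<open>2 * real n\<close>.\<close>
  have "(\<lambda>x. clip n (f x)) measurable_on UNIV"
    by (rule lebesgue_measurable_imp_measurable_on_real) (auto intro: measurable_completion)
  then obtain N g where N: "negligible N" and g: "\<And>k. continuous_on UNIV (g k)"
    and gl: "\<And>x. x \<notin> N \<Longrightarrow> (\<lambda>k. g k x) \<longlonglongrightarrow> clip n (f x)"
    unfolding measurable_on_def by auto
  have [measurable]: "g k \<in> borel_measurable borel" for k
    using g by (rule borel_measurable_continuous_onI)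
  have aeN: "AE x in lborel. x \<notin> N"
    using AE_not_in[OF N[unfolded negligible_iff_null_sets]] by (simp only: AE_completion_iff)
  have "(\<lambda>k. pow_int p (cball 0 R) (\<lambda>x. clip n (f x) - clip n (g k x))) \<longlonglongrightarrow> (\<integral>\<^sup>+x. 0 \<partial>(lborel :: 'a measure))"
    unfolding pow_int_def
  proof (rule nn_integral_dominated_convergence[where w="\<lambda>x. ennreal ((2 * real n) powr p) * indicator (cball 0 R) x"])
    show "AE x in lborel. ennreal (\<bar>clip n (f x) - clip n (g k x)\<bar> powr p) * indicator (cball 0 R) x
        \<le> ennreal ((2 * real n) powr p) * indicator (cball 0 R) x" for k
    proof (intro AE_I2 mult_right_mono ennreal_leI powr_mono2)
      show "\<bar>clip n (f x) - clip n (g k x)\<bar> \<le> 2 * real n" for x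
        using clip_le[of n "f x"] clip_le[of n "g k x"] by linarith
    qed (use p in auto)
    show "AE x in lborel. (\<lambda>k. ennreal (\<bar>clip n (f x) - clip n (g k x)\<bar> powr p) * indicator (cball 0 R) x) \<longlonglongrightarrow> 0"
      using aeN
    proof eventually_elim
      case (elim x)
      have "(\<lambda>k. clip n (g k x)) \<longlonglongrightarrow> clip n (clip n (f x))"
        by (rule continuous_on_tendsto_compose[OF clip_cont gl[OF elim]]) auto
      also have "clip n (clip n (f x)) = clip n (f x)" unfolding clip_def by auto
      finally have "(\<lambda>k. clip n (f x) - clip n (g k x)) \<longlonglongrightarrow> clip n (f x) - clip n (f x)"
        by (intro tendsto_intros)
      then have "(\<lambda>k. \<bar>clip n (f x) - clip n (g k x)\<bar>) \<longlonglongrightarrow> 0"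
        by (simp add: tendsto_rabs_zero_iff)
      then have "(\<lambda>k. \<bar>clip n (f x) - clip n (g k x)\<bar> powr p) \<longlonglongrightarrow> 0 powr p"
        using p by (intro tendsto_powr2) auto
      then have "(\<lambda>k. ennreal (\<bar>clip n (f x) - clip n (g k x)\<bar> powr p)) \<longlonglongrightarrow> 0"
        by (subst ennreal_tendsto_0_iff) auto
      then show ?case by (auto simp: indicator_def)
    qed
    show "(\<integral>\<^sup>+ x\<in>cball (0::'a) R. ennreal ((2 * real n) powr p) \<partial>lborel) < \<infinity>"
      using emeasure_lborel_cball_finite[of "0::'a" R]
      by (subst nn_integral_cmult_indicator) (auto simp: ennreal_mult_less_top)
  qed auto
  then have "\<forall>\<^sub>F k in sequentially. pow_int p (cball 0 R) (\<lambda>x. clip n (f x) - clip n (g k x)) < ennreal \<epsilon>'"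
    using \<epsilon>' by (intro order_tendstoD(2)[of _ "\<integral>\<^sup>+x. 0 \<partial>(lborel :: 'a measure)"]) auto
  then obtain k where k: "pow_int p (cball 0 R) (\<lambda>x. clip n (f x) - clip n (g k x)) < ennreal \<epsilon>'"
    using eventually_happens'[OF sequentially_bot] by blast
  show ?thesis
  proof (rule that)
    show "continuous_on UNIV (\<lambda>x. clip n (g k x))"
      using g clip_cont by (auto intro: continuous_on_compose2)
    have "pow_int p (cball 0 R) (\<lambda>x. f x - clip n (g k x)) \<le> ennreal (2 powr p) *
        (pow_int p (cball 0 R) (\<lambda>x. f x - clip n (f x)) + pow_int p (cball 0 R) (\<lambda>x. clip n (f x) - clip n (g k x)))"
      using p by (intro pow_int_diff_le) auto
    also have "\<dots> < ennreal (2 powr p) * (ennreal \<epsilon>' + ennreal \<epsilon>')"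
      using n k by (intro ennreal_mult_strict_left_mono add_strict_mono) auto
    also have "\<dots> = ennreal \<epsilon>"
      using \<epsilon>' by (simp add: \<epsilon>'_def flip: ennreal_mult' ennreal_plus)
    finally show "pow_int p (cball 0 R) (\<lambda>x. f x - clip n (g k x)) < ennreal \<epsilon>" .
  qed
qed

section \<open>Averages along segments towards the support of a mollifier\<close>

locale mollifier =
  fixes \<Omega> :: "'a::euclidean_space set" and \<eta> :: "'a \<Rightarrow> real"
  assumes open_\<Omega>: "open \<Omega>" and convex_\<Omega>: "convex \<Omega>"
    and test_\<eta>: "\<eta> \<in> test_functions \<Omega>" and \<eta>_nonneg: "\<And>x. 0 \<le> \<eta> x" and integral_\<eta>: "(\<integral>x. \<eta> x \<partial>lborel) = 1"
begin

definition supp where "supp = closure {x. \<eta> x \<noteq> 0}"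

lemma smooth_\<eta>: "smooth \<eta>" and compact_supp: "compact supp" and supp_\<Omega>: "supp \<subseteq> \<Omega>"
  using test_\<eta> by (auto simp: test_functions_def supp_def)

lemma \<eta>_supp: "x \<notin> supp \<Longrightarrow> \<eta> x = 0"
  using closure_subset[of "{x. \<eta> x \<noteq> 0}"] by (auto simp: supp_def)

lemma \<eta>_measurable[measurable]: "\<eta> \<in> borel_measurable borel"
  by (rule smooth_borel_measurable[OF smooth_\<eta>])

lemma integrable_\<eta>: "integrable lborel \<eta>"
  using integral_\<eta> not_integrable_integral_eq by fastforce

lemma nn_integral_\<eta>: "(\<integral>\<^sup>+x. ennreal (\<eta> x) \<partial>lborel) = 1"
  using nn_integral_eq_integral[OF integrable_\<eta>] \<eta>_nonneg integral_\<eta> by simp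

lemma supp_bounded: obtains R where "0 < R" "supp \<subseteq> ball 0 R"
  using bounded_subset_ballD[OF compact_imp_bounded[OF compact_supp], of 0] by blast

abbreviation (input) seg :: "real \<Rightarrow> 'a \<Rightarrow> 'a \<Rightarrow> 'a" where
  "seg s x y \<equiv> (1 - s) *\<^sub>R x + s *\<^sub>R y"

definition avg :: "real \<Rightarrow> ('a \<Rightarrow> real) \<Rightarrow> 'a \<Rightarrow> real" where
  "avg \<kappa> f x = (\<integral>y. \<eta> y * f (seg \<kappa> x y) \<partial>lborel)"

abbreviation \<mu> where "\<mu> \<equiv> density lborel (\<lambda>y. ennreal (\<eta> y))"

lemma prob_\<mu>: "measure \<mu> (space \<mu>) = 1" "finite_measure \<mu>"
proof -
  have "emeasure \<mu> (space \<mu>) = 1" by (simp add: emeasure_density nn_integral_\<eta>)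
  then show "measure \<mu> (space \<mu>) = 1" "finite_measure \<mu>"
    by (auto simp: measure_def intro!: finite_measureI)
qed

text \<open>Jensen's inequality for the probability measure \<mu>. The constant c will be f x, so
  the bound concerns the distance between f and its average.\<close>

lemma avg_diff_powr_le:
  assumes [measurable]: "f \<in> borel_measurable borel" and p: "1 \<le> p"
  shows "ennreal (\<bar>avg \<kappa> f x - c\<bar> powr p)
    \<le> (\<integral>\<^sup>+y. ennreal (\<eta> y) * ennreal (\<bar>f (seg \<kappa> x y) - c\<bar> powr p) \<partial>lborel)"
proof -
  interpret finite_measure \<mu> by (rule prob_\<mu>)
  have "avg \<kappa> f x = (\<integral>y. f (seg \<kappa> x y) \<partial>\<mu>)"
    unfolding avg_def by (subst integral_real_density) (auto simp: \<eta>_nonneg)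
  then have "ennreal (\<bar>avg \<kappa> f x - c\<bar> powr p) = ennreal (\<bar>(\<integral>y. c \<partial>\<mu>) - (\<integral>y. f (seg \<kappa> x y) \<partial>\<mu>)\<bar> powr p)"
    using prob_\<mu> by (simp add: abs_minus_commute)
  also have "\<dots> \<le> ennreal (1 powr (p - 1)) * (\<integral>\<^sup>+y. ennreal (\<bar>c - f (seg \<kappa> x y)\<bar> powr p) \<partial>\<mu>)"
    using prob_\<mu> by (intro powr_integral_diff_le[OF p]) auto
  also have "\<dots> = (\<integral>\<^sup>+y. ennreal (\<eta> y) * ennreal (\<bar>f (seg \<kappa> x y) - c\<bar> powr p) \<partial>lborel)"
    by (simp add: nn_integral_density abs_minus_commute)
  finally show ?thesis .
qed

text \<open>For y in the convex set S the map x to (1 - \<kappa>) x + \<kappa> y sends S into itself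
  with Jacobian (1 - \<kappa>)^DIM, and \<kappa> at most 1/2 bounds the inverse Jacobian by
  2^DIM.\<close>

lemma nn_integral_segment_le:
  fixes F :: "'a \<Rightarrow> ennreal"
  assumes [measurable]: "F \<in> borel_measurable borel" "S \<in> sets borel" and S: "convex S" "y \<in> S"
    and \<kappa>: "0 \<le> \<kappa>" "\<kappa> \<le> 1/2"
  shows "(\<integral>\<^sup>+x\<in>S. F (seg \<kappa> x y) \<partial>lborel) \<le> 2 ^ DIM('a) * (\<integral>\<^sup>+x\<in>S. F x \<partial>lborel)"
proof -
  have "(\<integral>\<^sup>+x\<in>S. F (seg \<kappa> x y) \<partial>lborel) \<le> (\<integral>\<^sup>+x. (\<lambda>z. F z * indicator S z) (\<kappa> *\<^sub>R y + (1 - \<kappa>) *\<^sub>R x) \<partial>lborel)"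
  proof (rule nn_integral_mono)
    fix x
    show "F (seg \<kappa> x y) * indicator S x \<le> F (\<kappa> *\<^sub>R y + (1 - \<kappa>) *\<^sub>R x) * indicator S (\<kappa> *\<^sub>R y + (1 - \<kappa>) *\<^sub>R x)"
      using convexD_alt[OF S(1) _ S(2), of x \<kappa>] \<kappa> by (auto simp: indicator_def add.commute)
  qed
  also have "\<dots> = ennreal (1 / \<bar>1 - \<kappa>\<bar> ^ DIM('a)) * (\<integral>\<^sup>+x\<in>S. F x \<partial>lborel)"
    using \<kappa> by (subst nn_integral_lborel_affine) auto
  also have "\<dots> \<le> ennreal (2 ^ DIM('a)) * (\<integral>\<^sup>+x\<in>S. F x \<partial>lborel)"
  proof (intro mult_right_mono ennreal_leI)
    have "(1 / (1 - \<kappa>)) ^ DIM('a) \<le> 2 ^ DIM('a)"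
      using \<kappa> by (intro power_mono) (auto simp: field_simps)
    then show "1 / \<bar>1 - \<kappa>\<bar> ^ DIM('a) \<le> 2 ^ DIM('a)" using \<kappa> by (simp add: power_divide)
  qed auto
  finally show ?thesis by (simp add: ennreal_power[symmetric])
qed

text \<open>By Fubini the bound for a fixed y is averaged against \<eta>, which has integral 1. Thus
  averages are bounded on L^p uniformly in \<kappa>.\<close>

lemma nn_integral_avg_le:
  fixes F :: "'a \<Rightarrow> ennreal"
  assumes [measurable]: "F \<in> borel_measurable borel" "S \<in> sets borel" and S: "convex S" "supp \<subseteq> S"
    and \<kappa>: "0 \<le> \<kappa>" "\<kappa> \<le> 1/2"
  shows "(\<integral>\<^sup>+x\<in>S. (\<integral>\<^sup>+y. ennreal (\<eta> y) * F (seg \<kappa> x y) \<partial>lborel) \<partial>lborel) \<le> 2 ^ DIM('a) * (\<integral>\<^sup>+x\<in>S. F x \<partial>lborel)"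
proof -
  have "(\<integral>\<^sup>+x\<in>S. (\<integral>\<^sup>+y. ennreal (\<eta> y) * F (seg \<kappa> x y) \<partial>lborel) \<partial>lborel) =
    (\<integral>\<^sup>+x. (\<integral>\<^sup>+y. ennreal (\<eta> y) * F (seg \<kappa> x y) * indicator S x \<partial>lborel) \<partial>lborel)"
    by (intro nn_integral_cong, subst nn_integral_multc) auto
  also have "\<dots> = (\<integral>\<^sup>+y. (\<integral>\<^sup>+x. ennreal (\<eta> y) * F (seg \<kappa> x y) * indicator S x \<partial>lborel) \<partial>lborel)"
    by (rule lborel_pair.Fubini') measurable
  also have "\<dots> = (\<integral>\<^sup>+y. ennreal (\<eta> y) * (\<integral>\<^sup>+x\<in>S. F (seg \<kappa> x y) \<partial>lborel) \<partial>lborel)"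
    by (intro nn_integral_cong, subst nn_integral_cmult[symmetric]) (auto simp: mult.assoc)
  also have "\<dots> \<le> (\<integral>\<^sup>+y. ennreal (\<eta> y) * (2 ^ DIM('a) * (\<integral>\<^sup>+x\<in>S. F x \<partial>lborel)) \<partial>lborel)"
  proof (rule nn_integral_mono)
    fix y
    show "ennreal (\<eta> y) * (\<integral>\<^sup>+x\<in>S. F (seg \<kappa> x y) \<partial>lborel) \<le> ennreal (\<eta> y) * (2 ^ DIM('a) * (\<integral>\<^sup>+x\<in>S. F x \<partial>lborel))"
      using nn_integral_segment_le[OF assms(1-3), of y \<kappa>] S(2) \<kappa> \<eta>_supp[of y]
      by (cases "y \<in> supp") (auto intro!: mult_left_mono)
  qed
  also have "\<dots> = 2 ^ DIM('a) * (\<integral>\<^sup>+x\<in>S. F x \<partial>lborel)"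
    by (subst nn_integral_multc) (auto simp: nn_integral_\<eta>)
  finally show ?thesis .
qed

text \<open>Replace f by a continuous g that is close in L^p. The average moves a point of the ball
  by at most 2 R \<kappa>, which is harmless for the uniformly continuous g; the error f - g is
  controlled both directly and after averaging, uniformly in \<kappa>.\<close>

lemma avg_tendsto:
  assumes [measurable]: "f \<in> borel_measurable borel" and p: "1 \<le> p"
    and fin: "pow_int p (cball 0 R) f < \<infinity>" and R: "0 < R" "supp \<subseteq> ball 0 R"
    and \<kappa>: "\<And>k. 0 \<le> \<kappa> k" "\<And>k. \<kappa> k \<le> 1/2" "\<kappa> \<longlonglongrightarrow> 0"
  shows "(\<lambda>k. pow_int p (cball 0 R) (\<lambda>x. avg (\<kappa> k) f x - f x)) \<longlonglongrightarrow> 0"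
proof (rule tendsto_zero_ennreal)
  fix \<epsilon> :: real assume \<epsilon>: "0 < \<epsilon>"
  let ?B = "cball (0::'a) R"
  have [measurable]: "?B \<in> sets borel" by (rule borel_closed) simp
  have B: "convex ?B" "supp \<subseteq> ?B" using R by auto
  define V where "V = measure lborel ?B"
  have V: "emeasure lborel ?B = ennreal V" "0 \<le> V"
    using emeasure_lborel_cball_finite[of "0::'a" R] by (auto simp: V_def emeasure_eq_ennreal_measure)
  \<comment> \<open>\<open>4 powr p\<close> comes from two triangle inequalities; in the bracket
    2^DIM belongs to the averaged error f - g, 1 to that error itself, and V to the constant error
    \<epsilon>' on the ball.\<close>
  define C where "C = 4 powr p * (2 ^ DIM('a) + 1 + V)"
  have C: "C > 0" using V by (simp add: C_def add_pos_nonneg)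
  define \<epsilon>' where "\<epsilon>' = \<epsilon> / (2 * C)"
  have \<epsilon>': "0 < \<epsilon>'" using \<epsilon> C by (simp add: \<epsilon>'_def)
  obtain g where g: "continuous_on UNIV g" "pow_int p ?B (\<lambda>x. f x - g x) < ennreal \<epsilon>'"
    using pow_int_approx_continuous[OF assms(1) p fin \<epsilon>'] by metis
  have [measurable]: "g \<in> borel_measurable borel" using g(1) by (rule borel_measurable_continuous_onI)
  have "uniformly_continuous_on ?B g"
    using g(1) by (intro compact_uniformly_continuous) (auto intro: continuous_on_subset)
  moreover have "0 < \<epsilon>' powr (1 / p)" using \<epsilon>' by simp
  ultimately obtain \<delta> where \<delta>: "0 < \<delta>"
    "\<And>x z. x \<in> ?B \<Longrightarrow> z \<in> ?B \<Longrightarrow> dist z x < \<delta> \<Longrightarrow> dist (g z) (g x) < \<epsilon>' powr (1 / p)"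
    unfolding uniformly_continuous_on_def by metis
  have "\<forall>\<^sub>F k in sequentially. \<kappa> k < \<delta> / (2 * R)"
    using \<kappa>(3) \<delta>(1) R by (intro order_tendstoD(2)[of \<kappa> 0]) auto
  then show "\<forall>\<^sub>F k in sequentially. pow_int p ?B (\<lambda>x. avg (\<kappa> k) f x - f x) < ennreal \<epsilon>"
  proof eventually_elim
    case (elim k)
    have key: "ennreal (\<bar>avg (\<kappa> k) f x - f x\<bar> powr p) \<le>
        ennreal (4 powr p) * ((\<integral>\<^sup>+y. ennreal (\<eta> y) * ennreal (\<bar>f (seg (\<kappa> k) x y) - g (seg (\<kappa> k) x y)\<bar> powr p) \<partial>lborel)
          + (ennreal \<epsilon>' + ennreal (\<bar>f x - g x\<bar> powr p)))" (is "_ \<le> ennreal (4 powr p) * (?I + _)") if x: "x \<in> ?B" for x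
    proof -
      have pt: "\<bar>f (seg (\<kappa> k) x y) - f x\<bar> powr p \<le>
          4 powr p * (\<bar>f (seg (\<kappa> k) x y) - g (seg (\<kappa> k) x y)\<bar> powr p + (\<epsilon>' + \<bar>f x - g x\<bar> powr p))"
        if y: "y \<in> supp" for y
      proof -
        define z where "z = seg (\<kappa> k) x y"
        have yB: "y \<in> ?B" using y B by auto
        have zB: "z \<in> ?B" unfolding z_def using \<kappa>(1,2)[of k] by (intro convexD_alt[OF B(1) x yB]) auto
        have "z - x = \<kappa> k *\<^sub>R (y - x)" by (simp add: z_def algebra_simps)
        then have "dist z x = \<kappa> k * norm (y - x)" using \<kappa>(1)[of k] by (simp add: dist_norm)
        also have "\<dots> \<le> \<kappa> k * (2 * R)"
          using x yB \<kappa>(1)[of k] norm_triangle_ineq4[of y x] by (intro mult_left_mono) auto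
        also have "\<dots> < \<delta>" using elim R by (simp add: field_simps)
        finally have "\<bar>g z - g x\<bar> \<le> \<epsilon>' powr (1 / p)" using \<delta>(2)[OF x zB] by (simp add: dist_real_def)
        then have "\<bar>g z - g x\<bar> powr p \<le> (\<epsilon>' powr (1 / p)) powr p" using p by (intro powr_mono2) auto
        also have "\<dots> = \<epsilon>'" using p \<epsilon>' by (simp add: powr_powr)
        finally have gz: "\<bar>g z - g x\<bar> powr p \<le> \<epsilon>'" .
        have "\<bar>f z - f x\<bar> powr p \<le> 2 powr p * (\<bar>f z - g z\<bar> powr p + \<bar>g z - f x\<bar> powr p)"
          using powr_abs_add_le[of p "f z - g z" "g z - f x"] p by simp
        also have "\<bar>g z - f x\<bar> powr p \<le> 2 powr p * (\<bar>g z - g x\<bar> powr p + \<bar>g x - f x\<bar> powr p)"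
          using powr_abs_add_le[of p "g z - g x" "g x - f x"] p by simp
        also have "\<bar>f z - g z\<bar> powr p \<le> 2 powr p * \<bar>f z - g z\<bar> powr p"
          using p by (simp add: ge_one_powr_ge_zero mult_le_cancel_right1)
        finally have "\<bar>f z - f x\<bar> powr p \<le> (2 powr p * 2 powr p) * (\<bar>f z - g z\<bar> powr p + (\<bar>g z - g x\<bar> powr p + \<bar>g x - f x\<bar> powr p))"
          by (simp add: algebra_simps)
        also have "(2::real) powr p * 2 powr p = 4 powr p" by (simp flip: powr_mult)
        finally have "\<bar>f z - f x\<bar> powr p \<le> 4 powr p * (\<bar>f z - g z\<bar> powr p + (\<bar>g z - g x\<bar> powr p + \<bar>g x - f x\<bar> powr p))" .
        also have "\<dots> \<le> 4 powr p * (\<bar>f z - g z\<bar> powr p + (\<epsilon>' + \<bar>f x - g x\<bar> powr p))"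
          using gz by (intro mult_left_mono add_left_mono add_mono) (auto simp: abs_minus_commute)
        finally show ?thesis by (simp add: z_def)
      qed
      have "ennreal (\<bar>avg (\<kappa> k) f x - f x\<bar> powr p)
          \<le> (\<integral>\<^sup>+y. ennreal (\<eta> y) * ennreal (\<bar>f (seg (\<kappa> k) x y) - f x\<bar> powr p) \<partial>lborel)"
        by (rule avg_diff_powr_le[OF assms(1) p])
      also have "\<dots> \<le> (\<integral>\<^sup>+y. ennreal (4 powr p) * (ennreal (\<eta> y) * ennreal (\<bar>f (seg (\<kappa> k) x y) - g (seg (\<kappa> k) x y)\<bar> powr p)
          + ennreal (\<eta> y) * (ennreal \<epsilon>' + ennreal (\<bar>f x - g x\<bar> powr p))) \<partial>lborel)"
      proof (rule nn_integral_mono)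
        fix y
        show "ennreal (\<eta> y) * ennreal (\<bar>f (seg (\<kappa> k) x y) - f x\<bar> powr p) \<le>
          ennreal (4 powr p) * (ennreal (\<eta> y) * ennreal (\<bar>f (seg (\<kappa> k) x y) - g (seg (\<kappa> k) x y)\<bar> powr p)
          + ennreal (\<eta> y) * (ennreal \<epsilon>' + ennreal (\<bar>f x - g x\<bar> powr p)))"
        proof (cases "y \<in> supp")
          case True
          have "ennreal (\<bar>f (seg (\<kappa> k) x y) - f x\<bar> powr p) \<le>
            ennreal (4 powr p) * (ennreal (\<bar>f (seg (\<kappa> k) x y) - g (seg (\<kappa> k) x y)\<bar> powr p) + (ennreal \<epsilon>' + ennreal (\<bar>f x - g x\<bar> powr p)))"
            using pt[OF True] \<epsilon>' by (simp add: ennreal_leI flip: ennreal_mult' ennreal_plus)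
          then have "ennreal (\<eta> y) * ennreal (\<bar>f (seg (\<kappa> k) x y) - f x\<bar> powr p) \<le> ennreal (\<eta> y) *
            (ennreal (4 powr p) * (ennreal (\<bar>f (seg (\<kappa> k) x y) - g (seg (\<kappa> k) x y)\<bar> powr p) + (ennreal \<epsilon>' + ennreal (\<bar>f x - g x\<bar> powr p))))"
            by (intro mult_left_mono) auto
          then show ?thesis by (simp add: distrib_left mult_ac)
        qed (use \<eta>_supp in auto)
      qed
      also have "\<dots> = ennreal (4 powr p) * (?I + (ennreal \<epsilon>' + ennreal (\<bar>f x - g x\<bar> powr p)))"
        by (subst nn_integral_cmult, simp, subst nn_integral_add, simp, simp, subst nn_integral_multc)
           (auto simp: nn_integral_\<eta>)
      finally show ?thesis .
    qed
    let ?J = "\<lambda>x. (\<integral>\<^sup>+y. ennreal (\<eta> y) * ennreal (\<bar>f (seg (\<kappa> k) x y) - g (seg (\<kappa> k) x y)\<bar> powr p) \<partial>lborel)"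
    have "pow_int p ?B (\<lambda>x. avg (\<kappa> k) f x - f x) \<le> (\<integral>\<^sup>+x. ennreal (4 powr p) * (?J x * indicator ?B x
          + (ennreal \<epsilon>' * indicator ?B x + ennreal (\<bar>f x - g x\<bar> powr p) * indicator ?B x)) \<partial>lborel)"
      unfolding pow_int_def
    proof (rule nn_integral_mono)
      fix x
      show "ennreal (\<bar>avg (\<kappa> k) f x - f x\<bar> powr p) * indicator ?B x \<le> ennreal (4 powr p) * (?J x * indicator ?B x
          + (ennreal \<epsilon>' * indicator ?B x + ennreal (\<bar>f x - g x\<bar> powr p) * indicator ?B x))"
        using key[of x] by (cases "x \<in> ?B") auto
    qed
    also have "\<dots> = ennreal (4 powr p) * ((\<integral>\<^sup>+x\<in>?B. ?J x \<partial>lborel) + (ennreal \<epsilon>' * ennreal V + pow_int p ?B (\<lambda>x. f x - g x)))"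
      unfolding pow_int_def
      by (simp add: nn_integral_cmult nn_integral_add V)
    also have "\<dots> \<le> ennreal (4 powr p) * (2 ^ DIM('a) * pow_int p ?B (\<lambda>x. f x - g x) + (ennreal \<epsilon>' * ennreal V + pow_int p ?B (\<lambda>x. f x - g x)))"
    proof (intro mult_left_mono add_right_mono)
      show "(\<integral>\<^sup>+x\<in>?B. ?J x \<partial>lborel) \<le> 2 ^ DIM('a) * pow_int p ?B (\<lambda>x. f x - g x)"
        unfolding pow_int_def
        by (rule nn_integral_avg_le[where F="\<lambda>z. ennreal (\<bar>f z - g z\<bar> powr p)"]) (use B \<kappa> in auto)
    qed auto
    also have "\<dots> \<le> ennreal (4 powr p) * (2 ^ DIM('a) * ennreal \<epsilon>' + (ennreal \<epsilon>' * ennreal V + ennreal \<epsilon>'))"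
      using g(2) by (intro mult_left_mono add_mono order_refl) auto
    also have "\<dots> = ennreal (4 powr p * (2 ^ DIM('a) * \<epsilon>' + (\<epsilon>' * V + \<epsilon>')))"
      using \<epsilon>' V by (simp add: ennreal_mult' ennreal_power[symmetric] flip: ennreal_numeral)
    also have "4 powr p * (2 ^ DIM('a) * \<epsilon>' + (\<epsilon>' * V + \<epsilon>')) = C * \<epsilon>'" by (simp add: C_def algebra_simps)
    also have "C * \<epsilon>' = \<epsilon> / 2" using C by (simp add: \<epsilon>'_def)
    also have "ennreal (\<epsilon> / 2) < ennreal \<epsilon>" using \<epsilon> by (simp add: ennreal_less_iff)
    finally show ?case .
  qed
qed

end

section \<open>Reconstruction of a function from its gradient\<close>

lemma measurable_fst_borel[measurable (raw)]:
  fixes f :: "'c \<Rightarrow> 'a::euclidean_space \<times> 'b::euclidean_space"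
  assumes "f \<in> borel_measurable M"
  shows "(\<lambda>x. fst (f x)) \<in> borel_measurable M"
  by (rule measurable_compose[OF assms]) (intro borel_measurable_continuous_onI continuous_intros)

lemma measurable_snd_borel[measurable (raw)]:
  fixes f :: "'c \<Rightarrow> 'a::euclidean_space \<times> 'b::euclidean_space"
  assumes "f \<in> borel_measurable M"
  shows "(\<lambda>x. snd (f x)) \<in> borel_measurable M"
  by (rule measurable_compose[OF assms]) (intro borel_measurable_continuous_onI continuous_intros)

lemma nn_integral_lborel_snd:
  assumes [measurable]: "f \<in> borel_measurable (borel :: ('a::euclidean_space \<times> 'b::euclidean_space) measure)"
  shows "(\<integral>\<^sup>+z. f z \<partial>lborel) = (\<integral>\<^sup>+y. (\<integral>\<^sup>+x. f (x, y) \<partial>lborel) \<partial>lborel)"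
  by (subst lborel_prod[symmetric], subst lborel_pair.nn_integral_snd) (auto simp: lborel_prod)

lemma nn_integral_lborel_fst:
  assumes [measurable]: "f \<in> borel_measurable (borel :: ('a::euclidean_space \<times> 'b::euclidean_space) measure)"
  shows "(\<integral>\<^sup>+z. f z \<partial>lborel) = (\<integral>\<^sup>+x. (\<integral>\<^sup>+y. f (x, y) \<partial>lborel) \<partial>lborel)"
  by (subst lborel_prod[symmetric], subst lborel.nn_integral_fst) (auto simp: lborel_prod)

context mollifier
begin

abbreviation (input) weight :: "'a \<times> real \<Rightarrow> ennreal" where
  "weight z \<equiv> ennreal (\<eta> (fst z) * indicator {0..1} (snd z))"

text \<open>If G is the gradient of F, integrating over s gives F x - F y by the fundamental theorem
  along the segment, so the result is F x minus the \<eta>-mean of F. The formula makes sense for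
  any vector field G, in particular for an L^p limit of gradients.\<close>

definition grad_avg :: "('a \<Rightarrow> 'a \<Rightarrow> real) \<Rightarrow> 'a \<Rightarrow> real" where
  "grad_avg G x = (\<integral>z. \<eta> (fst z) * indicator {0..1} (snd z) *
      (\<Sum>j\<in>Basis. G j (seg (snd z) x (fst z)) * ((x - fst z) \<bullet> j)) \<partial>(lborel :: ('a \<times> real) measure))"

lemma grad_avg_measurable[measurable]:
  assumes [measurable]: "\<And>j. j \<in> Basis \<Longrightarrow> G j \<in> borel_measurable borel"
  shows "grad_avg G \<in> borel_measurable borel"
  unfolding grad_avg_def by measurable

abbreviation \<nu> :: "('a \<times> real) measure" where
  "\<nu> \<equiv> density lborel (\<lambda>z. ennreal (\<eta> (fst z) * indicator {0..1} (snd z)))"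

lemma prob_\<nu>: "measure \<nu> (space \<nu>) = 1" "finite_measure \<nu>"
proof -
  have "emeasure \<nu> (space \<nu>) = (\<integral>\<^sup>+z. weight z \<partial>(lborel :: ('a \<times> real) measure))"
    by (simp add: emeasure_density)
  also have "\<dots> = (\<integral>\<^sup>+y. (\<integral>\<^sup>+s. ennreal (\<eta> y) * indicator {0..1::real} s \<partial>lborel) \<partial>lborel)"
    by (subst nn_integral_lborel_fst) (auto simp: ennreal_mult' \<eta>_nonneg ennreal_indicator)
  also have "\<dots> = 1"
    by (simp add: nn_integral_cmult_indicator nn_integral_\<eta>)
  finally have "emeasure \<nu> (space \<nu>) = 1" .
  then show "measure \<nu> (space \<nu>) = 1" "finite_measure \<nu>"
    by (auto simp: measure_def intro!: finite_measureI)
qed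

lemma integrable_\<nu>_continuous:
  fixes h :: "'a \<times> real \<Rightarrow> real"
  assumes h: "continuous_on UNIV h"
  shows "integrable lborel (\<lambda>z. \<eta> (fst z) * indicator {0..1} (snd z) * h z)"
proof -
  have "integrable lborel (\<lambda>z. indicator (supp \<times> {0..1}) z *\<^sub>R (\<eta> (fst z) * h z))"
    by (intro borel_integrable_compact compact_Times compact_supp continuous_intros
        continuous_on_compose2[OF smooth_continuous[OF smooth_\<eta>, of UNIV]] continuous_on_subset[OF h]) auto
  also have "(\<lambda>z. indicator (supp \<times> {0..1}) z *\<^sub>R (\<eta> (fst z) * h z)) = (\<lambda>z. \<eta> (fst z) * indicator {0..1} (snd z) * h z)"
  proof
    fix z :: "'a \<times> real"
    show "indicator (supp \<times> {0..1}) z *\<^sub>R (\<eta> (fst z) * h z) = \<eta> (fst z) * indicator {0..1} (snd z) * h z"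
      using \<eta>_supp[of "fst z"] by (cases z) (auto simp: indicator_def)
  qed
  finally show ?thesis .
qed

lemma continuous_grad_integrand:
  assumes "\<And>j. j \<in> Basis \<Longrightarrow> continuous_on UNIV (G j)"
  shows "continuous_on UNIV (\<lambda>z::'a \<times> real. \<Sum>j\<in>Basis. G j (seg (snd z) x (fst z)) * ((x - fst z) \<bullet> j))"
  by (intro continuous_intros continuous_on_compose2[OF assms]) auto

lemma grad_avg_partial_deriv:
  assumes F: "smooth F"
  shows "grad_avg (\<lambda>j. partial_deriv j F) x = F x - (\<integral>y. \<eta> y * F y \<partial>lborel)"
proof -
  let ?h = "\<lambda>z. \<Sum>j\<in>Basis. partial_deriv j F (seg (snd z) x (fst z)) * ((x - fst z) \<bullet> j)"
  have cont: "continuous_on UNIV ?h"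
    using F by (intro continuous_grad_integrand smooth_continuous smooth_partial_deriv) auto
  have ftc: "(\<integral>s. ?h (y, s) * indicator {0..1} s \<partial>lborel) = F x - F y" for y
  proof -
    have "(\<integral>s. ?h (y, s) * indicator {0..1} s \<partial>lborel) = - F (x + 1 *\<^sub>R (y - x)) - (- F (x + 0 *\<^sub>R (y - x)))"
    proof (rule integral_FTC_Icc_real)
      fix s :: real
      have "((\<lambda>s. - F (x + s *\<^sub>R (y - x))) has_real_derivative
          - (\<Sum>e\<in>Basis. ((y - x) \<bullet> e) * partial_deriv e F (x + s *\<^sub>R (y - x)))) (at s)"
        by (intro DERIV_minus smooth_line_derivative F)
      moreover have "x + s *\<^sub>R (y - x) = seg s x y" by (simp add: algebra_simps)
      ultimately show "((\<lambda>s. - F (x + s *\<^sub>R (y - x))) has_real_derivative ?h (y, s)) (at s)"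
        by (simp add: sum_negf[symmetric] inner_diff_left algebra_simps)
      have "continuous_on UNIV (\<lambda>s. ?h (y, s))"
        by (rule continuous_on_compose2[OF cont]) (auto intro!: continuous_intros)
      then show "isCont (\<lambda>s. ?h (y, s)) s"
        by (simp add: continuous_on_eq_continuous_at)
    qed simp
    then show ?thesis by simp
  qed
  have "grad_avg (\<lambda>j. partial_deriv j F) x = (\<integral>y. (\<integral>s. \<eta> y * indicator {0..1} s * ?h (y, s) \<partial>lborel) \<partial>lborel)"
    using lborel_pair.integral_fst'[of "\<lambda>z. \<eta> (fst z) * indicator {0..1} (snd z) * ?h z"]
      integrable_\<nu>_continuous[OF cont]
    unfolding grad_avg_def by (simp add: lborel_prod)
  also have "\<dots> = (\<integral>y. \<eta> y * (F x - F y) \<partial>lborel)"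
  proof (rule Bochner_Integration.integral_cong[OF refl])
    fix y
    have "(\<integral>s. \<eta> y * indicator {0..1} s * ?h (y, s) \<partial>lborel) = \<eta> y * (\<integral>s. ?h (y, s) * indicator {0..1} s \<partial>lborel)"
      by (subst integral_mult_right_zero[symmetric]) (simp only: mult_ac)
    then show "(\<integral>s. \<eta> y * indicator {0..1} s * ?h (y, s) \<partial>lborel) = \<eta> y * (F x - F y)" by (simp only: ftc)
  qed
  also have "\<dots> = (\<integral>y. \<eta> y * F x - \<eta> y * F y \<partial>lborel)" by (simp add: algebra_simps)
  also have "\<dots> = F x - (\<integral>y. \<eta> y * F y \<partial>lborel)"
  proof (subst Bochner_Integration.integral_diff)
    show "integrable lborel (\<lambda>y. \<eta> y * F y)"
      by (rule integrable_compact_support[OF smooth_continuous compact_supp]) (auto intro: smooth_mult smooth_\<eta> F simp: \<eta>_supp)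
  qed (use integrable_\<eta> integral_\<eta> in auto)
  finally show ?thesis .
qed

text \<open>Jensen's inequality for the difference of the gradient of F and G. The smooth side is
  integrable for \<nu>; if the G side is not, the right-hand side is infinite.\<close>

lemma grad_avg_diff_powr_le:
  assumes F: "smooth F" and [measurable]: "\<And>j. j \<in> Basis \<Longrightarrow> G j \<in> borel_measurable borel" and p: "1 \<le> p"
  shows "ennreal (\<bar>F x - (\<integral>y. \<eta> y * F y \<partial>lborel) - grad_avg G x\<bar> powr p) \<le>
    (\<integral>\<^sup>+z. weight z *
      ennreal (\<bar>\<Sum>j\<in>Basis. (partial_deriv j F (seg (snd z) x (fst z)) -
         G j (seg (snd z) x (fst z))) * ((x - fst z) \<bullet> j)\<bar> powr p) \<partial>(lborel :: ('a \<times> real) measure))"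
proof -
  interpret finite_measure \<nu> by (rule prob_\<nu>)
  have [measurable]: "partial_deriv j F \<in> borel_measurable borel" if "j \<in> Basis" for j
    by (intro smooth_borel_measurable smooth_partial_deriv F that)
  let ?h = "\<lambda>H z. \<Sum>j\<in>Basis. H j (seg (snd z) x (fst z)) * ((x - fst z) \<bullet> j)"
  have m: "?h H \<in> borel_measurable borel" if "\<And>j. j \<in> Basis \<Longrightarrow> H j \<in> borel_measurable borel" for H :: "'a \<Rightarrow> 'a \<Rightarrow> real"
    using that by measurable
  have avg: "grad_avg H x = (\<integral>z. ?h H z \<partial>\<nu>)" if "\<And>j. j \<in> Basis \<Longrightarrow> H j \<in> borel_measurable borel" for H
    unfolding grad_avg_def using m[OF that] by (subst integral_real_density) (auto simp: \<eta>_nonneg)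
  have int: "integrable \<nu> (?h (\<lambda>j. partial_deriv j F))"
    using m[of "\<lambda>j. partial_deriv j F"] F integrable_\<nu>_continuous[OF continuous_grad_integrand, of "\<lambda>j. partial_deriv j F" x]
    by (subst integrable_real_density) (auto simp: \<eta>_nonneg intro: smooth_continuous smooth_partial_deriv)
  have "F x - (\<integral>y. \<eta> y * F y \<partial>lborel) - grad_avg G x = (\<integral>z. ?h (\<lambda>j. partial_deriv j F) z \<partial>\<nu>) - (\<integral>z. ?h G z \<partial>\<nu>)"
    by (simp add: avg flip: grad_avg_partial_deriv[OF F])
  then have "ennreal (\<bar>F x - (\<integral>y. \<eta> y * F y \<partial>lborel) - grad_avg G x\<bar> powr p) \<le>
      ennreal (1 powr (p - 1)) * (\<integral>\<^sup>+z. ennreal (\<bar>?h (\<lambda>j. partial_deriv j F) z - ?h G z\<bar> powr p) \<partial>\<nu>)"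
    using prob_\<nu> m[of G] by (simp only:) (intro powr_integral_diff_le[OF p int]; simp)
  also have "\<dots> = (\<integral>\<^sup>+z. weight z * ennreal (\<bar>?h (\<lambda>j. partial_deriv j F) z - ?h G z\<bar> powr p) \<partial>lborel)"
    by (simp add: nn_integral_density)
  finally show ?thesis by (simp add: sum_subtractf[symmetric] left_diff_distrib)
qed

text \<open>The point (1 - s) x + s y is a good coordinate in x only for s away from 1 and in y only
  for s away from 0. So the range of s is split at 1/2: below it the variable x is substituted,
  above it y, where \<eta> is first replaced by its bound B and the free x-integral costs the
  measure of S. These are the two summands of the constant.\<close>

lemma nn_integral_grad_avg_le:
  fixes H :: "'a \<Rightarrow> ennreal"
  assumes [measurable]: "H \<in> borel_measurable borel" "S \<in> sets borel"
    and S: "convex S" "supp \<subseteq> S" and B: "\<And>x. \<eta> x \<le> B"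
  shows "(\<integral>\<^sup>+x\<in>S. (\<integral>\<^sup>+z. weight z * H (seg (snd z) x (fst z)) \<partial>(lborel :: ('a \<times> real) measure)) \<partial>lborel)
    \<le> 2 ^ DIM('a) * (1 + ennreal B * emeasure lborel S) * (\<integral>\<^sup>+x\<in>S. H x \<partial>lborel)"
proof -
  let ?C = "2 ^ DIM('a) * (1 + ennreal B * emeasure lborel S) * (\<integral>\<^sup>+x\<in>S. H x \<partial>lborel)"
  have slice: "(\<integral>\<^sup>+x\<in>S. (\<integral>\<^sup>+y. ennreal (\<eta> y) * H (seg s x y) \<partial>lborel) \<partial>lborel) \<le> ?C" if s: "0 \<le> s" "s \<le> 1" for s
  proof (cases "s \<le> 1/2")
    case True
    then have "(\<integral>\<^sup>+x\<in>S. (\<integral>\<^sup>+y. ennreal (\<eta> y) * H (seg s x y) \<partial>lborel) \<partial>lborel) \<le> 2 ^ DIM('a) * (\<integral>\<^sup>+x\<in>S. H x \<partial>lborel)"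
      using s by (intro nn_integral_avg_le S) auto
    also have "\<dots> = 2 ^ DIM('a) * 1 * (\<integral>\<^sup>+x\<in>S. H x \<partial>lborel)" by simp
    also have "\<dots> \<le> ?C" by (intro mult_right_mono mult_left_mono) auto
    finally show ?thesis .
  next
    \<comment> \<open>Now s > 1/2: the roles of x and y are exchanged, with 1 - s as the small
      parameter.\<close>
    case False
    have "(\<integral>\<^sup>+y. ennreal (\<eta> y) * H (seg s x y) \<partial>lborel) \<le> ennreal B * (2 ^ DIM('a) * (\<integral>\<^sup>+x\<in>S. H x \<partial>lborel))"
      if x: "x \<in> S" for x
    proof -
      have "(\<integral>\<^sup>+y. ennreal (\<eta> y) * H (seg s x y) \<partial>lborel) \<le>
          (\<integral>\<^sup>+y. ennreal B * (H ((1 - (1 - s)) *\<^sub>R y + (1 - s) *\<^sub>R x) * indicator S y) \<partial>lborel)"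
      proof (rule nn_integral_mono)
        fix y
        show "ennreal (\<eta> y) * H (seg s x y) \<le> ennreal B * (H ((1 - (1 - s)) *\<^sub>R y + (1 - s) *\<^sub>R x) * indicator S y)"
          using subsetD[OF S(2), of y] \<eta>_supp[of y] B[of y]
          by (cases "y \<in> supp") (auto simp: add.commute intro!: mult_right_mono ennreal_leI)
      qed
      also have "\<dots> = ennreal B * (\<integral>\<^sup>+y\<in>S. H ((1 - (1 - s)) *\<^sub>R y + (1 - s) *\<^sub>R x) \<partial>lborel)"
        by (rule nn_integral_cmult) measurable
      also have "\<dots> \<le> ennreal B * (2 ^ DIM('a) * (\<integral>\<^sup>+x\<in>S. H x \<partial>lborel))"
        using False s x S by (intro mult_left_mono nn_integral_segment_le) auto
      finally show ?thesis .
    qed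
    then have "(\<integral>\<^sup>+x\<in>S. (\<integral>\<^sup>+y. ennreal (\<eta> y) * H (seg s x y) \<partial>lborel) \<partial>lborel) \<le>
        (\<integral>\<^sup>+x. ennreal B * (2 ^ DIM('a) * (\<integral>\<^sup>+x\<in>S. H x \<partial>lborel)) * indicator S x \<partial>lborel)"
      by (intro nn_integral_mono) (auto simp: indicator_def)
    also have "\<dots> = 2 ^ DIM('a) * (ennreal B * emeasure lborel S) * (\<integral>\<^sup>+x\<in>S. H x \<partial>lborel)"
      by (subst nn_integral_cmult_indicator) (auto simp: mult_ac)
    also have "\<dots> \<le> ?C" by (intro mult_right_mono mult_left_mono) auto
    finally show ?thesis .
  qed
  have "(\<integral>\<^sup>+x\<in>S. (\<integral>\<^sup>+z. weight z * H (seg (snd z) x (fst z)) \<partial>(lborel :: ('a \<times> real) measure)) \<partial>lborel)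
    = (\<integral>\<^sup>+x. (\<integral>\<^sup>+s. (\<integral>\<^sup>+y. ennreal (\<eta> y) * H (seg s x y) \<partial>lborel) * indicator {0..1} s * indicator S x \<partial>lborel) \<partial>lborel)"
  proof (rule nn_integral_cong)
    fix x
    have "(\<integral>\<^sup>+z. weight z * H (seg (snd z) x (fst z)) \<partial>(lborel :: ('a \<times> real) measure))
      = (\<integral>\<^sup>+s. (\<integral>\<^sup>+y. ennreal (\<eta> y) * H (seg s x y) * indicator {0..1} s \<partial>lborel) \<partial>lborel)"
      by (subst nn_integral_lborel_snd) (auto simp: ennreal_mult' \<eta>_nonneg ennreal_indicator mult_ac)
    also have "\<dots> = (\<integral>\<^sup>+s. (\<integral>\<^sup>+y. ennreal (\<eta> y) * H (seg s x y) \<partial>lborel) * indicator {0..1} s \<partial>lborel)"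
      by (intro nn_integral_cong nn_integral_multc) measurable
    finally show "(\<integral>\<^sup>+z. weight z * H (seg (snd z) x (fst z)) \<partial>(lborel :: ('a \<times> real) measure)) * indicator S x
      = (\<integral>\<^sup>+s. (\<integral>\<^sup>+y. ennreal (\<eta> y) * H (seg s x y) \<partial>lborel) * indicator {0..1} s * indicator S x \<partial>lborel)"
      by (simp add: nn_integral_multc)
  qed
  also have "\<dots> = (\<integral>\<^sup>+s. (\<integral>\<^sup>+x. (\<integral>\<^sup>+y. ennreal (\<eta> y) * H (seg s x y) \<partial>lborel) * indicator {0..1} s * indicator S x \<partial>lborel) \<partial>lborel)"
    by (rule lborel_pair.Fubini') measurable
  also have "\<dots> \<le> (\<integral>\<^sup>+s. ?C * indicator {0..1::real} s \<partial>lborel)"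
  proof (rule nn_integral_mono)
    fix s :: real
    show "(\<integral>\<^sup>+x. (\<integral>\<^sup>+y. ennreal (\<eta> y) * H (seg s x y) \<partial>lborel) * indicator {0..1} s * indicator S x \<partial>lborel) \<le> ?C * indicator {0..1} s"
      using slice[of s] by (cases "s \<in> {0..1}") auto
  qed
  also have "\<dots> = ?C" by (subst nn_integral_cmult_indicator) auto
  finally show ?thesis .
qed

text \<open>Poincare's inequality in a form comparing F with the reconstruction from another field
  G. The factor 2 R bounds |x - y| inside the ball, and the dimension enters through the sum over
  components.\<close>

lemma pow_int_grad_avg_le:
  assumes F: "smooth F" and [measurable]: "\<And>j. j \<in> Basis \<Longrightarrow> G j \<in> borel_measurable borel" and p: "1 \<le> p"
    and [measurable]: "S \<in> sets borel" and S: "convex S" "supp \<subseteq> S" "S \<subseteq> ball 0 R" and B: "\<And>x. \<eta> x \<le> B"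
  shows "pow_int p S (\<lambda>x. F x - (\<integral>y. \<eta> y * F y \<partial>lborel) - grad_avg G x) \<le>
    ennreal ((2 * R * real DIM('a)) powr p) * (2 ^ DIM('a) * (1 + ennreal B * emeasure lborel S)) *
      (\<Sum>j\<in>Basis. pow_int p S (\<lambda>x. partial_deriv j F x - G j x))"
proof -
  let ?C = "ennreal ((2 * R * real DIM('a)) powr p)"
  let ?H = "\<lambda>w. \<Sum>j\<in>Basis. ennreal (\<bar>partial_deriv j F w - G j w\<bar> powr p)"
  have [measurable]: "partial_deriv j F \<in> borel_measurable borel" if "j \<in> Basis" for j
    by (intro smooth_borel_measurable smooth_partial_deriv F that)
  have pt: "ennreal (\<bar>F x - (\<integral>y. \<eta> y * F y \<partial>lborel) - grad_avg G x\<bar> powr p) \<le>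
      ?C * (\<integral>\<^sup>+z. weight z * ?H (seg (snd z) x (fst z)) \<partial>(lborel :: ('a \<times> real) measure))"
    if x: "x \<in> S" for x
  proof -
    have "ennreal (\<bar>F x - (\<integral>y. \<eta> y * F y \<partial>lborel) - grad_avg G x\<bar> powr p) \<le>
    (\<integral>\<^sup>+z. weight z *
      ennreal (\<bar>\<Sum>j\<in>Basis. (partial_deriv j F (seg (snd z) x (fst z)) -
         G j (seg (snd z) x (fst z))) * ((x - fst z) \<bullet> j)\<bar> powr p) \<partial>(lborel :: ('a \<times> real) measure))"
      by (rule grad_avg_diff_powr_le[OF F _ p]) measurable
    also have "\<dots> \<le> (\<integral>\<^sup>+z. ?C * (weight z * ?H (seg (snd z) x (fst z))) \<partial>(lborel :: ('a \<times> real) measure))"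
    proof (rule nn_integral_mono)
      fix z :: "'a \<times> real"
      let ?w = "seg (snd z) x (fst z)"
      show "weight z * ennreal (\<bar>\<Sum>j\<in>Basis. (partial_deriv j F ?w - G j ?w) * ((x - fst z) \<bullet> j)\<bar> powr p)
        \<le> ?C * (weight z * ?H ?w)"
      proof (cases "fst z \<in> supp")
        case True
        then have "norm x < R" "norm (fst z) < R" using S x by auto
        then have n: "norm (x - fst z) \<le> 2 * R" using norm_triangle_ineq4[of x "fst z"] by linarith
        have R: "0 \<le> R" using \<open>norm x < R\<close> norm_ge_zero[of x] by linarith
        have "\<bar>\<Sum>j\<in>Basis. (partial_deriv j F ?w - G j ?w) * ((x - fst z) \<bullet> j)\<bar> \<le> (\<Sum>j\<in>Basis. \<bar>2 * R * (partial_deriv j F ?w - G j ?w)\<bar>)"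
        proof (rule order_trans[OF sum_abs], rule sum_mono)
          fix j :: 'a assume j: "j \<in> Basis"
          have "\<bar>(x - fst z) \<bullet> j\<bar> \<le> 2 * R" using Basis_le_norm[OF j, of "x - fst z"] n by linarith
          then have "\<bar>partial_deriv j F ?w - G j ?w\<bar> * \<bar>(x - fst z) \<bullet> j\<bar> \<le> \<bar>partial_deriv j F ?w - G j ?w\<bar> * (2 * R)"
            by (intro mult_left_mono) auto
          then show "\<bar>(partial_deriv j F ?w - G j ?w) * ((x - fst z) \<bullet> j)\<bar> \<le> \<bar>2 * R * (partial_deriv j F ?w - G j ?w)\<bar>"
            by (simp only: abs_mult abs_of_nonneg[OF R] abs_numeral) (simp only: mult_ac)
        qed
        then have "\<bar>\<Sum>j\<in>Basis. (partial_deriv j F ?w - G j ?w) * ((x - fst z) \<bullet> j)\<bar> powr p \<le> (\<Sum>j\<in>Basis. \<bar>2 * R * (partial_deriv j F ?w - G j ?w)\<bar>) powr p"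
          using p by (intro powr_mono2) auto
        also have "\<dots> \<le> real (card (Basis::'a set)) powr p * (\<Sum>j\<in>Basis. \<bar>2 * R * (partial_deriv j F ?w - G j ?w)\<bar> powr p)"
          using p by (intro powr_sum_abs_le) auto
        also have "\<dots> = (2 * R * real DIM('a)) powr p * (\<Sum>j\<in>Basis. \<bar>partial_deriv j F ?w - G j ?w\<bar> powr p)"
          using R by (simp add: abs_mult powr_mult sum_distrib_left mult_ac del: right_diff_distrib_numeral)
        finally have "ennreal (\<bar>\<Sum>j\<in>Basis. (partial_deriv j F ?w - G j ?w) * ((x - fst z) \<bullet> j)\<bar> powr p) \<le> ?C * ?H ?w"
          by (simp add: ennreal_leI sum_nonneg flip: ennreal_mult')
        then have "weight z * ennreal (\<bar>\<Sum>j\<in>Basis. (partial_deriv j F ?w - G j ?w) * ((x - fst z) \<bullet> j)\<bar> powr p)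
           \<le> weight z * (?C * ?H ?w)"
          by (intro mult_left_mono) auto
        then show ?thesis by (simp add: mult_ac)
      qed (use \<eta>_supp in auto)
    qed
    also have "\<dots> = ?C * (\<integral>\<^sup>+z. weight z * ?H (seg (snd z) x (fst z)) \<partial>(lborel :: ('a \<times> real) measure))"
      by (rule nn_integral_cmult) measurable
    finally show ?thesis .
  qed
  have "pow_int p S (\<lambda>x. F x - (\<integral>y. \<eta> y * F y \<partial>lborel) - grad_avg G x) \<le>
    (\<integral>\<^sup>+x. ?C * ((\<integral>\<^sup>+z. weight z * ?H (seg (snd z) x (fst z)) \<partial>(lborel :: ('a \<times> real) measure)) * indicator S x) \<partial>lborel)"
    unfolding pow_int_def
  proof (rule nn_integral_mono)
    fix x
    show "ennreal (\<bar>F x - (\<integral>y. \<eta> y * F y \<partial>lborel) - grad_avg G x\<bar> powr p) * indicator S x \<le>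
      ?C * ((\<integral>\<^sup>+z. weight z * ?H (seg (snd z) x (fst z)) \<partial>(lborel :: ('a \<times> real) measure)) * indicator S x)"
      using pt[of x] by (cases "x \<in> S") auto
  qed
  also have "\<dots> = ?C * (\<integral>\<^sup>+x\<in>S. (\<integral>\<^sup>+z. weight z * ?H (seg (snd z) x (fst z)) \<partial>(lborel :: ('a \<times> real) measure)) \<partial>lborel)"
    by (rule nn_integral_cmult) measurable
  also have "\<dots> \<le> ?C * (2 ^ DIM('a) * (1 + ennreal B * emeasure lborel S) * (\<integral>\<^sup>+x\<in>S. ?H x \<partial>lborel))"
    by (intro mult_left_mono nn_integral_grad_avg_le S B) auto
  also have "(\<integral>\<^sup>+x\<in>S. ?H x \<partial>lborel) = (\<Sum>j\<in>Basis. pow_int p S (\<lambda>x. partial_deriv j F x - G j x))"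
    unfolding pow_int_def by (simp only: sum_distrib_right) (rule nn_integral_sum, measurable)
  finally show ?thesis by (simp add: mult.assoc)
qed

text \<open>Convergence of gradients and of \<eta>-means forces convergence of the functions. The
  limit is given by an explicit formula, so it serves as a concrete Borel representative.\<close>

lemma pow_int_reconstruct_tendsto:
  assumes F: "\<And>k. smooth (F k)" and [measurable]: "\<And>j. j \<in> Basis \<Longrightarrow> G j \<in> borel_measurable borel" and p: "1 \<le> p"
    and [measurable]: "S \<in> sets borel" and S: "convex S" "supp \<subseteq> S" "S \<subseteq> ball 0 R"
    and c: "(\<lambda>k. \<integral>y. \<eta> y * F k y \<partial>lborel) \<longlonglongrightarrow> c"
    and D: "\<And>j. j \<in> Basis \<Longrightarrow> (\<lambda>k. pow_int p S (\<lambda>x. partial_deriv j (F k) x - G j x)) \<longlonglongrightarrow> 0"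
  shows "(\<lambda>k. pow_int p S (\<lambda>x. F k x - (c + grad_avg G x))) \<longlonglongrightarrow> 0"
proof -
  obtain B where B: "0 < B" "\<And>x. \<bar>\<eta> x\<bar> \<le> B"
    using compact_support_bounded[OF smooth_continuous[OF smooth_\<eta>] compact_supp \<eta>_supp] by metis
  have B': "\<eta> x \<le> B" for x using B(2)[of x] by linarith
  have fin: "emeasure lborel S < top"
    using order_le_less_trans[OF emeasure_mono[OF S(3)] emeasure_lborel_ball_finite[of "0::'a" R]] by (simp add: less_top)
  let ?c = "\<lambda>k. \<integral>y. \<eta> y * F k y \<partial>lborel"
  have [measurable]: "F k \<in> borel_measurable borel" for k using F by (rule smooth_borel_measurable)
  have 1: "(\<lambda>k. pow_int p S (\<lambda>x. F k x - (?c k + grad_avg G x))) \<longlonglongrightarrow> 0"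
  proof (rule ennreal_tendsto_0_le)
    show "pow_int p S (\<lambda>x. F k x - (?c k + grad_avg G x)) \<le>
      ennreal ((2 * R * real DIM('a)) powr p) * (2 ^ DIM('a) * (1 + ennreal B * emeasure lborel S)) *
      (\<Sum>j\<in>Basis. pow_int p S (\<lambda>x. partial_deriv j (F k) x - G j x))" for k
      using pow_int_grad_avg_le[OF F assms(2) p assms(4) S B'] by (simp add: diff_diff_eq)
    have "(\<lambda>k. \<Sum>j\<in>Basis. pow_int p S (\<lambda>x. partial_deriv j (F k) x - G j x)) \<longlonglongrightarrow> (\<Sum>j\<in>(Basis::'a set). 0)"
      by (intro tendsto_sum D)
    then show "(\<lambda>k. ennreal ((2 * R * real DIM('a)) powr p) * (2 ^ DIM('a) * (1 + ennreal B * emeasure lborel S)) *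
      (\<Sum>j\<in>Basis. pow_int p S (\<lambda>x. partial_deriv j (F k) x - G j x))) \<longlonglongrightarrow> 0"
      using fin by (intro ennreal_tendsto_0_cmult) (auto simp: ennreal_mult_less_top power_less_top_ennreal)
  qed
  have "(\<lambda>k. \<bar>?c k - c\<bar>) \<longlonglongrightarrow> 0" using c by (subst tendsto_rabs_zero_iff) (simp add: LIM_zero)
  then have "(\<lambda>k. \<bar>?c k - c\<bar> powr p) \<longlonglongrightarrow> 0 powr p" using p by (intro tendsto_powr2) auto
  then have "(\<lambda>k. ennreal (\<bar>?c k - c\<bar> powr p)) \<longlonglongrightarrow> 0" by (subst ennreal_tendsto_0_iff) auto
  then have "(\<lambda>k. emeasure lborel S * ennreal (\<bar>?c k - c\<bar> powr p)) \<longlonglongrightarrow> 0"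
    using fin by (intro ennreal_tendsto_0_cmult)
  then have 2: "(\<lambda>k. pow_int p S (\<lambda>x. (?c k + grad_avg G x) - (c + grad_avg G x))) \<longlonglongrightarrow> 0"
    by (simp add: pow_int_const mult.commute)
  show ?thesis
    by (rule pow_int_tendsto_0_trans[OF _ _ _ _ _ 1 2]) (use p in auto)
qed

end

section \<open>Locally integrable functions and weak derivatives\<close>

lemma AE_lborel_ex_negligible:
  assumes "AE x in lborel. P x"
  obtains N where "negligible N" "\<And>x. x \<notin> N \<Longrightarrow> P x"
proof -
  have "AE x in lebesgue. P x" using assms by (rule AE_completion)
  then obtain N where "N \<in> null_sets lebesgue" "{x \<in> space lebesgue. \<not> P x} \<subseteq> N"
    by (auto simp: eventually_ae_filter)
  then show ?thesis using that[of N] by (auto simp: negligible_iff_null_sets)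
qed

lemma L1_loc_cong_AE:
  fixes u v :: "'a::euclidean_space \<Rightarrow> real"
  assumes "AE x in lborel. x \<in> \<Omega> \<longrightarrow> u x = v x" and u: "u \<in> L1_loc \<Omega>"
  shows "v \<in> L1_loc \<Omega>"
proof -
  obtain N where N: "negligible N" "\<And>x. x \<notin> N \<Longrightarrow> x \<in> \<Omega> \<longrightarrow> u x = v x"
    using AE_lborel_ex_negligible[OF assms(1)] by blast
  have "v absolutely_integrable_on K" if K: "compact K" "K \<subseteq> \<Omega>" for K
  proof (rule absolutely_integrable_spike[OF _ N(1)])
    show "u absolutely_integrable_on K" using u K by (simp add: L1_loc_def)
    show "v x = u x" if "x \<in> K - N" for x using N(2)[of x] that K by auto
  qed
  then show ?thesis by (auto simp: L1_loc_def)
qed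

lemma L1_loc_iff_integrable:
  fixes u :: "'a::euclidean_space \<Rightarrow> real"
  assumes [measurable]: "u \<in> borel_measurable borel"
  shows "u \<in> L1_loc \<Omega> \<longleftrightarrow> (\<forall>K. compact K \<and> K \<subseteq> \<Omega> \<longrightarrow> integrable lborel (\<lambda>x. indicator K x * u x))"
proof -
  have "u absolutely_integrable_on K \<longleftrightarrow> integrable lborel (\<lambda>x. indicator K x * u x)" if "compact K" for K
  proof -
    have [measurable]: "K \<in> sets borel" using that by (rule borel_compact)
    have "(\<lambda>x. indicator K x * u x) \<in> borel_measurable lborel" by measurable
    then show ?thesis by (simp add: set_integrable_def integrable_completion)
  qed
  then show ?thesis by (auto simp: L1_loc_def)
qed

lemma L1_loc_measurable:
  fixes u :: "'a::euclidean_space \<Rightarrow> real"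
  assumes "open \<Omega>" "u \<in> L1_loc \<Omega>"
  shows "(\<lambda>x. indicator \<Omega> x * u x) \<in> borel_measurable lebesgue"
proof -
  obtain C where C: "\<And>n. compact (C n)" "\<And>n. C n \<subseteq> \<Omega>" "\<And>n. C n \<subseteq> interior (C (Suc n))" "\<Union>(range C) = \<Omega>"
    using open_Union_compact_subsets[OF assms(1)] by metis
  have mono: "C n \<subseteq> C m" if "n \<le> m" for n m
    using lift_Suc_mono_le[of C n m] C(3) interior_subset that by blast
  show ?thesis
  proof (rule borel_measurable_LIMSEQ_real)
    show "(\<lambda>x. indicator (C n) x * u x) \<in> borel_measurable lebesgue" for n
      using assms C by (auto simp: L1_loc_def set_integrable_def dest!: borel_measurable_integrable)
    fix x
    have "\<forall>\<^sub>F n in sequentially. indicator (C n) x * u x = indicator \<Omega> x * u x"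
    proof (cases "x \<in> \<Omega>")
      case True
      then obtain n where n: "x \<in> C n" using C(4) by auto
      show ?thesis using eventually_ge_at_top[of n]
        by eventually_elim (use mono n True in \<open>auto simp: indicator_def\<close>)
    next
      case False
      then have "x \<notin> C n" for n using C(2) by auto
      then show ?thesis using False by simp
    qed
    then show "(\<lambda>n. indicator (C n) x * u x) \<longlonglongrightarrow> indicator \<Omega> x * u x" by (rule tendsto_eventually)
  qed
qed

text \<open>Borel measurability survives composition with continuous maps, unlike Lebesgue
  measurability, so all averages and iterated integrals are formed from such representatives. The
  value 0 outside \<Omega> later allows second derivatives to be averaged over whole balls.\<close>

lemma L1_loc_borel_representative:
  fixes u :: "'a::euclidean_space \<Rightarrow> real"
  assumes "open \<Omega>" "u \<in> L1_loc \<Omega>"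
  obtains v where "v \<in> borel_measurable borel" "AE x in lborel. x \<in> \<Omega> \<longrightarrow> u x = v x"
    "\<And>x. x \<notin> \<Omega> \<Longrightarrow> v x = 0" "v \<in> L1_loc \<Omega>"
proof -
  obtain g where g: "g \<in> borel_measurable lborel" "AE x in lborel. indicator \<Omega> x * u x = g x"
    using completion_ex_borel_measurable_real[OF L1_loc_measurable[OF assms]] by auto
  have [measurable]: "g \<in> borel_measurable borel" "\<Omega> \<in> sets borel" using g assms by auto
  have ae: "AE x in lborel. x \<in> \<Omega> \<longrightarrow> u x = indicator \<Omega> x * g x"
    using g(2) by eventually_elim (auto simp: indicator_def)
  show ?thesis
    by (rule that[of "\<lambda>x. indicator \<Omega> x * g x"])
       (use ae L1_loc_cong_AE[OF ae assms(2)] in \<open>auto simp: indicator_def\<close>)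
qed

lemma set_integral_eq_borel_representative:
  fixes u v \<psi> :: "'a::euclidean_space \<Rightarrow> real"
  assumes "open \<Omega>" "u \<in> L1_loc \<Omega>" and [measurable]: "v \<in> borel_measurable borel" "\<psi> \<in> borel_measurable borel"
    and ae: "AE x in lborel. x \<in> \<Omega> \<longrightarrow> u x = v x" and \<psi>: "\<And>x. x \<notin> \<Omega> \<Longrightarrow> \<psi> x = 0"
  shows "(LINT x:\<Omega>|lebesgue. u x * \<psi> x) = (\<integral>x. v x * \<psi> x \<partial>lborel)"
proof -
  note [measurable] = L1_loc_measurable[OF assms(1,2)]
  have vm: "(\<lambda>x. v x * \<psi> x) \<in> borel_measurable lborel" by measurable
  have pm: "\<psi> \<in> borel_measurable lebesgue" by (rule measurable_completion) simp
  have "(LINT x:\<Omega>|lebesgue. u x * \<psi> x) = (\<integral>x. (indicator \<Omega> x * u x) * \<psi> x \<partial>lebesgue)"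
    by (simp add: set_lebesgue_integral_def mult.assoc)
  also have "\<dots> = (\<integral>x. v x * \<psi> x \<partial>lebesgue)"
  proof (rule integral_cong_AE)
    show "(\<lambda>x. (indicator \<Omega> x * u x) * \<psi> x) \<in> borel_measurable lebesgue"
      by (rule borel_measurable_times[OF L1_loc_measurable[OF assms(1,2)] pm])
    show "(\<lambda>x. v x * \<psi> x) \<in> borel_measurable lebesgue" using vm by (rule measurable_completion)
    show "AE x in lebesgue. indicator \<Omega> x * u x * \<psi> x = v x * \<psi> x"
      using AE_completion[OF ae] by eventually_elim (use \<psi> in \<open>auto simp: indicator_def\<close>)
  qed
  also have "\<dots> = (\<integral>x. v x * \<psi> x \<partial>lborel)" by (rule integral_completion[OF vm])
  finally show ?thesis .
qed

lemma test_function_measurable: "\<phi> \<in> test_functions \<Omega> \<Longrightarrow> \<phi> \<in> borel_measurable borel"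
  by (auto simp: test_functions_def intro: smooth_borel_measurable)

lemma test_function_zero: "\<phi> \<in> test_functions \<Omega> \<Longrightarrow> x \<notin> \<Omega> \<Longrightarrow> \<phi> x = 0"
  using test_functionsD by (metis subsetD)

lemma has_weak_deriv_iff_borel:
  fixes u v u' v' :: "'a::euclidean_space \<Rightarrow> real"
  assumes "open \<Omega>" "u \<in> L1_loc \<Omega>" "set es \<subseteq> Basis"
    and u': "u' \<in> borel_measurable borel" "AE x in lborel. x \<in> \<Omega> \<longrightarrow> u x = u' x"
    and v': "v' \<in> borel_measurable borel" "AE x in lborel. x \<in> \<Omega> \<longrightarrow> v x = v' x"
  shows "has_weak_deriv \<Omega> es u v \<longleftrightarrow> v \<in> L1_loc \<Omega> \<and>
    (\<forall>\<phi>\<in>test_functions \<Omega>. (\<integral>x. u' x * partial_derivs es \<phi> x \<partial>lborel) = (- 1) ^ length es * (\<integral>x. v' x * \<phi> x \<partial>lborel))"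
proof (cases "v \<in> L1_loc \<Omega>")
  case True
  have "(LINT x:\<Omega>|lebesgue. u x * partial_derivs es \<phi> x) = (\<integral>x. u' x * partial_derivs es \<phi> x \<partial>lborel)"
    "(LINT x:\<Omega>|lebesgue. v x * \<phi> x) = (\<integral>x. v' x * \<phi> x \<partial>lborel)" if "\<phi> \<in> test_functions \<Omega>" for \<phi>
  proof -
    note t = test_functions_partial_derivs[OF that assms(3)]
    show "(LINT x:\<Omega>|lebesgue. u x * partial_derivs es \<phi> x) = (\<integral>x. u' x * partial_derivs es \<phi> x \<partial>lborel)"
      by (rule set_integral_eq_borel_representative[OF assms(1,2) u'(1) test_function_measurable[OF t] u'(2) test_function_zero[OF t]])
    show "(LINT x:\<Omega>|lebesgue. v x * \<phi> x) = (\<integral>x. v' x * \<phi> x \<partial>lborel)"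
      by (rule set_integral_eq_borel_representative[OF assms(1) True v'(1) test_function_measurable[OF that] v'(2) test_function_zero[OF that]])
  qed
  then show ?thesis using True by (auto simp: has_weak_deriv_def)
qed (auto simp: has_weak_deriv_def)

text \<open>Pointwise, |t| is at most d or equals |t|^(1-p) |t|^p, which is at most d^(1-p) |t|^p.
  With d free, L^p convergence on a set of finite measure yields L^1 convergence: first the sequence
  index grows, then d shrinks.\<close>

lemma pow_int_1_le:
  fixes h :: "'a::euclidean_space \<Rightarrow> real"
  assumes [measurable]: "h \<in> borel_measurable borel" "K \<in> sets borel" and p: "1 \<le> p" and d: "0 < d"
  shows "pow_int 1 K h \<le> ennreal d * emeasure lborel K + ennreal (d powr (1 - p)) * pow_int p K h"
proof -
  have pt: "\<bar>t\<bar> \<le> d + d powr (1 - p) * \<bar>t\<bar> powr p" for t :: real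
  proof (cases "\<bar>t\<bar> \<le> d")
    case False
    then have "\<bar>t\<bar> = \<bar>t\<bar> powr (1 - p) * \<bar>t\<bar> powr p" using d by (simp flip: powr_add)
    also have "\<dots> \<le> d powr (1 - p) * \<bar>t\<bar> powr p"
      using False d p by (intro mult_right_mono powr_mono2') auto
    finally show ?thesis using d by linarith
  qed (use d in \<open>simp add: add_increasing2\<close>)
  have "pow_int 1 K h \<le> (\<integral>\<^sup>+x. ennreal d * indicator K x + ennreal (d powr (1 - p)) * (ennreal (\<bar>h x\<bar> powr p) * indicator K x) \<partial>lborel)"
    unfolding pow_int_def using pt d
    by (intro nn_integral_mono) (auto simp: indicator_def simp flip: ennreal_mult' ennreal_plus intro!: ennreal_leI)
  also have "\<dots> = ennreal d * emeasure lborel K + ennreal (d powr (1 - p)) * pow_int p K h"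
    unfolding pow_int_def by (simp add: nn_integral_add nn_integral_cmult)
  finally show ?thesis .
qed

lemma pow_int_1_tendsto_0:
  fixes h :: "nat \<Rightarrow> 'a::euclidean_space \<Rightarrow> real"
  assumes [measurable]: "\<And>k. h k \<in> borel_measurable borel" "K \<in> sets borel" and p: "1 \<le> p"
    and K: "emeasure lborel K < top" and lim: "(\<lambda>k. pow_int p K (h k)) \<longlonglongrightarrow> 0"
  shows "(\<lambda>k. pow_int 1 K (h k)) \<longlonglongrightarrow> 0"
proof (rule tendsto_zero_ennreal)
  fix \<epsilon> :: real assume \<epsilon>: "0 < \<epsilon>"
  define V where "V = measure lborel K"
  have V: "emeasure lborel K = ennreal V" "0 \<le> V"
    using K by (auto simp: V_def emeasure_eq_ennreal_measure less_top)
  define d where "d = \<epsilon> / (2 * (V + 1))"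
  have d: "0 < d" using \<epsilon> V by (simp add: d_def)
  have dV: "d * V \<le> \<epsilon> / 2" using \<epsilon> V by (simp add: d_def field_simps)
  have "(\<lambda>k. ennreal (d powr (1 - p)) * pow_int p K (h k)) \<longlonglongrightarrow> 0"
    by (rule ennreal_tendsto_0_cmult[OF lim]) simp
  then have "\<forall>\<^sub>F k in sequentially. ennreal (d powr (1 - p)) * pow_int p K (h k) < ennreal (\<epsilon> / 4)"
    using \<epsilon> by (intro order_tendstoD(2)) auto
  then show "\<forall>\<^sub>F k in sequentially. pow_int 1 K (h k) < ennreal \<epsilon>"
  proof eventually_elim
    case (elim k)
    have "pow_int 1 K (h k) \<le> ennreal (d * V) + ennreal (d powr (1 - p)) * pow_int p K (h k)"
      using pow_int_1_le[OF assms(1,2) p d] d V by (simp add: ennreal_mult')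
    also have "\<dots> \<le> ennreal (\<epsilon> / 2) + ennreal (\<epsilon> / 4)"
      using dV elim by (intro add_mono ennreal_leI) auto
    also have "\<dots> = ennreal (3 * \<epsilon> / 4)" using \<epsilon> by (simp flip: ennreal_plus)
    also have "\<dots> < ennreal \<epsilon>" using \<epsilon> by (simp add: ennreal_less_iff)
    finally show ?case .
  qed
qed

lemma integrable_of_pow_int_1:
  fixes f :: "'a::euclidean_space \<Rightarrow> real"
  assumes [measurable]: "f \<in> borel_measurable borel" "K \<in> sets borel" and "pow_int 1 K f < \<infinity>"
  shows "integrable lborel (\<lambda>x. indicator K x * f x)"
proof (rule integrableI_bounded)
  have "(\<integral>\<^sup>+x. ennreal (norm (indicator K x * f x)) \<partial>lborel) = pow_int 1 K f"
    unfolding pow_int_def by (intro nn_integral_cong) (auto simp: indicator_def)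
  then show "(\<integral>\<^sup>+x. ennreal (norm (indicator K x * f x)) \<partial>lborel) < \<infinity>" using assms by simp
qed auto

lemma pow_int_1_finite:
  fixes f :: "'a::euclidean_space \<Rightarrow> real"
  assumes [measurable]: "f \<in> borel_measurable borel" "K \<in> sets borel" and "integrable lborel (\<lambda>x. indicator K x * f x)"
  shows "pow_int 1 K f < \<infinity>"
proof -
  have "pow_int 1 K f = (\<integral>\<^sup>+x. ennreal (norm (indicator K x * f x)) \<partial>lborel)"
    unfolding pow_int_def by (intro nn_integral_cong) (auto simp: indicator_def)
  then show ?thesis using assms(3) by (simp add: integrable_iff_bounded)
qed

lemma indicator_mult_support:
  fixes f g :: "'a \<Rightarrow> real"
  assumes "\<And>x. x \<notin> K \<Longrightarrow> g x = 0"
  shows "(\<lambda>x. indicator K x * f x * g x) = (\<lambda>x. f x * g x)"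
proof
  show "indicator K x * f x * g x = f x * g x" for x
    using assms[of x] by (cases "x \<in> K") auto
qed

text \<open>Integrability of \<open>f k\<close> times \<zeta> is only available once the L^1
  distance on K is finite, which holds eventually; that suffices for the limit.\<close>

lemma integral_mult_test_tendsto:
  fixes f :: "nat \<Rightarrow> 'a::euclidean_space \<Rightarrow> real"
  assumes [measurable]: "\<And>k. f k \<in> borel_measurable borel" "g \<in> borel_measurable borel"
    and K: "compact K" and z: "continuous_on UNIV \<zeta>" "\<And>x. x \<notin> K \<Longrightarrow> \<zeta> x = 0"
    and g: "integrable lborel (\<lambda>x. indicator K x * g x)"
    and lim: "(\<lambda>k. pow_int 1 K (\<lambda>x. f k x - g x)) \<longlonglongrightarrow> 0"
  shows "(\<lambda>k. \<integral>x. f k x * \<zeta> x \<partial>lborel) \<longlonglongrightarrow> (\<integral>x. g x * \<zeta> x \<partial>lborel)"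
proof -
  have [measurable]: "K \<in> sets borel" "\<zeta> \<in> borel_measurable borel"
    using K z by (auto intro: borel_compact borel_measurable_continuous_onI)
  obtain B where B: "0 < B" "\<And>x. \<bar>\<zeta> x\<bar> \<le> B" using compact_support_bounded[OF z(1) K z(2)] by metis
  have ig: "integrable lborel (\<lambda>x. g x * \<zeta> x)"
  proof -
    have "integrable lborel (\<lambda>x. (indicator K x * g x) * \<zeta> x)" by (rule integrable_mult_bounded[OF g _ B(2)]) simp
    moreover have "(\<lambda>x. (indicator K x * g x) * \<zeta> x) = (\<lambda>x. g x * \<zeta> x)" by (rule indicator_mult_support) (rule z(2))
    ultimately show ?thesis by simp
  qed
  have lim0: "(\<lambda>k. ennreal B * pow_int 1 K (\<lambda>x. f k x - g x)) \<longlonglongrightarrow> 0"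
    using lim by (rule ennreal_tendsto_0_cmult) simp
  have ev: "\<forall>\<^sub>F k in sequentially. ennreal \<bar>(\<integral>x. f k x * \<zeta> x \<partial>lborel) - (\<integral>x. g x * \<zeta> x \<partial>lborel)\<bar> \<le> ennreal B * pow_int 1 K (\<lambda>x. f k x - g x)"
  proof -
    have "\<forall>\<^sub>F k in sequentially. pow_int 1 K (\<lambda>x. f k x - g x) < 1" using lim by (rule order_tendstoD) simp
    then show ?thesis
    proof eventually_elim
      case (elim k)
      have "integrable lborel (\<lambda>x. indicator K x * (f k x - g x))"
        using elim by (intro integrable_of_pow_int_1) (auto intro: order.strict_trans)
      then have "integrable lborel (\<lambda>x. (indicator K x * (f k x - g x)) * \<zeta> x)" by (rule integrable_mult_bounded[OF _ _ B(2)]) simp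
      moreover have "(\<lambda>x. (indicator K x * (f k x - g x)) * \<zeta> x) = (\<lambda>x. (f k x - g x) * \<zeta> x)" by (rule indicator_mult_support) (rule z(2))
      ultimately have i1: "integrable lborel (\<lambda>x. (f k x - g x) * \<zeta> x)" by simp
      have "integrable lborel (\<lambda>x. (f k x - g x) * \<zeta> x + g x * \<zeta> x)" by (intro Bochner_Integration.integrable_add i1 ig)
      then have "integrable lborel (\<lambda>x. f k x * \<zeta> x)" by (simp add: algebra_simps)
      then have "(\<integral>x. f k x * \<zeta> x \<partial>lborel) - (\<integral>x. g x * \<zeta> x \<partial>lborel) = (\<integral>x. (f k x - g x) * \<zeta> x \<partial>lborel)"
        using ig by (simp add: left_diff_distrib)
      then have "ennreal \<bar>(\<integral>x. f k x * \<zeta> x \<partial>lborel) - (\<integral>x. g x * \<zeta> x \<partial>lborel)\<bar> \<le> (\<integral>\<^sup>+x. norm ((f k x - g x) * \<zeta> x) \<partial>lborel)"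
        using integral_norm_bound_ennreal[OF i1] by simp
      also have "\<dots> \<le> (\<integral>\<^sup>+x. ennreal B * (ennreal (\<bar>f k x - g x\<bar> powr 1) * indicator K x) \<partial>lborel)"
      proof (rule nn_integral_mono)
        fix x
        show "ennreal (norm ((f k x - g x) * \<zeta> x)) \<le> ennreal B * (ennreal (\<bar>f k x - g x\<bar> powr 1) * indicator K x)"
          using B z(2)[of x] mult_left_mono[OF B(2)[of x], of "\<bar>f k x - g x\<bar>"]
          by (cases "x \<in> K") (auto simp: abs_mult mult.commute intro!: ennreal_leI simp flip: ennreal_mult')
      qed
      also have "\<dots> = ennreal B * pow_int 1 K (\<lambda>x. f k x - g x)"
        unfolding pow_int_def by (rule nn_integral_cmult) measurable
      finally show ?case .
    qed
  qed
  have "(\<lambda>k. ennreal \<bar>(\<integral>x. f k x * \<zeta> x \<partial>lborel) - (\<integral>x. g x * \<zeta> x \<partial>lborel)\<bar>) \<longlonglongrightarrow> 0"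
    by (rule tendsto_sandwich[OF _ ev tendsto_const lim0]) simp
  then have "(\<lambda>k. \<bar>(\<integral>x. f k x * \<zeta> x \<partial>lborel) - (\<integral>x. g x * \<zeta> x \<partial>lborel)\<bar>) \<longlonglongrightarrow> 0"
    by (subst (asm) ennreal_tendsto_0_iff) auto
  then show ?thesis by (simp add: tendsto_rabs_zero_iff LIM_zero_iff)
qed

section \<open>Averages as integrals against test functions; uniqueness of weak derivatives\<close>

context mollifier
begin

text \<open>The weight that appears in \<open>avg\<close> after substituting z = (1 - \<kappa>) x +
  \<kappa> y. For x in \<Omega>, however close to the boundary, it is a test function of z in
  \<Omega>, so weak identities may be tested against it.\<close>

definition kernel :: "real \<Rightarrow> 'a \<Rightarrow> 'a \<Rightarrow> real" where
  "kernel \<kappa> x z = (1 / \<kappa> ^ DIM('a)) * \<eta> ((1 / \<kappa>) *\<^sub>R z + (- (1 - \<kappa>) / \<kappa>) *\<^sub>R x)"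

lemma kernel_support:
  assumes "0 < \<kappa>" "kernel \<kappa> x z \<noteq> 0"
  obtains y where "y \<in> supp" "z = seg \<kappa> x y"
proof -
  let ?y = "(1 / \<kappa>) *\<^sub>R z + (- (1 - \<kappa>) / \<kappa>) *\<^sub>R x"
  have "?y \<in> supp" using assms \<eta>_supp[of ?y] by (auto simp: kernel_def)
  moreover have "z = (1 - \<kappa>) *\<^sub>R x + \<kappa> *\<^sub>R ?y"
  proof -
    have "\<kappa> *\<^sub>R ?y = z + (- (1 - \<kappa>)) *\<^sub>R x"
      using assms(1) by (simp only: scaleR_add_right scaleR_scaleR) simp
    then show ?thesis by (simp add: algebra_simps)
  qed
  ultimately show ?thesis using that by blast
qed

lemma kernel_test_function:
  assumes "0 < \<kappa>" "\<kappa> \<le> 1" "x \<in> \<Omega>"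
  shows "kernel \<kappa> x \<in> test_functions \<Omega>"
proof (rule test_functionsI)
  show "smooth (kernel \<kappa> x)"
    unfolding kernel_def by (intro smooth_mult smooth_const smooth_affine smooth_\<eta>)
  show "compact ((\<lambda>y. seg \<kappa> x y) ` supp)"
    by (intro compact_continuous_image compact_supp continuous_intros)
  show "(\<lambda>y. seg \<kappa> x y) ` supp \<subseteq> \<Omega>"
    using assms supp_\<Omega> by (auto intro!: convexD_alt[OF convex_\<Omega>])
  show "kernel \<kappa> x z = 0" if "z \<notin> (\<lambda>y. seg \<kappa> x y) ` supp" for z
    using kernel_support[OF assms(1)] that by (metis imageI)
qed

lemma avg_eq_kernel_integral:
  assumes "0 < \<kappa>"
  shows "avg \<kappa> w x = (\<integral>z. w z * kernel \<kappa> x z \<partial>lborel)"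
proof -
  let ?f = "\<lambda>z. \<eta> ((1 / \<kappa>) *\<^sub>R z + (- (1 - \<kappa>) / \<kappa>) *\<^sub>R x) * w z"
  have "avg \<kappa> w x = (\<integral>y. ?f (seg \<kappa> x y) \<partial>lborel)"
    unfolding avg_def using assms
  proof (intro Bochner_Integration.integral_cong refl)
    fix y
    have "(1 / \<kappa>) *\<^sub>R (seg \<kappa> x y) + (- (1 - \<kappa>) / \<kappa>) *\<^sub>R x = ((1 - \<kappa>) / \<kappa> + - (1 - \<kappa>) / \<kappa>) *\<^sub>R x + y"
      using assms by (simp only: scaleR_add_right scaleR_left_distrib scaleR_scaleR) simp
    also have "(1 - \<kappa>) / \<kappa> + - (1 - \<kappa>) / \<kappa> = 0" using assms by (simp add: field_simps)
    also have "0 *\<^sub>R x + y = y" by simp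
    finally show "\<eta> y * w (seg \<kappa> x y) = ?f (seg \<kappa> x y)" by simp
  qed
  also have "\<dots> = (1 / \<kappa> ^ DIM('a)) * (\<integral>z. ?f z \<partial>lborel)"
    using assms by (subst integral_lborel_affine) auto
  also have "\<dots> = (\<integral>z. w z * kernel \<kappa> x z \<partial>lborel)"
    by (simp add: kernel_def mult_ac)
  finally show ?thesis .
qed

text \<open>The shift by 2 keeps the step at most 1/2, as required by the Jacobian bound.\<close>

definition step :: "nat \<Rightarrow> real" where "step k = 1 / real (k + 2)"

lemma step: "0 < step k" "0 \<le> step k" "step k \<le> 1/2" "step k \<le> 1" "step \<longlonglongrightarrow> 0"
proof -
  have "(\<lambda>k. 1 / real (k + 2)) \<longlonglongrightarrow> 0" by (rule LIMSEQ_ignore_initial_segment[OF lim_1_over_n])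
  then show "step \<longlonglongrightarrow> 0" by (simp add: step_def[abs_def])
qed (auto simp: step_def field_simps)

lemma avg_measurable[measurable]:
  assumes [measurable]: "f \<in> borel_measurable borel"
  shows "avg \<kappa> f \<in> borel_measurable borel"
  unfolding avg_def by measurable

text \<open>For \<open>x\<close> in \<open>K\<close> the average only sees \<open>f\<close> on the convex hull of \<open>K\<close> and the support
  of the mollifier, a compact subset of \<open>\<Omega>\<close>.\<close>

lemma avg_tendsto_L1_loc:
  assumes [measurable]: "f \<in> borel_measurable borel" and f: "f \<in> L1_loc \<Omega>" and K: "compact K" "K \<subseteq> \<Omega>"
  shows "(\<lambda>k. pow_int 1 K (\<lambda>x. avg (step k) f x - f x)) \<longlonglongrightarrow> 0"
proof -
  define K0 where "K0 = convex hull (K \<union> supp)"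
  have K0: "compact K0" "K0 \<subseteq> \<Omega>" "convex K0" "K \<subseteq> K0" "supp \<subseteq> K0"
  proof -
    show "compact K0" unfolding K0_def by (intro compact_convex_hull compact_Un K compact_supp)
    show "K0 \<subseteq> \<Omega>" unfolding K0_def using K supp_\<Omega> by (intro hull_minimal convex_\<Omega>) auto
    show "convex K0" unfolding K0_def by (rule convex_convex_hull)
    show "K \<subseteq> K0" "supp \<subseteq> K0" unfolding K0_def using hull_subset[of "K \<union> supp" convex] by auto
  qed
  have [measurable]: "K0 \<in> sets borel" using K0 by (intro borel_compact)
  obtain R where R: "0 < R" "K0 \<subseteq> ball 0 R"
    using bounded_subset_ballD[OF compact_imp_bounded[OF K0(1)], of 0] by blast
  define g where "g x = indicator K0 x * f x" for x
  have [measurable]: "g \<in> borel_measurable borel" unfolding g_def by measurable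
  have "integrable lborel g"
    using f K0 unfolding g_def by (subst (asm) L1_loc_iff_integrable) auto
  then have "integrable lborel (\<lambda>x. indicator (cball 0 R) x * g x)"
    using R by (subst mult.commute) (intro integrable_mult_bounded[where B=1], auto simp: indicator_def)
  then have fin: "pow_int 1 (cball 0 R) g < \<infinity>" by (intro pow_int_1_finite) auto
  have "(\<lambda>k. pow_int 1 (cball 0 R) (\<lambda>x. avg (step k) g x - g x)) \<longlonglongrightarrow> 0"
    using R K0 step by (intro avg_tendsto fin) auto
  moreover have "pow_int 1 K (\<lambda>x. avg (step k) f x - f x) \<le> pow_int 1 (cball 0 R) (\<lambda>x. avg (step k) g x - g x)" for k
  proof -
    have "avg (step k) f x - f x = avg (step k) g x - g x" if x: "x \<in> K" for x
    proof -
      have "avg (step k) f x = avg (step k) g x"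
        unfolding avg_def
      proof (intro Bochner_Integration.integral_cong refl)
        fix y
        have "seg (step k) x y \<in> K0" if "y \<in> supp"
          using K0 x that step(1-4)[of k] by (intro convexD_alt) auto
        then show "\<eta> y * f (seg (step k) x y) = \<eta> y * g (seg (step k) x y)"
          using \<eta>_supp[of y] by (cases "y \<in> supp") (auto simp: g_def)
      qed
      then show ?thesis using x K0 by (auto simp: g_def)
    qed
    then have "pow_int 1 K (\<lambda>x. avg (step k) f x - f x) = pow_int 1 K (\<lambda>x. avg (step k) g x - g x)" by (rule pow_int_cong)
    also have "\<dots> \<le> pow_int 1 (cball 0 R) (\<lambda>x. avg (step k) g x - g x)"
      using K0 R by (intro pow_int_mono_set) auto
    finally show ?thesis .
  qed
  ultimately show ?thesis by (rule ennreal_tendsto_0_le)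
qed

lemma AE_of_compact_subsets:
  assumes "\<And>K. compact K \<Longrightarrow> K \<subseteq> \<Omega> \<Longrightarrow> AE x in lborel. x \<in> K \<longrightarrow> P x"
  shows "AE x in lborel. x \<in> \<Omega> \<longrightarrow> P x"
proof -
  obtain C where C: "\<And>n. compact (C n)" "\<And>n. C n \<subseteq> \<Omega>" "\<And>n. C n \<subseteq> interior (C (Suc n))" "\<Union>(range C) = \<Omega>"
    using open_Union_compact_subsets[OF open_\<Omega>] by metis
  have "AE x in lborel. \<forall>n::nat. x \<in> C n \<longrightarrow> P x"
    using assms C by (subst AE_all_countable) auto
  then show ?thesis by eventually_elim (use C(4) in auto)
qed

lemma pow_int_0_imp_AE:
  assumes [measurable]: "f \<in> borel_measurable borel" "K \<in> sets borel" and "pow_int p K f = 0"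
  shows "AE x in lborel. x \<in> K \<longrightarrow> f x = 0"
proof -
  have "AE x in lborel. ennreal (\<bar>f x\<bar> powr p) * indicator K x = 0"
    using assms(3) unfolding pow_int_def by (subst (asm) nn_integral_0_iff_AE) auto
  then show ?thesis by eventually_elim (auto simp: indicator_def)
qed

text \<open>Kernels are test functions, so every average of f vanishes on \<Omega>; on the other
  hand the averages converge to f in L^1 of each compact subset.\<close>

lemma fundamental_lemma:
  assumes [measurable]: "f \<in> borel_measurable borel" and f: "f \<in> L1_loc \<Omega>"
    and z: "\<And>\<phi>. \<phi> \<in> test_functions \<Omega> \<Longrightarrow> (\<integral>x. f x * \<phi> x \<partial>lborel) = 0"
  shows "AE x in lborel. x \<in> \<Omega> \<longrightarrow> f x = 0"
proof (rule AE_of_compact_subsets)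
  fix K assume K: "compact K" "K \<subseteq> \<Omega>"
  have [measurable]: "K \<in> sets borel" using K by (intro borel_compact)
  have "avg (step k) f x = 0" if "x \<in> K" for k x
    using that K step(1-4)[of k] by (subst avg_eq_kernel_integral) (auto intro!: z kernel_test_function)
  then have "pow_int 1 K (\<lambda>x. avg (step k) f x - f x) = pow_int 1 K f" for k
    unfolding pow_int_def by (intro nn_integral_cong) (auto simp: indicator_def)
  then have "(\<lambda>k::nat. pow_int 1 K f) \<longlonglongrightarrow> 0" using avg_tendsto_L1_loc[OF assms(1) f K] by simp
  then have "pow_int 1 K f = 0" using LIMSEQ_unique tendsto_const by blast
  then show "AE x in lborel. x \<in> K \<longrightarrow> f x = 0" by (intro pow_int_0_imp_AE) auto
qed

text \<open>Resolves the choice in \<open>weak_deriv\<close>: once some weak derivative v is known,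
  the chosen one exists and agrees with v almost everywhere in \<Omega>.\<close>

lemma weak_deriv_AE_eq:
  assumes "has_weak_deriv \<Omega> es u v"
  shows "has_weak_deriv \<Omega> es u (weak_deriv \<Omega> es u)" "AE x in lborel. x \<in> \<Omega> \<longrightarrow> weak_deriv \<Omega> es u x = v x"
proof -
  show w: "has_weak_deriv \<Omega> es u (weak_deriv \<Omega> es u)"
    unfolding weak_deriv_def using assms by (rule someI[where P="has_weak_deriv \<Omega> es u"])
  let ?w = "weak_deriv \<Omega> es u"
  have L: "?w \<in> L1_loc \<Omega>" "v \<in> L1_loc \<Omega>" using w assms by (auto simp: has_weak_deriv_def)
  obtain w' where w': "w' \<in> borel_measurable borel" "AE x in lborel. x \<in> \<Omega> \<longrightarrow> ?w x = w' x" "w' \<in> L1_loc \<Omega>"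
    using L1_loc_borel_representative[OF open_\<Omega> L(1)] by blast
  obtain v' where v': "v' \<in> borel_measurable borel" "AE x in lborel. x \<in> \<Omega> \<longrightarrow> v x = v' x" "v' \<in> L1_loc \<Omega>"
    using L1_loc_borel_representative[OF open_\<Omega> L(2)] by blast
  note [measurable] = w'(1) v'(1)
  have "AE x in lborel. x \<in> \<Omega> \<longrightarrow> w' x - v' x = 0"
  proof (rule fundamental_lemma)
    have i: "integrable lborel (\<lambda>x. indicator K x * w' x)" "integrable lborel (\<lambda>x. indicator K x * v' x)"
      if "compact K" "K \<subseteq> \<Omega>" for K
      using w'(3) v'(3) that by (auto simp: L1_loc_iff_integrable)
    show "(\<lambda>x. w' x - v' x) \<in> L1_loc \<Omega>"
      using i by (subst L1_loc_iff_integrable) (auto simp: right_diff_distrib)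
    fix \<phi> assume \<phi>: "\<phi> \<in> test_functions \<Omega>"
    obtain K where K: "compact K" "K \<subseteq> \<Omega>" "\<And>x. x \<notin> K \<Longrightarrow> \<phi> x = 0" "smooth \<phi>"
      using test_functionsD[OF \<phi>] by metis
    obtain B where B: "0 < B" "\<And>x. \<bar>\<phi> x\<bar> \<le> B" using compact_support_bounded[OF smooth_continuous[OF K(4)] K(1,3)] by metis
    note [measurable] = smooth_borel_measurable[OF K(4)]
    have *: "integrable lborel (\<lambda>x. f x * \<phi> x)" if "integrable lborel (\<lambda>x. indicator K x * f x)" for f
    proof -
      have "integrable lborel (\<lambda>x. (indicator K x * f x) * \<phi> x)" by (rule integrable_mult_bounded[OF that _ B(2)]) simp
      moreover have "(\<lambda>x. (indicator K x * f x) * \<phi> x) = (\<lambda>x. f x * \<phi> x)" by (rule indicator_mult_support) (rule K(3))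
      ultimately show ?thesis by simp
    qed
    have "(- 1) ^ length es * (LINT x:\<Omega>|lebesgue. ?w x * \<phi> x) = (- 1) ^ length es * (LINT x:\<Omega>|lebesgue. v x * \<phi> x)"
      using w assms \<phi> unfolding has_weak_deriv_def by auto
    then have "(LINT x:\<Omega>|lebesgue. ?w x * \<phi> x) = (LINT x:\<Omega>|lebesgue. v x * \<phi> x)" by simp
    then have "(\<integral>x. w' x * \<phi> x \<partial>lborel) = (\<integral>x. v' x * \<phi> x \<partial>lborel)"
      using set_integral_eq_borel_representative[OF open_\<Omega> L(1) w'(1) _ w'(2), of \<phi>]
        set_integral_eq_borel_representative[OF open_\<Omega> L(2) v'(1) _ v'(2), of \<phi>] test_function_zero[OF \<phi>]
      by simp
    then show "(\<integral>x. (w' x - v' x) * \<phi> x \<partial>lborel) = 0"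
      using *[OF i(1)] *[OF i(2)] K by (simp add: left_diff_distrib)
  qed simp
  then show "AE x in lborel. x \<in> \<Omega> \<longrightarrow> ?w x = v x"
    using w'(2) v'(2) by eventually_elim auto
qed

end

section \<open>Smooth approximation with convergence up to the boundary\<close>

lemma pow_int_continuous_finite:
  fixes f :: "'a::euclidean_space \<Rightarrow> real"
  assumes f: "continuous_on UNIV f" and K: "bounded K" "K \<in> sets borel" and p: "0 \<le> p"
  shows "pow_int p K f < \<infinity>"
proof -
  obtain R where R: "K \<subseteq> cball 0 R" using bounded_subset_ballD[OF K(1), of 0] ball_subset_cball by blast
  have "bounded (f ` cball 0 R)"
    by (intro compact_imp_bounded compact_continuous_image continuous_on_subset[OF f]) auto
  then obtain B where B: "0 < B" "\<And>x. x \<in> cball 0 R \<Longrightarrow> \<bar>f x\<bar> \<le> B" by (auto simp: bounded_pos)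
  have "pow_int p K f \<le> pow_int p K (\<lambda>x. B)"
    using R B p by (intro pow_int_mono) force+
  also have "\<dots> \<le> pow_int p (cball (0::'a) R) (\<lambda>x. B)" by (rule pow_int_mono_set[OF R])
  also have "\<dots> < \<infinity>"
    using emeasure_lborel_cball_finite[of "0::'a" R] by (simp add: pow_int_const ennreal_mult_less_top)
  finally show ?thesis .
qed

context mollifier
begin

text \<open>The integration-by-parts half of \<open>has_weak_deriv\<close>, for Borel
  representatives and \<open>lborel\<close>; membership in \<open>L1_loc\<close> is established
  separately.\<close>

definition weak_identity :: "'a list \<Rightarrow> ('a \<Rightarrow> real) \<Rightarrow> ('a \<Rightarrow> real) \<Rightarrow> bool" where
  "weak_identity es u w \<longleftrightarrow> (\<forall>\<phi>\<in>test_functions \<Omega>.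
     (\<integral>x. u x * partial_derivs es \<phi> x \<partial>lborel) = (- 1) ^ length es * (\<integral>x. w x * \<phi> x \<partial>lborel))"

text \<open>The closure contains every point at which \<open>avg (step k) u x\<close> looks at u for
  x in \<Omega> within distance k of the origin, including x on the boundary.\<close>

definition approx_set :: "nat \<Rightarrow> 'a set" where
  "approx_set k = (\<lambda>(x, y). seg (step k) x y) ` (closure (\<Omega> \<inter> ball 0 (real k)) \<times> supp)"

text \<open>A rescaled and reflected \<eta>: \<open>conv\<close> evaluates its kernel at the
  difference of the outer point and z, which reverses the sign of z.\<close>

definition approx_kernel :: "nat \<Rightarrow> 'a \<Rightarrow> real" where
  "approx_kernel k y = (1 / step k ^ DIM('a)) * \<eta> ((- (1 / step k)) *\<^sub>R y + 0)"

text \<open>On \<open>\<Omega> \<inter> ball 0 k\<close> this is the average \<open>avg (step k) u\<close>; cutting \<open>u\<close> off outside a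
  compact subset of \<open>\<Omega>\<close> makes it a smooth function on the whole space.\<close>

definition approx :: "('a \<Rightarrow> real) \<Rightarrow> nat \<Rightarrow> 'a \<Rightarrow> real" where
  "approx u k x = 1 * conv (\<lambda>z. indicator (approx_set k) z * u z) (approx_kernel k) ((1 - step k) *\<^sub>R x + 0)"

text \<open>A point strictly between a point of the closure and an interior point of a convex set is
  interior. This is where convexity yields smoothness up to the boundary.\<close>

lemma approx_set: "compact (approx_set k)" "approx_set k \<subseteq> \<Omega>"
proof -
  show "compact (approx_set k)"
    unfolding approx_set_def
  proof (rule compact_continuous_image)
    show "compact (closure (\<Omega> \<inter> ball 0 (real k)) \<times> supp)"
      by (intro compact_Times compact_supp) (simp add: compact_closure bounded_Int)
  qed (auto intro!: continuous_intros simp: case_prod_unfold)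
  show "approx_set k \<subseteq> \<Omega>"
  proof
    fix z assume "z \<in> approx_set k"
    then obtain x y where xy: "x \<in> closure (\<Omega> \<inter> ball 0 (real k))" "y \<in> supp" "z = seg (step k) x y"
      by (auto simp: approx_set_def)
    have "x \<in> closure \<Omega>" using xy(1) closure_mono[of "\<Omega> \<inter> ball 0 (real k)" \<Omega>] by auto
    moreover have "y \<in> interior \<Omega>" using xy(2) supp_\<Omega> open_\<Omega> by (auto simp: interior_open)
    ultimately have "x - step k *\<^sub>R (x - y) \<in> interior \<Omega>"
      using step(1,4)[of k] by (intro mem_interior_closure_convex_shrink convex_\<Omega>)
    moreover have "x - step k *\<^sub>R (x - y) = z" using xy(3) by (simp add: algebra_simps)
    ultimately show "z \<in> \<Omega>" using interior_subset by blast
  qed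
qed

lemma approx_kernel: "smooth (approx_kernel k)" "compact ((\<lambda>y. (- step k) *\<^sub>R y) ` supp)"
  "y \<notin> (\<lambda>y. (- step k) *\<^sub>R y) ` supp \<Longrightarrow> approx_kernel k y = 0"
proof -
  show "smooth (approx_kernel k)"
    unfolding approx_kernel_def[abs_def] by (intro smooth_mult smooth_const smooth_affine smooth_\<eta>)
  show "compact ((\<lambda>y. (- step k) *\<^sub>R y) ` supp)"
    by (intro compact_continuous_image compact_supp continuous_intros)
  assume *: "y \<notin> (\<lambda>y. (- step k) *\<^sub>R y) ` supp"
  have "y = (- step k) *\<^sub>R ((- (1 / step k)) *\<^sub>R y)" using step(1)[of k] by simp
  then have "(- (1 / step k)) *\<^sub>R y \<notin> supp" using * by (metis imageI)
  then show "approx_kernel k y = 0" by (simp add: approx_kernel_def \<eta>_supp)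
qed

lemma integrable_approx:
  assumes [measurable]: "u \<in> borel_measurable borel" and "u \<in> L1_loc \<Omega>"
  shows "integrable lborel (\<lambda>z. indicator (approx_set k) z * u z)"
  using assms(2) approx_set by (auto simp: L1_loc_iff_integrable)

lemma smooth_approx:
  assumes "u \<in> borel_measurable borel" "u \<in> L1_loc \<Omega>"
  shows "smooth (approx u k)"
  unfolding approx_def[abs_def]
  by (intro smooth_mult smooth_const smooth_affine
      smooth_conv[OF approx_kernel(2) integrable_approx[OF assms] approx_kernel(1,3)])

text \<open>Each derivative in x brings a factor \<open>1 - step k\<close>. Writing the derivatives
  of \<open>approx_kernel\<close> as z-derivatives of \<open>kernel\<close> produces a sign, which
  cancels the sign of the weak identity. Only the identity for the whole list \<open>es\<close> is
  used, so second derivatives can be treated without knowing the first ones.\<close>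

lemma partial_derivs_approx:
  assumes u: "u \<in> borel_measurable borel" "u \<in> L1_loc \<Omega>" and es: "set es \<subseteq> Basis"
    and w: "weak_identity es u w" and x: "x \<in> \<Omega> \<inter> ball 0 (real k)"
  shows "partial_derivs es (approx u k) x = (1 - step k) ^ length es * avg (step k) w x"
proof -
  let ?f = "\<lambda>z. indicator (approx_set k) z * u z"
  let ?X = "(1 - step k) *\<^sub>R x"
  note C = approx_kernel(2) integrable_approx[OF u] approx_kernel(1,3)
  have kern: "kernel (step k) x = (\<lambda>z. 1 * approx_kernel k ((- 1) *\<^sub>R z + ?X))"
  proof
    fix z
    have "(- (1 / step k)) *\<^sub>R ((- 1) *\<^sub>R z + ?X) = (1 / step k) *\<^sub>R z + (- (1 - step k) / step k) *\<^sub>R x"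
    proof -
      have "(- (1 / step k)) *\<^sub>R ((- 1) *\<^sub>R z + ?X) = (- (1 / step k) * - 1) *\<^sub>R z + (- (1 / step k) * (1 - step k)) *\<^sub>R x"
        by (simp only: scaleR_add_right scaleR_scaleR)
      also have "- (1 / step k) * (1 - step k) = - (1 - step k) / step k"
          using step(1)[of k] by (simp add: field_simps)
      finally show ?thesis by simp
    qed
    then show "kernel (step k) x z = 1 * approx_kernel k ((- 1) *\<^sub>R z + ?X)"
      by (simp add: kernel_def approx_kernel_def)
  qed
  have test: "kernel (step k) x \<in> test_functions \<Omega>"
    using x step(1,4)[of k] by (intro kernel_test_function) auto
  have dk: "partial_derivs es (kernel (step k) x) = (\<lambda>z. 1 * (- 1) ^ length es * partial_derivs es (approx_kernel k) ((- 1) *\<^sub>R z + ?X))"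
    unfolding kern by (rule partial_derivs_affine[OF approx_kernel(1) es])
  have z: "partial_derivs es (kernel (step k) x) z = 0" if "z \<notin> approx_set k" for z
  proof (rule partial_derivs_support[OF _ _ that])
    show "closed (approx_set k)" using approx_set by (intro compact_imp_closed)
    fix z assume z: "z \<notin> approx_set k"
    show "kernel (step k) x z = 0"
    proof (rule ccontr)
      assume "kernel (step k) x z \<noteq> 0"
      then obtain y where "y \<in> supp" "z = seg (step k) x y"
        by (rule kernel_support[OF step(1)])
      moreover have "x \<in> closure (\<Omega> \<inter> ball 0 (real k))" by (rule subsetD[OF closure_subset x])
      ultimately have "z \<in> approx_set k"
        unfolding approx_set_def by (intro image_eqI[where x="(x, y)"]) simp_all
      then show False using z by simp
    qed
  qed
  have "partial_derivs es (approx u k) x = 1 * (1 - step k) ^ length es * partial_derivs es (conv ?f (approx_kernel k)) (?X + 0)"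
    unfolding approx_def[abs_def] by (subst partial_derivs_affine[OF smooth_conv[OF C] es]) simp_all
  also have "partial_derivs es (conv ?f (approx_kernel k)) (?X + 0) = conv ?f (partial_derivs es (approx_kernel k)) ?X"
    by (subst partial_derivs_conv[OF C es]) simp_all
  also have "\<dots> = (\<integral>z. (- 1) ^ length es * (indicator (approx_set k) z * u z * partial_derivs es (kernel (step k) x) z) \<partial>lborel)"
    unfolding conv_def dk by (intro Bochner_Integration.integral_cong refl) (simp add: power_mult_distrib[symmetric])
  also have "\<dots> = (\<integral>z. (- 1) ^ length es * (u z * partial_derivs es (kernel (step k) x) z) \<partial>lborel)"
  proof (intro Bochner_Integration.integral_cong refl arg_cong[of _ _ "(*) ((- 1) ^ length es)"])
    show "indicator (approx_set k) y * u y * partial_derivs es (kernel (step k) x) y = u y * partial_derivs es (kernel (step k) x) y" for y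
      using z[of y] by (cases "y \<in> approx_set k") auto
  qed
  also have "\<dots> = (- 1) ^ length es * (\<integral>z. u z * partial_derivs es (kernel (step k) x) z \<partial>lborel)" by simp
  also have "\<dots> = (- 1) ^ length es * ((- 1) ^ length es * (\<integral>z. w z * kernel (step k) x z \<partial>lborel))"
    using w test by (simp add: weak_identity_def)
  also have "\<dots> = avg (step k) w x"
    by (simp add: avg_eq_kernel_integral[OF step(1)] mult.assoc[symmetric] power_mult_distrib[symmetric])
  finally show ?thesis by simp
qed

lemma Lp_limit_L1_loc:
  assumes F: "\<And>k. smooth (F k)" and [measurable]: "g \<in> borel_measurable borel" and p: "1 \<le> p"
    and lim: "\<And>R. (\<lambda>k. pow_int p (\<Omega> \<inter> ball 0 R) (\<lambda>x. F k x - g x)) \<longlonglongrightarrow> 0"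
  shows "g \<in> L1_loc \<Omega>"
    and "\<phi> \<in> test_functions \<Omega> \<Longrightarrow> (\<lambda>k. \<integral>x. F k x * \<phi> x \<partial>lborel) \<longlonglongrightarrow> (\<integral>x. g x * \<phi> x \<partial>lborel)"
    and "compact K \<Longrightarrow> K \<subseteq> \<Omega> \<Longrightarrow> (\<lambda>k. pow_int 1 K (\<lambda>x. F k x - g x)) \<longlonglongrightarrow> 0"
proof -
  have [measurable]: "F k \<in> borel_measurable borel" for k using F by (rule smooth_borel_measurable)
  show L1: "(\<lambda>k. pow_int 1 K (\<lambda>x. F k x - g x)) \<longlonglongrightarrow> 0" if K: "compact K" "K \<subseteq> \<Omega>" for K
  proof (rule pow_int_1_tendsto_0[OF _ _ p])
    show "K \<in> sets borel" using K by (intro borel_compact)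
    show "emeasure lborel K < top" using K emeasure_compact_finite by auto
    obtain R where "K \<subseteq> ball 0 R" using bounded_subset_ballD[OF compact_imp_bounded[OF K(1)], of 0] by blast
    then show "(\<lambda>k. pow_int p K (\<lambda>x. F k x - g x)) \<longlonglongrightarrow> 0"
      using K by (intro ennreal_tendsto_0_le[OF lim[of R] pow_int_mono_set]) auto
  qed measurable
  have int: "integrable lborel (\<lambda>x. indicator K x * g x)" if K: "compact K" "K \<subseteq> \<Omega>" for K
  proof (rule integrable_of_pow_int_1)
    show [measurable]: "K \<in> sets borel" using K by (intro borel_compact)
    have "\<forall>\<^sub>F k in sequentially. pow_int 1 K (\<lambda>x. F k x - g x) < 1"
      using L1[OF K] by (rule order_tendstoD) simp
    then obtain k where k: "pow_int 1 K (\<lambda>x. F k x - g x) < 1"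
      using eventually_happens'[OF sequentially_bot] by blast
    have "pow_int 1 K g \<le> ennreal (2 powr 1) * (pow_int 1 K (\<lambda>x. g x - F k x) + pow_int 1 K (F k))"
      using pow_int_add_le[of "\<lambda>x. g x - F k x" "F k" K 1] by simp
    also have "\<dots> < \<infinity>"
    proof -
      have "pow_int 1 K (\<lambda>x. g x - F k x) < \<infinity>"
        using k by (subst pow_int_minus_commute) (auto intro: order.strict_trans)
      moreover have "pow_int 1 K (F k) < \<infinity>"
        using K F by (intro pow_int_continuous_finite smooth_continuous compact_imp_bounded) auto
      ultimately show ?thesis by (simp add: ennreal_mult_less_top)
    qed
    finally show "pow_int 1 K g < \<infinity>" .
  qed simp
  show "g \<in> L1_loc \<Omega>" using int by (subst L1_loc_iff_integrable) auto
  assume "\<phi> \<in> test_functions \<Omega>"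
  then obtain K where K: "compact K" "K \<subseteq> \<Omega>" "\<And>x. x \<notin> K \<Longrightarrow> \<phi> x = 0" "smooth \<phi>"
    using test_functionsD by metis
  show "(\<lambda>k. \<integral>x. F k x * \<phi> x \<partial>lborel) \<longlonglongrightarrow> (\<integral>x. g x * \<phi> x \<partial>lborel)"
    by (rule integral_mult_test_tendsto[OF _ _ K(1) smooth_continuous[OF K(4)] K(3) int[OF K(1,2)] L1[OF K(1,2)]]) measurable
qed

text \<open>Integration by parts for the smooth \<open>F k\<close>, passed to the limit on both
  sides. This is how the first weak derivatives of u come into existence.\<close>

lemma weak_identity_of_limits:
  assumes F: "\<And>k. smooth (F k)" and i: "i \<in> Basis" and p: "1 \<le> p"
    and g: "g \<in> borel_measurable borel" "\<And>R. (\<lambda>k. pow_int p (\<Omega> \<inter> ball 0 R) (\<lambda>x. F k x - g x)) \<longlonglongrightarrow> 0"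
    and h: "h \<in> borel_measurable borel" "\<And>R. (\<lambda>k. pow_int p (\<Omega> \<inter> ball 0 R) (\<lambda>x. partial_deriv i (F k) x - h x)) \<longlonglongrightarrow> 0"
  shows "weak_identity [i] g h"
  unfolding weak_identity_def
proof
  fix \<phi> assume \<phi>: "\<phi> \<in> test_functions \<Omega>"
  have 1: "(\<lambda>k. \<integral>x. F k x * partial_deriv i \<phi> x \<partial>lborel) \<longlonglongrightarrow> (\<integral>x. g x * partial_deriv i \<phi> x \<partial>lborel)"
    by (rule Lp_limit_L1_loc(2)[OF F g(1) p g(2) test_functions_partial_deriv[OF \<phi> i]])
  have 2: "(\<lambda>k. - (\<integral>x. partial_deriv i (F k) x * \<phi> x \<partial>lborel)) \<longlonglongrightarrow> - (\<integral>x. h x * \<phi> x \<partial>lborel)"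
    by (intro tendsto_minus Lp_limit_L1_loc(2)[OF smooth_partial_deriv[OF F i] h(1) p h(2) \<phi>])
  have "(\<integral>x. g x * partial_deriv i \<phi> x \<partial>lborel) = - (\<integral>x. h x * \<phi> x \<partial>lborel)"
    using LIMSEQ_unique[OF 1] 2 by (simp add: integral_by_parts_test[OF F \<phi> i])
  then show "(\<integral>x. g x * partial_derivs [i] \<phi> x \<partial>lborel) = (- 1) ^ length [i] * (\<integral>x. h x * \<phi> x \<partial>lborel)" by simp
qed

section \<open>Convergence of the approximants, from the second derivatives down\<close>

context
  fixes u :: "'a \<Rightarrow> real" and W :: "'a \<Rightarrow> 'a \<Rightarrow> 'a \<Rightarrow> real" and p :: real
  assumes u[measurable]: "u \<in> borel_measurable borel" and u_L1: "u \<in> L1_loc \<Omega>"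
    and p: "1 \<le> p"
    and W_meas[measurable]: "\<And>i j. i \<in> Basis \<Longrightarrow> j \<in> Basis \<Longrightarrow> W j i \<in> borel_measurable borel"
    and W_zero: "\<And>i j x. x \<notin> \<Omega> \<Longrightarrow> W j i x = 0"
    and W_fin: "\<And>i j. i \<in> Basis \<Longrightarrow> j \<in> Basis \<Longrightarrow> pow_int p \<Omega> (W j i) < \<infinity>"
    and W_weak: "\<And>i j. i \<in> Basis \<Longrightarrow> j \<in> Basis \<Longrightarrow> weak_identity [j, i] u (W j i)"
begin

lemma open_ball_measurable[measurable]: "\<Omega> \<inter> ball 0 R \<in> sets borel"
  using open_\<Omega> by (intro borel_open) auto

lemma approx_deriv2_tendsto:
  assumes ij: "i \<in> Basis" "j \<in> Basis"
  shows "(\<lambda>k. pow_int p (\<Omega> \<inter> ball 0 R) (\<lambda>x. partial_deriv j (partial_deriv i (approx u k)) x - W j i x)) \<longlonglongrightarrow> 0"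
proof -
  let ?S = "\<Omega> \<inter> ball 0 R"
  let ?w = "W j i"
  note [measurable] = W_meas[OF ij]
  obtain R0 where R0: "0 < R0" "supp \<subseteq> ball 0 R0" using supp_bounded .
  \<comment> \<open>The ball must contain the support of \<eta> for the averages to stay inside
    it.\<close>
  define R' where "R' = max R R0"
  have R': "0 < R'" "supp \<subseteq> ball 0 R'" "?S \<subseteq> cball 0 R'" using R0 by (auto simp: R'_def)
  have "pow_int p (cball 0 R') ?w \<le> pow_int p \<Omega> ?w"
    unfolding pow_int_def using W_zero p by (intro nn_integral_mono) (auto simp: indicator_def)
  then have fin: "pow_int p (cball 0 R') ?w < \<infinity>" using W_fin[OF ij] by (rule order_le_less_trans)
  have "(\<lambda>k. pow_int p (cball 0 R') (\<lambda>x. avg (step k) ?w x - ?w x)) \<longlonglongrightarrow> 0"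
    using R' step fin by (intro avg_tendsto p) auto
  then have 0: "(\<lambda>k. pow_int p ?S (\<lambda>x. avg (step k) ?w x - ?w x)) \<longlonglongrightarrow> 0"
    by (rule ennreal_tendsto_0_le) (rule pow_int_mono_set[OF R'(3)])
  have 1: "(\<lambda>k. pow_int p ?S (\<lambda>x. (1 - step k)\<^sup>2 * avg (step k) ?w x - (1 - step k)\<^sup>2 * ?w x)) \<longlonglongrightarrow> 0"
  proof (rule ennreal_tendsto_0_le[OF 0])
    fix k
    have le: "(1 - step k)\<^sup>2 \<le> 1" using step(2,4)[of k] by (simp add: power_le_one)
    show "pow_int p ?S (\<lambda>x. (1 - step k)\<^sup>2 * avg (step k) ?w x - (1 - step k)\<^sup>2 * ?w x) \<le> pow_int p ?S (\<lambda>x. avg (step k) ?w x - ?w x)"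
    proof (rule pow_int_mono)
      fix x
      have "(1 - step k)\<^sup>2 * avg (step k) ?w x - (1 - step k)\<^sup>2 * ?w x = (1 - step k)\<^sup>2 * (avg (step k) ?w x - ?w x)"
        by (simp add: right_diff_distrib)
      then show "\<bar>(1 - step k)\<^sup>2 * avg (step k) ?w x - (1 - step k)\<^sup>2 * ?w x\<bar> \<le> \<bar>avg (step k) ?w x - ?w x\<bar>"
        using le by (simp add: abs_mult mult_left_le_one_le)
    qed (use p in auto)
  qed
  have 2: "(\<lambda>k. pow_int p ?S (\<lambda>x. (1 - step k)\<^sup>2 * ?w x - ?w x)) \<longlonglongrightarrow> 0"
  proof -
    have "(\<lambda>k. \<bar>(1 - step k)\<^sup>2 - 1\<bar> powr p) \<longlonglongrightarrow> \<bar>(1 - 0)\<^sup>2 - 1\<bar> powr p"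
      using p by (intro tendsto_powr2 tendsto_intros step) auto
    then have "(\<lambda>k. ennreal (\<bar>(1 - step k)\<^sup>2 - 1\<bar> powr p)) \<longlonglongrightarrow> 0"
      by (subst ennreal_tendsto_0_iff) auto
    moreover have "pow_int p ?S ?w < \<infinity>"
      by (rule order_le_less_trans[OF pow_int_mono_set fin]) (use R' in auto)
    ultimately have "(\<lambda>k. pow_int p ?S ?w * ennreal (\<bar>(1 - step k)\<^sup>2 - 1\<bar> powr p)) \<longlonglongrightarrow> 0"
      by (intro ennreal_tendsto_0_cmult) auto
    moreover have "pow_int p ?S (\<lambda>x. (1 - step k)\<^sup>2 * ?w x - ?w x) = ennreal (\<bar>(1 - step k)\<^sup>2 - 1\<bar> powr p) * pow_int p ?S ?w" for k
      by (subst pow_int_cmult[symmetric]) (auto simp: left_diff_distrib)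
    ultimately show ?thesis by (simp add: mult.commute)
  qed
  have 3: "(\<lambda>k. pow_int p ?S (\<lambda>x. (1 - step k)\<^sup>2 * avg (step k) ?w x - ?w x)) \<longlonglongrightarrow> 0"
    by (rule pow_int_tendsto_0_trans[OF _ _ _ _ _ 1 2]) (use p in auto)
  \<comment> \<open>\<open>approx u k\<close> agrees with the average only on the part of \<Omega>
    in the ball of radius k, which contains the present set once k is at least R.\<close>
  obtain k0 :: nat where k0: "R \<le> real k0" using real_arch_simple by blast
  have "\<forall>\<^sub>F k in sequentially. pow_int p ?S (\<lambda>x. (1 - step k)\<^sup>2 * avg (step k) ?w x - ?w x)
      = pow_int p ?S (\<lambda>x. partial_deriv j (partial_deriv i (approx u k)) x - ?w x)"
    using eventually_ge_at_top[of k0]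
  proof eventually_elim
    case (elim k)
    show ?case
    proof (rule pow_int_cong)
      fix x assume "x \<in> ?S"
      then have "x \<in> \<Omega> \<inter> ball 0 (real k)" using k0 elim by auto
      from partial_derivs_approx[OF u u_L1 _ W_weak[OF ij] this]
      show "(1 - step k)\<^sup>2 * avg (step k) ?w x - ?w x = partial_deriv j (partial_deriv i (approx u k)) x - ?w x"
        using ij by (simp add: power2_eq_square)
    qed
  qed
  then show ?thesis by (rule Lim_transform_eventually[OF 3])
qed

lemma approx_tendsto_L1_loc:
  assumes K: "compact K" "K \<subseteq> \<Omega>"
  shows "(\<lambda>k. pow_int 1 K (\<lambda>x. approx u k x - u x)) \<longlonglongrightarrow> 0"
proof -
  obtain R where R: "K \<subseteq> ball 0 R" using bounded_subset_ballD[OF compact_imp_bounded[OF K(1)], of 0] by blast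
  obtain k0 :: nat where k0: "R \<le> real k0" using real_arch_simple by blast
  have w: "weak_identity [] u u" by (simp add: weak_identity_def)
  have "\<forall>\<^sub>F k in sequentially. pow_int 1 K (\<lambda>x. avg (step k) u x - u x) = pow_int 1 K (\<lambda>x. approx u k x - u x)"
    using eventually_ge_at_top[of k0]
  proof eventually_elim
    case (elim k)
    show ?case
    proof (rule pow_int_cong)
      fix x assume "x \<in> K"
      then have "x \<in> \<Omega> \<inter> ball 0 (real k)" using k0 elim K R by force
      from partial_derivs_approx[OF u u_L1 _ w this]
      show "avg (step k) u x - u x = approx u k x - u x" by simp
    qed
  qed
  then show ?thesis by (rule Lim_transform_eventually[OF avg_tendsto_L1_loc[OF u u_L1 K]])
qed

lemma approx_test_tendsto:
  assumes "\<phi> \<in> test_functions \<Omega>"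
  shows "(\<lambda>k. \<integral>x. approx u k x * \<phi> x \<partial>lborel) \<longlonglongrightarrow> (\<integral>x. u x * \<phi> x \<partial>lborel)"
proof -
  obtain K where K: "compact K" "K \<subseteq> \<Omega>" "\<And>x. x \<notin> K \<Longrightarrow> \<phi> x = 0" "smooth \<phi>"
    using test_functionsD[OF assms] by metis
  have "integrable lborel (\<lambda>x. indicator K x * u x)" using u_L1 K by (auto simp: L1_loc_iff_integrable)
  then show ?thesis
    by (intro integral_mult_test_tendsto[OF _ _ K(1) smooth_continuous[OF K(4)] K(3) _ approx_tendsto_L1_loc[OF K(1,2)]])
       (auto intro: smooth_borel_measurable smooth_approx u u_L1)
qed

text \<open>The candidate for the i-th first derivative: its \<eta>-mean, computed from u by moving
  the derivative to \<eta>, plus the reconstruction from the second derivatives.\<close>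

definition deriv1 :: "'a \<Rightarrow> 'a \<Rightarrow> real" where
  "deriv1 i x = - (\<integral>x. u x * partial_deriv i \<eta> x \<partial>lborel) + grad_avg (\<lambda>j. W j i) x"

lemma deriv1_measurable[measurable]: "i \<in> Basis \<Longrightarrow> deriv1 i \<in> borel_measurable borel"
  unfolding deriv1_def by measurable

lemma reconstruct_tendsto:
  assumes F: "\<And>k. smooth (F k)" and G[measurable]: "\<And>j. j \<in> Basis \<Longrightarrow> G j \<in> borel_measurable borel"
    and c: "(\<lambda>k. \<integral>y. \<eta> y * F k y \<partial>lborel) \<longlonglongrightarrow> c"
    and D: "\<And>j R. j \<in> Basis \<Longrightarrow> (\<lambda>k. pow_int p (\<Omega> \<inter> ball 0 R) (\<lambda>x. partial_deriv j (F k) x - G j x)) \<longlonglongrightarrow> 0"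
  shows "(\<lambda>k. pow_int p (\<Omega> \<inter> ball 0 R) (\<lambda>x. F k x - (c + grad_avg G x))) \<longlonglongrightarrow> 0"
proof -
  obtain R0 where R0: "0 < R0" "supp \<subseteq> ball 0 R0" using supp_bounded .
  define R' where "R' = max R R0"
  have "(\<lambda>k. pow_int p (\<Omega> \<inter> ball 0 R') (\<lambda>x. F k x - (c + grad_avg G x))) \<longlonglongrightarrow> 0"
  proof (rule pow_int_reconstruct_tendsto[OF F G p _ _ _ _ c D])
    show "convex (\<Omega> \<inter> ball 0 R')" using convex_\<Omega> by (intro convex_Int) auto
    show "supp \<subseteq> \<Omega> \<inter> ball 0 R'" using R0 supp_\<Omega> by (force simp: R'_def)
    show "\<Omega> \<inter> ball 0 R' \<subseteq> ball 0 R'" by auto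
  qed auto
  then show ?thesis
    by (rule ennreal_tendsto_0_le) (auto intro!: pow_int_mono_set simp: R'_def)
qed

lemma approx_deriv1_tendsto:
  assumes i: "i \<in> Basis"
  shows "(\<lambda>k. pow_int p (\<Omega> \<inter> ball 0 R) (\<lambda>x. partial_deriv i (approx u k) x - deriv1 i x)) \<longlonglongrightarrow> 0"
  unfolding deriv1_def
proof (rule reconstruct_tendsto)
  show "smooth (partial_deriv i (approx u k))" for k
    by (intro smooth_partial_deriv smooth_approx u u_L1 i)
  show "W j i \<in> borel_measurable borel" if "j \<in> Basis" for j by (rule W_meas[OF i that])
  show "(\<lambda>k. pow_int p (\<Omega> \<inter> ball 0 R) (\<lambda>x. partial_deriv j (partial_deriv i (approx u k)) x - W j i x)) \<longlonglongrightarrow> 0"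
    if "j \<in> Basis" for j R by (rule approx_deriv2_tendsto[OF i that])
  have "(\<integral>y. \<eta> y * partial_deriv i (approx u k) y \<partial>lborel) = - (\<integral>x. approx u k x * partial_deriv i \<eta> x \<partial>lborel)" for k
    using integral_by_parts_test[OF smooth_approx[OF u u_L1] test_\<eta> i, of k] by (simp add: mult.commute)
  then show "(\<lambda>k. \<integral>y. \<eta> y * partial_deriv i (approx u k) y \<partial>lborel) \<longlonglongrightarrow> - (\<integral>x. u x * partial_deriv i \<eta> x \<partial>lborel)"
    by (simp only:) (intro tendsto_minus approx_test_tendsto test_functions_partial_deriv test_\<eta> i)
qed

text \<open>Reconstruction gives an L^p limit up to the boundary, an explicit function; locally in
  L^1 the same sequence tends to u. So u equals the explicit function almost everywhere in \<Omega>
  and inherits the stronger convergence, although it was only locally integrable.\<close>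

lemma approx_deriv0_tendsto:
  "(\<lambda>k. pow_int p (\<Omega> \<inter> ball 0 R) (\<lambda>x. approx u k x - u x)) \<longlonglongrightarrow> 0"
proof -
  let ?U = "\<lambda>x. (\<integral>x. u x * \<eta> x \<partial>lborel) + grad_avg deriv1 x"
  have [measurable]: "approx u k \<in> borel_measurable borel" for k
    by (intro smooth_borel_measurable smooth_approx u u_L1)
  have [measurable]: "?U \<in> borel_measurable borel" by measurable
  have U: "(\<lambda>k. pow_int p (\<Omega> \<inter> ball 0 R) (\<lambda>x. approx u k x - ?U x)) \<longlonglongrightarrow> 0" for R
  proof (rule reconstruct_tendsto)
    show "(\<lambda>k. \<integral>y. \<eta> y * approx u k y \<partial>lborel) \<longlonglongrightarrow> (\<integral>x. u x * \<eta> x \<partial>lborel)"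
      using approx_test_tendsto[OF test_\<eta>] by (simp add: mult.commute)
  qed (auto intro: smooth_approx u u_L1 approx_deriv1_tendsto)
  have "AE x in lborel. x \<in> \<Omega> \<longrightarrow> u x - ?U x = 0"
  proof (rule AE_of_compact_subsets)
    fix K assume K: "compact K" "K \<subseteq> \<Omega>"
    have [measurable]: "K \<in> sets borel" using K by (intro borel_compact)
    have 1: "(\<lambda>k. pow_int 1 K (\<lambda>x. u x - approx u k x)) \<longlonglongrightarrow> 0"
      using approx_tendsto_L1_loc[OF K] by (subst pow_int_minus_commute)
    have 2: "(\<lambda>k. pow_int 1 K (\<lambda>x. approx u k x - ?U x)) \<longlonglongrightarrow> 0"
      by (rule Lp_limit_L1_loc(3)[OF smooth_approx[OF u u_L1] _ p U K]) measurable
    have "(\<lambda>k::nat. pow_int 1 K (\<lambda>x. u x - ?U x)) \<longlonglongrightarrow> 0"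
      by (rule pow_int_tendsto_0_trans[OF _ _ _ _ _ 1 2]) auto
    then have "pow_int 1 K (\<lambda>x. u x - ?U x) = 0" using LIMSEQ_unique tendsto_const by blast
    then show "AE x in lborel. x \<in> K \<longrightarrow> u x - ?U x = 0"
      by (intro pow_int_0_imp_AE[where p=1]) auto
  qed
  then have "AE x in lborel. x \<in> \<Omega> \<inter> ball 0 R \<longrightarrow> approx u k x - ?U x = approx u k x - u x" for k
    by eventually_elim auto
  then have "pow_int p (\<Omega> \<inter> ball 0 R) (\<lambda>x. approx u k x - ?U x) = pow_int p (\<Omega> \<inter> ball 0 R) (\<lambda>x. approx u k x - u x)" for k
    by (rule pow_int_cong_AE)
  then show ?thesis using U[of R] by simp
qed

lemma weak_identity_deriv1:
  assumes i: "i \<in> Basis"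
  shows "weak_identity [i] u (deriv1 i)" "deriv1 i \<in> L1_loc \<Omega>"
  by (rule weak_identity_of_limits[OF smooth_approx[OF u u_L1] i p u approx_deriv0_tendsto
        deriv1_measurable[OF i] approx_deriv1_tendsto[OF i]],
      rule Lp_limit_L1_loc(1)[OF smooth_partial_deriv[OF smooth_approx[OF u u_L1] i] deriv1_measurable[OF i] p
        approx_deriv1_tendsto[OF i]])

lemma weak_identity_deriv2:
  assumes ij: "i \<in> Basis" "j \<in> Basis"
  shows "weak_identity [j] (deriv1 i) (W j i)" "W j i \<in> L1_loc \<Omega>"
  by (rule weak_identity_of_limits[OF smooth_partial_deriv[OF smooth_approx[OF u u_L1] ij(1)] ij(2) p
        deriv1_measurable[OF ij(1)] approx_deriv1_tendsto[OF ij(1)] W_meas[OF ij] approx_deriv2_tendsto[OF ij]],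
      rule Lp_limit_L1_loc(1)[OF smooth_partial_deriv[OF smooth_partial_deriv[OF smooth_approx[OF u u_L1] ij(1)] ij(2)]
        W_meas[OF ij] p approx_deriv2_tendsto[OF ij]])

end

end

section \<open>Translation to \<open>Lp\<close>, \<open>has_weak_deriv\<close> and
  \<open>hom_sobolev\<close>\<close>

lemma nn_integral_lebesgue_eq_pow_int:
  "(\<integral>\<^sup>+x\<in>S. ennreal (\<bar>f x\<bar> powr p) \<partial>lebesgue) = pow_int p S f"
  by (simp add: pow_int_def nn_integral_completion)

lemma Lp_finite:
  fixes f :: "'a::euclidean_space \<Rightarrow> real"
  assumes "f \<in> Lp p S" "S \<in> sets borel"
  shows "pow_int p S f < \<infinity>"
proof -
  have "integrable (lebesgue_on S) (\<lambda>x. \<bar>f x\<bar> powr p)" using assms by (simp add: Lp_def)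
  then have "(\<integral>\<^sup>+x. ennreal (norm (\<bar>f x\<bar> powr p)) \<partial>lebesgue_on S) < \<infinity>"
    unfolding integrable_iff_bounded by blast
  then have "(\<integral>\<^sup>+x\<in>S. ennreal (\<bar>f x\<bar> powr p) \<partial>lebesgue) < \<infinity>"
    using assms(2) by (subst (asm) nn_integral_restrict_space) auto
  then show ?thesis by (simp only: nn_integral_lebesgue_eq_pow_int)
qed

lemma LpI:
  fixes f :: "'a::euclidean_space \<Rightarrow> real"
  assumes [measurable]: "f \<in> borel_measurable borel" and S[measurable]: "S \<in> sets borel" and fin: "pow_int p S f < \<infinity>"
  shows "f \<in> Lp p S"
proof -
  have f: "f \<in> borel_measurable lebesgue" by (rule measurable_completion) simp
  have m: "f \<in> borel_measurable (lebesgue_on S)" by (rule measurable_restrict_space1[OF f])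
  have "integrable (lebesgue_on S) (\<lambda>x. \<bar>f x\<bar> powr p)"
  proof (rule integrableI_bounded)
    have "(\<integral>\<^sup>+x. ennreal (norm (\<bar>f x\<bar> powr p)) \<partial>lebesgue_on S) = (\<integral>\<^sup>+x\<in>S. ennreal (\<bar>f x\<bar> powr p) \<partial>lebesgue)"
      using S by (subst nn_integral_restrict_space) auto
    then show "(\<integral>\<^sup>+x. ennreal (norm (\<bar>f x\<bar> powr p)) \<partial>lebesgue_on S) < \<infinity>"
      using fin by (simp only: nn_integral_lebesgue_eq_pow_int)
  qed (use m in measurable)
  then show ?thesis using m by (simp add: Lp_def)
qed

lemma hom_sobolev_smooth_approx:
  fixes \<Omega> :: "'a::euclidean_space set"
  assumes \<Omega>: "open \<Omega>" "convex \<Omega>" "\<Omega> \<noteq> {}" and p: "1 \<le> p" and u: "u \<in> hom_sobolev 2 p \<Omega>"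
  obtains u' V W \<phi> where
    "u' \<in> borel_measurable borel" "AE x in lborel. x \<in> \<Omega> \<longrightarrow> u x = u' x"
    "\<And>i. i \<in> Basis \<Longrightarrow> V i \<in> borel_measurable borel"
    "\<And>i. i \<in> Basis \<Longrightarrow> AE x in lborel. x \<in> \<Omega> \<longrightarrow> weak_deriv \<Omega> [i] u x = V i x"
    "\<And>i j. i \<in> Basis \<Longrightarrow> j \<in> Basis \<Longrightarrow> W j i \<in> borel_measurable borel"
    "\<And>i j. i \<in> Basis \<Longrightarrow> j \<in> Basis \<Longrightarrow> AE x in lborel. x \<in> \<Omega> \<longrightarrow> weak_deriv \<Omega> [j] (weak_deriv \<Omega> [i] u) x = W j i x"
    "\<And>i j. i \<in> Basis \<Longrightarrow> j \<in> Basis \<Longrightarrow> AE x in lborel. x \<in> \<Omega> \<longrightarrow> weak_deriv \<Omega> [i, j] u x = W j i x"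
    "\<And>k. smooth (\<phi> k :: 'a \<Rightarrow> real)"
    "\<And>R. (\<lambda>k. pow_int p (\<Omega> \<inter> ball 0 R) (\<lambda>x. \<phi> k x - u' x)) \<longlonglongrightarrow> 0"
    "\<And>i R. i \<in> Basis \<Longrightarrow> (\<lambda>k. pow_int p (\<Omega> \<inter> ball 0 R) (\<lambda>x. partial_deriv i (\<phi> k) x - V i x)) \<longlonglongrightarrow> 0"
    "\<And>i j R. i \<in> Basis \<Longrightarrow> j \<in> Basis \<Longrightarrow>
       (\<lambda>k. pow_int p (\<Omega> \<inter> ball 0 R) (\<lambda>x. partial_deriv j (partial_deriv i (\<phi> k)) x - W j i x)) \<longlonglongrightarrow> 0"
proof -
  obtain \<eta> where "\<eta> \<in> test_functions \<Omega>" "\<And>x. 0 \<le> \<eta> x" "(\<integral>x. \<eta> x \<partial>lborel) = 1"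
    using ex_mollifier[OF \<Omega>(1,3)] by blast
  then interpret mollifier \<Omega> \<eta> using \<Omega> by unfold_locales auto
  have uL: "u \<in> L1_loc \<Omega>" using u by (simp add: hom_sobolev_def)
  obtain u' where u': "u' \<in> borel_measurable borel" "AE x in lborel. x \<in> \<Omega> \<longrightarrow> u x = u' x" "u' \<in> L1_loc \<Omega>"
    using L1_loc_borel_representative[OF \<Omega>(1) uL] by blast
  have "\<exists>w. w \<in> borel_measurable borel \<and> (\<forall>x. x \<notin> \<Omega> \<longrightarrow> w x = 0) \<and> pow_int p \<Omega> w < \<infinity> \<and> weak_identity [j, i] u' w"
    if ij: "i \<in> Basis" "j \<in> Basis" for i j
  proof -
    have "length [j, i] = 2 \<and> set [j, i] \<subseteq> Basis" using ij by simp
    then obtain v where v: "v \<in> Lp p \<Omega>" "has_weak_deriv \<Omega> [j, i] u v"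
      using u unfolding hom_sobolev_def by blast
    have vL: "v \<in> L1_loc \<Omega>" using v(2) by (simp add: has_weak_deriv_def)
    obtain w where w: "w \<in> borel_measurable borel" "AE x in lborel. x \<in> \<Omega> \<longrightarrow> v x = w x" "\<And>x. x \<notin> \<Omega> \<Longrightarrow> w x = 0"
      using L1_loc_borel_representative[OF \<Omega>(1) vL] by blast
    have "pow_int p \<Omega> w = pow_int p \<Omega> v" using w(2) by (intro pow_int_cong_AE) auto
    moreover have "pow_int p \<Omega> v < \<infinity>" using Lp_finite[OF v(1)] \<Omega> by auto
    moreover have "weak_identity [j, i] u' w"
      using v(2) has_weak_deriv_iff_borel[OF \<Omega>(1) uL _ u'(1,2) w(1,2), of "[j, i]"] ij
      by (simp add: weak_identity_def)
    ultimately show ?thesis using w by auto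
  qed
  note ex = this
  define P where "P i j w \<longleftrightarrow> w \<in> borel_measurable borel \<and> (\<forall>x. x \<notin> \<Omega> \<longrightarrow> w x = 0) \<and> pow_int p \<Omega> w < \<infinity> \<and> weak_identity [j, i] u' w" for i j w
  define W where "W j i = (SOME w. P i j w)" for j i
  have W: "\<And>i j. i \<in> Basis \<Longrightarrow> j \<in> Basis \<Longrightarrow> W j i \<in> borel_measurable borel \<and>
      (\<forall>x. x \<notin> \<Omega> \<longrightarrow> W j i x = 0) \<and> pow_int p \<Omega> (W j i) < \<infinity> \<and> weak_identity [j, i] u' (W j i)"
    using someI_ex[OF ex[folded P_def]] unfolding W_def[symmetric] unfolding P_def .
  \<comment> \<open>The vanishing outside \<Omega> is assumed for all indices in the context above,
    so the choice is set to 0 for indices outside \<open>Basis\<close>.\<close>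
  define W' where "W' j i = (if i \<in> Basis \<and> j \<in> Basis then W j i else (\<lambda>x. 0))" for i j
  have W': "\<And>i j. i \<in> Basis \<Longrightarrow> j \<in> Basis \<Longrightarrow> W' j i \<in> borel_measurable borel"
    "\<And>i j x. x \<notin> \<Omega> \<Longrightarrow> W' j i x = 0"
    "\<And>i j. i \<in> Basis \<Longrightarrow> j \<in> Basis \<Longrightarrow> pow_int p \<Omega> (W' j i) < \<infinity>"
    "\<And>i j. i \<in> Basis \<Longrightarrow> j \<in> Basis \<Longrightarrow> weak_identity [j, i] u' (W' j i)"
    using W by (auto simp: W'_def)
  note C = u'(1,3) p W'
  let ?V = "deriv1 u' W'"
  have Vm: "?V i \<in> borel_measurable borel" if "i \<in> Basis" for i by (rule deriv1_measurable[OF C that])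
  have "has_weak_deriv \<Omega> [i] u (?V i)" if i: "i \<in> Basis" for i
    using has_weak_deriv_iff_borel[OF \<Omega>(1) uL _ u'(1,2) Vm[OF i], of "[i]" "?V i"]
      weak_identity_deriv1[OF C i] i by (simp add: weak_identity_def)
  note V = weak_deriv_AE_eq[OF this]
  have VL: "weak_deriv \<Omega> [i] u \<in> L1_loc \<Omega>" if "i \<in> Basis" for i
    using V(1)[OF that] by (simp add: has_weak_deriv_def)
  have "has_weak_deriv \<Omega> [j] (weak_deriv \<Omega> [i] u) (W' j i)" if ij: "i \<in> Basis" "j \<in> Basis" for i j
    using has_weak_deriv_iff_borel[OF \<Omega>(1) VL[OF ij(1)] _ Vm[OF ij(1)] V(2)[OF ij(1)] W'(1)[OF ij], of "[j]" "W' j i"]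
      weak_identity_deriv2[OF C ij] ij by (simp add: weak_identity_def)
  note D2 = weak_deriv_AE_eq(2)[OF this]
  \<comment> \<open>\<open>W' j i\<close> was chosen for the opposite order \<open>[j, i]\<close>.
    The order \<open>[i, j]\<close> follows by moving the i-derivative to u, which gives the first
    derivative, and then the j-derivative.\<close>
  have "has_weak_deriv \<Omega> [i, j] u (W' j i)" if ij: "i \<in> Basis" "j \<in> Basis" for i j
  proof -
    have "weak_identity [i, j] u' (W' j i)"
      unfolding weak_identity_def
    proof
      fix \<phi> assume \<phi>: "\<phi> \<in> test_functions \<Omega>"
      have "(\<integral>x. u' x * partial_deriv i (partial_deriv j \<phi>) x \<partial>lborel) = - (\<integral>x. ?V i x * partial_deriv j \<phi> x \<partial>lborel)"
        using weak_identity_deriv1(1)[OF C ij(1)] test_functions_partial_deriv[OF \<phi> ij(2)]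
        by (simp add: weak_identity_def)
      also have "(\<integral>x. ?V i x * partial_deriv j \<phi> x \<partial>lborel) = - (\<integral>x. W' j i x * \<phi> x \<partial>lborel)"
        using weak_identity_deriv2(1)[OF C ij] \<phi> by (simp add: weak_identity_def)
      finally show "(\<integral>x. u' x * partial_derivs [i, j] \<phi> x \<partial>lborel) = (- 1) ^ length [i, j] * (\<integral>x. W' j i x * \<phi> x \<partial>lborel)"
        by simp
    qed
    then show ?thesis
      using has_weak_deriv_iff_borel[OF \<Omega>(1) uL _ u'(1,2) W'(1)[OF ij], of "[i, j]" "W' j i"]
        weak_identity_deriv2(2)[OF C ij] ij by (simp add: weak_identity_def)
  qed
  note D2' = weak_deriv_AE_eq(2)[OF this]
  show ?thesis
    by (rule that[of u' ?V W' "approx u'"])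
       (use u' Vm V(2) W'(1) D2 D2' smooth_approx[OF u'(1,3)] approx_deriv0_tendsto[OF C]
          approx_deriv1_tendsto[OF C] approx_deriv2_tendsto[OF C] in \<open>assumption | blast\<close>)+
qed

section \<open>Traces on the boundary of the strip\<close>

lemma strip_properties:
  "open (strip a b :: ('a::euclidean_space \<times> real) set)" "convex (strip a b :: ('a \<times> real) set)"
  "a < b \<Longrightarrow> strip a b \<noteq> ({} :: ('a \<times> real) set)" "strip a b \<in> sets (borel :: ('a \<times> real) measure)"
proof -
  have eq: "strip a b = (UNIV :: 'a set) \<times> {a<..<b}" by (auto simp: strip_def)
  show o: "open (strip a b :: ('a \<times> real) set)" unfolding eq by (intro open_Times) auto
  show "convex (strip a b :: ('a \<times> real) set)" unfolding eq by (intro convex_Times) auto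
  show "a < b \<Longrightarrow> strip a b \<noteq> ({} :: ('a \<times> real) set)" unfolding eq by auto
  show "strip a b \<in> sets (borel :: ('a \<times> real) measure)" using o by (rule borel_open)
qed

lemma ball_times_subset_strip:
  "ball (0::'a::euclidean_space) R \<times> {a<..<b} \<subseteq> strip a b \<inter> ball 0 (R + (\<bar>a\<bar> + \<bar>b\<bar>))"
proof
  fix z :: "'a \<times> real" assume z: "z \<in> ball 0 R \<times> {a<..<b}"
  then have "\<bar>snd z\<bar> \<le> \<bar>a\<bar> + \<bar>b\<bar>" by auto
  moreover have "norm (fst z, snd z) \<le> norm (fst z) + norm (snd z)" by (rule norm_Pair_le)
  ultimately show "z \<in> strip a b \<inter> ball 0 (R + (\<bar>a\<bar> + \<bar>b\<bar>))" using z by (auto simp: strip_def)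
qed

lemma pow_int_Times:
  fixes h :: "'a::euclidean_space \<times> real \<Rightarrow> real"
  assumes [measurable]: "h \<in> borel_measurable borel" "A \<in> sets borel"
  shows "pow_int p (A \<times> {a<..<b}) h = (\<integral>\<^sup>+x\<in>A. (\<integral>\<^sup>+s\<in>{a<..<b}. ennreal (\<bar>h (x, s)\<bar> powr p) \<partial>lborel) \<partial>lborel)"
proof -
  have eq: "indicator (A \<times> {a<..<b}) z = (indicator A (fst z) * indicator {a<..<b} (snd z) :: ennreal)" for z :: "'a \<times> real"
    by (cases z) (auto simp: indicator_def)
  have "pow_int p (A \<times> {a<..<b}) h = (\<integral>\<^sup>+x. (\<integral>\<^sup>+s. ennreal (\<bar>h (x, s)\<bar> powr p) * (indicator A x * indicator {a<..<b} s) \<partial>lborel) \<partial>lborel)"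
    unfolding pow_int_def eq by (subst nn_integral_lborel_fst) auto
  also have "\<dots> = (\<integral>\<^sup>+x. (\<integral>\<^sup>+s. ennreal (\<bar>h (x, s)\<bar> powr p) * indicator {a<..<b} s * indicator A x \<partial>lborel) \<partial>lborel)"
    by (simp only: mult_ac)
  also have "\<dots> = (\<integral>\<^sup>+x\<in>A. (\<integral>\<^sup>+s\<in>{a<..<b}. ennreal (\<bar>h (x, s)\<bar> powr p) \<partial>lborel) \<partial>lborel)"
    by (intro nn_integral_cong nn_integral_multc) measurable
  finally show ?thesis .
qed

section \<open>Integrals over vertical segments\<close>

lemma interval_FTC:
  fixes f F :: "real \<Rightarrow> real"
  assumes "a \<le> b" "\<And>s. (F has_real_derivative f s) (at s)" "continuous_on UNIV f"
  shows "(\<integral>s. f s * indicator {a<..<b} s \<partial>lborel) = F b - F a"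
proof -
  have [measurable]: "f \<in> borel_measurable borel" using assms(3) by (rule borel_measurable_continuous_onI)
  have "(\<integral>s. f s * indicator {a<..<b} s \<partial>lborel) = (\<integral>s. f s * indicator {a..b} s \<partial>lborel)"
    using AE_lborel_singleton[of a] AE_lborel_singleton[of b]
    by (intro integral_cong_AE) (auto elim!: eventually_elim2 simp: indicator_def)
  also have "\<dots> = F b - F a"
    using assms by (intro integral_FTC_Icc_real) (auto simp: continuous_on_eq_continuous_at)
  finally show ?thesis .
qed

lemma interval_integrable:
  fixes f :: "real \<Rightarrow> real"
  assumes "continuous_on UNIV f"
  shows "integrable lborel (\<lambda>s. f s * indicator {a<..<b} s)"
proof -
  have [measurable]: "f \<in> borel_measurable borel" using assms by (rule borel_measurable_continuous_onI)
  have "integrable lborel (\<lambda>s. indicator {a..b} s *\<^sub>R f s)"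
    using assms by (intro borel_integrable_compact) (auto intro: continuous_on_subset)
  then show ?thesis
    by (rule Bochner_Integration.integrable_bound) (auto simp: indicator_def)
qed

text \<open>Jensen's inequality with the interval as the finite measure; its mass produces the
  factor \<open>(b - a) powr (p - 1)\<close> of the first estimate.\<close>

lemma interval_powr_integral_diff_le:
  fixes f g :: "real \<Rightarrow> real"
  assumes p: "1 \<le> p" and f: "continuous_on UNIV f" and [measurable]: "g \<in> borel_measurable borel" and ab: "a < b"
  shows "ennreal (\<bar>(\<integral>s. f s * indicator {a<..<b} s \<partial>lborel) - (\<integral>s. g s * indicator {a<..<b} s \<partial>lborel)\<bar> powr p)
    \<le> ennreal ((b - a) powr (p - 1)) * (\<integral>\<^sup>+s\<in>{a<..<b}. ennreal (\<bar>f s - g s\<bar> powr p) \<partial>lborel)"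
proof -
  let ?M = "density lborel (\<lambda>s. ennreal (indicator {a<..<b} s))"
  have em: "emeasure ?M (space ?M) = ennreal (b - a)"
    using ab by (simp add: emeasure_density ennreal_indicator)
  interpret finite_measure ?M using em by (intro finite_measureI) simp
  have W: "measure ?M (space ?M) = b - a" using em ab by (simp add: measure_def)
  have [measurable]: "f \<in> borel_measurable borel" using f by (rule borel_measurable_continuous_onI)
  have i: "(\<integral>s. h s \<partial>?M) = (\<integral>s. h s * indicator {a<..<b} s \<partial>lborel)" if "h \<in> borel_measurable borel" for h :: "real \<Rightarrow> real"
    using that by (subst integral_real_density) (auto simp: mult.commute)
  have int: "integrable ?M f"
    using interval_integrable[OF f, of a b] by (subst integrable_real_density) (auto simp: mult.commute)
  have "ennreal (\<bar>(\<integral>s. f s \<partial>?M) - (\<integral>s. g s \<partial>?M)\<bar> powr p)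
    \<le> ennreal ((b - a) powr (p - 1)) * (\<integral>\<^sup>+s. ennreal (\<bar>f s - g s\<bar> powr p) \<partial>?M)"
    using W ab by (intro powr_integral_diff_le[OF p int]) auto
  also have "(\<integral>\<^sup>+s. ennreal (\<bar>f s - g s\<bar> powr p) \<partial>?M) = (\<integral>\<^sup>+s\<in>{a<..<b}. ennreal (\<bar>f s - g s\<bar> powr p) \<partial>lborel)"
    by (subst nn_integral_density) (auto simp: ennreal_indicator mult.commute)
  also have "(\<integral>s. f s \<partial>?M) = (\<integral>s. f s * indicator {a<..<b} s \<partial>lborel)" by (rule i) simp
  also have "(\<integral>s. g s \<partial>?M) = (\<integral>s. g s * indicator {a<..<b} s \<partial>lborel)" by (rule i) simp
  finally show ?thesis .
qed

lemma smooth_slice_derivative: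
  assumes "smooth (\<psi> :: 'a::euclidean_space \<times> real \<Rightarrow> real)"
  shows "((\<lambda>s. \<psi> (x, s)) has_real_derivative partial_deriv (0, 1) \<psi> (x, s)) (at s)"
proof -
  have 1: "((\<lambda>s. (x, s)) has_derivative (\<lambda>h. (0, h))) (at s)"
    by (auto intro!: derivative_eq_intros)
  have "(\<psi> has_derivative frechet_derivative \<psi> (at (x, s))) (at (x, s))"
    using smooth_differentiable[OF assms] by (simp add: frechet_derivative_works)
  from has_derivative_compose[OF 1 this]
  have d: "((\<lambda>s. \<psi> (x, s)) has_derivative (\<lambda>h. frechet_derivative \<psi> (at (x, s)) (0, h))) (at s)" .
  interpret L: bounded_linear "frechet_derivative \<psi> (at (x, s))"
    using smooth_differentiable[OF assms] by (intro has_derivative_bounded_linear) (simp add: frechet_derivative_works)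
  have "frechet_derivative \<psi> (at (x, s)) (0, h) = partial_deriv (0, 1) \<psi> (x, s) * h" for h
    using L.scaleR[of h "(0, 1)"] by (simp add: partial_deriv_def)
  then have "(\<lambda>h. frechet_derivative \<psi> (at (x, s)) (0, h)) = (*) (partial_deriv (0, 1) \<psi> (x, s))" by auto
  then show ?thesis using d by (simp add: has_field_derivative_def)
qed

lemma e_N_Basis: "(0, 1) \<in> (Basis :: ('a::euclidean_space \<times> real) set)"
  by (simp add: Basis_prod_def)

lemma smooth_slice_continuous:
  assumes "smooth (\<psi> :: 'a::euclidean_space \<times> real \<Rightarrow> real)"
  shows "continuous_on UNIV (\<lambda>s. \<psi> (x, s))" "continuous_on UNIV (\<lambda>x. \<psi> (x, s))"
  by (auto intro!: continuous_on_compose2[OF smooth_continuous[OF assms, of UNIV]] continuous_intros)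

text \<open>The value of a smooth function at the face \<open>x\<^sub>N = c\<close> as an integral over the interior:
  for \<open>c = b\<close> take \<open>d = a\<close>, for \<open>c = a\<close> take \<open>d = b\<close>, and integrate the derivative of
  \<open>(s - d) \<psi>(x', s)\<close>. For Sobolev functions the right-hand side defines the trace.\<close>

definition trace_formula :: "real \<Rightarrow> real \<Rightarrow> ('a::euclidean_space \<times> real \<Rightarrow> real) \<Rightarrow> ('a \<times> real \<Rightarrow> real) \<Rightarrow> real \<Rightarrow> 'a \<Rightarrow> real" where
  "trace_formula a b v w t x = (1 / (b - a)) *
     (\<integral>s. (v (x, s) + (s - (if t = b then a else b)) * w (x, s)) * indicator {a<..<b} s \<partial>lborel)"

lemma trace_formula_measurable[measurable]:
  assumes [measurable]: "v \<in> borel_measurable borel" "w \<in> borel_measurable borel"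
  shows "trace_formula a b v w t \<in> borel_measurable borel"
  unfolding trace_formula_def by measurable

lemma trace_formula_smooth:
  fixes \<psi> :: "'a::euclidean_space \<times> real \<Rightarrow> real"
  assumes \<psi>: "smooth \<psi>" and ab: "a < b" and t: "t \<in> {a, b}"
  shows "trace_formula a b \<psi> (partial_deriv (0, 1) \<psi>) t x = \<psi> (x, t)"
proof -
  let ?d = "if t = b then a else b"
  have "(\<integral>s. (\<psi> (x, s) + (s - ?d) * partial_deriv (0, 1) \<psi> (x, s)) * indicator {a<..<b} s \<partial>lborel) =
      (b - ?d) * \<psi> (x, b) - (a - ?d) * \<psi> (x, a)"
  proof (rule interval_FTC[where F="\<lambda>s. (s - ?d) * \<psi> (x, s)"])
    show "((\<lambda>s. (s - ?d) * \<psi> (x, s)) has_real_derivative \<psi> (x, s) + (s - ?d) * partial_deriv (0, 1) \<psi> (x, s)) (at s)" for s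
      by (auto intro!: derivative_eq_intros smooth_slice_derivative[OF \<psi>])
    show "continuous_on UNIV (\<lambda>s. \<psi> (x, s) + (s - ?d) * partial_deriv (0, 1) \<psi> (x, s))"
      by (intro continuous_intros smooth_slice_continuous smooth_partial_deriv \<psi> e_N_Basis)
  qed (use ab in simp)
  also have "\<dots> = (b - a) * \<psi> (x, t)" using t ab by (auto simp: algebra_simps)
  finally show ?thesis using ab by (simp add: trace_formula_def)
qed

text \<open>Continuity of the trace: the distance on a face is controlled by the interior distances
  of function and normal derivative. With L = b - a, the factor 1 / L is (1 / L)^p from the formula
  times L^(p-1) from Jensen, and |s - d| is at most L in front of the derivative.\<close>

lemma trace_formula_diff_le:
  fixes \<psi> v w :: "'a::euclidean_space \<times> real \<Rightarrow> real"
  assumes \<psi>: "smooth \<psi>" and ab: "a < b" and t: "t \<in> {a, b}" and p: "1 \<le> p"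
    and [measurable]: "v \<in> borel_measurable borel" "w \<in> borel_measurable borel" "A \<in> sets borel"
  shows "pow_int p A (\<lambda>x. \<psi> (x, t) - trace_formula a b v w t x) \<le>
    ennreal (2 powr p / (b - a)) * (pow_int p (A \<times> {a<..<b}) (\<lambda>z. \<psi> z - v z)
      + ennreal ((b - a) powr p) * pow_int p (A \<times> {a<..<b}) (\<lambda>z. partial_deriv (0, 1) \<psi> z - w z))"
proof -
  define L where "L = b - a"
  have L: "0 < L" using ab by (simp add: L_def)
  let ?d = "if t = b then a else b"
  let ?w = "partial_deriv (0, 1) \<psi>"
  have [measurable]: "\<psi> \<in> borel_measurable borel" "?w \<in> borel_measurable borel"
    using \<psi> by (auto intro!: smooth_borel_measurable smooth_partial_deriv e_N_Basis)
  let ?I = "\<lambda>h x. \<integral>\<^sup>+s\<in>{a<..<b}. ennreal (\<bar>h (x, s)\<bar> powr p) \<partial>lborel"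
  have pt: "ennreal (\<bar>\<psi> (x, t) - trace_formula a b v w t x\<bar> powr p) \<le>
      ennreal (2 powr p / L) * (?I (\<lambda>z. \<psi> z - v z) x + ennreal (L powr p) * ?I (\<lambda>z. ?w z - w z) x)" for x
  proof -
    let ?f = "\<lambda>s. \<psi> (x, s) + (s - ?d) * ?w (x, s)"
    let ?g = "\<lambda>s. v (x, s) + (s - ?d) * w (x, s)"
    have "\<psi> (x, t) - trace_formula a b v w t x =
        (1 / L) * ((\<integral>s. ?f s * indicator {a<..<b} s \<partial>lborel) - (\<integral>s. ?g s * indicator {a<..<b} s \<partial>lborel))"
      unfolding trace_formula_smooth[OF \<psi> ab t, of x, symmetric]
      by (simp only: trace_formula_def L_def right_diff_distrib)
    then have "\<bar>\<psi> (x, t) - trace_formula a b v w t x\<bar> powr p = (1 / L) powr p *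
        \<bar>(\<integral>s. ?f s * indicator {a<..<b} s \<partial>lborel) - (\<integral>s. ?g s * indicator {a<..<b} s \<partial>lborel)\<bar> powr p"
      using L by (simp only: abs_mult powr_mult abs_ge_zero) simp
    then have "ennreal (\<bar>\<psi> (x, t) - trace_formula a b v w t x\<bar> powr p) = ennreal ((1 / L) powr p) *
        ennreal (\<bar>(\<integral>s. ?f s * indicator {a<..<b} s \<partial>lborel) - (\<integral>s. ?g s * indicator {a<..<b} s \<partial>lborel)\<bar> powr p)"
      by (simp only: ennreal_mult' powr_ge_zero)
    also have "\<dots> \<le> ennreal ((1 / L) powr p) * (ennreal (L powr (p - 1)) * (\<integral>\<^sup>+s\<in>{a<..<b}. ennreal (\<bar>?f s - ?g s\<bar> powr p) \<partial>lborel))"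
      unfolding L_def
      by (intro mult_left_mono interval_powr_integral_diff_le p ab continuous_intros smooth_slice_continuous
          smooth_partial_deriv \<psi> e_N_Basis) auto
    also have "\<dots> = ennreal (1 / L) * (\<integral>\<^sup>+s\<in>{a<..<b}. ennreal (\<bar>?f s - ?g s\<bar> powr p) \<partial>lborel)"
      using L by (simp add: mult.assoc[symmetric] ennreal_mult'[symmetric] powr_divide powr_diff)
    also have "\<dots> \<le> ennreal (1 / L) * (\<integral>\<^sup>+s. ennreal (2 powr p) * (ennreal (\<bar>\<psi> (x, s) - v (x, s)\<bar> powr p) * indicator {a<..<b} s
        + ennreal (L powr p) * (ennreal (\<bar>?w (x, s) - w (x, s)\<bar> powr p) * indicator {a<..<b} s)) \<partial>lborel)"
    proof (intro mult_left_mono nn_integral_mono)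
      fix s
      show "ennreal (\<bar>?f s - ?g s\<bar> powr p) * indicator {a<..<b} s \<le>
        ennreal (2 powr p) * (ennreal (\<bar>\<psi> (x, s) - v (x, s)\<bar> powr p) * indicator {a<..<b} s
        + ennreal (L powr p) * (ennreal (\<bar>?w (x, s) - w (x, s)\<bar> powr p) * indicator {a<..<b} s))"
      proof (cases "s \<in> {a<..<b}")
        case True
        have "?f s - ?g s = (\<psi> (x, s) - v (x, s)) + (s - ?d) * (?w (x, s) - w (x, s))" by (simp add: algebra_simps)
        then have "\<bar>?f s - ?g s\<bar> powr p \<le> 2 powr p * (\<bar>\<psi> (x, s) - v (x, s)\<bar> powr p + \<bar>(s - ?d) * (?w (x, s) - w (x, s))\<bar> powr p)"
          by (simp only:) (rule powr_abs_add_le, use p in simp)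
        also have "\<bar>(s - ?d) * (?w (x, s) - w (x, s))\<bar> powr p \<le> (L * \<bar>?w (x, s) - w (x, s)\<bar>) powr p"
          using True p by (intro powr_mono2) (auto simp: abs_mult L_def intro!: mult_right_mono)
        also have "(L * \<bar>?w (x, s) - w (x, s)\<bar>) powr p = L powr p * \<bar>?w (x, s) - w (x, s)\<bar> powr p"
          using L by (intro powr_mult)
        finally have "\<bar>?f s - ?g s\<bar> powr p \<le> 2 powr p * (\<bar>\<psi> (x, s) - v (x, s)\<bar> powr p + L powr p * \<bar>?w (x, s) - w (x, s)\<bar> powr p)"
          by simp
        from ennreal_leI[OF this] show ?thesis using True by (simp add: ennreal_mult')
      qed auto
    qed auto
    also have "\<dots> = ennreal (1 / L) * (ennreal (2 powr p) * (?I (\<lambda>z. \<psi> z - v z) x + ennreal (L powr p) * ?I (\<lambda>z. ?w z - w z) x))"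
      by (simp add: nn_integral_cmult nn_integral_add)
    also have "\<dots> = ennreal (2 powr p / L) * (?I (\<lambda>z. \<psi> z - v z) x + ennreal (L powr p) * ?I (\<lambda>z. ?w z - w z) x)"
      using L by (simp add: mult.assoc[symmetric] ennreal_mult'[symmetric] mult.commute)
    finally show ?thesis .
  qed
  have "pow_int p A (\<lambda>x. \<psi> (x, t) - trace_formula a b v w t x) \<le>
    (\<integral>\<^sup>+x. ennreal (2 powr p / L) * (?I (\<lambda>z. \<psi> z - v z) x * indicator A x + ennreal (L powr p) * (?I (\<lambda>z. ?w z - w z) x * indicator A x)) \<partial>lborel)"
    unfolding pow_int_def
  proof (rule nn_integral_mono)
    fix x
    show "ennreal (\<bar>\<psi> (x, t) - trace_formula a b v w t x\<bar> powr p) * indicator A x \<le>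
      ennreal (2 powr p / L) * (?I (\<lambda>z. \<psi> z - v z) x * indicator A x + ennreal (L powr p) * (?I (\<lambda>z. ?w z - w z) x * indicator A x))"
      using pt[of x] by (cases "x \<in> A") auto
  qed
  also have "\<dots> = ennreal (2 powr p / L) * (pow_int p (A \<times> {a<..<b}) (\<lambda>z. \<psi> z - v z)
      + ennreal (L powr p) * pow_int p (A \<times> {a<..<b}) (\<lambda>z. ?w z - w z))"
    by (simp add: nn_integral_cmult nn_integral_add pow_int_Times)
  finally show ?thesis by (simp add: L_def)
qed

section \<open>Existence of traces and the sequence behind a chosen trace\<close>

lemma sobolev_dist_pow_eq:
  assumes "S \<subseteq> \<Omega>" "AE x in lborel. x \<in> \<Omega> \<longrightarrow> v x = v' x"
    and "\<And>e. e \<in> Basis \<Longrightarrow> AE x in lborel. x \<in> \<Omega> \<longrightarrow> weak_deriv \<Omega> [e] v x = w e x"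
  shows "sobolev_dist_pow p \<Omega> S \<phi> v = pow_int p S (\<lambda>x. \<phi> x - v' x) + (\<Sum>e\<in>Basis. pow_int p S (\<lambda>x. partial_deriv e \<phi> x - w e x))"
proof -
  have 1: "pow_int p S (\<lambda>x. \<phi> x - v x) = pow_int p S (\<lambda>x. \<phi> x - v' x)"
    by (rule pow_int_cong_AE, use assms(2) in eventually_elim) (use assms(1) in auto)
  have 2: "pow_int p S (\<lambda>x. partial_deriv e \<phi> x - weak_deriv \<Omega> [e] v x) = pow_int p S (\<lambda>x. partial_deriv e \<phi> x - w e x)"
    if "e \<in> Basis" for e
    by (rule pow_int_cong_AE, use assms(3)[OF that] in eventually_elim) (use assms(1) in auto)
  show ?thesis unfolding sobolev_dist_pow_def by (simp add: nn_integral_lebesgue_eq_pow_int 1 2)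
qed

text \<open>\<open>G a\<close> and \<open>G b\<close> are Borel representatives of the two traces of a function with Borel
  representative \<open>v\<close> and partial derivatives \<open>w e\<close>.\<close>

definition trace_approx :: "real \<Rightarrow> real \<Rightarrow> real \<Rightarrow> ('a::euclidean_space \<times> real \<Rightarrow> real) \<Rightarrow>
    ('a \<times> real \<Rightarrow> 'a \<times> real \<Rightarrow> real) \<Rightarrow> (real \<Rightarrow> 'a \<Rightarrow> real) \<Rightarrow> (nat \<Rightarrow> 'a \<times> real \<Rightarrow> real) \<Rightarrow> bool" where
  "trace_approx p a b v w G \<phi> \<longleftrightarrow> v \<in> borel_measurable borel \<and> (\<forall>e\<in>Basis. w e \<in> borel_measurable borel) \<and>
     (\<forall>t\<in>{a, b}. G t \<in> borel_measurable borel) \<and> (\<forall>k. smooth (\<phi> k)) \<and>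
     (\<forall>R. (\<lambda>k. pow_int p (ball 0 R \<times> {a<..<b}) (\<lambda>x. \<phi> k x - v x)) \<longlonglongrightarrow> 0) \<and>
     (\<forall>R. \<forall>e\<in>Basis. (\<lambda>k. pow_int p (ball 0 R \<times> {a<..<b}) (\<lambda>x. partial_deriv e (\<phi> k) x - w e x)) \<longlonglongrightarrow> 0) \<and>
     (\<forall>R. \<forall>t\<in>{a, b}. (\<lambda>k. pow_int p (ball 0 R) (\<lambda>x'. \<phi> k (x', t) - G t x')) \<longlonglongrightarrow> 0)"

text \<open>Needed because \<open>Tr\<close> is a choice. The explicit trace formula of the
  representatives is a witness: the approximants converge to it on both faces by the continuity
  estimate.\<close>

lemma ex_has_trace:
  fixes v :: "'a::euclidean_space \<times> real \<Rightarrow> real"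
  assumes ab: "a < b" and p: "1 \<le> p"
    and v': "v' \<in> borel_measurable borel" "AE x in lborel. x \<in> strip a b \<longrightarrow> v x = v' x"
    and w: "\<And>e. e \<in> Basis \<Longrightarrow> w e \<in> borel_measurable borel"
      "\<And>e. e \<in> Basis \<Longrightarrow> AE x in lborel. x \<in> strip a b \<longrightarrow> weak_deriv (strip a b) [e] v x = w e x"
    and \<phi>: "\<And>k. smooth (\<phi> k)"
    and lim: "\<And>R. (\<lambda>k. pow_int p (strip a b \<inter> ball 0 R) (\<lambda>x. \<phi> k x - v' x)) \<longlonglongrightarrow> 0"
      "\<And>e R. e \<in> Basis \<Longrightarrow> (\<lambda>k. pow_int p (strip a b \<inter> ball 0 R) (\<lambda>x. partial_deriv e (\<phi> k) x - w e x)) \<longlonglongrightarrow> 0"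
  shows "\<exists>g. has_trace p a b v g"
proof -
  let ?e = "(0, 1) :: 'a \<times> real"
  let ?G = "trace_formula a b v' (w ?e)"
  define g where "g z = ?G (snd z) (fst z)" for z
  note [measurable] = v'(1) w(1)[OF e_N_Basis]
  have Gm[measurable]: "?G t \<in> borel_measurable borel" for t by measurable
  have conv: "(\<lambda>k. pow_int p (ball 0 R) (\<lambda>x'. \<phi> k (x', t) - ?G t x')) \<longlonglongrightarrow> 0" if t: "t \<in> {a, b}" for R t
  proof (rule ennreal_tendsto_0_le)
    show "pow_int p (ball 0 R) (\<lambda>x'. \<phi> k (x', t) - ?G t x') \<le>
      ennreal (2 powr p / (b - a)) * (pow_int p (ball 0 R \<times> {a<..<b}) (\<lambda>z. \<phi> k z - v' z)
      + ennreal ((b - a) powr p) * pow_int p (ball 0 R \<times> {a<..<b}) (\<lambda>z. partial_deriv ?e (\<phi> k) z - w ?e z))" for k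
      by (rule trace_formula_diff_le[OF \<phi> ab t p]) auto
    have "(\<lambda>k. pow_int p (ball 0 R \<times> {a<..<b}) (\<lambda>z. \<phi> k z - v' z)) \<longlonglongrightarrow> 0"
      "(\<lambda>k. pow_int p (ball 0 R \<times> {a<..<b}) (\<lambda>z. partial_deriv ?e (\<phi> k) z - w ?e z)) \<longlonglongrightarrow> 0"
      by (rule ennreal_tendsto_0_le[OF lim(1) pow_int_mono_set[OF ball_times_subset_strip]],
          rule ennreal_tendsto_0_le[OF lim(2)[OF e_N_Basis] pow_int_mono_set[OF ball_times_subset_strip]])
    then show "(\<lambda>k. ennreal (2 powr p / (b - a)) * (pow_int p (ball 0 R \<times> {a<..<b}) (\<lambda>z. \<phi> k z - v' z)
      + ennreal ((b - a) powr p) * pow_int p (ball 0 R \<times> {a<..<b}) (\<lambda>z. partial_deriv ?e (\<phi> k) z - w ?e z))) \<longlonglongrightarrow> 0"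
      by (intro ennreal_tendsto_0_cmult ennreal_tendsto_0_add) auto
  qed
  have "has_trace p a b v g"
    unfolding has_trace_def
  proof (intro conjI allI impI ballI exI[of _ \<phi>] \<phi>)
    fix R t :: real assume t: "t \<in> {a, b}"
    show "(\<lambda>x'. g (x', t)) \<in> Lp p (ball 0 R)"
    proof (rule LpI)
      have "\<forall>\<^sub>F k in sequentially. pow_int p (ball 0 R) (\<lambda>x'. \<phi> k (x', t) - ?G t x') < 1"
        using conv[OF t] by (rule order_tendstoD) simp
      then obtain k where k: "pow_int p (ball 0 R) (\<lambda>x'. \<phi> k (x', t) - ?G t x') < 1"
        using eventually_happens'[OF sequentially_bot] by blast
      have c: "continuous_on UNIV (\<lambda>x'. \<phi> k (x', t))" by (rule smooth_slice_continuous[OF \<phi>])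
      then have [measurable]: "(\<lambda>x'. \<phi> k (x', t)) \<in> borel_measurable borel" by (rule borel_measurable_continuous_onI)
      have "pow_int p (ball 0 R) (?G t) \<le> ennreal (2 powr p) *
          (pow_int p (ball 0 R) (\<lambda>x'. ?G t x' - \<phi> k (x', t)) + pow_int p (ball 0 R) (\<lambda>x'. \<phi> k (x', t)))"
        using pow_int_add_le[of "\<lambda>x'. ?G t x' - \<phi> k (x', t)" "\<lambda>x'. \<phi> k (x', t)" "ball 0 R" p] p by simp
      also have "\<dots> < \<infinity>"
      proof -
        have "pow_int p (ball 0 R) (\<lambda>x'. ?G t x' - \<phi> k (x', t)) < \<infinity>"
          using k by (subst pow_int_minus_commute) (auto intro: order.strict_trans)
        moreover have "pow_int p (ball 0 R) (\<lambda>x'. \<phi> k (x', t)) < \<infinity>"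
          using c p by (intro pow_int_continuous_finite) auto
        ultimately show ?thesis by (simp add: ennreal_mult_less_top)
      qed
      finally show "pow_int p (ball 0 R) (\<lambda>x'. g (x', t)) < \<infinity>" by (simp add: g_def)
    qed (simp_all add: g_def)
  next
    fix R :: real
    have "sobolev_dist_pow p (strip a b) (strip a b \<inter> ball 0 R) (\<phi> k) v =
      pow_int p (strip a b \<inter> ball 0 R) (\<lambda>x. \<phi> k x - v' x) + (\<Sum>e\<in>Basis. pow_int p (strip a b \<inter> ball 0 R) (\<lambda>x. partial_deriv e (\<phi> k) x - w e x))" for k
      by (rule sobolev_dist_pow_eq[OF _ v'(2) w(2)]) auto
    moreover have "(\<lambda>k. pow_int p (strip a b \<inter> ball 0 R) (\<lambda>x. \<phi> k x - v' x) +
        (\<Sum>e\<in>Basis. pow_int p (strip a b \<inter> ball 0 R) (\<lambda>x. partial_deriv e (\<phi> k) x - w e x))) \<longlonglongrightarrow> 0 + (\<Sum>e\<in>(Basis :: ('a \<times> real) set). 0)"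
      by (intro tendsto_add tendsto_sum lim)
    ultimately show "(\<lambda>k. sobolev_dist_pow p (strip a b) (strip a b \<inter> ball 0 R) (\<phi> k) v) \<longlonglongrightarrow> 0" by simp
  next
    fix R t :: real assume t: "t \<in> {a, b}"
    show "(\<lambda>k. \<integral>\<^sup>+x'\<in>ball 0 R. ennreal (\<bar>\<phi> k (x', t) - g (x', t)\<bar> powr p) \<partial>lebesgue) \<longlonglongrightarrow> 0"
      using conv[OF t] by (simp add: nn_integral_lebesgue_eq_pow_int g_def)
  qed
  then show ?thesis by blast
qed

text \<open>The converse direction, for an arbitrary g: whichever trace was chosen, it brings a
  smooth sequence, and the estimates are proved along that sequence. Measurability of g on each ball
  is glued together and g is replaced by a Borel function.\<close>

lemma has_trace_imp_trace_approx:
  fixes v :: "'a::euclidean_space \<times> real \<Rightarrow> real"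
  assumes "has_trace p a b v g"
    and v': "v' \<in> borel_measurable borel" "AE x in lborel. x \<in> strip a b \<longrightarrow> v x = v' x"
    and w: "\<And>e. e \<in> Basis \<Longrightarrow> w e \<in> borel_measurable borel"
      "\<And>e. e \<in> Basis \<Longrightarrow> AE x in lborel. x \<in> strip a b \<longrightarrow> weak_deriv (strip a b) [e] v x = w e x"
  obtains G \<phi> where "trace_approx p a b v' w G \<phi>" "\<And>t. t \<in> {a, b} \<Longrightarrow> AE x' in lborel. g (x', t) = G t x'"
proof -
  have gL: "\<And>R t. 0 < R \<Longrightarrow> t \<in> {a, b} \<Longrightarrow> (\<lambda>x'. g (x', t)) \<in> Lp p (ball 0 R)"
    using assms(1) by (auto simp: has_trace_def)
  obtain \<phi> where \<phi>: "\<And>k. smooth (\<phi> k)"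
    and lim: "\<And>R. 0 < R \<Longrightarrow> (\<lambda>k. sobolev_dist_pow p (strip a b) (strip a b \<inter> ball 0 R) (\<phi> k) v) \<longlonglongrightarrow> 0"
      "\<And>R t. 0 < R \<Longrightarrow> t \<in> {a, b} \<Longrightarrow> (\<lambda>k. \<integral>\<^sup>+x'\<in>ball 0 R. ennreal (\<bar>\<phi> k (x', t) - g (x', t)\<bar> powr p) \<partial>lebesgue) \<longlonglongrightarrow> 0"
    using assms(1) unfolding has_trace_def by blast
  have "\<exists>h. h \<in> borel_measurable borel \<and> (AE x' in lborel. g (x', t) = h x')" if t: "t \<in> {a, b}" for t
  proof -
    have "(\<lambda>x'. g (x', t)) \<in> borel_measurable lebesgue"
    proof (rule borel_measurable_LIMSEQ_real)
      show "(\<lambda>x'. if x' \<in> ball 0 (real (Suc n)) then g (x', t) else 0) \<in> borel_measurable lebesgue" for n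
        using gL[of "real (Suc n)", OF _ t] by (intro borel_measurable_if_I) (auto simp: Lp_def)
      fix x' :: 'a
      obtain N :: nat where N: "norm x' < real N" using reals_Archimedean2 by blast
      have "\<forall>\<^sub>F n in sequentially. (if x' \<in> ball 0 (real (Suc n)) then g (x', t) else 0) = g (x', t)"
        using eventually_ge_at_top[of N] by eventually_elim (use N in auto)
      then show "(\<lambda>n. if x' \<in> ball 0 (real (Suc n)) then g (x', t) else 0) \<longlonglongrightarrow> g (x', t)" by (rule tendsto_eventually)
    qed
    from completion_ex_borel_measurable_real[OF this] show ?thesis by auto
  qed
  then obtain G where G: "\<And>t. t \<in> {a, b} \<Longrightarrow> G t \<in> borel_measurable borel"
    "\<And>t. t \<in> {a, b} \<Longrightarrow> AE x' in lborel. g (x', t) = G t x'" by metis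
  have sd: "sobolev_dist_pow p (strip a b) (strip a b \<inter> ball 0 R) (\<phi> k) v =
      pow_int p (strip a b \<inter> ball 0 R) (\<lambda>x. \<phi> k x - v' x) + (\<Sum>e\<in>Basis. pow_int p (strip a b \<inter> ball 0 R) (\<lambda>x. partial_deriv e (\<phi> k) x - w e x))" for k R
    by (rule sobolev_dist_pow_eq[OF _ v'(2) w(2)]) auto
  \<comment> \<open>\<open>has_trace\<close> speaks of positive radii only; \<open>max 1\<close>
    keeps the radius positive for every R.\<close>
  have sub: "ball 0 R \<times> {a<..<b} \<subseteq> strip a b \<inter> ball (0 :: 'a \<times> real) (max 1 (R + (\<bar>a\<bar> + \<bar>b\<bar>)))" for R
    using ball_times_subset_strip[of R a b] by auto
  show ?thesis
  proof (rule that)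
    show "trace_approx p a b v' w G \<phi>"
      unfolding trace_approx_def
    proof (intro conjI allI ballI v'(1) w(1) G(1) \<phi>)
      fix R
      show "(\<lambda>k. pow_int p (ball 0 R \<times> {a<..<b}) (\<lambda>x. \<phi> k x - v' x)) \<longlonglongrightarrow> 0"
      proof (rule ennreal_tendsto_0_le[OF lim(1)[of "max 1 (R + (\<bar>a\<bar> + \<bar>b\<bar>))"]])
        show "pow_int p (ball 0 R \<times> {a<..<b}) (\<lambda>x. \<phi> k x - v' x) \<le>
          sobolev_dist_pow p (strip a b) (strip a b \<inter> ball 0 (max 1 (R + (\<bar>a\<bar> + \<bar>b\<bar>)))) (\<phi> k) v" for k
          unfolding sd by (rule order_trans[OF pow_int_mono_set[OF sub]]) simp
      qed simp
      fix e :: "'a \<times> real" assume e: "e \<in> Basis"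
      show "(\<lambda>k. pow_int p (ball 0 R \<times> {a<..<b}) (\<lambda>x. partial_deriv e (\<phi> k) x - w e x)) \<longlonglongrightarrow> 0"
      proof (rule ennreal_tendsto_0_le[OF lim(1)[of "max 1 (R + (\<bar>a\<bar> + \<bar>b\<bar>))"]])
        fix k
        have "pow_int p (ball 0 R \<times> {a<..<b}) (\<lambda>x. partial_deriv e (\<phi> k) x - w e x) \<le>
           pow_int p (strip a b \<inter> ball 0 (max 1 (R + (\<bar>a\<bar> + \<bar>b\<bar>)))) (\<lambda>x. partial_deriv e (\<phi> k) x - w e x)"
          by (rule pow_int_mono_set[OF sub])
        also have "\<dots> \<le> (\<Sum>e\<in>Basis. pow_int p (strip a b \<inter> ball 0 (max 1 (R + (\<bar>a\<bar> + \<bar>b\<bar>)))) (\<lambda>x. partial_deriv e (\<phi> k) x - w e x))"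
          using e by (intro member_le_sum) auto
        also have "\<dots> \<le> sobolev_dist_pow p (strip a b) (strip a b \<inter> ball 0 (max 1 (R + (\<bar>a\<bar> + \<bar>b\<bar>)))) (\<phi> k) v"
          unfolding sd by simp
        finally show "pow_int p (ball 0 R \<times> {a<..<b}) (\<lambda>x. partial_deriv e (\<phi> k) x - w e x) \<le>
          sobolev_dist_pow p (strip a b) (strip a b \<inter> ball 0 (max 1 (R + (\<bar>a\<bar> + \<bar>b\<bar>)))) (\<phi> k) v" .
      qed simp
    next
      fix R t assume t: "t \<in> {a, b}"
      have eq: "(\<integral>\<^sup>+x'\<in>ball 0 (max 1 R). ennreal (\<bar>\<phi> k (x', t) - g (x', t)\<bar> powr p) \<partial>lebesgue) = pow_int p (ball 0 (max 1 R)) (\<lambda>x'. \<phi> k (x', t) - G t x')" for k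
        unfolding nn_integral_lebesgue_eq_pow_int
        by (rule pow_int_cong_AE, use G(2)[OF t] in eventually_elim) auto
      show "(\<lambda>k. pow_int p (ball 0 R) (\<lambda>x'. \<phi> k (x', t) - G t x')) \<longlonglongrightarrow> 0"
        using lim(2)[OF _ t, of "max 1 R"] unfolding eq
        by (rule ennreal_tendsto_0_le) (auto intro!: pow_int_mono_set)
    qed auto
  qed (rule G(2))
qed

section \<open>Passing to the limit in inequalities\<close>

lemma pow_int_add_le_weighted:
  assumes [measurable]: "f \<in> borel_measurable borel" "g \<in> borel_measurable borel" "S \<in> sets borel"
    and p: "1 \<le> p" and \<theta>: "0 < \<theta>" "\<theta> < 1"
  shows "pow_int p S (\<lambda>x. f x + g x) \<le> ennreal ((1 - \<theta>) powr (1 - p)) * pow_int p S f + ennreal (\<theta> powr (1 - p)) * pow_int p S g"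
proof -
  have "pow_int p S (\<lambda>x. f x + g x) \<le>
      (\<integral>\<^sup>+x. ennreal ((1 - \<theta>) powr (1 - p)) * (ennreal (\<bar>f x\<bar> powr p) * indicator S x)
        + ennreal (\<theta> powr (1 - p)) * (ennreal (\<bar>g x\<bar> powr p) * indicator S x) \<partial>lborel)"
    unfolding pow_int_def using powr_abs_add_le_weighted[OF p \<theta>]
    by (intro nn_integral_mono) (auto simp: indicator_def simp flip: ennreal_mult' ennreal_plus intro!: ennreal_leI)
  also have "\<dots> = ennreal ((1 - \<theta>) powr (1 - p)) * pow_int p S f + ennreal (\<theta> powr (1 - p)) * pow_int p S g"
    unfolding pow_int_def by (simp add: nn_integral_add nn_integral_cmult)
  finally show ?thesis .
qed

text \<open>The weighted triangle inequality loses a factor \<open>A \<theta>\<close> twice, but \<open>A \<theta>\<close> tends to \<open>1\<close>, so the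
  constant \<open>C\<close> survives the limit.\<close>

lemma ennreal_limit_le:
  fixes X Y C :: ennreal and Xk Yk D E P :: "nat \<Rightarrow> ennreal"
  assumes X: "\<And>\<theta> k. 0 < \<theta> \<Longrightarrow> \<theta> < 1 \<Longrightarrow> X \<le> ennreal ((1 - \<theta>) powr (1 - p)) * Xk k + ennreal (\<theta> powr (1 - p)) * D k"
    and Xk: "\<And>k. Xk k \<le> C * Yk k + P k"
    and Yk: "\<And>\<theta> k. 0 < \<theta> \<Longrightarrow> \<theta> < 1 \<Longrightarrow> Yk k \<le> ennreal ((1 - \<theta>) powr (1 - p)) * Y + ennreal (\<theta> powr (1 - p)) * E k"
    and lim: "D \<longlonglongrightarrow> 0" "E \<longlonglongrightarrow> 0" "P \<longlonglongrightarrow> 0" and C: "C < top"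
  shows "X \<le> C * Y"
proof (cases "C * Y = top")
  case False
  have *: "X \<le> C * Y * ennreal ((1 - \<theta>) powr (1 - p) * (1 - \<theta>) powr (1 - p))" if \<theta>: "0 < \<theta>" "\<theta> < 1" for \<theta>
  proof -
    define A where "A = ennreal ((1 - \<theta>) powr (1 - p))"
    define B where "B = ennreal (\<theta> powr (1 - p))"
    have AB: "A < top" "B < top" by (auto simp: A_def B_def)
    have "X \<le> C * Y * (A * A) + (A * C * B * E k + (A * P k + B * D k))" for k
    proof -
      have "X \<le> A * Xk k + B * D k" unfolding A_def B_def by (rule X[OF \<theta>])
      also have "\<dots> \<le> A * (C * (A * Y + B * E k) + P k) + B * D k"
        unfolding A_def B_def using Xk Yk[OF \<theta>]
        by (intro add_right_mono mult_left_mono order_trans[OF Xk] add_mono) auto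
      also have "\<dots> = C * Y * (A * A) + (A * C * B * E k + (A * P k + B * D k))"
        by (simp add: distrib_left mult_ac add_ac)
      finally show ?thesis .
    qed
    moreover have "(\<lambda>k. C * Y * (A * A) + (A * C * B * E k + (A * P k + B * D k))) \<longlonglongrightarrow> C * Y * (A * A) + 0"
      using AB C lim
      by (intro tendsto_add tendsto_const ennreal_tendsto_0_add ennreal_tendsto_0_cmult) (auto simp: ennreal_mult_less_top)
    ultimately have "X \<le> C * Y * (A * A) + 0" by (intro LIMSEQ_le_const) auto
    then show ?thesis by (simp add: A_def ennreal_mult')
  qed
  have "(\<lambda>n. (1 - 1 / real (n + 2)) powr (1 - p)) \<longlonglongrightarrow> (1 - 0) powr (1 - p)"
    by (intro tendsto_powr tendsto_diff tendsto_const LIMSEQ_ignore_initial_segment[OF lim_1_over_n]) auto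
  then have "(\<lambda>n. ennreal ((1 - 1 / real (n + 2)) powr (1 - p) * (1 - 1 / real (n + 2)) powr (1 - p))) \<longlonglongrightarrow> ennreal (1 * 1)"
    by (intro tendsto_ennrealI tendsto_mult) auto
  then have "(\<lambda>n. C * Y * ennreal ((1 - 1 / real (n + 2)) powr (1 - p) * (1 - 1 / real (n + 2)) powr (1 - p))) \<longlonglongrightarrow> C * Y * ennreal (1 * 1)"
    using False by (intro ennreal_tendsto_cmult) (auto simp: less_top[symmetric])
  moreover have "X \<le> C * Y * ennreal ((1 - 1 / real (n + 2)) powr (1 - p) * (1 - 1 / real (n + 2)) powr (1 - p))" for n
    by (rule *) (auto simp: field_simps)
  ultimately have "X \<le> C * Y * ennreal (1 * 1)" by (intro LIMSEQ_le_const) auto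
  then show ?thesis by simp
qed simp

lemma nn_integral_UN_le:
  fixes f :: "'a \<Rightarrow> ennreal"
  assumes [measurable]: "f \<in> borel_measurable M" "\<And>n. A n \<in> sets M" and inc: "incseq A"
    and le: "\<And>n::nat. (\<integral>\<^sup>+x\<in>A n. f x \<partial>M) \<le> C"
  shows "(\<integral>\<^sup>+x\<in>(\<Union>n. A n). f x \<partial>M) \<le> C"
proof -
  have "(\<integral>\<^sup>+x\<in>(\<Union>n. A n). f x \<partial>M) \<le> (\<integral>\<^sup>+x. (SUP n. f x * indicator (A n) x) \<partial>M)"
  proof (rule nn_integral_mono)
    fix x
    show "f x * indicator (\<Union>n. A n) x \<le> (SUP n. f x * indicator (A n) x)"
    proof (cases "x \<in> (\<Union>n. A n)")
      case True
      then obtain n where "x \<in> A n" by auto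
      then show ?thesis using True by (intro SUP_upper2[of n]) auto
    qed auto
  qed
  also have "\<dots> = (SUP n. \<integral>\<^sup>+x. f x * indicator (A n) x \<partial>M)"
  proof (rule nn_integral_monotone_convergence_SUP)
    show "incseq (\<lambda>n x. f x * indicator (A n) x)"
      using inc by (auto simp: incseq_def le_fun_def indicator_def split: if_splits intro!: mult_left_mono)
  qed measurable
  also have "\<dots> \<le> C" using le by (intro SUP_least)
  finally show ?thesis .
qed

lemma pow_int_UNIV_le:
  fixes f :: "'a::euclidean_space \<Rightarrow> real"
  assumes [measurable]: "f \<in> borel_measurable borel" and le: "\<And>n::nat. pow_int p (ball 0 (real n)) f \<le> C"
  shows "pow_int p UNIV f \<le> C"
proof -
  have U: "(\<Union>n::nat. ball (0::'a) (real n)) = UNIV"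
    using reals_Archimedean2 by (auto simp: set_eq_iff)
  have "(\<integral>\<^sup>+x\<in>(\<Union>n::nat. ball (0::'a) (real n)). ennreal (\<bar>f x\<bar> powr p) \<partial>lborel) \<le> C"
    using le by (intro nn_integral_UN_le) (auto simp: pow_int_def incseq_def intro!: subset_ball)
  then show ?thesis by (simp add: U pow_int_def)
qed

lemma AE_lborel_translate:
  fixes x :: "'a::euclidean_space"
  assumes "AE y in lborel. P y"
  shows "AE h in lborel. P (x + h)"
proof -
  obtain N where N: "{y \<in> space lborel. \<not> P y} \<subseteq> N" "emeasure lborel N = 0" "N \<in> sets lborel"
    using AE_E[OF assms] by metis
  have [measurable]: "N \<in> sets borel" using N by simp
  have "(\<integral>\<^sup>+h. indicator N (x + 1 *\<^sub>R h) \<partial>lborel) = ennreal (1 / \<bar>1\<bar> ^ DIM('a)) * (\<integral>\<^sup>+y. indicator N y \<partial>lborel)"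
    by (rule nn_integral_lborel_affine) auto
  also have "\<dots> = 0" using N by simp
  finally have "AE h in lborel. indicator N (x + 1 *\<^sub>R h) = (0::ennreal)"
    by (subst (asm) nn_integral_0_iff_AE) auto
  then show ?thesis by eventually_elim (use N(1) in \<open>auto simp: indicator_def split: if_splits\<close>)
qed

lemma ennreal_powr_inverse:
  assumes "0 < p"
  shows "ennreal_powr (ennreal_powr x (1 / p)) p = x"
  using assms by (cases x) (auto simp: ennreal_powr_def powr_powr)

section \<open>Differences of the two traces\<close>

text \<open>The fundamental theorem and Jensen's inequality on each vertical segment, then
  integration over A. The antiderivative F is left general because it is used for a smooth function
  itself and for one corrected by a linear weight times another.\<close>

lemma slice_diff_le:
  fixes f :: "'a::euclidean_space \<times> real \<Rightarrow> real"
  assumes f: "continuous_on UNIV f" and F: "\<And>x s. (F x has_real_derivative f (x, s)) (at s)"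
    and [measurable]: "A \<in> sets borel" and p: "1 \<le> p" and ab: "a < b"
  shows "pow_int p A (\<lambda>x. F x b - F x a) \<le> ennreal ((b - a) powr (p - 1)) * pow_int p (A \<times> {a<..<b}) f"
proof -
  have [measurable]: "f \<in> borel_measurable borel" using f by (rule borel_measurable_continuous_onI)
  have pt: "ennreal (\<bar>F x b - F x a\<bar> powr p) \<le> ennreal ((b - a) powr (p - 1)) * (\<integral>\<^sup>+s\<in>{a<..<b}. ennreal (\<bar>f (x, s)\<bar> powr p) \<partial>lborel)" for x
  proof -
    have c: "continuous_on UNIV (\<lambda>s. f (x, s))"
      by (rule continuous_on_compose2[OF f]) (auto intro!: continuous_intros)
    have "F x b - F x a = (\<integral>s. f (x, s) * indicator {a<..<b} s \<partial>lborel)"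
      using ab by (intro interval_FTC[symmetric] F c) auto
    then show ?thesis
      using interval_powr_integral_diff_le[OF p c, of "\<lambda>s. 0" a b] ab by simp
  qed
  have "pow_int p A (\<lambda>x. F x b - F x a) \<le>
      (\<integral>\<^sup>+x. ennreal ((b - a) powr (p - 1)) * ((\<integral>\<^sup>+s\<in>{a<..<b}. ennreal (\<bar>f (x, s)\<bar> powr p) \<partial>lborel) * indicator A x) \<partial>lborel)"
    unfolding pow_int_def
  proof (rule nn_integral_mono)
    fix x
    show "ennreal (\<bar>F x b - F x a\<bar> powr p) * indicator A x \<le>
      ennreal ((b - a) powr (p - 1)) * ((\<integral>\<^sup>+s\<in>{a<..<b}. ennreal (\<bar>f (x, s)\<bar> powr p) \<partial>lborel) * indicator A x)"
      using pt[of x] by (cases "x \<in> A") auto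
  qed
  also have "\<dots> = ennreal ((b - a) powr (p - 1)) * pow_int p (A \<times> {a<..<b}) f"
    by (simp add: nn_integral_cmult pow_int_Times)
  finally show ?thesis .
qed

lemma pow_int_le_weighted_diff:
  assumes [measurable]: "f \<in> borel_measurable borel" "g \<in> borel_measurable borel" "S \<in> sets borel"
    and p: "1 \<le> p" and \<theta>: "0 < \<theta>" "\<theta> < 1"
  shows "pow_int p S f \<le> ennreal ((1 - \<theta>) powr (1 - p)) * pow_int p S g + ennreal (\<theta> powr (1 - p)) * pow_int p S (\<lambda>x. f x - g x)"
  using pow_int_add_le_weighted[of g "\<lambda>x. f x - g x" S p \<theta>] p \<theta> by simp

lemma trace_difference_le:
  fixes v :: "'a::euclidean_space \<times> real \<Rightarrow> real"
  assumes tr: "trace_approx p a b v w G \<phi>" and p: "1 \<le> p" and ab: "a < b"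
  shows "pow_int p UNIV (\<lambda>x. G b x - G a x) \<le> ennreal ((b - a) powr (p - 1)) * pow_int p (strip a b) (w (0, 1))"
proof -
  let ?e = "(0, 1) :: 'a \<times> real"
  have \<phi>: "\<And>k. smooth (\<phi> k)" and [measurable]: "w ?e \<in> borel_measurable borel" "G a \<in> borel_measurable borel" "G b \<in> borel_measurable borel"
    using tr e_N_Basis by (auto simp: trace_approx_def)
  have D\<phi>: "smooth (partial_deriv ?e (\<phi> k))" for k by (intro smooth_partial_deriv \<phi> e_N_Basis)
  note [measurable] = smooth_borel_measurable[OF \<phi>] smooth_borel_measurable[OF D\<phi>]
  have sl[measurable]: "(\<lambda>x. \<phi> k (x, t)) \<in> borel_measurable borel" for k t
    by (intro borel_measurable_continuous_onI smooth_slice_continuous \<phi>)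
  show ?thesis
  proof (rule pow_int_UNIV_le)
    fix n :: nat
    let ?B = "ball (0::'a) (real n)"
    let ?Q = "?B \<times> {a<..<b}"
    have [measurable]: "?Q \<in> sets borel" by (intro borel_open open_Times) auto
    have "pow_int p ?B (\<lambda>x. G b x - G a x) \<le> ennreal ((b - a) powr (p - 1)) * pow_int p ?Q (w ?e)"
    proof (rule ennreal_limit_le)
      fix \<theta> :: real and k assume \<theta>: "0 < \<theta>" "\<theta> < 1"
      show "pow_int p ?B (\<lambda>x. G b x - G a x) \<le> ennreal ((1 - \<theta>) powr (1 - p)) * pow_int p ?B (\<lambda>x. \<phi> k (x, b) - \<phi> k (x, a))
          + ennreal (\<theta> powr (1 - p)) * pow_int p ?B (\<lambda>x. (G b x - G a x) - (\<phi> k (x, b) - \<phi> k (x, a)))"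
        by (rule pow_int_le_weighted_diff[OF _ _ _ p \<theta>]) auto
      show "pow_int p ?Q (partial_deriv ?e (\<phi> k)) \<le> ennreal ((1 - \<theta>) powr (1 - p)) * pow_int p ?Q (w ?e)
          + ennreal (\<theta> powr (1 - p)) * pow_int p ?Q (\<lambda>x. partial_deriv ?e (\<phi> k) x - w ?e x)"
        by (rule pow_int_le_weighted_diff[OF _ _ _ p \<theta>]) auto
    next
      show "pow_int p ?B (\<lambda>x. \<phi> k (x, b) - \<phi> k (x, a)) \<le> ennreal ((b - a) powr (p - 1)) * pow_int p ?Q (partial_deriv ?e (\<phi> k)) + 0" for k
        using slice_diff_le[OF smooth_continuous[OF D\<phi>] smooth_slice_derivative[OF \<phi>] _ p ab, of ?B k] by simp
      show "(\<lambda>k. pow_int p ?Q (\<lambda>x. partial_deriv ?e (\<phi> k) x - w ?e x)) \<longlonglongrightarrow> 0"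
        using tr e_N_Basis by (auto simp: trace_approx_def)
      show "(\<lambda>k. pow_int p ?B (\<lambda>x. (G b x - G a x) - (\<phi> k (x, b) - \<phi> k (x, a)))) \<longlonglongrightarrow> 0"
      proof (rule ennreal_tendsto_0_le)
        show "(\<lambda>k. ennreal (2 powr p) * (pow_int p ?B (\<lambda>x. \<phi> k (x, b) - G b x) + pow_int p ?B (\<lambda>x. \<phi> k (x, a) - G a x))) \<longlonglongrightarrow> 0"
          using tr by (intro ennreal_tendsto_0_cmult ennreal_tendsto_0_add) (auto simp: trace_approx_def)
        fix k
        have "(\<lambda>x. (G b x - G a x) - (\<phi> k (x, b) - \<phi> k (x, a))) = (\<lambda>x. (G b x - \<phi> k (x, b)) + (\<phi> k (x, a) - G a x))" by auto
        moreover have "pow_int p ?B (\<lambda>x. (G b x - \<phi> k (x, b)) + (\<phi> k (x, a) - G a x)) \<le> ennreal (2 powr p) *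
            (pow_int p ?B (\<lambda>x. G b x - \<phi> k (x, b)) + pow_int p ?B (\<lambda>x. \<phi> k (x, a) - G a x))"
          using p by (intro pow_int_add_le) auto
        ultimately show "pow_int p ?B (\<lambda>x. (G b x - G a x) - (\<phi> k (x, b) - \<phi> k (x, a))) \<le> ennreal (2 powr p) *
            (pow_int p ?B (\<lambda>x. \<phi> k (x, b) - G b x) + pow_int p ?B (\<lambda>x. \<phi> k (x, a) - G a x))"
          by (simp only: pow_int_minus_commute[of p ?B "\<lambda>x. \<phi> k (x, b)" "G b"])
      qed
    qed auto
    also have "\<dots> \<le> ennreal ((b - a) powr (p - 1)) * pow_int p (strip a b) (w ?e)"
      by (intro mult_left_mono pow_int_mono_set) (auto simp: strip_def)
    finally show "pow_int p ?B (\<lambda>x. G b x - G a x) \<le> ennreal ((b - a) powr (p - 1)) * pow_int p (strip a b) (w ?e)" .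
  qed simp
qed

text \<open>Subtracting \<open>(s - m) \<psi>(x', s)\<close> with \<open>m\<close> the midpoint turns the left-hand side into the
  integral of \<open>\<partial>\<^sub>N \<phi> - \<psi> - (s - m) \<partial>\<^sub>N \<psi>\<close>, whose first two terms cancel in the limit.\<close>

lemma trace_trapezoid_le:
  fixes u :: "'a::euclidean_space \<times> real \<Rightarrow> real"
  assumes tru: "trace_approx p a b u V H \<phi>" and tr: "trace_approx p a b (V (0, 1)) w G \<psi>" and p: "1 \<le> p" and ab: "a < b"
  shows "pow_int p UNIV (\<lambda>x. H b x - H a x - (G b x + G a x) * ((b - a) / 2)) \<le>
    ennreal ((b - a) powr (2 * p - 1)) * pow_int p (strip a b) (w (0, 1))"
proof -
  let ?e = "(0, 1) :: 'a \<times> real"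
  define L where "L = b - a"
  define m where "m = (a + b) / 2"
  have L: "0 < L" using ab by (simp add: L_def)
  have \<phi>: "\<And>k. smooth (\<phi> k)" and \<psi>: "\<And>k. smooth (\<psi> k)"
    and [measurable]: "w ?e \<in> borel_measurable borel" "V ?e \<in> borel_measurable borel"
      "G a \<in> borel_measurable borel" "G b \<in> borel_measurable borel" "H a \<in> borel_measurable borel" "H b \<in> borel_measurable borel"
    using tru tr e_N_Basis by (auto simp: trace_approx_def)
  have D\<phi>: "smooth (partial_deriv ?e (\<phi> k))" and D\<psi>: "smooth (partial_deriv ?e (\<psi> k))" for k
    by (intro smooth_partial_deriv \<phi> \<psi> e_N_Basis)+
  note [measurable] = smooth_borel_measurable[OF \<phi>] smooth_borel_measurable[OF D\<phi>]
    smooth_borel_measurable[OF \<psi>] smooth_borel_measurable[OF D\<psi>]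
  have sl[measurable]: "(\<lambda>x. \<phi> k (x, t)) \<in> borel_measurable borel" "(\<lambda>x. \<psi> k (x, t)) \<in> borel_measurable borel" for k t
    by (intro borel_measurable_continuous_onI smooth_slice_continuous \<phi> \<psi>)+
  let ?X = "\<lambda>x. H b x - H a x - (G b x + G a x) * (L / 2)"
  let ?Xk = "\<lambda>k x. \<phi> k (x, b) - \<phi> k (x, a) - (\<psi> k (x, b) + \<psi> k (x, a)) * (L / 2)"
  have Xm[measurable]: "?X \<in> borel_measurable borel" "\<And>k. ?Xk k \<in> borel_measurable borel" by measurable
  have "pow_int p UNIV ?X \<le> ennreal (L powr (2 * p - 1)) * pow_int p (strip a b) (w ?e)"
  proof (rule pow_int_UNIV_le[OF Xm(1)])
    fix n :: nat
    let ?B = "ball (0::'a) (real n)"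
    let ?Q = "?B \<times> {a<..<b}"
    have [measurable]: "?Q \<in> sets borel" by (intro borel_open open_Times) auto
    let ?P = "\<lambda>k. ennreal (L powr (p - 1) * 2 powr p) * pow_int p ?Q (\<lambda>z. partial_deriv ?e (\<phi> k) z - \<psi> k z)"
    have "pow_int p ?B ?X \<le> ennreal (L powr (2 * p - 1)) * pow_int p ?Q (w ?e)"
    proof (rule ennreal_limit_le)
      fix \<theta> :: real and k assume \<theta>: "0 < \<theta>" "\<theta> < 1"
      show "pow_int p ?B ?X \<le> ennreal ((1 - \<theta>) powr (1 - p)) * pow_int p ?B (?Xk k)
          + ennreal (\<theta> powr (1 - p)) * pow_int p ?B (\<lambda>x. ?X x - ?Xk k x)"
        by (rule pow_int_le_weighted_diff[OF Xm _ p \<theta>]) auto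
      show "pow_int p ?Q (partial_deriv ?e (\<psi> k)) \<le> ennreal ((1 - \<theta>) powr (1 - p)) * pow_int p ?Q (w ?e)
          + ennreal (\<theta> powr (1 - p)) * pow_int p ?Q (\<lambda>x. partial_deriv ?e (\<psi> k) x - w ?e x)"
        by (rule pow_int_le_weighted_diff[OF _ _ _ p \<theta>]) auto
    next
      fix k
      let ?f = "\<lambda>z. (partial_deriv ?e (\<phi> k) z - \<psi> k z) + - ((snd z - m) * partial_deriv ?e (\<psi> k) z)"
      let ?F = "\<lambda>x s. \<phi> k (x, s) - (s - m) * \<psi> k (x, s)"
      have "pow_int p ?Q (\<lambda>z. - ((snd z - m) * partial_deriv ?e (\<psi> k) z)) \<le> pow_int p ?Q (\<lambda>z. (L / 2) * partial_deriv ?e (\<psi> k) z)"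
      proof (rule pow_int_mono)
        fix z assume "z \<in> ?Q"
        then have "\<bar>snd z - m\<bar> \<le> \<bar>L / 2\<bar>" by (auto simp: L_def m_def abs_le_iff field_simps)
        then show "\<bar>- ((snd z - m) * partial_deriv ?e (\<psi> k) z)\<bar> \<le> \<bar>(L / 2) * partial_deriv ?e (\<psi> k) z\<bar>"
          unfolding abs_minus_cancel abs_mult by (intro mult_right_mono) auto
      qed (use p in simp)
      also have "\<dots> = ennreal ((L / 2) powr p) * pow_int p ?Q (partial_deriv ?e (\<psi> k))"
        using L by (subst pow_int_cmult) auto
      finally have mid: "pow_int p ?Q (\<lambda>z. - ((snd z - m) * partial_deriv ?e (\<psi> k) z)) \<le>
          ennreal ((L / 2) powr p) * pow_int p ?Q (partial_deriv ?e (\<psi> k))" .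
      \<comment> \<open>At the end points s - m is plus or minus L / 2, so the correction term
        contributes exactly the sum of the boundary values of \<psi> times L / 2.\<close>
      have "pow_int p ?B (?Xk k) = pow_int p ?B (\<lambda>x. ?F x b - ?F x a)"
        by (rule pow_int_cong) (simp add: L_def m_def field_simps)
      also have "\<dots> \<le> ennreal (L powr (p - 1)) * pow_int p ?Q ?f"
        unfolding L_def
      proof (rule slice_diff_le[OF _ _ _ p ab])
        show "continuous_on UNIV ?f"
          by (intro continuous_intros smooth_continuous \<psi> D\<phi> D\<psi>)
        show "(?F x has_real_derivative ?f (x, s)) (at s)" for x s
          by (auto intro!: derivative_eq_intros smooth_slice_derivative[OF \<phi>] smooth_slice_derivative[OF \<psi>])
      qed simp
      also have "\<dots> \<le> ennreal (L powr (p - 1)) * (ennreal (2 powr p) * (pow_int p ?Q (\<lambda>z. partial_deriv ?e (\<phi> k) z - \<psi> k z)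
          + pow_int p ?Q (\<lambda>z. - ((snd z - m) * partial_deriv ?e (\<psi> k) z))))"
        using p by (intro mult_left_mono pow_int_add_le) auto
      also have "\<dots> \<le> ennreal (L powr (p - 1)) * (ennreal (2 powr p) * (pow_int p ?Q (\<lambda>z. partial_deriv ?e (\<phi> k) z - \<psi> k z)
          + ennreal ((L / 2) powr p) * pow_int p ?Q (partial_deriv ?e (\<psi> k))))"
        by (intro mult_left_mono add_left_mono mid) auto
      also have "\<dots> = ennreal (L powr (p - 1) * 2 powr p * (L / 2) powr p) * pow_int p ?Q (partial_deriv ?e (\<psi> k)) + ?P k"
        by (simp add: distrib_left mult.assoc ennreal_mult' add.commute)
      \<comment> \<open>Jensen gives L^(p-1), the triangle inequality 2^p, and the bound L / 2 for
        |s - m| the last factor; the powers of 2 cancel and leave the exact constant.\<close>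
      also have "L powr (p - 1) * 2 powr p * (L / 2) powr p = L powr (2 * p - 1)"
        using L by (simp add: powr_divide powr_add[symmetric])
      finally show "pow_int p ?B (?Xk k) \<le> ennreal (L powr (2 * p - 1)) * pow_int p ?Q (partial_deriv ?e (\<psi> k)) + ?P k" .
    next
      show "(\<lambda>k. pow_int p ?Q (\<lambda>x. partial_deriv ?e (\<psi> k) x - w ?e x)) \<longlonglongrightarrow> 0"
        using tr e_N_Basis by (auto simp: trace_approx_def)
      have 1: "(\<lambda>k. pow_int p ?Q (\<lambda>x. partial_deriv ?e (\<phi> k) x - V ?e x)) \<longlonglongrightarrow> 0"
        using tru e_N_Basis by (auto simp: trace_approx_def)
      have "(\<lambda>k. pow_int p ?Q (\<lambda>x. \<psi> k x - V ?e x)) \<longlonglongrightarrow> 0"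
        using tr by (auto simp: trace_approx_def)
      then have 2: "(\<lambda>k. pow_int p ?Q (\<lambda>x. V ?e x - \<psi> k x)) \<longlonglongrightarrow> 0"
        by (simp only: pow_int_minus_commute[of p ?Q "V ?e"])
      have "(\<lambda>k. pow_int p ?Q (\<lambda>z. partial_deriv ?e (\<phi> k) z - \<psi> k z)) \<longlonglongrightarrow> 0"
        by (rule ennreal_tendsto_0_le[OF ennreal_tendsto_0_cmult[OF ennreal_tendsto_0_add[OF 1 2], of "ennreal (2 powr p)"] pow_int_diff_le])
           (use p in auto)
      then show "?P \<longlonglongrightarrow> 0" by (rule ennreal_tendsto_0_cmult) simp
      show "(\<lambda>k. pow_int p ?B (\<lambda>x. ?X x - ?Xk k x)) \<longlonglongrightarrow> 0"
      proof (rule ennreal_tendsto_0_le)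
        let ?bound = "\<lambda>k. ennreal (2 powr p) * ((ennreal (2 powr p) * (pow_int p ?B (\<lambda>x. \<phi> k (x, b) - H b x) + pow_int p ?B (\<lambda>x. \<phi> k (x, a) - H a x)))
          + ennreal ((L / 2) powr p) * (ennreal (2 powr p) * (pow_int p ?B (\<lambda>x. \<psi> k (x, b) - G b x) + pow_int p ?B (\<lambda>x. \<psi> k (x, a) - G a x))))"
        show "?bound \<longlonglongrightarrow> 0"
          using tru tr by (intro ennreal_tendsto_0_cmult ennreal_tendsto_0_add) (auto simp: trace_approx_def)
        fix k
        have "pow_int p ?B (\<lambda>x. ?X x - ?Xk k x) = pow_int p ?B (\<lambda>x. ((H b x - \<phi> k (x, b)) + (\<phi> k (x, a) - H a x))
            + (L / 2) * ((\<psi> k (x, b) - G b x) + (\<psi> k (x, a) - G a x)))"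
          by (rule pow_int_cong) (simp add: field_simps)
        also have "\<dots> \<le> ennreal (2 powr p) * (pow_int p ?B (\<lambda>x. (H b x - \<phi> k (x, b)) + (\<phi> k (x, a) - H a x))
            + pow_int p ?B (\<lambda>x. (L / 2) * ((\<psi> k (x, b) - G b x) + (\<psi> k (x, a) - G a x))))"
          using p by (intro pow_int_add_le) auto
        also have "pow_int p ?B (\<lambda>x. (L / 2) * ((\<psi> k (x, b) - G b x) + (\<psi> k (x, a) - G a x))) =
            ennreal ((L / 2) powr p) * pow_int p ?B (\<lambda>x. (\<psi> k (x, b) - G b x) + (\<psi> k (x, a) - G a x))"
          using L by (subst pow_int_cmult) auto
        also have "ennreal (2 powr p) * (pow_int p ?B (\<lambda>x. (H b x - \<phi> k (x, b)) + (\<phi> k (x, a) - H a x)) +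
            ennreal ((L / 2) powr p) * pow_int p ?B (\<lambda>x. (\<psi> k (x, b) - G b x) + (\<psi> k (x, a) - G a x)))
          \<le> ennreal (2 powr p) * ((ennreal (2 powr p) * (pow_int p ?B (\<lambda>x. H b x - \<phi> k (x, b)) + pow_int p ?B (\<lambda>x. \<phi> k (x, a) - H a x)))
          + ennreal ((L / 2) powr p) * (ennreal (2 powr p) * (pow_int p ?B (\<lambda>x. \<psi> k (x, b) - G b x) + pow_int p ?B (\<lambda>x. \<psi> k (x, a) - G a x))))"
          using p by (intro mult_left_mono add_mono pow_int_add_le) auto
        also have "pow_int p ?B (\<lambda>x. H b x - \<phi> k (x, b)) = pow_int p ?B (\<lambda>x. \<phi> k (x, b) - H b x)" by (rule pow_int_minus_commute)
        finally show "pow_int p ?B (\<lambda>x. ?X x - ?Xk k x) \<le> ?bound k" .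
      qed
    qed auto
    also have "\<dots> \<le> ennreal (L powr (2 * p - 1)) * pow_int p (strip a b) (w ?e)"
      by (intro mult_left_mono pow_int_mono_set) (auto simp: strip_def)
    finally show "pow_int p ?B ?X \<le> ennreal (L powr (2 * p - 1)) * pow_int p (strip a b) (w ?e)" .
  qed
  then show ?thesis by (simp add: L_def)
qed

section \<open>The truncated seminorm of a trace\<close>

lemma nn_integral_powr_tail:
  fixes \<gamma> c :: real
  assumes "0 < \<gamma>" "0 < c"
  shows "(\<integral>\<^sup>+r. ennreal (\<gamma> * r powr (- \<gamma> - 1)) * indicator {c..} r \<partial>lborel) = ennreal (c powr (- \<gamma>))"
proof -
  have "(\<integral>\<^sup>+r. ennreal (\<gamma> * r powr (- \<gamma> - 1)) * indicator {c..} r \<partial>lborel) = ennreal (0 - (- (c powr (- \<gamma>))))"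
  proof (rule nn_integral_FTC_atLeast[where F="\<lambda>r. - (r powr (- \<gamma>))"])
    show "((\<lambda>r. - (r powr (- \<gamma>))) has_real_derivative \<gamma> * r powr (- \<gamma> - 1)) (at r)" if "c \<le> r" for r
    proof -
      have "0 < r" using that assms by linarith
      from DERIV_minus[OF has_real_derivative_powr[OF this, of "- \<gamma>"]]
      show ?thesis by simp
    qed
    have "((\<lambda>r::real. r powr (- \<gamma>)) \<longlongrightarrow> 0) at_top"
      using assms by (intro tendsto_neg_powr filterlim_ident) auto
    from tendsto_minus[OF this] show "((\<lambda>r. - (r powr (- \<gamma>))) \<longlongrightarrow> 0) at_top" by simp
  qed (use assms in auto)
  then show ?thesis by simp
qed

text \<open>Layer cake: \<open>|h| powr - \<gamma>\<close> is the integral of \<open>\<gamma> r powr (- \<gamma> - 1)\<close> over \<open>r \<ge> |h|\<close>.\<close>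

lemma nn_integral_norm_powr_tail_le:
  fixes \<beta> \<tau> :: real
  assumes \<beta>: "0 < \<beta>" and \<tau>: "0 < \<tau>"
  shows "(\<integral>\<^sup>+h. (if \<tau> \<le> norm h then ennreal (norm h powr (- (real DIM('a) + \<beta>))) else 0) \<partial>(lborel :: 'a::euclidean_space measure))
    \<le> ennreal ((real DIM('a) + \<beta>) * unit_ball_vol (real DIM('a)) / \<beta> * \<tau> powr (- \<beta>))"
proof -
  define d where "d = real DIM('a)"
  define \<gamma> where "\<gamma> = d + \<beta>"
  define V where "V = unit_ball_vol d"
  have d: "0 < d" by (simp add: d_def)
  have \<gamma>: "0 < \<gamma>" using d \<beta> by (simp add: \<gamma>_def)
  have V: "0 \<le> V" using d by (simp add: V_def)
  have "(\<integral>\<^sup>+h. (if \<tau> \<le> norm h then ennreal (norm h powr (- \<gamma>)) else 0) \<partial>(lborel :: 'a measure)) =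
    (\<integral>\<^sup>+h. (\<integral>\<^sup>+r. (if \<tau> \<le> norm h \<and> norm h \<le> r then ennreal (\<gamma> * r powr (- \<gamma> - 1)) else 0) \<partial>lborel) \<partial>(lborel :: 'a measure))"
  proof (rule nn_integral_cong)
    fix h :: 'a
    show "(if \<tau> \<le> norm h then ennreal (norm h powr (- \<gamma>)) else 0) =
      (\<integral>\<^sup>+r. (if \<tau> \<le> norm h \<and> norm h \<le> r then ennreal (\<gamma> * r powr (- \<gamma> - 1)) else 0) \<partial>lborel)"
    proof (cases "\<tau> \<le> norm h")
      case True
      then have "ennreal (norm h powr (- \<gamma>)) = (\<integral>\<^sup>+r. ennreal (\<gamma> * r powr (- \<gamma> - 1)) * indicator {norm h..} r \<partial>lborel)"
        using \<gamma> \<tau> by (intro nn_integral_powr_tail[symmetric]) auto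
      also have "\<dots> = (\<integral>\<^sup>+r. (if \<tau> \<le> norm h \<and> norm h \<le> r then ennreal (\<gamma> * r powr (- \<gamma> - 1)) else 0) \<partial>lborel)"
        using True by (intro nn_integral_cong) (auto simp: indicator_def)
      finally show ?thesis using True by simp
    qed simp
  qed
  also have "\<dots> = (\<integral>\<^sup>+r. (\<integral>\<^sup>+h. (if \<tau> \<le> norm h \<and> norm h \<le> r then ennreal (\<gamma> * r powr (- \<gamma> - 1)) else 0) \<partial>(lborel :: 'a measure)) \<partial>lborel)"
    by (rule lborel_pair.Fubini') measurable
  also have "\<dots> \<le> (\<integral>\<^sup>+r. ennreal (\<gamma> * V / \<beta>) * (ennreal (\<beta> * r powr (- \<beta> - 1)) * indicator {\<tau>..} r) \<partial>lborel)"
  proof (rule nn_integral_mono)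
    fix r :: real
    show "(\<integral>\<^sup>+h. (if \<tau> \<le> norm h \<and> norm h \<le> r then ennreal (\<gamma> * r powr (- \<gamma> - 1)) else 0) \<partial>(lborel :: 'a measure))
      \<le> ennreal (\<gamma> * V / \<beta>) * (ennreal (\<beta> * r powr (- \<beta> - 1)) * indicator {\<tau>..} r)"
    proof (cases "\<tau> \<le> r")
      case True
      \<comment> \<open>Dropping the lower bound on |h| leaves the ball of radius r, whose volume V
        r^d turns r^(-\<gamma>-1) into r^(-\<beta>-1), still integrable from \<tau> to
        infinity.\<close>
      then have r: "0 < r" using \<tau> by simp
      have "(\<integral>\<^sup>+h. (if \<tau> \<le> norm h \<and> norm h \<le> r then ennreal (\<gamma> * r powr (- \<gamma> - 1)) else 0) \<partial>(lborel :: 'a measure))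
        \<le> (\<integral>\<^sup>+h. ennreal (\<gamma> * r powr (- \<gamma> - 1)) * indicator (cball (0::'a) r) h \<partial>lborel)"
        by (intro nn_integral_mono) (auto simp: indicator_def)
      also have "\<dots> = ennreal (\<gamma> * r powr (- \<gamma> - 1)) * ennreal (V * r ^ DIM('a))"
        using r by (subst nn_integral_cmult_indicator) (auto simp: emeasure_cball V_def d_def)
      also have "\<dots> = ennreal (\<gamma> * V * (r powr (- \<gamma> - 1) * r powr d))"
        using \<gamma> V r by (simp add: d_def powr_realpow ennreal_mult'[symmetric] mult_ac)
      also have "r powr (- \<gamma> - 1) * r powr d = r powr (- \<beta> - 1)"
        by (simp add: \<gamma>_def powr_add[symmetric])
      also have "ennreal (\<gamma> * V * r powr (- \<beta> - 1)) = ennreal (\<gamma> * V / \<beta>) * ennreal (\<beta> * r powr (- \<beta> - 1))"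
        using \<gamma> V \<beta> by (simp add: ennreal_mult'[symmetric])
      finally show ?thesis using True by simp
    next
      case False
      then have "(\<integral>\<^sup>+h. (if \<tau> \<le> norm h \<and> norm h \<le> r then ennreal (\<gamma> * r powr (- \<gamma> - 1)) else 0) \<partial>(lborel :: 'a measure)) = (\<integral>\<^sup>+h. 0 \<partial>(lborel :: 'a measure))"
        by (intro nn_integral_cong) auto
      then show ?thesis by simp
    qed
  qed
  also have "\<dots> = ennreal (\<gamma> * V / \<beta>) * ennreal (\<tau> powr (- \<beta>))"
    by (subst nn_integral_cmult) (simp_all add: nn_integral_powr_tail[OF \<beta> \<tau>])
  also have "\<dots> = ennreal (\<gamma> * V / \<beta> * \<tau> powr (- \<beta>))"
    using \<gamma> V \<beta> by (simp add: ennreal_mult'[symmetric])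
  finally show ?thesis by (simp only: \<gamma>_def V_def d_def)
qed

text \<open>Jensen's inequality for the measure \<open>\<tau> powr (- 1/2) d\<tau>\<close>. The weight gained on the right is
  what makes the integrals over \<open>h\<close> below converge (Hardy's inequality).\<close>

lemma weighted_interval_powr_le:
  fixes k :: "real \<Rightarrow> real"
  assumes p: "1 \<le> p" and k: "continuous_on UNIV k" and c: "0 < c"
  shows "ennreal (\<bar>\<integral>\<tau>. k \<tau> * indicator {0<..<c} \<tau> \<partial>lborel\<bar> powr p) \<le>
    ennreal ((2 * c powr (1/2)) powr (p - 1)) * (\<integral>\<^sup>+\<tau>\<in>{0<..<c}. ennreal (\<bar>k \<tau>\<bar> powr p * \<tau> powr ((p - 1) / 2)) \<partial>lborel)"
proof -
  have [measurable]: "k \<in> borel_measurable borel" using k by (rule borel_measurable_continuous_onI)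
  let ?M = "density lborel (\<lambda>\<tau>. ennreal (indicator {0<..<c} \<tau> * \<tau> powr (- 1 / 2)))"
  have "(\<integral>\<^sup>+\<tau>. ennreal (indicator {0<..<c} \<tau> * \<tau> powr (- 1 / 2)) \<partial>lborel) = (\<integral>\<^sup>+\<tau>. ennreal (indicator {0..c} \<tau> * \<tau> powr (- 1 / 2)) \<partial>lborel)"
    by (rule nn_integral_cong_AE, use AE_lborel_singleton[of 0] AE_lborel_singleton[of c] in eventually_elim)
       (auto simp: indicator_def)
  also have "\<dots> = ennreal (c powr (- 1 / 2 + 1) / (- 1 / 2 + 1))"
    using has_integral_powr_from_0[of "- 1 / 2" c] c
      nn_integral_has_integral_lebesgue[of "{0..c}" "\<lambda>\<tau>. \<tau> powr (- 1 / 2)" "c powr (- 1 / 2 + 1) / (- 1 / 2 + 1)"]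
    by simp
  also have "c powr (- 1 / 2 + 1) / (- 1 / 2 + 1) = 2 * c powr (1/2)" by simp
  finally have em: "emeasure ?M (space ?M) = ennreal (2 * c powr (1/2))" by (simp add: emeasure_density)
  interpret finite_measure ?M using em by (intro finite_measureI) simp
  have W: "measure ?M (space ?M) = 2 * c powr (1/2)" using em by (simp add: measure_def)
  have "(\<integral>\<tau>. k \<tau> * \<tau> powr (1/2) \<partial>?M) = (\<integral>\<tau>. indicator {0<..<c} \<tau> * \<tau> powr (- 1 / 2) * (k \<tau> * \<tau> powr (1/2)) \<partial>lborel)"
    by (subst integral_real_density) auto
  also have "\<dots> = (\<integral>\<tau>. k \<tau> * indicator {0<..<c} \<tau> \<partial>lborel)"
  proof (rule Bochner_Integration.integral_cong[OF refl])
    fix \<tau> :: real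
    show "indicator {0<..<c} \<tau> * \<tau> powr (- 1 / 2) * (k \<tau> * \<tau> powr (1/2)) = k \<tau> * indicator {0<..<c} \<tau>"
    proof (cases "\<tau> \<in> {0<..<c}")
      case True
      then have "\<tau> powr (- 1 / 2) * \<tau> powr (1/2) = 1" by (simp flip: powr_add)
      then show ?thesis using True by (simp add: mult_ac)
    qed auto
  qed
  finally have "ennreal (\<bar>\<integral>\<tau>. k \<tau> * indicator {0<..<c} \<tau> \<partial>lborel\<bar> powr p) \<le>
      ennreal ((2 * c powr (1/2)) powr (p - 1)) * (\<integral>\<^sup>+\<tau>. ennreal (\<bar>k \<tau> * \<tau> powr (1/2)\<bar> powr p) \<partial>?M)"
    using powr_integral_le[OF p, of "\<lambda>\<tau>. k \<tau> * \<tau> powr (1/2)"] W by simp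
  also have "(\<integral>\<^sup>+\<tau>. ennreal (\<bar>k \<tau> * \<tau> powr (1/2)\<bar> powr p) \<partial>?M) =
      (\<integral>\<^sup>+\<tau>. ennreal (indicator {0<..<c} \<tau> * \<tau> powr (- 1 / 2)) * ennreal (\<bar>k \<tau> * \<tau> powr (1/2)\<bar> powr p) \<partial>lborel)"
    by (rule nn_integral_density) measurable
  also have "\<dots> = (\<integral>\<^sup>+\<tau>\<in>{0<..<c}. ennreal (\<bar>k \<tau>\<bar> powr p * \<tau> powr ((p - 1) / 2)) \<partial>lborel)"
  proof (rule nn_integral_cong)
    fix \<tau> :: real
    show "ennreal (indicator {0<..<c} \<tau> * \<tau> powr (- 1 / 2)) * ennreal (\<bar>k \<tau> * \<tau> powr (1/2)\<bar> powr p) =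
      ennreal (\<bar>k \<tau>\<bar> powr p * \<tau> powr ((p - 1) / 2)) * indicator {0<..<c} \<tau>"
    proof (cases "\<tau> \<in> {0<..<c}")
      case True
      then have "\<tau> powr (- 1 / 2) * (\<bar>k \<tau> * \<tau> powr (1/2)\<bar> powr p) = \<bar>k \<tau>\<bar> powr p * (\<tau> powr (- 1 / 2) * \<tau> powr (1/2 * p))"
        by (simp add: abs_mult powr_mult powr_powr mult_ac)
      also have "\<tau> powr (- 1 / 2) * \<tau> powr (1/2 * p) = \<tau> powr ((p - 1) / 2)"
        by (simp add: powr_add[symmetric] diff_divide_distrib)
      finally show ?thesis using True by (simp add: ennreal_mult'[symmetric])
    qed auto
  qed
  finally show ?thesis .
qed

text \<open>\<open>2 powr (p - 1)\<close> comes from the weighted Jensen inequality; the rest is the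
  constant of \<open>nn_integral_norm_powr_tail_le\<close> with \<beta> = (p - 1) / 2.\<close>

definition half_const :: "real \<Rightarrow> nat \<Rightarrow> real" where
  "half_const p d = 2 powr (p - 1) * ((real d + (p - 1) / 2) * unit_ball_vol (real d) / ((p - 1) / 2))"

text \<open>The l^1 norm of the gradient. It bounds the derivative in the direction
  \<open>(sgn h, \<sigma>)\<close>, whose components are at most 1 in absolute value.\<close>

definition abs_grad :: "('a::euclidean_space \<Rightarrow> real) \<Rightarrow> 'a \<Rightarrow> real" where
  "abs_grad \<psi> z = (\<Sum>e\<in>Basis. \<bar>partial_deriv e \<psi> z\<bar>)"

lemma abs_grad_measurable:
  assumes "smooth \<psi>"
  shows "abs_grad \<psi> \<in> borel_measurable borel"
proof -
  have [measurable]: "partial_deriv e \<psi> \<in> borel_measurable borel" if "e \<in> Basis" for e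
    by (intro smooth_borel_measurable smooth_partial_deriv assms that)
  show ?thesis unfolding abs_grad_def[abs_def] by measurable
qed

text \<open>The increment along the first of the two segments, ending above or below the midpoint of
  x and x + h at depth |h| / 2. The sign \<sigma> is 1 at the lower and -1 at the upper face, so
  that the segment points into the strip.\<close>

definition half_diff :: "('a::euclidean_space \<times> real \<Rightarrow> real) \<Rightarrow> real \<Rightarrow> real \<Rightarrow> 'a \<Rightarrow> 'a \<Rightarrow> real" where
  "half_diff \<psi> t \<sigma> x h = \<psi> (x + (1 / 2) *\<^sub>R h, t + \<sigma> * (norm h / 2)) - \<psi> (x, t)"

context
  fixes \<psi> :: "'a::euclidean_space \<times> real \<Rightarrow> real" and a b t \<sigma> p :: real
  assumes \<psi>: "smooth \<psi>" and p: "1 < p" and ab: "a < b"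
    and t: "t = a \<and> \<sigma> = 1 \<or> t = b \<and> \<sigma> = -1"
begin

text \<open>The segment is parametrised by its depth \<tau> from 0 to |h| / 2 in direction
  \<open>(sgn h, \<sigma>)\<close>; then the fundamental theorem and the weighted Jensen inequality
  apply.\<close>

lemma half_diff_powr_le:
  assumes h: "h \<noteq> 0"
  shows "ennreal (\<bar>half_diff \<psi> t \<sigma> x h\<bar> powr p) \<le> ennreal (2 powr (p - 1) * norm h powr ((p - 1) / 2)) *
    (\<integral>\<^sup>+\<tau>\<in>{0<..<norm h / 2}. ennreal (abs_grad \<psi> (x + \<tau> *\<^sub>R sgn h, t + \<tau> * \<sigma>) powr p * \<tau> powr ((p - 1) / 2)) \<partial>lborel)"
proof -
  note [measurable] = smooth_borel_measurable[OF \<psi>] abs_grad_measurable[OF \<psi>]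
  let ?c = "norm h / 2"
  have c: "0 < ?c" using h by simp
  let ?k = "\<lambda>\<tau>. \<Sum>e\<in>Basis. ((sgn h, \<sigma>) \<bullet> e) * partial_deriv e \<psi> ((x, t) + \<tau> *\<^sub>R (sgn h, \<sigma>))"
  have kc: "continuous_on UNIV ?k"
    by (intro continuous_intros continuous_on_compose2[OF smooth_continuous[OF smooth_partial_deriv[OF \<psi>], of _ UNIV]]) auto
  have "(\<integral>\<tau>. ?k \<tau> * indicator {0<..<?c} \<tau> \<partial>lborel) = \<psi> ((x, t) + ?c *\<^sub>R (sgn h, \<sigma>)) - \<psi> ((x, t) + 0 *\<^sub>R (sgn h, \<sigma>))"
    using c by (intro interval_FTC[OF _ _ kc] smooth_line_derivative \<psi>) auto
  also have "\<dots> = half_diff \<psi> t \<sigma> x h"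
    using h by (simp add: half_diff_def sgn_div_norm mult.commute)
  finally have "ennreal (\<bar>half_diff \<psi> t \<sigma> x h\<bar> powr p) \<le>
    ennreal ((2 * ?c powr (1/2)) powr (p - 1)) * (\<integral>\<^sup>+\<tau>\<in>{0<..<?c}. ennreal (\<bar>?k \<tau>\<bar> powr p * \<tau> powr ((p - 1) / 2)) \<partial>lborel)"
    using weighted_interval_powr_le[OF _ kc c, of p] p by simp
  also have "\<dots> \<le> ennreal (2 powr (p - 1) * norm h powr ((p - 1) / 2)) *
    (\<integral>\<^sup>+\<tau>\<in>{0<..<?c}. ennreal (abs_grad \<psi> (x + \<tau> *\<^sub>R sgn h, t + \<tau> * \<sigma>) powr p * \<tau> powr ((p - 1) / 2)) \<partial>lborel)"
  proof (rule mult_mono)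
    have "(2 * ?c powr (1/2)) powr (p - 1) \<le> (2 * norm h powr (1/2)) powr (p - 1)"
      using p by (intro powr_mono2 mult_left_mono) auto
    also have "\<dots> = 2 powr (p - 1) * norm h powr ((p - 1) / 2)"
      by (simp add: powr_mult powr_powr)
    finally show "ennreal ((2 * ?c powr (1/2)) powr (p - 1)) \<le> ennreal (2 powr (p - 1) * norm h powr ((p - 1) / 2))"
      by (rule ennreal_leI)
    have "ennreal (\<bar>?k \<tau>\<bar> powr p * \<tau> powr ((p - 1) / 2)) * indicator {0<..<?c} \<tau> \<le>
      ennreal (abs_grad \<psi> (x + \<tau> *\<^sub>R sgn h, t + \<tau> * \<sigma>) powr p * \<tau> powr ((p - 1) / 2)) * indicator {0<..<?c} \<tau>" for \<tau>
    proof -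
    have "\<bar>?k \<tau>\<bar> \<le> abs_grad \<psi> ((x, t) + \<tau> *\<^sub>R (sgn h, \<sigma>))"
      unfolding abs_grad_def
    proof (rule order_trans[OF sum_abs], rule sum_mono)
      fix e :: "'a \<times> real" assume "e \<in> Basis"
      then have "\<bar>(sgn h, \<sigma>) \<bullet> e\<bar> \<le> 1"
        using t Basis_le_norm[of _ "sgn h"] h by (auto simp: Basis_prod_def norm_sgn)
      then show "\<bar>(sgn h, \<sigma>) \<bullet> e * partial_deriv e \<psi> ((x, t) + \<tau> *\<^sub>R (sgn h, \<sigma>))\<bar> \<le> \<bar>partial_deriv e \<psi> ((x, t) + \<tau> *\<^sub>R (sgn h, \<sigma>))\<bar>"
        by (simp add: abs_mult mult_left_le_one_le)
    qed
    then have "\<bar>?k \<tau>\<bar> powr p \<le> abs_grad \<psi> (x + \<tau> *\<^sub>R sgn h, t + \<tau> * \<sigma>) powr p"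
      using p by (intro powr_mono2) auto
    then show ?thesis by (intro mult_right_mono ennreal_leI) auto
    qed
    then show "(\<integral>\<^sup>+\<tau>\<in>{0<..<?c}. ennreal (\<bar>?k \<tau>\<bar> powr p * \<tau> powr ((p - 1) / 2)) \<partial>lborel) \<le>
      (\<integral>\<^sup>+\<tau>\<in>{0<..<?c}. ennreal (abs_grad \<psi> (x + \<tau> *\<^sub>R sgn h, t + \<tau> * \<sigma>) powr p * \<tau> powr ((p - 1) / 2)) \<partial>lborel)"
      by (rule nn_integral_mono)
  qed auto
  finally show ?thesis .
qed

text \<open>After Jensen the exponent of |h| is -(p + d - 1) + (p - 1) / 2 = -(d + \<beta>). For
  fixed h and \<tau>, translating x by \<tau> \<open>sgn h\<close> removes h from the gradient term,
  at the price of a larger ball. The remaining h-integral over |h| at least \<tau> is at most a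
  constant times \<tau>^(-\<beta>), cancelling the weight \<tau>^\<beta>, and s = t + \<sigma>
  \<tau> maps the depths onto the whole interval from a to b.\<close>

lemma half_diff_integral_le:
  "(\<integral>\<^sup>+x\<in>ball 0 r. (\<integral>\<^sup>+h\<in>ball 0 (b - a). ennreal (\<bar>half_diff \<psi> t \<sigma> x h\<bar> powr p * norm h powr (- (p + real DIM('a) - 1))) \<partial>lborel) \<partial>lborel)
    \<le> ennreal (half_const p DIM('a)) * pow_int p (ball 0 (r + (b - a)) \<times> {a<..<b}) (abs_grad \<psi>)"
proof -
  note [measurable] = smooth_borel_measurable[OF \<psi>] abs_grad_measurable[OF \<psi>]
  have [measurable]: "ball (0::'a) s \<in> sets borel" for s by (rule borel_open) simp
  define \<beta> where "\<beta> = (p - 1) / 2"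
  define d where "d = real DIM('a)"
  define L where "L = b - a"
  define Cd where "Cd = (d + \<beta>) * unit_ball_vol d / \<beta>"
  have \<beta>: "0 < \<beta>" using p by (simp add: \<beta>_def)
  have L: "0 < L" using ab by (simp add: L_def)
  have Cd: "0 \<le> Cd" using \<beta> by (simp add: Cd_def d_def)
  define g where "g x h \<tau> = ennreal (abs_grad \<psi> (x + \<tau> *\<^sub>R sgn h, t + \<tau> * \<sigma>) powr p)" for x h :: 'a and \<tau>
  \<comment> \<open>All factors depending on h and \<tau> alone. The range \<tau> < |h| / 2 is
    relaxed to \<tau> at most |h|, the form the tail integral expects.\<close>
  define w where "w h \<tau> = (if 0 < \<tau> \<and> \<tau> < L \<and> \<tau> \<le> norm h then ennreal (\<tau> powr \<beta> * norm h powr (- (d + \<beta>))) else 0)" for h :: 'a and \<tau>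
  have g0: "(\<lambda>z :: 'a \<times> 'a \<times> real. g (fst z) (fst (snd z)) (snd (snd z))) \<in> borel_measurable borel"
    unfolding g_def by measurable
  have g[measurable (raw)]: "(\<lambda>y. g (f1 y) (f2 y) (f3 y)) \<in> borel_measurable M"
    if "f1 \<in> borel_measurable M" "f2 \<in> borel_measurable M" "f3 \<in> borel_measurable M" for f1 f2 f3 and M :: "'c measure"
    using measurable_compose[OF borel_measurable_Pair[OF that(1) borel_measurable_Pair[OF that(2,3)]] g0] by simp
  have w0: "(\<lambda>z :: 'a \<times> real. w (fst z) (snd z)) \<in> borel_measurable borel"
    unfolding w_def by measurable
  have w[measurable (raw)]: "(\<lambda>y. w (f1 y) (f2 y)) \<in> borel_measurable M"
    if "f1 \<in> borel_measurable M" "f2 \<in> borel_measurable M" for f1 f2 and M :: "'c measure"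
    using measurable_compose[OF borel_measurable_Pair[OF that] w0] by simp
  let ?G = "\<lambda>s. \<integral>\<^sup>+y\<in>ball 0 (r + L). ennreal (abs_grad \<psi> (y, s) powr p) \<partial>lborel"
  have pt: "ennreal (\<bar>half_diff \<psi> t \<sigma> x h\<bar> powr p * norm h powr (- (p + real DIM('a) - 1))) * indicator (ball 0 L) h \<le>
      ennreal (2 powr (p - 1)) * (\<integral>\<^sup>+\<tau>. g x h \<tau> * w h \<tau> \<partial>lborel)" for x h
  proof (cases "h \<noteq> 0 \<and> h \<in> ball 0 L")
    case True
    have "ennreal (\<bar>half_diff \<psi> t \<sigma> x h\<bar> powr p * norm h powr (- (p + real DIM('a) - 1))) = ennreal (norm h powr (- (p + real DIM('a) - 1))) * ennreal (\<bar>half_diff \<psi> t \<sigma> x h\<bar> powr p)"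
      by (simp add: ennreal_mult'[symmetric] mult.commute)
    also have "\<dots> \<le> ennreal (norm h powr (- (p + real DIM('a) - 1))) * (ennreal (2 powr (p - 1) * norm h powr \<beta>) *
      (\<integral>\<^sup>+\<tau>\<in>{0<..<norm h / 2}. ennreal (abs_grad \<psi> (x + \<tau> *\<^sub>R sgn h, t + \<tau> * \<sigma>) powr p * \<tau> powr \<beta>) \<partial>lborel))"
      unfolding \<beta>_def using True by (intro mult_left_mono half_diff_powr_le) auto
    also have "\<dots> = ennreal (2 powr (p - 1)) * (ennreal (norm h powr (- (d + \<beta>))) *
      (\<integral>\<^sup>+\<tau>\<in>{0<..<norm h / 2}. ennreal (abs_grad \<psi> (x + \<tau> *\<^sub>R sgn h, t + \<tau> * \<sigma>) powr p * \<tau> powr \<beta>) \<partial>lborel))"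
    proof -
      have "norm h powr (- (p + real DIM('a) - 1)) * norm h powr \<beta> = norm h powr (- (d + \<beta>))"
      proof -
        have "- (p + real DIM('a) - 1) + \<beta> = - (d + \<beta>)" by (simp add: \<beta>_def d_def field_simps)
        then show ?thesis by (simp only: powr_add[symmetric])
      qed
      then have "ennreal (norm h powr (- (p + real DIM('a) - 1))) * ennreal (2 powr (p - 1) * norm h powr \<beta>) = ennreal (2 powr (p - 1)) * ennreal (norm h powr (- (d + \<beta>)))"
        by (simp add: ennreal_mult'[symmetric] mult_ac)
      then show ?thesis by (simp add: mult.assoc[symmetric])
    qed
    also have "\<dots> = ennreal (2 powr (p - 1)) * (\<integral>\<^sup>+\<tau>. ennreal (norm h powr (- (d + \<beta>))) *
        (ennreal (abs_grad \<psi> (x + \<tau> *\<^sub>R sgn h, t + \<tau> * \<sigma>) powr p * \<tau> powr \<beta>) * indicator {0<..<norm h / 2} \<tau>) \<partial>lborel)"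
      by (subst nn_integral_cmult) auto
    also have "\<dots> \<le> ennreal (2 powr (p - 1)) * (\<integral>\<^sup>+\<tau>. g x h \<tau> * w h \<tau> \<partial>lborel)"
    proof (intro mult_left_mono nn_integral_mono)
      fix \<tau> :: real
      show "ennreal (norm h powr (- (d + \<beta>))) *
        (ennreal (abs_grad \<psi> (x + \<tau> *\<^sub>R sgn h, t + \<tau> * \<sigma>) powr p * \<tau> powr \<beta>) * indicator {0<..<norm h / 2} \<tau>) \<le> g x h \<tau> * w h \<tau>"
      proof (cases "\<tau> \<in> {0<..<norm h / 2}")
        case \<tau>: True
        then have "0 < \<tau> \<and> \<tau> < L \<and> \<tau> \<le> norm h" using True by auto
        then show ?thesis using \<tau> by (simp add: g_def w_def ennreal_mult'[symmetric] mult_ac)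
      qed auto
    qed auto
    finally show ?thesis using True by simp
  next
    case False
    then have "ennreal (\<bar>half_diff \<psi> t \<sigma> x h\<bar> powr p * norm h powr (- (p + real DIM('a) - 1))) * indicator (ball 0 L) h = 0"
      by (cases "h = 0") simp_all
    then show ?thesis by (rule ord_eq_le_trans) simp
  qed
  have "(\<integral>\<^sup>+x\<in>ball 0 r. (\<integral>\<^sup>+h\<in>ball 0 (b - a). ennreal (\<bar>half_diff \<psi> t \<sigma> x h\<bar> powr p * norm h powr (- (p + real DIM('a) - 1))) \<partial>lborel) \<partial>lborel)
    \<le> (\<integral>\<^sup>+x. ennreal (2 powr (p - 1)) * (\<integral>\<^sup>+h. (\<integral>\<^sup>+\<tau>. g x h \<tau> * w h \<tau> * indicator (ball 0 r) x \<partial>lborel) \<partial>lborel) \<partial>lborel)"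
  proof (rule nn_integral_mono)
    fix x :: 'a
    have "(\<integral>\<^sup>+h\<in>ball 0 (b - a). ennreal (\<bar>half_diff \<psi> t \<sigma> x h\<bar> powr p * norm h powr (- (p + real DIM('a) - 1))) \<partial>lborel)
      \<le> (\<integral>\<^sup>+h. ennreal (2 powr (p - 1)) * (\<integral>\<^sup>+\<tau>. g x h \<tau> * w h \<tau> \<partial>lborel) \<partial>lborel)"
      unfolding L_def[symmetric] by (rule nn_integral_mono) (rule pt)
    also have "\<dots> = ennreal (2 powr (p - 1)) * (\<integral>\<^sup>+h. (\<integral>\<^sup>+\<tau>. g x h \<tau> * w h \<tau> \<partial>lborel) \<partial>lborel)"
      by (rule nn_integral_cmult) measurable
    finally show "(\<integral>\<^sup>+h\<in>ball 0 (b - a). ennreal (\<bar>half_diff \<psi> t \<sigma> x h\<bar> powr p * norm h powr (- (p + real DIM('a) - 1))) \<partial>lborel) * indicator (ball 0 r) x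
      \<le> ennreal (2 powr (p - 1)) * (\<integral>\<^sup>+h. (\<integral>\<^sup>+\<tau>. g x h \<tau> * w h \<tau> * indicator (ball 0 r) x \<partial>lborel) \<partial>lborel)"
      by (cases "x \<in> ball 0 r") auto
  qed
  also have "\<dots> = ennreal (2 powr (p - 1)) * (\<integral>\<^sup>+x. (\<integral>\<^sup>+h. (\<integral>\<^sup>+\<tau>. g x h \<tau> * w h \<tau> * indicator (ball 0 r) x \<partial>lborel) \<partial>lborel) \<partial>lborel)"
    by (rule nn_integral_cmult) measurable
  also have "(\<integral>\<^sup>+x. (\<integral>\<^sup>+h. (\<integral>\<^sup>+\<tau>. g x h \<tau> * w h \<tau> * indicator (ball 0 r) x \<partial>lborel) \<partial>lborel) \<partial>lborel)
    = (\<integral>\<^sup>+h. (\<integral>\<^sup>+x. (\<integral>\<^sup>+\<tau>. g x h \<tau> * w h \<tau> * indicator (ball 0 r) x \<partial>lborel) \<partial>lborel) \<partial>lborel)"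
    by (rule lborel_pair.Fubini') measurable
  also have "\<dots> = (\<integral>\<^sup>+h. (\<integral>\<^sup>+\<tau>. (\<integral>\<^sup>+x. g x h \<tau> * w h \<tau> * indicator (ball 0 r) x \<partial>lborel) \<partial>lborel) \<partial>lborel)"
    by (intro nn_integral_cong lborel_pair.Fubini') measurable
  also have "\<dots> \<le> (\<integral>\<^sup>+h. (\<integral>\<^sup>+\<tau>. ?G (t + \<sigma> * \<tau>) * w h \<tau> \<partial>lborel) \<partial>(lborel :: 'a measure))"
  proof (intro nn_integral_mono)
    fix h :: 'a and \<tau> :: real
    show "(\<integral>\<^sup>+x. g x h \<tau> * w h \<tau> * indicator (ball 0 r) x \<partial>lborel) \<le> ?G (t + \<sigma> * \<tau>) * w h \<tau>"
    proof (cases "0 < \<tau> \<and> \<tau> < L \<and> \<tau> \<le> norm h")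
      case True
      let ?f = "\<lambda>y. ennreal (abs_grad \<psi> (y, t + \<sigma> * \<tau>) powr p) * indicator (ball 0 (r + L)) y"
      have "(\<integral>\<^sup>+x. g x h \<tau> * w h \<tau> * indicator (ball 0 r) x \<partial>lborel) \<le> (\<integral>\<^sup>+x. ?f (\<tau> *\<^sub>R sgn h + 1 *\<^sub>R x) * w h \<tau> \<partial>lborel)"
      proof (rule nn_integral_mono)
        fix x :: 'a
        have "x \<in> ball 0 r \<Longrightarrow> \<tau> *\<^sub>R sgn h + x \<in> ball 0 (r + L)"
        proof -
          assume x: "x \<in> ball 0 r"
          have "norm (\<tau> *\<^sub>R sgn h) \<le> \<tau>" using True by (simp add: norm_sgn)
          moreover have "norm x < r" using x by simp
          ultimately have "norm (\<tau> *\<^sub>R sgn h + x) < r + L"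
            using True norm_triangle_ineq[of "\<tau> *\<^sub>R sgn h" x] by linarith
          then show ?thesis by simp
        qed
        then show "g x h \<tau> * w h \<tau> * indicator (ball 0 r) x \<le> ?f (\<tau> *\<^sub>R sgn h + 1 *\<^sub>R x) * w h \<tau>"
          by (cases "x \<in> ball 0 r") (simp_all add: g_def add.commute mult.commute)
      qed
      also have "\<dots> = (\<integral>\<^sup>+x. ?f (\<tau> *\<^sub>R sgn h + 1 *\<^sub>R x) \<partial>lborel) * w h \<tau>"
        by (rule nn_integral_multc) measurable
      also have "(\<integral>\<^sup>+x. ?f (\<tau> *\<^sub>R sgn h + 1 *\<^sub>R x) \<partial>lborel) = ?G (t + \<sigma> * \<tau>)"
        by (subst nn_integral_lborel_affine) auto
      finally show ?thesis .
    qed (auto simp: w_def)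
  qed
  also have "\<dots> = (\<integral>\<^sup>+\<tau>. (\<integral>\<^sup>+h. ?G (t + \<sigma> * \<tau>) * w h \<tau> \<partial>(lborel :: 'a measure)) \<partial>lborel)"
    by (rule lborel_pair.Fubini') measurable
  also have "\<dots> \<le> (\<integral>\<^sup>+\<tau>. ennreal Cd * (?G (t + \<sigma> * \<tau>) * indicator {0<..<L} \<tau>) \<partial>lborel)"
  proof (rule nn_integral_mono)
    fix \<tau> :: real
    show "(\<integral>\<^sup>+h. ?G (t + \<sigma> * \<tau>) * w h \<tau> \<partial>(lborel :: 'a measure)) \<le> ennreal Cd * (?G (t + \<sigma> * \<tau>) * indicator {0<..<L} \<tau>)"
    proof (cases "\<tau> \<in> {0<..<L}")
      case True
      have "(\<integral>\<^sup>+h. ?G (t + \<sigma> * \<tau>) * w h \<tau> \<partial>(lborel :: 'a measure)) =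
          (\<integral>\<^sup>+h. ?G (t + \<sigma> * \<tau>) * ennreal (\<tau> powr \<beta>) * (if \<tau> \<le> norm h then ennreal (norm h powr (- (d + \<beta>))) else 0) \<partial>(lborel :: 'a measure))"
        using True by (intro nn_integral_cong) (auto simp: w_def ennreal_mult' mult.assoc)
      also have "\<dots> = ?G (t + \<sigma> * \<tau>) * ennreal (\<tau> powr \<beta>) * (\<integral>\<^sup>+h. (if \<tau> \<le> norm h then ennreal (norm h powr (- (d + \<beta>))) else 0) \<partial>(lborel :: 'a measure))"
        by (rule nn_integral_cmult) measurable
      also have "\<dots> \<le> ?G (t + \<sigma> * \<tau>) * ennreal (\<tau> powr \<beta>) * ennreal (Cd * \<tau> powr (- \<beta>))"
        unfolding Cd_def d_def using True by (intro mult_left_mono nn_integral_norm_powr_tail_le \<beta>) auto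
      also have "\<dots> = ?G (t + \<sigma> * \<tau>) * ennreal (Cd * (\<tau> powr \<beta> * \<tau> powr (- \<beta>)))"
      proof -
        have "ennreal (\<tau> powr \<beta>) * ennreal (Cd * \<tau> powr (- \<beta>)) = ennreal (Cd * (\<tau> powr \<beta> * \<tau> powr (- \<beta>)))"
          by (subst ennreal_mult'[symmetric]) (simp_all add: mult_ac)
        then show ?thesis by (simp only: mult.assoc)
      qed
      also have "\<tau> powr \<beta> * \<tau> powr (- \<beta>) = 1" using True by (simp add: powr_add[symmetric])
      finally show ?thesis using True by (simp add: mult.commute)
    next
      case False
      then have "(\<integral>\<^sup>+h. ?G (t + \<sigma> * \<tau>) * w h \<tau> \<partial>(lborel :: 'a measure)) = (\<integral>\<^sup>+h. 0 \<partial>(lborel :: 'a measure))"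
        by (intro nn_integral_cong) (auto simp: w_def)
      then show ?thesis by simp
    qed
  qed
  also have "\<dots> = ennreal Cd * (\<integral>\<^sup>+\<tau>. ?G (t + \<sigma> * \<tau>) * indicator {0<..<L} \<tau> \<partial>lborel)"
    by (rule nn_integral_cmult) measurable
  also have "(\<integral>\<^sup>+\<tau>. ?G (t + \<sigma> * \<tau>) * indicator {0<..<L} \<tau> \<partial>lborel) = (\<integral>\<^sup>+\<tau>. (\<lambda>s. ?G s * indicator {a<..<b} s) (t + \<sigma> *\<^sub>R \<tau>) \<partial>lborel)"
    using t by (intro nn_integral_cong) (auto simp: indicator_def L_def)
  also have "\<dots> = (\<integral>\<^sup>+s. ?G s * indicator {a<..<b} s \<partial>lborel)"
    using t by (subst nn_integral_lborel_affine) auto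
  also have "\<dots> = (\<integral>\<^sup>+s. (\<integral>\<^sup>+y. ennreal (abs_grad \<psi> (y, s) powr p) * indicator {a<..<b} s * indicator (ball 0 (r + L)) y \<partial>lborel) \<partial>lborel)"
    by (intro nn_integral_cong, subst nn_integral_multc[symmetric]) (auto simp: mult_ac)
  also have "\<dots> = (\<integral>\<^sup>+y. (\<integral>\<^sup>+s. ennreal (abs_grad \<psi> (y, s) powr p) * indicator {a<..<b} s * indicator (ball 0 (r + L)) y \<partial>lborel) \<partial>lborel)"
    by (rule lborel_pair.Fubini') measurable
  also have "\<dots> = pow_int p (ball 0 (r + L) \<times> {a<..<b}) (abs_grad \<psi>)"
  proof -
    have abs: "\<bar>abs_grad \<psi> z\<bar> = abs_grad \<psi> z" for z by (simp add: abs_grad_def sum_nonneg)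
    have "pow_int p (ball 0 (r + L) \<times> {a<..<b}) (abs_grad \<psi>) =
        (\<integral>\<^sup>+y\<in>ball 0 (r + L). (\<integral>\<^sup>+s\<in>{a<..<b}. ennreal (abs_grad \<psi> (y, s) powr p) \<partial>lborel) \<partial>lborel)"
      by (subst pow_int_Times) (simp_all add: abs)
    also have "\<dots> = (\<integral>\<^sup>+y. (\<integral>\<^sup>+s. ennreal (abs_grad \<psi> (y, s) powr p) * indicator {a<..<b} s * indicator (ball 0 (r + L)) y \<partial>lborel) \<partial>lborel)"
      by (rule nn_integral_cong, rule nn_integral_multc[symmetric]) measurable
    finally show ?thesis by (rule sym)
  qed
  finally have "(\<integral>\<^sup>+x\<in>ball 0 r. (\<integral>\<^sup>+h\<in>ball 0 (b - a). ennreal (\<bar>half_diff \<psi> t \<sigma> x h\<bar> powr p * norm h powr (- (p + real DIM('a) - 1))) \<partial>lborel) \<partial>lborel)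
    \<le> ennreal (2 powr (p - 1)) * (ennreal Cd * pow_int p (ball 0 (r + L) \<times> {a<..<b}) (abs_grad \<psi>))"
    by (simp add: mult_left_mono)
  moreover have "ennreal (half_const p DIM('a)) = ennreal (2 powr (p - 1)) * ennreal Cd"
    using Cd by (simp add: half_const_def Cd_def d_def \<beta>_def ennreal_mult'[symmetric])
  ultimately show ?thesis by (simp add: mult.assoc L_def)
qed

end

lemma ball_borel[measurable]: "ball (x::'a::euclidean_space) r \<in> sets borel"
  by (rule borel_open) simp

text \<open>The second segment starts at x + h and belongs to the increment -h. Substituting y = x +
  h and reversing h reduces it to the first segment, with base points in a ball larger by L.\<close>

lemma nn_integral_reflect_le:
  fixes I :: "'a::euclidean_space \<Rightarrow> 'a \<Rightarrow> ennreal"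
  assumes [measurable]: "(\<lambda>z. I (fst z) (snd z)) \<in> borel_measurable borel"
  shows "(\<integral>\<^sup>+x\<in>ball 0 r. (\<integral>\<^sup>+h\<in>ball 0 L. I (x + h) (- h) \<partial>lborel) \<partial>lborel) \<le> (\<integral>\<^sup>+x\<in>ball 0 (r + L). (\<integral>\<^sup>+h\<in>ball 0 L. I x h \<partial>lborel) \<partial>lborel)"
proof -
  have I[measurable (raw)]: "(\<lambda>y. I (f1 y) (f2 y)) \<in> borel_measurable M"
    if "f1 \<in> borel_measurable M" "f2 \<in> borel_measurable M" for f1 f2 and M :: "'c measure"
    using measurable_compose[OF borel_measurable_Pair[OF that] assms] by simp
  let ?K = "\<lambda>h. \<integral>\<^sup>+y. I y h * indicator (ball 0 L) h * indicator (ball 0 (r + L)) y \<partial>lborel"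
  have "(\<integral>\<^sup>+x\<in>ball 0 r. (\<integral>\<^sup>+h\<in>ball 0 L. I (x + h) (- h) \<partial>lborel) \<partial>lborel) =
    (\<integral>\<^sup>+x. (\<integral>\<^sup>+h. I (x + h) (- h) * indicator (ball 0 L) h * indicator (ball 0 r) x \<partial>lborel) \<partial>lborel)"
    by (rule nn_integral_cong, rule nn_integral_multc[symmetric]) measurable
  also have "\<dots> = (\<integral>\<^sup>+h. (\<integral>\<^sup>+x. I (x + h) (- h) * indicator (ball 0 L) h * indicator (ball 0 r) x \<partial>lborel) \<partial>lborel)"
    by (rule lborel_pair.Fubini') measurable
  also have "\<dots> \<le> (\<integral>\<^sup>+h. ?K (0 + (-1) *\<^sub>R h) \<partial>lborel)"
  proof (rule nn_integral_mono)
    fix h :: 'a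
    have "(\<integral>\<^sup>+x. I (x + h) (- h) * indicator (ball 0 L) h * indicator (ball 0 r) x \<partial>lborel) \<le>
      (\<integral>\<^sup>+x. (\<lambda>y. I y (- h) * indicator (ball 0 L) (- h) * indicator (ball 0 (r + L)) y) (h + 1 *\<^sub>R x) \<partial>lborel)"
    proof (rule nn_integral_mono)
      fix x :: 'a
      show "I (x + h) (- h) * indicator (ball 0 L) h * indicator (ball 0 r) x \<le>
        I (h + 1 *\<^sub>R x) (- h) * indicator (ball 0 L) (- h) * indicator (ball 0 (r + L)) (h + 1 *\<^sub>R x)"
      proof (cases "h \<in> ball 0 L \<and> x \<in> ball 0 r")
        case True
        then have "norm (h + x) < r + L" using norm_triangle_ineq[of h x] by simp
        then show ?thesis using True by (simp add: add.commute)
      qed (auto simp: indicator_def)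
    qed
    also have "\<dots> = ?K (- h)"
      by (subst nn_integral_lborel_affine) auto
    finally show "(\<integral>\<^sup>+x. I (x + h) (- h) * indicator (ball 0 L) h * indicator (ball 0 r) x \<partial>lborel) \<le> ?K (0 + (-1) *\<^sub>R h)" by simp
  qed
  also have "\<dots> = (\<integral>\<^sup>+h. ?K h \<partial>lborel)"
    by (subst nn_integral_lborel_affine) auto
  also have "\<dots> = (\<integral>\<^sup>+y. (\<integral>\<^sup>+h. I y h * indicator (ball 0 L) h * indicator (ball 0 (r + L)) y \<partial>lborel) \<partial>lborel)"
    by (rule lborel_pair.Fubini') measurable
  also have "\<dots> = (\<integral>\<^sup>+x\<in>ball 0 (r + L). (\<integral>\<^sup>+h\<in>ball 0 L. I x h \<partial>lborel) \<partial>lborel)"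
    by (rule nn_integral_cong, rule nn_integral_multc) measurable
  finally show ?thesis .
qed

text \<open>\<open>2 powr p\<close> splits the increment over two segments, 2 counts them,
  \<open>half_const\<close> bounds each, and the last factor passes from the l^1 norm of the
  gradient to the d + 1 separate partial derivatives. The width of the strip does not enter.\<close>

definition seminorm_const :: "real \<Rightarrow> nat \<Rightarrow> real" where
  "seminorm_const p d = 2 powr p * 2 * half_const p d * real (d + 1) powr p"

lemma half_const_pos: "1 < p \<Longrightarrow> 0 < half_const p d"
  unfolding half_const_def by (intro mult_pos_pos divide_pos_pos add_nonneg_pos) auto

lemma seminorm_const_pos: "1 < p \<Longrightarrow> 0 < seminorm_const p d"
  unfolding seminorm_const_def using half_const_pos[of p d] by simp

lemma pow_int_abs_grad_le:
  fixes \<psi> :: "'a::euclidean_space \<Rightarrow> real"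
  assumes \<psi>: "smooth \<psi>" and p: "0 < p" and [measurable]: "S \<in> sets borel"
  shows "pow_int p S (abs_grad \<psi>) \<le> ennreal (real DIM('a) powr p) * (\<Sum>e\<in>Basis. pow_int p S (partial_deriv e \<psi>))"
proof -
  have [measurable]: "partial_deriv e \<psi> \<in> borel_measurable borel" if "e \<in> Basis" for e
    by (intro smooth_borel_measurable smooth_partial_deriv \<psi> that)
  have "pow_int p S (abs_grad \<psi>) \<le> (\<integral>\<^sup>+x. ennreal (real DIM('a) powr p) * (\<Sum>e\<in>Basis. ennreal (\<bar>partial_deriv e \<psi> x\<bar> powr p) * indicator S x) \<partial>lborel)"
    unfolding pow_int_def
  proof (rule nn_integral_mono)
    fix x
    have "\<bar>abs_grad \<psi> x\<bar> powr p \<le> real DIM('a) powr p * (\<Sum>e\<in>Basis. \<bar>partial_deriv e \<psi> x\<bar> powr p)"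
      using powr_sum_abs_le[of Basis p "\<lambda>e. partial_deriv e \<psi> x"] p by (simp add: abs_grad_def sum_nonneg)
    from ennreal_leI[OF this]
    have "ennreal (\<bar>abs_grad \<psi> x\<bar> powr p) \<le> ennreal (real DIM('a) powr p) * (\<Sum>e\<in>Basis. ennreal (\<bar>partial_deriv e \<psi> x\<bar> powr p))"
      by (simp add: ennreal_mult' sum_nonneg)
    from mult_right_mono[OF this, of "indicator S x"]
    show "ennreal (\<bar>abs_grad \<psi> x\<bar> powr p) * indicator S x \<le> ennreal (real DIM('a) powr p) * (\<Sum>e\<in>Basis. ennreal (\<bar>partial_deriv e \<psi> x\<bar> powr p) * indicator S x)"
      by (simp only: mult.assoc sum_distrib_right zero_le)
  qed
  also have "\<dots> = ennreal (real DIM('a) powr p) * (\<integral>\<^sup>+x. (\<Sum>e\<in>Basis. ennreal (\<bar>partial_deriv e \<psi> x\<bar> powr p) * indicator S x) \<partial>lborel)"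
    by (rule nn_integral_cmult) measurable
  also have "(\<integral>\<^sup>+x. (\<Sum>e\<in>Basis. ennreal (\<bar>partial_deriv e \<psi> x\<bar> powr p) * indicator S x) \<partial>lborel) = (\<Sum>e\<in>Basis. pow_int p S (partial_deriv e \<psi>))"
    unfolding pow_int_def by (rule nn_integral_sum) measurable
  finally show ?thesis .
qed

text \<open>Of the enlargement by 2 (b - a), one b - a accounts for the base point x + h of the
  second segment, the other for the horizontal extent of a segment.\<close>

lemma smooth_trace_seminorm_le:
  fixes \<psi> :: "'a::euclidean_space \<times> real \<Rightarrow> real"
  assumes \<psi>: "smooth \<psi>" and p: "1 < p" and ab: "a < b" and t: "t \<in> {a, b}"
  shows "(\<integral>\<^sup>+x\<in>ball 0 r. (\<integral>\<^sup>+h\<in>ball 0 (b - a). ennreal (\<bar>\<psi> (x + h, t) - \<psi> (x, t)\<bar> powr p * norm h powr (- (p + real DIM('a) - 1))) \<partial>lborel) \<partial>lborel)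
    \<le> ennreal (seminorm_const p DIM('a)) * (\<Sum>e\<in>Basis. pow_int p (ball 0 (r + 2 * (b - a)) \<times> {a<..<b}) (partial_deriv e \<psi>))"
proof -
  define \<sigma> :: real where "\<sigma> = (if t = a then 1 else - 1)"
  have \<sigma>: "t = a \<and> \<sigma> = 1 \<or> t = b \<and> \<sigma> = -1" using t by (auto simp: \<sigma>_def)
  define L where "L = b - a"
  have L: "0 < L" using ab by (simp add: L_def)
  define I where "I x h = ennreal (\<bar>half_diff \<psi> t \<sigma> x h\<bar> powr p * norm h powr (- (p + real DIM('a) - 1)))" for x h :: 'a
  have [measurable]: "\<psi> \<in> borel_measurable borel" by (rule smooth_borel_measurable[OF \<psi>])
  have I0[measurable]: "(\<lambda>z. I (fst z) (snd z)) \<in> borel_measurable borel"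
    unfolding I_def half_diff_def by measurable
  have I[measurable (raw)]: "(\<lambda>y. I (f1 y) (f2 y)) \<in> borel_measurable M"
    if "f1 \<in> borel_measurable M" "f2 \<in> borel_measurable M" for f1 f2 and M :: "'c measure"
    using measurable_compose[OF borel_measurable_Pair[OF that] I0] by simp
  let ?J = "\<lambda>r. \<integral>\<^sup>+x\<in>ball 0 r. (\<integral>\<^sup>+h\<in>ball 0 L. I x h \<partial>lborel) \<partial>lborel"
  have J: "?J r \<le> ennreal (half_const p DIM('a)) * pow_int p (ball 0 (r + L) \<times> {a<..<b}) (abs_grad \<psi>)" for r
    unfolding I_def L_def by (rule half_diff_integral_le[OF \<psi> p ab \<sigma>])
  have pt: "ennreal (\<bar>\<psi> (x + h, t) - \<psi> (x, t)\<bar> powr p * norm h powr (- (p + real DIM('a) - 1))) \<le> ennreal (2 powr p) * (I x h + I (x + h) (- h))" for x h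
  proof -
    \<comment> \<open>Both segments end at the same interior point, so the value there cancels in
      the difference.\<close>
    have "x + h + (1 / 2) *\<^sub>R (- h) = x + (1 / 2) *\<^sub>R h"
      using scaleR_left_distrib[of "1/2" "1/2" h] by (simp add: algebra_simps)
    then have "half_diff \<psi> t \<sigma> (x + h) (- h) = \<psi> (x + (1 / 2) *\<^sub>R h, t + \<sigma> * (norm h / 2)) - \<psi> (x + h, t)"
      by (simp only: half_diff_def norm_minus_cancel)
    then have eq: "\<psi> (x + h, t) - \<psi> (x, t) = half_diff \<psi> t \<sigma> x h + - half_diff \<psi> t \<sigma> (x + h) (- h)"
      by (simp add: half_diff_def)
    have "\<bar>\<psi> (x + h, t) - \<psi> (x, t)\<bar> powr p \<le> 2 powr p * (\<bar>half_diff \<psi> t \<sigma> x h\<bar> powr p + \<bar>- half_diff \<psi> t \<sigma> (x + h) (- h)\<bar> powr p)"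
      unfolding eq using p by (intro powr_abs_add_le) auto
    from mult_right_mono[OF this, of "norm h powr (- (p + real DIM('a) - 1))"]
    have "\<bar>\<psi> (x + h, t) - \<psi> (x, t)\<bar> powr p * norm h powr (- (p + real DIM('a) - 1)) \<le>
      2 powr p * (\<bar>half_diff \<psi> t \<sigma> x h\<bar> powr p * norm h powr (- (p + real DIM('a) - 1)) + \<bar>half_diff \<psi> t \<sigma> (x + h) (- h)\<bar> powr p * norm (- h) powr (- (p + real DIM('a) - 1)))"
      by (simp add: algebra_simps)
    from ennreal_leI[OF this] show ?thesis
      unfolding I_def by (simp add: ennreal_mult')
  qed
  have "(\<integral>\<^sup>+x\<in>ball 0 r. (\<integral>\<^sup>+h\<in>ball 0 (b - a). ennreal (\<bar>\<psi> (x + h, t) - \<psi> (x, t)\<bar> powr p * norm h powr (- (p + real DIM('a) - 1))) \<partial>lborel) \<partial>lborel)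
    \<le> (\<integral>\<^sup>+x. ennreal (2 powr p) * ((\<integral>\<^sup>+h\<in>ball 0 L. I x h \<partial>lborel) * indicator (ball 0 r) x + (\<integral>\<^sup>+h\<in>ball 0 L. I (x + h) (- h) \<partial>lborel) * indicator (ball 0 r) x) \<partial>lborel)"
  proof (rule nn_integral_mono)
    fix x :: 'a
    have "(\<integral>\<^sup>+h\<in>ball 0 (b - a). ennreal (\<bar>\<psi> (x + h, t) - \<psi> (x, t)\<bar> powr p * norm h powr (- (p + real DIM('a) - 1))) \<partial>lborel) \<le>
      (\<integral>\<^sup>+h. ennreal (2 powr p) * (I x h * indicator (ball 0 L) h + I (x + h) (- h) * indicator (ball 0 L) h) \<partial>lborel)"
    proof (rule nn_integral_mono)
      fix h :: 'a
      show "ennreal (\<bar>\<psi> (x + h, t) - \<psi> (x, t)\<bar> powr p * norm h powr (- (p + real DIM('a) - 1))) * indicator (ball 0 (b - a)) h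
        \<le> ennreal (2 powr p) * (I x h * indicator (ball 0 L) h + I (x + h) (- h) * indicator (ball 0 L) h)"
        unfolding L_def using pt[of x h] by (cases "h \<in> ball 0 (b - a)") auto
    qed
    also have "\<dots> = ennreal (2 powr p) * ((\<integral>\<^sup>+h\<in>ball 0 L. I x h \<partial>lborel) + (\<integral>\<^sup>+h\<in>ball 0 L. I (x + h) (- h) \<partial>lborel))"
      by (subst nn_integral_cmult; simp add: nn_integral_add)
    finally show "(\<integral>\<^sup>+h\<in>ball 0 (b - a). ennreal (\<bar>\<psi> (x + h, t) - \<psi> (x, t)\<bar> powr p * norm h powr (- (p + real DIM('a) - 1))) \<partial>lborel) * indicator (ball 0 r) x
      \<le> ennreal (2 powr p) * ((\<integral>\<^sup>+h\<in>ball 0 L. I x h \<partial>lborel) * indicator (ball 0 r) x + (\<integral>\<^sup>+h\<in>ball 0 L. I (x + h) (- h) \<partial>lborel) * indicator (ball 0 r) x)"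
      by (cases "x \<in> ball 0 r") auto
  qed
  also have "\<dots> = ennreal (2 powr p) * (?J r + (\<integral>\<^sup>+x\<in>ball 0 r. (\<integral>\<^sup>+h\<in>ball 0 L. I (x + h) (- h) \<partial>lborel) \<partial>lborel))"
    by (subst nn_integral_cmult; simp add: nn_integral_add)
  also have "\<dots> \<le> ennreal (2 powr p) * (?J (r + L) + ?J (r + L))"
  proof (intro mult_left_mono add_mono)
    show "?J r \<le> ?J (r + L)"
      using L by (intro nn_integral_mono mult_left_mono) (auto simp: indicator_def)
    show "(\<integral>\<^sup>+x\<in>ball 0 r. (\<integral>\<^sup>+h\<in>ball 0 L. I (x + h) (- h) \<partial>lborel) \<partial>lborel) \<le> ?J (r + L)"
      by (rule nn_integral_reflect_le) measurable
  qed auto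
  also have "\<dots> = ennreal (2 powr p * 2) * ?J (r + L)" by (simp add: ennreal_mult' mult.assoc mult_2)
  also have "\<dots> \<le> ennreal (2 powr p * 2) * (ennreal (half_const p DIM('a)) * (ennreal (real DIM('a \<times> real) powr p) *
      (\<Sum>e\<in>Basis. pow_int p (ball 0 (r + L + L) \<times> {a<..<b}) (partial_deriv e \<psi>))))"
  proof -
    have Q: "ball (0::'a) (r + L + L) \<times> {a<..<b} \<in> sets borel" by (intro borel_open open_Times) auto
    show ?thesis
      using p by (intro mult_left_mono order_trans[OF J] pow_int_abs_grad_le[OF \<psi> _ Q]) auto
  qed
  also have "\<dots> = ennreal (seminorm_const p DIM('a)) * (\<Sum>e\<in>Basis. pow_int p (ball 0 (r + 2 * (b - a)) \<times> {a<..<b}) (partial_deriv e \<psi>))"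
    using half_const_pos[OF p, of "DIM('a)"] by (simp add: seminorm_const_def ennreal_mult' mult.assoc L_def algebra_simps)
  finally show ?thesis .
qed

section \<open>The seminorm as an L^p norm over pairs of base point and increment\<close>

lemma pow_int_pairs:
  fixes F :: "'a::euclidean_space \<times> 'a \<Rightarrow> real"
  assumes [measurable]: "F \<in> borel_measurable borel" "A \<in> sets borel" "B \<in> sets borel"
  shows "pow_int p (A \<times> B) F = (\<integral>\<^sup>+x\<in>A. (\<integral>\<^sup>+h\<in>B. ennreal (\<bar>F (x, h)\<bar> powr p) \<partial>lborel) \<partial>lborel)"
    and "pow_int p (A \<times> B) F = (\<integral>\<^sup>+h\<in>B. (\<integral>\<^sup>+x\<in>A. ennreal (\<bar>F (x, h)\<bar> powr p) \<partial>lborel) \<partial>lborel)"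
proof -
  have eq: "indicator (A \<times> B) z = (indicator A (fst z) * indicator B (snd z) :: ennreal)" for z :: "'a \<times> 'a"
    by (cases z) (auto simp: indicator_def)
  have "pow_int p (A \<times> B) F = (\<integral>\<^sup>+x. (\<integral>\<^sup>+h. ennreal (\<bar>F (x, h)\<bar> powr p) * (indicator A x * indicator B h) \<partial>lborel) \<partial>lborel)"
    unfolding pow_int_def eq by (subst nn_integral_lborel_fst) auto
  also have "\<dots> = (\<integral>\<^sup>+x. (\<integral>\<^sup>+h. ennreal (\<bar>F (x, h)\<bar> powr p) * indicator B h * indicator A x \<partial>lborel) \<partial>lborel)"
    by (simp only: mult_ac)
  also have "\<dots> = (\<integral>\<^sup>+x\<in>A. (\<integral>\<^sup>+h\<in>B. ennreal (\<bar>F (x, h)\<bar> powr p) \<partial>lborel) \<partial>lborel)"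
    by (rule nn_integral_cong, rule nn_integral_multc) measurable
  finally show "pow_int p (A \<times> B) F = (\<integral>\<^sup>+x\<in>A. (\<integral>\<^sup>+h\<in>B. ennreal (\<bar>F (x, h)\<bar> powr p) \<partial>lborel) \<partial>lborel)" .
  have "pow_int p (A \<times> B) F = (\<integral>\<^sup>+h. (\<integral>\<^sup>+x. ennreal (\<bar>F (x, h)\<bar> powr p) * (indicator A x * indicator B h) \<partial>lborel) \<partial>lborel)"
    unfolding pow_int_def eq by (subst nn_integral_lborel_snd) auto
  also have "\<dots> = (\<integral>\<^sup>+h. (\<integral>\<^sup>+x. ennreal (\<bar>F (x, h)\<bar> powr p) * indicator A x * indicator B h \<partial>lborel) \<partial>lborel)"
    by (simp only: mult_ac)
  also have "\<dots> = (\<integral>\<^sup>+h\<in>B. (\<integral>\<^sup>+x\<in>A. ennreal (\<bar>F (x, h)\<bar> powr p) \<partial>lborel) \<partial>lborel)"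
    by (rule nn_integral_cong, rule nn_integral_multc) measurable
  finally show "pow_int p (A \<times> B) F = (\<integral>\<^sup>+h\<in>B. (\<integral>\<^sup>+x\<in>A. ennreal (\<bar>F (x, h)\<bar> powr p) \<partial>lborel) \<partial>lborel)" .
qed

text \<open>Convergence on balls thus carries over to convergence of increments over pairs, where
  the weight in |h| is bounded.\<close>

lemma pow_int_translate_difference_le:
  fixes E :: "'a::euclidean_space \<Rightarrow> real"
  assumes [measurable]: "E \<in> borel_measurable borel" and p: "0 \<le> p" and L: "0 < L"
  shows "pow_int p (ball 0 r \<times> ball 0 L) (\<lambda>z. E (fst z + snd z) - E (fst z)) \<le>
    ennreal (2 powr p * 2) * emeasure lborel (ball (0::'a) L) * pow_int p (ball 0 (r + L)) E"
proof -
  let ?V = "emeasure lborel (ball (0::'a) L)"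
  have [measurable]: "ball (0::'a) r \<times> ball (0::'a) L \<in> sets borel" by (intro borel_open open_Times) auto
  have 1: "pow_int p (ball 0 r \<times> ball 0 L) (\<lambda>z. E (fst z + snd z)) \<le> pow_int p (ball 0 (r + L)) E * ?V"
  proof -
    have "pow_int p (ball 0 r \<times> ball 0 L) (\<lambda>z. E (fst z + snd z)) = (\<integral>\<^sup>+h\<in>ball 0 L. (\<integral>\<^sup>+x\<in>ball 0 r. ennreal (\<bar>E (x + h)\<bar> powr p) \<partial>lborel) \<partial>lborel)"
      by (subst pow_int_pairs(2)) auto
    also have "\<dots> \<le> (\<integral>\<^sup>+h. pow_int p (ball 0 (r + L)) E * indicator (ball (0::'a) L) h \<partial>lborel)"
    proof (rule nn_integral_mono)
      fix h :: 'a
      show "(\<integral>\<^sup>+x\<in>ball 0 r. ennreal (\<bar>E (x + h)\<bar> powr p) \<partial>lborel) * indicator (ball 0 L) h \<le> pow_int p (ball 0 (r + L)) E * indicator (ball 0 L) h"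
      proof (cases "h \<in> ball 0 L")
        case True
        have "(\<integral>\<^sup>+x\<in>ball 0 r. ennreal (\<bar>E (x + h)\<bar> powr p) \<partial>lborel) \<le> (\<integral>\<^sup>+x. (\<lambda>y. ennreal (\<bar>E y\<bar> powr p) * indicator (ball 0 (r + L)) y) (h + 1 *\<^sub>R x) \<partial>lborel)"
        proof (rule nn_integral_mono)
          fix x :: 'a
          show "ennreal (\<bar>E (x + h)\<bar> powr p) * indicator (ball 0 r) x \<le> ennreal (\<bar>E (h + 1 *\<^sub>R x)\<bar> powr p) * indicator (ball 0 (r + L)) (h + 1 *\<^sub>R x)"
            using True norm_triangle_ineq[of h x] by (cases "x \<in> ball 0 r") (auto simp: add.commute)
        qed
        also have "\<dots> = pow_int p (ball 0 (r + L)) E"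
          unfolding pow_int_def by (subst nn_integral_lborel_affine) auto
        finally show ?thesis using True by simp
      qed auto
    qed
    also have "\<dots> = pow_int p (ball 0 (r + L)) E * ?V" by (rule nn_integral_cmult_indicator) auto
    finally show ?thesis .
  qed
  have 2: "pow_int p (ball 0 r \<times> ball (0::'a) L) (\<lambda>z. - E (fst z)) \<le> pow_int p (ball 0 (r + L)) E * ?V"
  proof -
    have "pow_int p (ball 0 r \<times> ball (0::'a) L) (\<lambda>z. - E (fst z)) = (\<integral>\<^sup>+h\<in>ball 0 L. (\<integral>\<^sup>+x\<in>ball 0 r. ennreal (\<bar>E x\<bar> powr p) \<partial>lborel) \<partial>(lborel :: 'a measure))"
      by (subst pow_int_pairs(2)) auto
    also have "\<dots> = pow_int p (ball 0 r) E * ?V"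
      unfolding pow_int_def[symmetric] by (rule nn_integral_cmult_indicator) auto
    also have "\<dots> \<le> pow_int p (ball 0 (r + L)) E * ?V"
      using L by (intro mult_right_mono pow_int_mono_set) auto
    finally show ?thesis .
  qed
  have "pow_int p (ball 0 r \<times> ball 0 L) (\<lambda>z. E (fst z + snd z) - E (fst z)) \<le> ennreal (2 powr p) *
      (pow_int p (ball 0 r \<times> ball 0 L) (\<lambda>z. E (fst z + snd z)) + pow_int p (ball 0 r \<times> ball (0::'a) L) (\<lambda>z. - E (fst z)))"
    using pow_int_add_le[of "\<lambda>z. E (fst z + snd z)" "\<lambda>z. - E (fst z)" "ball (0::'a) r \<times> ball (0::'a) L" p] p by simp
  also have "\<dots> \<le> ennreal (2 powr p) * (pow_int p (ball 0 (r + L)) E * ?V + pow_int p (ball 0 (r + L)) E * ?V)"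
    by (intro mult_left_mono add_mono 1 2) auto
  also have "\<dots> = ennreal (2 powr p * 2) * ?V * pow_int p (ball 0 (r + L)) E"
    by (simp only: ennreal_mult' powr_ge_zero ennreal_numeral mult_2[symmetric] mult_ac)
  finally show ?thesis .
qed

text \<open>The integrand is the p-th power of f(x + h) - f(x) times |h|^(-q/p), a linear expression
  in f, so the limit argument for L^p norms applies. The weight is singular at h = 0; hence the
  limit is taken on sets that stay away from h = 0 and the sets are exhausted afterwards.\<close>

lemma trace_seminorm_le:
  fixes v :: "'a::euclidean_space \<times> real \<Rightarrow> real"
  assumes tr: "trace_approx p a b v w G \<phi>" and p: "1 < p" and ab: "a < b" and t: "t \<in> {a, b}"
  shows "(\<integral>\<^sup>+x. (\<integral>\<^sup>+h\<in>ball 0 (b - a). ennreal (\<bar>G t (x + h) - G t x\<bar> powr p / norm h powr (p + real DIM('a) - 1)) \<partial>lborel) \<partial>lborel)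
    \<le> ennreal (seminorm_const p DIM('a)) * (\<Sum>e\<in>Basis. pow_int p (strip a b) (w e))"
proof -
  define q where "q = p + real DIM('a) - 1"
  define L where "L = b - a"
  have L: "0 < L" using ab by (simp add: L_def)
  have q: "0 \<le> q" using p by (simp add: q_def)
  have \<phi>: "\<And>k. smooth (\<phi> k)" and w[measurable]: "\<And>e. e \<in> Basis \<Longrightarrow> w e \<in> borel_measurable borel" and [measurable]: "G t \<in> borel_measurable borel"
    using tr t by (auto simp: trace_approx_def)
  have D\<phi>: "e \<in> Basis \<Longrightarrow> smooth (partial_deriv e (\<phi> k))" for e k by (intro smooth_partial_deriv \<phi>)
  have [measurable]: "(\<lambda>x. \<phi> k (x, t)) \<in> borel_measurable borel" for k
    by (intro borel_measurable_continuous_onI smooth_slice_continuous \<phi>)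
  let ?F = "\<lambda>f z. (f (fst z + snd z) - f (fst z)) * norm (snd z) powr (- q / p)"
  have Fm[measurable]: "?F f \<in> borel_measurable borel" if [measurable]: "f \<in> borel_measurable borel" for f :: "'a \<Rightarrow> real"
    by measurable
  have Fpow: "\<bar>?F f (x, h)\<bar> powr p = \<bar>f (x + h) - f x\<bar> powr p * norm h powr (- q)" for f :: "'a \<Rightarrow> real" and x h
    using p by (simp add: abs_mult powr_mult powr_powr)
  define A where "A n = {z :: 'a \<times> 'a. norm (fst z) < real n \<and> 1 / real (Suc n) < norm (snd z) \<and> norm (snd z) < L}" for n
  have Ao: "open (A n)" for n
    unfolding A_def by (intro open_Collect_conj open_Collect_less continuous_intros)
  have [measurable]: "A n \<in> sets borel" for n using Ao by (rule borel_open)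
  have Asub: "A n \<subseteq> ball 0 (real n) \<times> ball 0 L" for n by (auto simp: A_def)
  have bound: "pow_int p (A n) (?F (G t)) \<le> ennreal (seminorm_const p DIM('a)) * (\<Sum>e\<in>Basis. pow_int p (strip a b) (w e))" for n
  proof -
    let ?Q = "ball (0::'a) (real n + 2 * (b - a)) \<times> {a<..<b}"
    have Q: "?Q \<in> sets borel" by (intro borel_open open_Times) auto
    have BL[measurable]: "ball (0::'a) (real n) \<times> ball (0::'a) L \<in> sets borel" by (intro borel_open open_Times) auto
    let ?f = "\<lambda>k x. \<phi> k (x, t)"
    have "pow_int p (A n) (?F (G t)) \<le> ennreal (seminorm_const p DIM('a)) * (\<Sum>e\<in>Basis. pow_int p ?Q (w e))"
    proof (rule ennreal_limit_le)
      fix \<theta> :: real and k assume \<theta>: "0 < \<theta>" "\<theta> < 1"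
      show "pow_int p (A n) (?F (G t)) \<le> ennreal ((1 - \<theta>) powr (1 - p)) * pow_int p (A n) (?F (?f k))
          + ennreal (\<theta> powr (1 - p)) * pow_int p (A n) (\<lambda>z. ?F (G t) z - ?F (?f k) z)"
        using p by (intro pow_int_le_weighted_diff[OF _ _ _ _ \<theta>] Fm) auto
      have "(\<Sum>e\<in>Basis. pow_int p ?Q (partial_deriv e (\<phi> k))) \<le> (\<Sum>e\<in>Basis. ennreal ((1 - \<theta>) powr (1 - p)) * pow_int p ?Q (w e)
          + ennreal (\<theta> powr (1 - p)) * pow_int p ?Q (\<lambda>x. partial_deriv e (\<phi> k) x - w e x))"
        using p by (intro sum_mono pow_int_le_weighted_diff[OF _ _ Q _ \<theta>] w smooth_borel_measurable D\<phi>) auto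
      then show "(\<Sum>e\<in>Basis. pow_int p ?Q (partial_deriv e (\<phi> k))) \<le> ennreal ((1 - \<theta>) powr (1 - p)) * (\<Sum>e\<in>Basis. pow_int p ?Q (w e))
          + ennreal (\<theta> powr (1 - p)) * (\<Sum>e\<in>Basis. pow_int p ?Q (\<lambda>x. partial_deriv e (\<phi> k) x - w e x))"
        by (simp only: sum.distrib sum_distrib_left)
    next
      fix k
      have "pow_int p (A n) (?F (?f k)) \<le> pow_int p (ball 0 (real n) \<times> ball 0 L) (?F (?f k))"
        by (rule pow_int_mono_set[OF Asub])
      also have "\<dots> = (\<integral>\<^sup>+x\<in>ball 0 (real n). (\<integral>\<^sup>+h\<in>ball 0 L. ennreal (\<bar>\<phi> k (x + h, t) - \<phi> k (x, t)\<bar> powr p * norm h powr (- q)) \<partial>lborel) \<partial>lborel)"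
      proof -
        have "?F (?f k) \<in> borel_measurable borel" by (rule Fm) measurable
        from pow_int_pairs(1)[OF this ball_borel ball_borel]
        show ?thesis by (simp only: Fpow[of "?f k"])
      qed
      also have "\<dots> \<le> ennreal (seminorm_const p DIM('a)) * (\<Sum>e\<in>Basis. pow_int p ?Q (partial_deriv e (\<phi> k)))"
        unfolding L_def q_def by (rule smooth_trace_seminorm_le[OF \<phi> p ab t])
      finally show "pow_int p (A n) (?F (?f k)) \<le> ennreal (seminorm_const p DIM('a)) * (\<Sum>e\<in>Basis. pow_int p ?Q (partial_deriv e (\<phi> k))) + 0" by simp
    next
      have "(\<lambda>k. \<Sum>e\<in>Basis. pow_int p ?Q (\<lambda>x. partial_deriv e (\<phi> k) x - w e x)) \<longlonglongrightarrow> (\<Sum>e\<in>(Basis :: ('a \<times> real) set). 0)"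
        using tr by (intro tendsto_sum) (auto simp: trace_approx_def)
      then show "(\<lambda>k. \<Sum>e\<in>Basis. pow_int p ?Q (\<lambda>x. partial_deriv e (\<phi> k) x - w e x)) \<longlonglongrightarrow> 0" by simp
      \<comment> \<open>The bound for the weight on \<open>A n\<close>, where |h| exceeds 1 / (n +
        1).\<close>
      define c where "c = real (Suc n) powr (q / p)"
      show "(\<lambda>k. pow_int p (A n) (\<lambda>z. ?F (G t) z - ?F (?f k) z)) \<longlonglongrightarrow> 0"
      proof (rule ennreal_tendsto_0_le)
        have "(\<lambda>k. pow_int p (ball 0 (real n + L)) (\<lambda>x. G t x - ?f k x)) \<longlonglongrightarrow> 0"
          using tr t by (subst pow_int_minus_commute) (auto simp: trace_approx_def)
        then show "(\<lambda>k. ennreal (\<bar>c\<bar> powr p) * (ennreal (2 powr p * 2) * emeasure lborel (ball (0::'a) L) * pow_int p (ball 0 (real n + L)) (\<lambda>x. G t x - ?f k x))) \<longlonglongrightarrow> 0"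
          using emeasure_lborel_ball_finite[of "0::'a" L]
          by (intro ennreal_tendsto_0_cmult) (auto simp: ennreal_mult_less_top)
        fix k
        let ?E = "\<lambda>x. G t x - ?f k x"
        have "pow_int p (A n) (\<lambda>z. ?F (G t) z - ?F (?f k) z) \<le> pow_int p (A n) (\<lambda>z. c * (?E (fst z + snd z) - ?E (fst z)))"
        proof (rule pow_int_mono)
          fix z assume z: "z \<in> A n"
          then have n: "1 / real (Suc n) < norm (snd z)" by (simp add: A_def)
          have "norm (snd z) powr (- q / p) \<le> (1 / real (Suc n)) powr (- q / p)"
            using n q p by (intro powr_mono2') auto
          also have "\<dots> = c" by (simp add: c_def powr_divide powr_minus field_simps)
          finally have c: "norm (snd z) powr (- q / p) \<le> \<bar>c\<bar>" by simp
          have "?F (G t) z - ?F (?f k) z = norm (snd z) powr (- q / p) * (?E (fst z + snd z) - ?E (fst z))"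
            by (simp add: algebra_simps)
          then show "\<bar>?F (G t) z - ?F (?f k) z\<bar> \<le> \<bar>c * (?E (fst z + snd z) - ?E (fst z))\<bar>"
            using c by (simp only: abs_mult abs_of_nonneg[OF powr_ge_zero]) (intro mult_right_mono, auto)
        qed (use p in simp)
        also have "\<dots> \<le> pow_int p (ball 0 (real n) \<times> ball 0 L) (\<lambda>z. c * (?E (fst z + snd z) - ?E (fst z)))"
          by (rule pow_int_mono_set[OF Asub])
        also have "\<dots> = ennreal (\<bar>c\<bar> powr p) * pow_int p (ball 0 (real n) \<times> ball 0 L) (\<lambda>z. ?E (fst z + snd z) - ?E (fst z))"
          by (rule pow_int_cmult[OF _ BL]) measurable
        also have "\<dots> \<le> ennreal (\<bar>c\<bar> powr p) * (ennreal (2 powr p * 2) * emeasure lborel (ball (0::'a) L) * pow_int p (ball 0 (real n + L)) ?E)"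
          using p L by (intro mult_left_mono pow_int_translate_difference_le) auto
        finally show "pow_int p (A n) (\<lambda>z. ?F (G t) z - ?F (?f k) z) \<le>
          ennreal (\<bar>c\<bar> powr p) * (ennreal (2 powr p * 2) * emeasure lborel (ball (0::'a) L) * pow_int p (ball 0 (real n + L)) ?E)" .
      qed
    qed auto
    also have "\<dots> \<le> ennreal (seminorm_const p DIM('a)) * (\<Sum>e\<in>Basis. pow_int p (strip a b) (w e))"
      by (intro mult_left_mono sum_mono pow_int_mono_set) (auto simp: strip_def)
    finally show ?thesis .
  qed
  have U: "(\<Union>n. A n) = {z. snd z \<noteq> 0 \<and> norm (snd z) < L}"
  proof (intro set_eqI iffI)
    fix z :: "'a \<times> 'a" assume z: "z \<in> {z. snd z \<noteq> 0 \<and> norm (snd z) < L}"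
    obtain n1 :: nat where n1: "norm (fst z) < real n1" using reals_Archimedean2 by blast
    obtain n2 :: nat where n2: "1 / real (Suc n2) < norm (snd z)"
      using z reals_Archimedean[of "norm (snd z)"] by (auto simp: inverse_eq_divide)
    have "1 / real (Suc (max n1 n2)) \<le> 1 / real (Suc n2)" by (intro divide_left_mono) auto
    then have "z \<in> A (max n1 n2)" using n1 n2 z by (auto simp: A_def simp del: of_nat_Suc)
    then show "z \<in> (\<Union>n. A n)" by blast
  next
    fix z assume "z \<in> (\<Union>n. A n)"
    then obtain n where z: "norm (snd z) < L" "1 / real (Suc n) < norm (snd z)" by (auto simp: A_def)
    moreover have "0 < 1 / real (Suc n)" by simp
    ultimately have "0 < norm (snd z)" by linarith
    then show "z \<in> {z. snd z \<noteq> 0 \<and> norm (snd z) < L}" using z by simp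
  qed
  have inc: "incseq A"
  proof (rule incseq_SucI)
    fix n
    have "1 / real (Suc (Suc n)) \<le> 1 / real (Suc n)" by (intro divide_left_mono) auto
    then show "A n \<le> A (Suc n)" by (auto simp: A_def simp del: of_nat_Suc)
  qed
  have "(\<integral>\<^sup>+z\<in>(\<Union>n. A n). ennreal (\<bar>?F (G t) z\<bar> powr p) \<partial>lborel) \<le> ennreal (seminorm_const p DIM('a)) * (\<Sum>e\<in>Basis. pow_int p (strip a b) (w e))"
  proof (rule nn_integral_UN_le[OF _ _ inc])
    show "(\<integral>\<^sup>+z\<in>A n. ennreal (\<bar>?F (G t) z\<bar> powr p) \<partial>lborel) \<le> ennreal (seminorm_const p DIM('a)) * (\<Sum>e\<in>Basis. pow_int p (strip a b) (w e))" for n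
      using bound[of n] by (simp only: pow_int_def)
  qed measurable
  moreover have "(\<integral>\<^sup>+z\<in>(\<Union>n. A n). ennreal (\<bar>?F (G t) z\<bar> powr p) \<partial>lborel) =
    (\<integral>\<^sup>+x. (\<integral>\<^sup>+h\<in>ball 0 L. ennreal (\<bar>G t (x + h) - G t x\<bar> powr p / norm h powr q) \<partial>lborel) \<partial>lborel)"
  proof -
    have [measurable]: "(\<Union>n. A n) \<in> sets borel" by measurable
    have "(\<integral>\<^sup>+z\<in>(\<Union>n. A n). ennreal (\<bar>?F (G t) z\<bar> powr p) \<partial>lborel) =
      (\<integral>\<^sup>+x. (\<integral>\<^sup>+h. ennreal (\<bar>?F (G t) (x, h)\<bar> powr p) * indicator (\<Union>n. A n) (x, h) \<partial>lborel) \<partial>lborel)"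
      by (rule nn_integral_lborel_fst) measurable
    also have "\<dots> = (\<integral>\<^sup>+x. (\<integral>\<^sup>+h\<in>ball 0 L. ennreal (\<bar>G t (x + h) - G t x\<bar> powr p / norm h powr q) \<partial>lborel) \<partial>lborel)"
    proof (intro nn_integral_cong)
      fix x h :: 'a
      have "\<bar>G t (x + h) - G t x\<bar> powr p * norm h powr (- q) = \<bar>G t (x + h) - G t x\<bar> powr p / norm h powr q"
        by (simp add: powr_minus divide_inverse)
      \<comment> \<open>At h = 0 the left side vanishes because no \<open>A n\<close> contains such
        a point, the right side because division by 0 gives 0.\<close>
      moreover have "norm h powr q = 0" if "h = 0" using that by simp
      ultimately show "ennreal (\<bar>?F (G t) (x, h)\<bar> powr p) * indicator (\<Union>n. A n) (x, h) = ennreal (\<bar>G t (x + h) - G t x\<bar> powr p / norm h powr q) * indicator (ball 0 L) h"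
        unfolding Fpow U by (cases "h = 0") (auto simp: indicator_def)
    qed
    finally show ?thesis .
  qed
  ultimately show ?thesis by (simp add: L_def q_def)
qed

section \<open>The estimates for the chosen traces\<close>

lemma abs_le_hessian_norm:
  assumes "i \<in> Basis" "j \<in> Basis"
  shows "\<bar>weak_deriv \<Omega> [i, j] u x\<bar> \<le> hessian_norm \<Omega> u x"
proof -
  have "(weak_deriv \<Omega> [i, j] u x)\<^sup>2 \<le> (\<Sum>j\<in>Basis. (weak_deriv \<Omega> [i, j] u x)\<^sup>2)"
    using assms by (intro member_le_sum) auto
  also have "\<dots> \<le> (\<Sum>i\<in>Basis. \<Sum>j\<in>Basis. (weak_deriv \<Omega> [i, j] u x)\<^sup>2)"
    using assms by (intro member_le_sum[of i _ "\<lambda>i. \<Sum>j\<in>Basis. (weak_deriv \<Omega> [i, j] u x)\<^sup>2"]) (auto intro: sum_nonneg)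
  finally show ?thesis unfolding hessian_norm_def by (rule real_le_rsqrt[of "\<bar>weak_deriv \<Omega> [i, j] u x\<bar>", simplified power2_abs])
qed

text \<open>For fixed x, translation invariance of null sets gives f(x + h) = g(x + h) for almost
  every h; the outer power undoes the p-th root in the seminorm.\<close>

lemma trunc_seminorm_cong_AE:
  fixes f g :: "'a::euclidean_space \<Rightarrow> real"
  assumes p: "0 < p" and ae: "AE x in lborel. f x = g x"
  shows "ennreal_powr (trunc_seminorm p r f) p =
    (\<integral>\<^sup>+x. (\<integral>\<^sup>+h\<in>ball 0 r. ennreal (\<bar>g (x + h) - g x\<bar> powr p / norm h powr (p + real DIM('a) - 1)) \<partial>lborel) \<partial>lborel)"
proof -
  have "ennreal_powr (trunc_seminorm p r f) p =
    (\<integral>\<^sup>+x. (\<integral>\<^sup>+h\<in>ball 0 r. ennreal (\<bar>f (x + h) - f x\<bar> powr p / norm h powr (p + real DIM('a) - 1)) \<partial>lborel) \<partial>lborel)"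
    unfolding trunc_seminorm_def by (simp only: ennreal_powr_inverse[OF p] nn_integral_completion)
  also have "\<dots> = (\<integral>\<^sup>+x. (\<integral>\<^sup>+h\<in>ball 0 r. ennreal (\<bar>g (x + h) - g x\<bar> powr p / norm h powr (p + real DIM('a) - 1)) \<partial>lborel) \<partial>lborel)"
  proof (rule nn_integral_cong_AE, use ae in eventually_elim)
    case (elim x)
    show ?case
      by (rule nn_integral_cong_AE, use AE_lborel_translate[OF ae, of x] in eventually_elim) (simp add: elim)
  qed
  finally show ?thesis .
qed

lemma strip_trace_estimates:
  fixes u :: "'a::euclidean_space \<times> real \<Rightarrow> real"
  assumes p: "1 < p" and ab: "a < b" and u: "u \<in> hom_sobolev 2 p (strip a b)" and i: "i \<in> Basis"
  shows "pow_int p UNIV (\<lambda>x'. Tr p a b (weak_deriv (strip a b) [i] u) (x', b) - Tr p a b (weak_deriv (strip a b) [i] u) (x', a))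
      \<le> ennreal ((b - a) powr (p - 1)) * pow_int p (strip a b) (weak_deriv (strip a b) [i, (0, 1)] u)" (is ?A)
    and "pow_int p UNIV (\<lambda>x'. Tr p a b u (x', b) - Tr p a b u (x', a)
        - (Tr p a b (weak_deriv (strip a b) [(0, 1)] u) (x', b) + Tr p a b (weak_deriv (strip a b) [(0, 1)] u) (x', a)) * ((b - a) / 2))
      \<le> ennreal ((b - a) powr (2 * p - 1)) * pow_int p (strip a b) (weak_deriv (strip a b) [(0, 1), (0, 1)] u)" (is ?B)
    and "t \<in> {a, b} \<Longrightarrow> ennreal_powr (trunc_seminorm p (b - a) (\<lambda>x'. Tr p a b (weak_deriv (strip a b) [i] u) (x', t))) p
      \<le> ennreal (seminorm_const p DIM('a) * real DIM('a \<times> real)) * pow_int p (strip a b) (hessian_norm (strip a b) u)" (is "_ \<Longrightarrow> ?C")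
proof -
  let ?\<Omega> = "strip a b :: ('a \<times> real) set"
  let ?e = "(0, 1) :: 'a \<times> real"
  have p1: "1 \<le> p" using p by simp
  obtain u' V W \<phi> where
    u': "u' \<in> borel_measurable borel" "AE x in lborel. x \<in> ?\<Omega> \<longrightarrow> u x = u' x"
    and V: "\<And>i. i \<in> Basis \<Longrightarrow> V i \<in> borel_measurable borel"
      "\<And>i. i \<in> Basis \<Longrightarrow> AE x in lborel. x \<in> ?\<Omega> \<longrightarrow> weak_deriv ?\<Omega> [i] u x = V i x"
    and W: "\<And>i j. i \<in> Basis \<Longrightarrow> j \<in> Basis \<Longrightarrow> W j i \<in> borel_measurable borel"
      "\<And>i j. i \<in> Basis \<Longrightarrow> j \<in> Basis \<Longrightarrow> AE x in lborel. x \<in> ?\<Omega> \<longrightarrow> weak_deriv ?\<Omega> [j] (weak_deriv ?\<Omega> [i] u) x = W j i x"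
      "\<And>i j. i \<in> Basis \<Longrightarrow> j \<in> Basis \<Longrightarrow> AE x in lborel. x \<in> ?\<Omega> \<longrightarrow> weak_deriv ?\<Omega> [i, j] u x = W j i x"
    and \<phi>: "\<And>k. smooth (\<phi> k :: 'a \<times> real \<Rightarrow> real)"
    and lim: "\<And>R. (\<lambda>k. pow_int p (?\<Omega> \<inter> ball 0 R) (\<lambda>x. \<phi> k x - u' x)) \<longlonglongrightarrow> 0"
      "\<And>i R. i \<in> Basis \<Longrightarrow> (\<lambda>k. pow_int p (?\<Omega> \<inter> ball 0 R) (\<lambda>x. partial_deriv i (\<phi> k) x - V i x)) \<longlonglongrightarrow> 0"
      "\<And>i j R. i \<in> Basis \<Longrightarrow> j \<in> Basis \<Longrightarrow>
       (\<lambda>k. pow_int p (?\<Omega> \<inter> ball 0 R) (\<lambda>x. partial_deriv j (partial_deriv i (\<phi> k)) x - W j i x)) \<longlonglongrightarrow> 0"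
    using hom_sobolev_smooth_approx[OF strip_properties(1,2) strip_properties(3)[OF ab] p1 u] by blast
  have "has_trace p a b u (Tr p a b u)"
    unfolding Tr_def by (rule someI_ex[where P="has_trace p a b u"], rule ex_has_trace[OF ab p1 u' V \<phi> lim(1,2)])
  then obtain H \<phi>0 where H: "trace_approx p a b u' V H \<phi>0" "\<And>t. t \<in> {a, b} \<Longrightarrow> AE x' in lborel. Tr p a b u (x', t) = H t x'"
    using has_trace_imp_trace_approx[OF _ u' V] by blast
  \<comment> \<open>A trace of \<open>weak_deriv \<Omega> [i] u\<close> refers to the weak
    derivatives of that function, the estimates to second weak derivatives of u.
    \<open>W j i\<close> represents both.\<close>
  have tr: "\<exists>G \<psi>. trace_approx p a b (V i) (\<lambda>j. W j i) G \<psi> \<and> (\<forall>t\<in>{a, b}. AE x' in lborel. Tr p a b (weak_deriv ?\<Omega> [i] u) (x', t) = G t x')"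
    if i: "i \<in> Basis" for i
  proof -
    have "has_trace p a b (weak_deriv ?\<Omega> [i] u) (Tr p a b (weak_deriv ?\<Omega> [i] u))"
      unfolding Tr_def
      by (rule someI_ex[where P="has_trace p a b (weak_deriv ?\<Omega> [i] u)"], rule ex_has_trace[OF ab p1 V(1)[OF i] V(2)[OF i] W(1)[OF i] W(2)[OF i]
            smooth_partial_deriv[OF \<phi> i] lim(2)[OF i] lim(3)[OF i]])
    then show ?thesis
      by (rule has_trace_imp_trace_approx[OF _ V(1)[OF i] V(2)[OF i] W(1)[OF i] W(2)[OF i]]) blast+
  qed
  obtain G \<psi> where G: "trace_approx p a b (V i) (\<lambda>j. W j i) G \<psi>"
    "\<And>t. t \<in> {a, b} \<Longrightarrow> AE x' in lborel. Tr p a b (weak_deriv ?\<Omega> [i] u) (x', t) = G t x'"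
    using tr[OF i] by blast
  obtain N \<psi>N where N: "trace_approx p a b (V ?e) (\<lambda>j. W j ?e) N \<psi>N"
    "\<And>t. t \<in> {a, b} \<Longrightarrow> AE x' in lborel. Tr p a b (weak_deriv ?\<Omega> [?e] u) (x', t) = N t x'"
    using tr[OF e_N_Basis] by blast
  have W_eq: "pow_int p ?\<Omega> (W j i) = pow_int p ?\<Omega> (weak_deriv ?\<Omega> [i, j] u)" if "i \<in> Basis" "j \<in> Basis" for i j
    by (rule pow_int_cong_AE, use W(3)[OF that] in eventually_elim) simp
  have ends: "a \<in> {a, b}" "b \<in> {a, b}" by auto
  have "pow_int p UNIV (\<lambda>x'. Tr p a b (weak_deriv ?\<Omega> [i] u) (x', b) - Tr p a b (weak_deriv ?\<Omega> [i] u) (x', a)) = pow_int p UNIV (\<lambda>x'. G b x' - G a x')"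
    by (rule pow_int_cong_AE, use G(2)[OF ends(1)] G(2)[OF ends(2)] in eventually_elim) simp
  then show ?A
    using trace_difference_le[OF G(1) p1 ab] by (simp add: W_eq[OF i e_N_Basis])
  have "pow_int p UNIV (\<lambda>x'. Tr p a b u (x', b) - Tr p a b u (x', a)
        - (Tr p a b (weak_deriv ?\<Omega> [?e] u) (x', b) + Tr p a b (weak_deriv ?\<Omega> [?e] u) (x', a)) * ((b - a) / 2))
      = pow_int p UNIV (\<lambda>x'. H b x' - H a x' - (N b x' + N a x') * ((b - a) / 2))"
    by (rule pow_int_cong_AE, use N(2)[OF ends(1)] N(2)[OF ends(2)] H(2)[OF ends(1)] H(2)[OF ends(2)] in eventually_elim) simp
  then show ?B
    using trace_trapezoid_le[OF H(1) N(1) p1 ab] by (simp only: W_eq[OF e_N_Basis e_N_Basis])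
  assume t: "t \<in> {a, b}"
  have "ennreal_powr (trunc_seminorm p (b - a) (\<lambda>x'. Tr p a b (weak_deriv ?\<Omega> [i] u) (x', t))) p =
      (\<integral>\<^sup>+x. (\<integral>\<^sup>+h\<in>ball 0 (b - a). ennreal (\<bar>G t (x + h) - G t x\<bar> powr p / norm h powr (p + real DIM('a) - 1)) \<partial>lborel) \<partial>lborel)"
    using p by (intro trunc_seminorm_cong_AE G(2) t) auto
  also have "\<dots> \<le> ennreal (seminorm_const p DIM('a)) * (\<Sum>e\<in>Basis. pow_int p ?\<Omega> (W e i))"
    by (rule trace_seminorm_le[OF G(1) p ab t])
  \<comment> \<open>Each of the N second derivatives involving i is dominated by the Hessian norm,
    which accounts for the factor \<open>DIM('a \<times> real)\<close>.\<close>
  also have "\<dots> \<le> ennreal (seminorm_const p DIM('a)) * (\<Sum>e\<in>(Basis :: ('a \<times> real) set). pow_int p ?\<Omega> (hessian_norm ?\<Omega> u))"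
  proof (intro mult_left_mono sum_mono)
    fix e :: "'a \<times> real" assume e: "e \<in> Basis"
    have "\<bar>weak_deriv ?\<Omega> [i, e] u x\<bar> \<le> \<bar>hessian_norm ?\<Omega> u x\<bar>" for x
      using abs_le_hessian_norm[OF i e, of ?\<Omega> u x] by linarith
    then show "pow_int p ?\<Omega> (W e i) \<le> pow_int p ?\<Omega> (hessian_norm ?\<Omega> u)"
      using p unfolding W_eq[OF i e] by (intro pow_int_mono) auto
  qed auto
  also have "\<dots> = ennreal (seminorm_const p DIM('a) * real DIM('a \<times> real)) * pow_int p ?\<Omega> (hessian_norm ?\<Omega> u)"
    using seminorm_const_pos[OF p, of "DIM('a)"] by (simp add: ennreal_mult' mult.assoc ennreal_of_nat_eq_real_of_nat)
  finally show ?C .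
qed

theorem theorem1p8:
  fixes p :: real
  assumes "1 < p"
  shows "\<exists>c>0. \<forall>(bm::real) (bp::real). bm < bp \<longrightarrow>
    (\<forall>u \<in> hom_sobolev 2 p (strip bm bp :: ((real ^ 'n) \<times> real) set).
      let \<Omega> = (strip bm bp :: ((real ^ 'n) \<times> real) set);
          eN = (0, 1) :: (real ^ 'n) \<times> real
      in \<forall>i\<in>Basis.
        (\<integral>\<^sup>+x'. ennreal (\<bar>Tr p bm bp (weak_deriv \<Omega> [i] u) (x', bp)
                      - Tr p bm bp (weak_deriv \<Omega> [i] u) (x', bm)\<bar> powr p) \<partial>lebesgue)
          \<le> ennreal ((bp - bm) powr (p - 1)) *
             (\<integral>\<^sup>+x\<in>\<Omega>. ennreal (\<bar>weak_deriv \<Omega> [i, eN] u x\<bar> powr p) \<partial>lebesgue)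
        \<and>
        (\<integral>\<^sup>+x'. ennreal (\<bar>Tr p bm bp u (x', bp) - Tr p bm bp u (x', bm)
                      - (Tr p bm bp (weak_deriv \<Omega> [eN] u) (x', bp)
                         + Tr p bm bp (weak_deriv \<Omega> [eN] u) (x', bm))
                        * ((bp - bm) / 2)\<bar> powr p) \<partial>lebesgue)
          \<le> ennreal ((bp - bm) powr (2 * p - 1)) *
             (\<integral>\<^sup>+x\<in>\<Omega>. ennreal (\<bar>weak_deriv \<Omega> [eN, eN] u x\<bar> powr p) \<partial>lebesgue)
        \<and>
        (\<forall>t\<in>{bm, bp}.
          ennreal_powr (trunc_seminorm p (bp - bm)
              (\<lambda>x'. Tr p bm bp (weak_deriv \<Omega> [i] u) (x', t))) p
            \<le> ennreal c * (\<integral>\<^sup>+x\<in>\<Omega>. ennreal (hessian_norm \<Omega> u x powr p) \<partial>lebesgue)))"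
proof (intro exI conjI allI impI ballI)
  show "0 < seminorm_const p DIM(real ^ 'n) * real DIM((real ^ 'n) \<times> real)"
    using seminorm_const_pos[OF assms] by (intro mult_pos_pos) auto
  fix bm bp :: real and u :: "(real ^ 'n) \<times> real \<Rightarrow> real"
  assume b: "bm < bp" and u: "u \<in> hom_sobolev 2 p (strip bm bp)"
  have hess: "(\<integral>\<^sup>+x\<in>strip bm bp. ennreal (hessian_norm (strip bm bp) u x powr p) \<partial>lebesgue) =
      pow_int p (strip bm bp) (hessian_norm (strip bm bp) u)"
    unfolding nn_integral_lebesgue_eq_pow_int[symmetric] by (simp add: hessian_norm_def sum_nonneg)
  have all: "(\<integral>\<^sup>+x. ennreal (\<bar>f x\<bar> powr p) \<partial>lebesgue) = pow_int p UNIV f" for f :: "real ^ 'n \<Rightarrow> real"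
    by (simp add: pow_int_def nn_integral_completion)
  show "let \<Omega> = strip bm bp; eN = (0, 1)
      in \<forall>i\<in>Basis.
        (\<integral>\<^sup>+x'. ennreal (\<bar>Tr p bm bp (weak_deriv \<Omega> [i] u) (x', bp) - Tr p bm bp (weak_deriv \<Omega> [i] u) (x', bm)\<bar> powr p) \<partial>lebesgue)
          \<le> ennreal ((bp - bm) powr (p - 1)) * (\<integral>\<^sup>+x\<in>\<Omega>. ennreal (\<bar>weak_deriv \<Omega> [i, eN] u x\<bar> powr p) \<partial>lebesgue)
        \<and> (\<integral>\<^sup>+x'. ennreal (\<bar>Tr p bm bp u (x', bp) - Tr p bm bp u (x', bm)
              - (Tr p bm bp (weak_deriv \<Omega> [eN] u) (x', bp) + Tr p bm bp (weak_deriv \<Omega> [eN] u) (x', bm)) * ((bp - bm) / 2)\<bar> powr p) \<partial>lebesgue)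
          \<le> ennreal ((bp - bm) powr (2 * p - 1)) * (\<integral>\<^sup>+x\<in>\<Omega>. ennreal (\<bar>weak_deriv \<Omega> [eN, eN] u x\<bar> powr p) \<partial>lebesgue)
        \<and> (\<forall>t\<in>{bm, bp}. ennreal_powr (trunc_seminorm p (bp - bm) (\<lambda>x'. Tr p bm bp (weak_deriv \<Omega> [i] u) (x', t))) p
            \<le> ennreal (seminorm_const p DIM(real ^ 'n) * real DIM((real ^ 'n) \<times> real)) *
              (\<integral>\<^sup>+x\<in>\<Omega>. ennreal (hessian_norm \<Omega> u x powr p) \<partial>lebesgue))"
    unfolding Let_def hess nn_integral_lebesgue_eq_pow_int all
    using strip_trace_estimates[OF assms b u] by blast
qed

end
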